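(* Let $g$ be an admissible random surface tension that is $\mathbb{R}^d$-stationary with respect to a measure-preserving group action $\{\tau_z\}_{z\in\mathbb{R}^d}$ and satisfies a multiscale functional inequality with weight $\pi$ (with respect to the oscillation). Then there exists a constant $c_d>0$ such that for all $p\ge1$, every $(a,b)\in\mathcal{M}\times\mathcal{M}$ and every $\nu\in\mathbb{S}^{d-1}$ the estimate $$\mathbb{E}\Big[\big(X_{t,\ell_t}^{a,b,\nu}(g)-\mathbb{E}[X_{t,\ell_t}^{a,b,\nu}(g)]\big)^{2p}\Big]\le (c_dp^2)^p\,t^{p(1-d)}\ell_t^p\int_0^{+\infty}(s+1)^{2p(d-1)}\pi(s)\,ds$$ holds whenever $t\ge\ell_t\ge1$. In particular, $${\rm Var}\big(X_{t,\ell_t}^{a,b,\nu}(g)\big)\le c_d\,t^{1-d}\ell_t\int_0^{+\infty}(s+1)^{2(d-1)}\pi(s)\,ds.$$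
   Context: Let $d\ge 2$, $m\ge1$ and fix a finite set $\mathcal{M}\subset\mathbb{R}^m$. For $c\ge1$, $\mathcal{A}_c$ is the class of Borel functions $g:\mathbb{R}^d\times\mathbb{R}^m\times\mathbb{S}^{d-1}\to[0,+\infty)$ with $\frac1c\le g(x,\zeta,\nu)\le c$ and $g(x,\zeta,\nu)=g(x,-\zeta,-\nu)$. For $g\in\mathcal{A}_c$ and $D\subset\mathbb{R}^d$ open with Lipschitz boundary, $E_g(u,D)=\int_{D\cap S_u}g(x,u^+-u^-,\nu_u)\,d\mathcal{H}^{d-1}$ if $u\in BV(D;\mathcal{M})$ and $+\infty$ otherwise. $(\Omega,\mathcal{F},\mathbb{P})$ is a complete probability space. An admissible random surface tension is a jointly measurable $g:\Omega\times\mathbb{R}^d\times\mathbb{R}^m\times\mathbb{S}^{d-1}\to[0,+\infty)$ with $g(\omega,\cdot)\in\mathcal{A}_c$ for every $\omega$, for some fixed $c\ge1$; $E_g(\omega):=E_{g(\omega,\cdot)}$. A measure-preserving group action $\{\tau_z\}_{z\in\mathbb{R}^d}$: measurable $\tau_z:\Omega\to\Omega$ with $\mathbb{P}(\tau_zA)=\mathbb{P}(A)$, $\tau_0=\mathrm{id}$, $\tau_{z_1+z_2}=\tau_{z_2}\circ\tau_{z_1}$; stationarity means $g(\tau_z\omega,x,\zeta,\nu)=g(\omega,x+z,\zeta,\nu)$. Multiscale functional inequality with weight $\pi$: $\pi\in L^1((0,+\infty))$ is non-negative and there is $C>0$ such that for every $X:\mathcal{A}_c\to\mathbb{R}$ with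 $\omega\mapsto X(g(\omega))$ measurable, ${\rm Var}(X(g))\le C\,\mathbb{E}\big[\int_0^\infty\int_{\mathbb{R}^d}(\partial^{\rm osc}_{g,B_{s+1}(x)}X(g))^2\,dx\,(s+1)^{-d}\pi(s)\,ds\big]$, where for $U\subset\mathbb{R}^d$ the oscillation is $\partial^{\rm osc}_{g,U}X(g)(\omega)=\mathrm{ess\,sup}\{X(g'):g'\in\mathcal{A}_c,\ g'=g(\omega)\text{ on }(\mathbb{R}^d\setminus U)\times\mathbb{R}^m\times\mathbb{S}^{d-1}\}-\mathrm{ess\,inf}\{\text{same}\}$ (understood via a measurable envelope). For $\nu\in\mathbb{S}^{d-1}$, $O_\nu$ is the orthogonal matrix of $x\mapsto 2\frac{\langle x,\nu+e_d\rangle}{|\nu+e_d|^2}(\nu+e_d)-x$ if $\nu\ne-e_d$, $x\mapsto-x$ otherwise; $\nu_j=O_\nu e_j$. $R^\nu_{t,\ell}=\{x:|\langle x,\nu\rangle|<\ell/2,\ |\langle x,\nu_j\rangle|<t/2,\ j\le d-1\}$. $u^{a,b,\nu}(x)=b$ if $\langle x,\nu\rangle>0$, $a$ otherwise. $\mathscr{A}(\bar u,D)=\{u\in BV(D;\mathcal{M}):u=\bar u\text{ near }\partial D\}$. $X_{t,\ell}^{a,b,\nu}(g)(\omega)=t^{1-d}\inf\{E_g(\omega)(u,R^\nu_{t,\ell}):u\in\mathscr{A}(u^{a,b,\nu},R^\nu_{t,\ell})\}$. *)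

theory Defs
  imports "HOL-Analysis.Analysis" "HOL-Probability.Probability"
begin

definition hausdorff_const :: "real \<Rightarrow> real" where
  "hausdorff_const s = pi powr (s / 2) / Gamma (s / 2 + 1)"

definition hausdorff_pre :: "real \<Rightarrow> real \<Rightarrow> 'a::euclidean_space set \<Rightarrow> ennreal" where
  "hausdorff_pre s \<delta> A =
     (INF C \<in> {C :: nat \<Rightarrow> 'a set. A \<subseteq> (\<Union>i. C i) \<and> (\<forall>i. bounded (C i) \<and> diameter (C i) \<le> \<delta>)}.
        (\<Sum>i. ennreal (hausdorff_const s * (diameter (C i) / 2) powr s)))"

definition hausdorff_outer :: "real \<Rightarrow> 'a::euclidean_space set \<Rightarrow> ennreal" where
  "hausdorff_outer s A = (SUP \<delta> \<in> {0<..}. hausdorff_pre s \<delta> A)"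

definition hausdorff_measure :: "real \<Rightarrow> 'a::euclidean_space measure" where
  "hausdorff_measure s = measure_of UNIV (sets borel) (hausdorff_outer s)"

definition test_fields :: "(real^'n::finite) set \<Rightarrow> (real^'n \<Rightarrow> real^'n^'m::finite) set" where
  "test_fields D = {\<phi>. \<exists>\<phi>'. (\<forall>x. (\<phi> has_derivative \<phi>' x) (at x))
       \<and> (\<forall>j. continuous_on UNIV (\<lambda>x. \<phi>' x (axis j 1)))
       \<and> (\<exists>K. compact K \<and> K \<subseteq> D \<and> (\<forall>x. x \<notin> K \<longrightarrow> \<phi> x = 0))
       \<and> (\<forall>x. norm (\<phi> x) \<le> 1)}"

definition div_row :: "(real^'n::finite \<Rightarrow> real^'n^'m::finite) \<Rightarrow> 'm \<Rightarrow> real^'n \<Rightarrow> real" where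
  "div_row \<phi> k x = (\<Sum>j\<in>UNIV. (frechet_derivative \<phi> (at x) (axis j 1)) $ k $ j)"

definition total_variation :: "(real^'n::finite \<Rightarrow> real^'m::finite) \<Rightarrow> (real^'n) set \<Rightarrow> ereal" where
  "total_variation u D = (SUP \<phi> \<in> test_fields D.
      ereal (integral D (\<lambda>x. \<Sum>k\<in>UNIV. u x $ k * div_row \<phi> k x)))"

definition BV_M :: "(real^'m::finite) set \<Rightarrow> (real^'n::finite) set \<Rightarrow> (real^'n \<Rightarrow> real^'m) set" where
  "BV_M M D = {u. u absolutely_integrable_on D \<and> total_variation u D < \<infinity> \<and> (\<forall>x\<in>D. u x \<in> M)}"

definition half_ball :: "real^'n::finite \<Rightarrow> real \<Rightarrow> real^'n \<Rightarrow> (real^'n) set" where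
  "half_ball x r \<nu> = {y \<in> ball x r. (y - x) \<bullet> \<nu> > 0}"

definition jump_triple :: "(real^'n::finite \<Rightarrow> real^'m::finite) \<Rightarrow> real^'n \<Rightarrow> real^'m \<Rightarrow> real^'m \<Rightarrow> real^'n \<Rightarrow> bool" where
  "jump_triple u x a b \<nu> \<longleftrightarrow> a \<noteq> b \<and> norm \<nu> = 1 \<and>
     ((\<lambda>r. (\<integral>\<^sup>+ y \<in> half_ball x r \<nu>. ennreal (norm (u y - b)) \<partial>lborel) / ennreal (r ^ CARD('n))) \<longlongrightarrow> 0) (at_right 0) \<and>
     ((\<lambda>r. (\<integral>\<^sup>+ y \<in> half_ball x r (-\<nu>). ennreal (norm (u y - a)) \<partial>lborel) / ennreal (r ^ CARD('n))) \<longlongrightarrow> 0) (at_right 0)"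

definition jump_set :: "(real^'n::finite \<Rightarrow> real^'m::finite) \<Rightarrow> (real^'n) set" where
  "jump_set u = {x. \<exists>a b \<nu>. jump_triple u x a b \<nu>}"

definition jump_data :: "(real^'n::finite \<Rightarrow> real^'m::finite) \<Rightarrow> real^'n \<Rightarrow> (real^'m) \<times> (real^'m) \<times> (real^'n)" where
  "jump_data u x = (SOME (a, b, \<nu>). jump_triple u x a b \<nu>)"

type_synonym ('n, 'm) tension = "real^'n \<Rightarrow> real^'m \<Rightarrow> real^'n \<Rightarrow> real"

text \<open>The class A_c. Surface tensions are only relevant on R^d x R^m x S^{d-1};
  we fix the (irrelevant) values off the sphere to be 0 so that A_c contains
  exactly one representative per function on R^d x R^m x S^{d-1}.\<close>
definition adm_class :: "real \<Rightarrow> ('n::finite, 'm::finite) tension set" where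
  "adm_class c = {g.
     (\<lambda>(x, \<zeta>, \<nu>). g x \<zeta> \<nu>) \<in> borel_measurable (borel \<Otimes>\<^sub>M (borel \<Otimes>\<^sub>M restrict_space borel (sphere 0 1)))
     \<and> (\<forall>x \<zeta> \<nu>. \<nu> \<in> sphere 0 1 \<longrightarrow> 1 / c \<le> g x \<zeta> \<nu> \<and> g x \<zeta> \<nu> \<le> c \<and> g x \<zeta> \<nu> = g x (-\<zeta>) (-\<nu>))
     \<and> (\<forall>x \<zeta> \<nu>. \<nu> \<notin> sphere 0 1 \<longrightarrow> g x \<zeta> \<nu> = 0)}"

definition energy :: "(real^'m::finite) set \<Rightarrow> ('n::finite, 'm) tension \<Rightarrow> (real^'n \<Rightarrow> real^'m) \<Rightarrow> (real^'n) set \<Rightarrow> ennreal" where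
  "energy M g u D = (if u \<in> BV_M M D then
     (\<integral>\<^sup>+ x \<in> D \<inter> jump_set u.
        (case jump_data u x of (a, b, \<nu>) \<Rightarrow> ennreal (g x (b - a) \<nu>)) \<partial>hausdorff_measure (real CARD('n) - 1))
     else \<infinity>)"

definition e_last :: "(real, 'n::{finite,linorder}) vec" where
  "e_last = axis (Max UNIV) 1"

definition O_mat :: "(real, 'n::{finite,linorder}) vec \<Rightarrow> (real, 'n) vec \<Rightarrow> (real, 'n) vec" where
  "O_mat \<nu> x = (if \<nu> = - e_last then - x
      else (2 * (x \<bullet> (\<nu> + e_last)) / (norm (\<nu> + e_last))\<^sup>2) *\<^sub>R (\<nu> + e_last) - x)"

definition rect :: "(real, 'n::{finite,linorder}) vec \<Rightarrow> real \<Rightarrow> real \<Rightarrow> ((real, 'n) vec) set" where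
  "rect \<nu> t l = {x. \<bar>x \<bullet> \<nu>\<bar> < l / 2 \<and>
      (\<forall>j. j \<noteq> Max UNIV \<longrightarrow> \<bar>x \<bullet> O_mat \<nu> (axis j 1)\<bar> < t / 2)}"

definition u_jump :: "(real, 'm::finite) vec \<Rightarrow> (real, 'm) vec \<Rightarrow> (real, 'n::finite) vec \<Rightarrow> (real, 'n) vec \<Rightarrow> (real, 'm) vec" where
  "u_jump a b \<nu> x = (if x \<bullet> \<nu> > 0 then b else a)"

definition admissible :: "((real, 'm::finite) vec) set \<Rightarrow> ((real, 'n::finite) vec \<Rightarrow> (real, 'm) vec) \<Rightarrow> ((real, 'n) vec) set \<Rightarrow> ((real, 'n) vec \<Rightarrow> (real, 'm) vec) set" where
  "admissible M ubar D = {u. u \<in> BV_M M D \<and>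
      (\<exists>U. open U \<and> frontier D \<subseteq> U \<and> (\<forall>x \<in> U \<inter> D. u x = ubar x))}"

definition X_cell :: "((real, 'm::finite) vec) set \<Rightarrow> real \<Rightarrow> real \<Rightarrow> (real, 'm) vec \<Rightarrow> (real, 'm) vec \<Rightarrow> (real, 'n::{finite,linorder}) vec
     \<Rightarrow> ('n, 'm) tension \<Rightarrow> real" where
  "X_cell M t l a b \<nu> g = t powr (1 - real CARD('n)) *
     enn2real (INF u \<in> admissible M (u_jump a b \<nu>) (rect \<nu> t l). energy M g u (rect \<nu> t l))"

definition random_surface_tension :: "'w measure \<Rightarrow> real \<Rightarrow> ('w \<Rightarrow> ('n::finite, 'm::finite) tension) \<Rightarrow> bool" where
  "random_surface_tension P c G \<longleftrightarrow>
     (\<lambda>(\<omega>, x, \<zeta>, \<nu>). G \<omega> x \<zeta> \<nu>) \<in> borel_measurable (P \<Otimes>\<^sub>M (borel \<Otimes>\<^sub>M (borel \<Otimes>\<^sub>M restrict_space borel (sphere 0 1))))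
     \<and> (\<forall>\<omega> \<in> space P. G \<omega> \<in> adm_class c)"

definition mp_group_action :: "'w measure \<Rightarrow> (real^'n::finite \<Rightarrow> 'w \<Rightarrow> 'w) \<Rightarrow> bool" where
  "mp_group_action P \<tau> \<longleftrightarrow>
     (\<forall>z. \<tau> z \<in> measurable P P \<and> (\<forall>A \<in> sets P. emeasure P (\<tau> z ` A) = emeasure P A))
     \<and> (\<forall>\<omega> \<in> space P. \<tau> 0 \<omega> = \<omega>)
     \<and> (\<forall>z1 z2. \<forall>\<omega> \<in> space P. \<tau> (z1 + z2) \<omega> = \<tau> z2 (\<tau> z1 \<omega>))"

definition stationary :: "'w measure \<Rightarrow> (real^'n::finite \<Rightarrow> 'w \<Rightarrow> 'w) \<Rightarrow> ('w \<Rightarrow> ('n, 'm::finite) tension) \<Rightarrow> bool" where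
  "stationary P \<tau> G \<longleftrightarrow>
     (\<forall>\<omega> \<in> space P. \<forall>z x \<zeta> \<nu>. G (\<tau> z \<omega>) x \<zeta> \<nu> = G \<omega> (x + z) \<zeta> \<nu>)"

text \<open>Outer integral = integral of the measurable envelope.\<close>
definition outer_nn_integral :: "'a measure \<Rightarrow> ('a \<Rightarrow> ennreal) \<Rightarrow> ennreal" where
  "outer_nn_integral M f = (INF h \<in> {h \<in> borel_measurable M. \<forall>x \<in> space M. f x \<le> h x}. \<integral>\<^sup>+ x. h x \<partial>M)"

definition oscillation :: "real \<Rightarrow> (('n::finite, 'm::finite) tension \<Rightarrow> real) \<Rightarrow> ('n, 'm) tension \<Rightarrow> (real^'n) set \<Rightarrow> ennreal" where
  "oscillation c X g U =
     (let S = {g' \<in> adm_class c. \<forall>x \<in> - U. \<forall>\<zeta>. \<forall>\<nu> \<in> sphere 0 1. g' x \<zeta> \<nu> = g x \<zeta> \<nu>}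
      in e2ennreal ((SUP g' \<in> S. ereal (X g')) - (INF g' \<in> S. ereal (X g'))))"

definition variance_enn :: "'w measure \<Rightarrow> ('w \<Rightarrow> real) \<Rightarrow> ennreal" where
  "variance_enn P Y = (if integrable P Y
      then \<integral>\<^sup>+ \<omega>. ennreal ((Y \<omega> - (\<integral> \<omega>'. Y \<omega>' \<partial>P))\<^sup>2) \<partial>P else \<infinity>)"

definition multiscale_FI :: "'w measure \<Rightarrow> real \<Rightarrow> ('w \<Rightarrow> ('n::finite, 'm::finite) tension) \<Rightarrow> (real \<Rightarrow> real) \<Rightarrow> bool" where
  "multiscale_FI P c G \<pi> \<longleftrightarrow>
     (\<forall>s > 0. 0 \<le> \<pi> s) \<and> set_integrable lborel {0<..} \<pi> \<and>
     (\<exists>C > 0. \<forall>X :: ('n, 'm) tension \<Rightarrow> real. (\<lambda>\<omega>. X (G \<omega>)) \<in> borel_measurable P \<longrightarrow>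
        variance_enn P (\<lambda>\<omega>. X (G \<omega>)) \<le> ennreal C * outer_nn_integral P (\<lambda>\<omega>.
           outer_nn_integral lborel (\<lambda>s. indicator {0<..} s *
             outer_nn_integral lborel (\<lambda>x. (oscillation c X (G \<omega>) (ball x (s + 1)))\<^sup>2)
             * ennreal ((s + 1) powr (- real CARD('n)) * \<pi> s))))"

end

theory Submission
  imports Defs
begin

text \<open>Changing the surface tension on a ball of radius \<open>\<sigma>\<close> changes the minimal energy by
  \<open>O(\<sigma>^(d-1))\<close>: inside a cube containing the ball a competitor may be replaced by the pure interface
  function, which costs at most the area of the cube faces and of the interface. Only balls meeting
  the cell matter, and their centres fill a volume \<open>O(t^(d-1) l \<sigma>^d)\<close>. Inserted in the multiscale
  inequality this gives the variance bound. For higher moments the inequality is applied to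
  \<open>\<bar>X - E X\<bar>^p\<close>, whose oscillation is controlled by the one of \<open>X\<close>; Young's inequality absorbs the
  lower moments produced in this way, and \<open>E \<bar>X - E X\<bar>^p\<close> itself is handled by interpolation.

  The inequality only speaks about measurable functionals, so the infimum over the uncountable set of
  competitors has to be shown to be a random variable. Competitors are coded by points of Baire space,
  and the infimum is measurable by the measurable projection theorem once the energy is jointly
  measurable in the code and in the randomness. The surface energy is an integral over the jump set,
  which is covered by countably many compact Lipschitz pieces depending measurably on the code; the
  Hausdorff measure of a random compact set is measurable because it can be computed from finite covers
  by open sets taken from a countable family.\<close>

section \<open>Measurable projection along Baire space\<close>

text \<open>The powers in the estimate come from one count. A change on a ball of radius s + 1 moves
  the normalised functional by at most \<open>k\<close> (s + 1)^(d-1), with \<open>k\<close> of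
  order t^(1-d); the relevant centres fill a volume \<open>V\<close> (s + 1)^d, with
  \<open>V\<close> of order t^(d-1) l. The factor (s + 1)^(-d) of the inequality cancels the volume
  growth, which leaves the weight (s + 1)^(2(d-1)) and \<open>V\<close> \<open>k\<close>^2 of order
  t^(1-d) l. For the p-th power the chain rule puts p^2 into the variance, hence (p^2)^p after
  absorption; numerical factors b \<ge> 1 are bounded by b^p, so one constant serves all p. Two
  obstacles shape the measurability part. The jump data are a Hilbert choice, so the energy density
  is rewritten as a finite supremum over pairs of values in \<open>M\<close>, with a normal
  recovered by a measurable formula. And the Hausdorff measure is not sigma-finite, so Fubini fails
  on the whole space; integration is done over pieces of finite measure that vary measurably and are
  treated as kernels. Competitors are coded only up to null sets, because jumps and variation depend
  on almost everywhere classes.\<close>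

lemma measurable_if_inner_outer_approx:
  assumes "finite_measure P" "complete_measure P" "B \<subseteq> space P"
    and inner: "\<And>r::real. \<not> (\<exists>C\<in>sets P. B \<subseteq> C \<and> measure P C \<le> r) \<Longrightarrow> \<exists>W\<in>sets P. W \<subseteq> B \<and> r \<le> measure P W"
  shows "B \<in> sets P"
proof -
  interpret finite_measure P by fact
  interpret complete_measure P by fact
  define R where "R = {measure P C | C. C \<in> sets P \<and> B \<subseteq> C}"
  have Rne: "R \<noteq> {}" using assms(3) by (auto simp: R_def)
  have Rb: "bdd_below R" by (auto simp: R_def intro!: bdd_belowI[of _ 0])
  define r where "r = Inf R"
  have "\<exists>C\<in>sets P. B \<subseteq> C \<and> measure P C < r + 1 / Suc n" for n
  proof -
    have "Inf R < r + 1 / Suc n" by (simp add: r_def)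
    then obtain x where "x \<in> R" "x < r + 1 / Suc n" using cInf_less_iff[OF Rne Rb] by blast
    then show ?thesis by (auto simp: R_def)
  qed
  then obtain C where C: "\<And>n. C n \<in> sets P" "\<And>n. B \<subseteq> C n" "\<And>n. measure P (C n) < r + 1 / Suc n"
    by metis
  \<comment> \<open>No measurable superset has measure below the infimum \<open>r\<close>, so
    \<open>inner\<close> applies at every level strictly under \<open>r\<close>.\<close>
  have "\<exists>W\<in>sets P. W \<subseteq> B \<and> r - 1 / Suc n \<le> measure P W" for n
  proof (rule inner, rule notI)
    assume "\<exists>C\<in>sets P. B \<subseteq> C \<and> measure P C \<le> r - 1 / real (Suc n)"
    then obtain C where "C \<in> sets P" "B \<subseteq> C" "measure P C \<le> r - 1 / real (Suc n)" by auto
    then have "r \<le> r - 1 / real (Suc n)" unfolding r_def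
      by (intro order_trans[OF cInf_lower[OF _ Rb]]) (auto simp: R_def)
    then show False by simp
  qed
  then obtain W where W: "\<And>n. W n \<in> sets P" "\<And>n. W n \<subseteq> B" "\<And>n. r - 1 / Suc n \<le> measure P (W n)"
    by metis
  define V where "V = (\<Union>n. W n)"
  define D where "D = (\<Inter>n. C n)"
  have VD: "V \<in> sets P" "D \<in> sets P" "V \<subseteq> B" "B \<subseteq> D"
    using W(1,2) C(1,2) by (auto simp: V_def D_def dest: subsetD[OF C(2)])
  have "measure P (D - V) \<le> 2 * (1 / Suc n)" for n
  proof -
    have "measure P (D - V) = measure P D - measure P V"
      using VD by (intro finite_measure_Diff) auto
    moreover have "measure P D \<le> measure P (C n)" using C(1) by (intro finite_measure_mono) (auto simp: D_def)
    moreover have "measure P (W n) \<le> measure P V" using VD by (intro finite_measure_mono) (auto simp: V_def)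
    ultimately show ?thesis using C(3)[of n] W(3)[of n] by linarith
  qed
  then have "(\<lambda>n. 2 * (1 / Suc n)) \<longlonglongrightarrow> 2 * 0 \<Longrightarrow> measure P (D - V) \<le> 2 * 0"
    by (intro LIMSEQ_le_const) auto
  moreover have "(\<lambda>n. 2 * (1 / real (Suc n))) \<longlonglongrightarrow> 2 * 0"
    by (intro tendsto_intros) (use LIMSEQ_inverse_real_of_nat in \<open>simp add: field_simps\<close>)
  ultimately have "measure P (D - V) = 0" by (simp add: measure_le_0_iff)
  \<comment> \<open>The hull \<open>D\<close> and the kernel \<open>V\<close> differ by a null set;
    completeness makes its subset \<open>B - V\<close> measurable.\<close>
  then have "D - V \<in> null_sets P" using VD by (auto simp: null_sets_def emeasure_eq_measure)
  then have "B - V \<in> sets P" using VD by (intro complete[of "B - V" "D - V"]) auto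
  then have "V \<union> (B - V) \<in> sets P" using VD by blast
  then show ?thesis using VD by (simp add: Un_absorb1)
qed

text \<open>Continuity of an outer measure along increasing sets: the covers \<open>C n\<close> need
  not increase, but their tail intersections do, and these still contain \<open>A n\<close> because
  every \<open>A m\<close> with \<open>m \<ge> n\<close> does.\<close>

lemma outer_bound_UN:
  assumes "finite_measure P" "incseq A"
    and "\<And>n::nat. \<exists>C\<in>sets P. A n \<subseteq> C \<and> measure P C \<le> r"
  shows "\<exists>C\<in>sets P. (\<Union>n. A n) \<subseteq> C \<and> measure P C \<le> r"
proof -
  interpret finite_measure P by fact
  obtain C where C: "\<And>n. C n \<in> sets P" "\<And>n. A n \<subseteq> C n" "\<And>n. measure P (C n) \<le> r"
    using assms(3) by metis
  define D where "D n = (\<Inter>m\<in>{n..}. C m)" for n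
  have D: "D n \<in> sets P" for n unfolding D_def by (rule sets.countable_INT') (auto simp: C)
  have AD: "A n \<subseteq> D n" for n using C(2) incseqD[OF assms(2)] by (fastforce simp: D_def)
  have inc: "incseq D" by (auto simp: incseq_def D_def)
  have Dr: "measure P (D n) \<le> r" for n
    by (rule order_trans[OF finite_measure_mono C(3)[of n]]) (auto simp: D_def C)
  have "(\<lambda>n. measure P (D n)) \<longlonglongrightarrow> measure P (\<Union>n. D n)"
    using D inc by (intro finite_Lim_measure_incseq) auto
  then have "measure P (\<Union>n. D n) \<le> r" by (rule LIMSEQ_le_const2) (use Dr in auto)
  then show ?thesis using AD D by (intro bexI[of _ "\<Union>n. D n"]) auto
qed

lemma compact_bounded_seqs: "compact {z::nat \<Rightarrow> nat. \<forall>i. z i \<le> k i}"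
proof -
  have "compactin (product_topology (\<lambda>i::nat. euclidean) UNIV) (PiE UNIV (\<lambda>i. {..k i}))"
    by (subst compactin_PiE) (auto intro: finite_imp_compact)
  then have "compact (PiE UNIV (\<lambda>i. {..k i}))"
    by (simp add: euclidean_product_topology)
  also have "PiE UNIV (\<lambda>i. {..k i}) = {z. \<forall>i. z i \<le> k i}" by auto
  finally show ?thesis .
qed

text \<open>The capacity argument: bounding the coordinates of the witness one after the other loses
  no outer measure, and bounded witnesses form a compact set.\<close>

lemma suslin_projection_cylinders:
  fixes F :: "nat \<Rightarrow> 'w set" and U :: "nat \<Rightarrow> (nat \<Rightarrow> nat) set"
  assumes "finite_measure P" "complete_measure P"
    and F: "\<And>i. F i \<in> sets P"
    and U: "\<And>i z z'. (\<forall>j < N i. z j = z' j) \<Longrightarrow> z \<in> U i \<Longrightarrow> z' \<in> U i"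
  shows "{\<omega> \<in> space P. \<exists>z. \<forall>i. \<omega> \<in> F i \<longrightarrow> z \<notin> U i} \<in> sets P" (is "?B \<in> _")
proof (rule measurable_if_inner_outer_approx[OF assms(1,2)])
  interpret finite_measure P by fact
  fix r :: real
  define out where "out A \<longleftrightarrow> (\<exists>C\<in>sets P. A \<subseteq> C \<and> measure P C \<le> r)" for A
  assume "\<not> (\<exists>C\<in>sets P. ?B \<subseteq> C \<and> measure P C \<le> r)"
  then have nB: "\<not> out ?B" by (simp add: out_def)
  define good where "good z \<omega> \<longleftrightarrow> (\<forall>i. \<omega> \<in> F i \<longrightarrow> z \<notin> U i)" for z \<omega>
  \<comment> \<open>Points with a good witness whose first coordinates are bounded by the list
    \<open>s\<close>; the remaining coordinates are still free.\<close>
  define Bs where "Bs s = {\<omega> \<in> space P. \<exists>z. (\<forall>i<length s. z i \<le> s ! i) \<and> good z \<omega>}" for s :: "nat list"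
  have step: "\<exists>k. \<not> out (Bs (s @ [k]))" if "\<not> out (Bs s)" for s
  proof (rule ccontr)
    assume "\<not> ?thesis"
    then have "\<exists>C\<in>sets P. (\<Union>k. Bs (s @ [k])) \<subseteq> C \<and> measure P C \<le> r"
      by (intro outer_bound_UN[OF assms(1)])
        (auto simp: incseq_def Bs_def out_def nth_append, metis le_trans less_antisym)
    moreover have "Bs s \<subseteq> (\<Union>k. Bs (s @ [k]))"
    proof
      fix \<omega> assume "\<omega> \<in> Bs s"
      then obtain z where "\<omega> \<in> space P" "\<forall>i<length s. z i \<le> s ! i" "good z \<omega>" by (auto simp: Bs_def)
      then have "\<omega> \<in> Bs (s @ [z (length s)])"
        unfolding Bs_def by (auto intro!: exI[of _ z] simp: nth_append less_Suc_eq)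
      then show "\<omega> \<in> (\<Union>k. Bs (s @ [k]))" by blast
    qed
    ultimately show False using that by (auto simp: out_def)
  qed
  have "\<exists>S. \<forall>n. (length (S n) = n \<and> \<not> out (Bs (S n))) \<and> (\<exists>k. S (Suc n) = S n @ [k])"
  proof (rule dependent_nat_choice)
    show "\<exists>x. length x = 0 \<and> \<not> out (Bs x)" using nB by (simp add: Bs_def good_def)
    show "\<exists>y. (length y = Suc n \<and> \<not> out (Bs y)) \<and> (\<exists>k. y = x @ [k])"
      if "length x = n \<and> \<not> out (Bs x)" for x n
      using step[of x] that by (metis length_append_singleton)
  qed
  then obtain S where S: "\<And>n. length (S n) = n" "\<And>n. \<not> out (Bs (S n))" "\<And>n. \<exists>k. S (Suc n) = S n @ [k]"
    by blast
  define k where "k i = S (Suc i) ! i" for i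
  have Sk: "S n ! i = k i" if "i < n" for i n
    using that
  proof (induction n)
    case (Suc n)
    show ?case
    proof (cases "i = n")
      case False
      then have "i < n" using Suc.prems by simp
      moreover obtain k' where "S (Suc n) = S n @ [k']" using S(3) by blast
      ultimately show ?thesis using Suc.IH S(1) by (simp add: nth_append)
    qed (simp add: k_def)
  qed simp
  \<comment> \<open>\<open>W n\<close> keeps all the bounds \<open>k\<close> but only finitely many
    constraints, those that see the first \<open>n\<close> coordinates. A witness may then be
    truncated to a list, and \<open>W n\<close> is measurable as a countable union over
    lists.\<close>
  define W where "W n = {\<omega> \<in> space P. \<exists>z. (\<forall>i. z i \<le> k i) \<and> (\<forall>i<n. N i \<le> n \<longrightarrow> \<omega> \<in> F i \<longrightarrow> z \<notin> U i)}" for n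
  have W_alt: "W n = (\<Union>s::nat list. if length s = n \<and> (\<forall>i<n. s ! i \<le> k i) then
      {\<omega> \<in> space P. \<forall>i\<in>{..<n}. N i \<le> n \<longrightarrow> \<omega> \<in> F i \<longrightarrow> (\<lambda>i. if i < n then s ! i else 0) \<notin> U i} else {})" for n
  proof (intro set_eqI iffI)
    fix \<omega> assume "\<omega> \<in> W n"
    then obtain z where z: "\<omega> \<in> space P" "\<forall>i. z i \<le> k i" "\<forall>i<n. N i \<le> n \<longrightarrow> \<omega> \<in> F i \<longrightarrow> z \<notin> U i"
      by (auto simp: W_def)
    have "(\<lambda>j. if j < n then map z [0..<n] ! j else 0) \<notin> U i" if "z \<notin> U i" "N i \<le> n" for i
    proof
      assume "(\<lambda>j. if j < n then map z [0..<n] ! j else 0) \<in> U i"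
      then have "z \<in> U i" by (rule U[rotated]) (use that in auto)
      then show False using that by simp
    qed
    then show "\<omega> \<in> (\<Union>s. if length s = n \<and> (\<forall>i<n. s ! i \<le> k i) then
      {\<omega> \<in> space P. \<forall>i\<in>{..<n}. N i \<le> n \<longrightarrow> \<omega> \<in> F i \<longrightarrow> (\<lambda>i. if i < n then s ! i else 0) \<notin> U i} else {})"
      using z by (intro UN_I[of "map z [0..<n]"]) auto
  next
    fix \<omega> assume "\<omega> \<in> (\<Union>s. if length s = n \<and> (\<forall>i<n. s ! i \<le> k i) then
      {\<omega> \<in> space P. \<forall>i\<in>{..<n}. N i \<le> n \<longrightarrow> \<omega> \<in> F i \<longrightarrow> (\<lambda>i. if i < n then s ! i else 0) \<notin> U i} else {})"
    then obtain s :: "nat list" where "\<omega> \<in> space P" "\<forall>i<n. s ! i \<le> k i"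
        "\<forall>i\<in>{..<n}. N i \<le> n \<longrightarrow> \<omega> \<in> F i \<longrightarrow> (\<lambda>i. if i < n then s ! i else 0) \<notin> U i"
      by (auto split: if_splits)
    then show "\<omega> \<in> W n"
      by (auto simp: W_def intro!: exI[of _ "\<lambda>i. if i < n then s ! i else 0"])
  qed
  have Wm: "W n \<in> sets P" for n
  proof -
    have "{\<omega> \<in> space P. \<forall>i\<in>{..<n}. N i \<le> n \<longrightarrow> \<omega> \<in> F i \<longrightarrow> V i} \<in> sets P" for V n
    proof (rule sets.sets_Collect_finite_All)
      fix i
      have "{\<omega> \<in> space P. N i \<le> n \<longrightarrow> \<omega> \<in> F i \<longrightarrow> V i} = (if N i \<le> n \<and> \<not> V i then space P - F i else space P)"
        by auto
      then show "{\<omega> \<in> space P. N i \<le> n \<longrightarrow> \<omega> \<in> F i \<longrightarrow> V i} \<in> sets P" using F by auto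
    qed simp
    note * = this
    have "(if b then {\<omega> \<in> space P. \<forall>i\<in>{..<n}. N i \<le> n \<longrightarrow> \<omega> \<in> F i \<longrightarrow> V i} else {}) \<in> sets P" for b V n
      by (cases b) (simp_all only: if_True if_False * sets.empty_sets)
    then show ?thesis unfolding W_alt by (intro sets.countable_UN image_subsetI)
  qed
  have WB: "Bs (S n) \<subseteq> W n" for n
  proof
    fix \<omega> assume "\<omega> \<in> Bs (S n)"
    then obtain z where z: "\<omega> \<in> space P" "\<forall>i<n. z i \<le> k i" "good z \<omega>" by (auto simp: Bs_def S(1) Sk)
    have "(\<lambda>j. if j < n then z j else 0) \<notin> U i" if "z \<notin> U i" "N i \<le> n" for i
    proof
      assume "(\<lambda>j. if j < n then z j else 0) \<in> U i"
      then have "z \<in> U i" by (rule U[rotated]) (use that in auto)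
      then show False using that by simp
    qed
    then show "\<omega> \<in> W n" using z by (auto simp: W_def good_def intro!: exI[of _ "\<lambda>j. if j < n then z j else 0"])
  qed
  have Wr: "r \<le> measure P (W n)" for n
    using S(2)[of n] WB[of n] Wm[of n] unfolding out_def by force
  have Wdec: "decseq W" unfolding decseq_def
  proof (intro allI impI subsetI)
    fix m n \<omega> assume mn: "m \<le> n" and "\<omega> \<in> W n"
    then obtain z where z: "\<omega> \<in> space P" "\<forall>i. z i \<le> k i" "\<And>i. i < n \<Longrightarrow> N i \<le> n \<Longrightarrow> \<omega> \<in> F i \<Longrightarrow> z \<notin> U i"
      unfolding W_def by blast
    have "z \<notin> U i" if "i < m" "N i \<le> m" "\<omega> \<in> F i" for i using z(3)[of i] that mn by linarith
    then show "\<omega> \<in> W m" using z unfolding W_def by blast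
  qed
  have "(\<lambda>n. measure P (W n)) \<longlonglongrightarrow> measure P (\<Inter>n. W n)"
    using Wm Wdec by (intro finite_Lim_measure_decseq) auto
  then have "r \<le> measure P (\<Inter>n. W n)" by (rule LIMSEQ_le_const) (use Wr in auto)
  moreover have "(\<Inter>n. W n) \<subseteq> ?B"
  proof
    fix \<omega> assume \<omega>: "\<omega> \<in> (\<Inter>n. W n)"
    then have "\<forall>n. \<exists>z. (\<forall>i. z i \<le> k i) \<and> (\<forall>i<n. N i \<le> n \<longrightarrow> \<omega> \<in> F i \<longrightarrow> z \<notin> U i)" by (auto simp: W_def)
    then obtain z where z: "\<And>n i. z n i \<le> k i" "\<And>n i. i < n \<Longrightarrow> N i \<le> n \<Longrightarrow> \<omega> \<in> F i \<Longrightarrow> z n \<notin> U i" by metis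
    \<comment> \<open>The approximate witnesses have a limit point in the box of bounded sequences.
      In the discrete topology each coordinate is eventually that of the limit, and each
      \<open>U i\<close> depends on finitely many coordinates, so the limit violates no
      constraint.\<close>
    have "seq_compact {z::nat \<Rightarrow> nat. \<forall>i. z i \<le> k i}"
      using compact_bounded_seqs by (rule compact_imp_seq_compact)
    then obtain l \<sigma> where l: "strict_mono \<sigma>" "(z \<circ> \<sigma>) \<longlonglongrightarrow> l"
      using z(1) by (elim seq_compactE[where f = z]) auto
    have ev: "\<forall>\<^sub>F n in sequentially. z (\<sigma> n) i = l i" for i
    proof -
      have "(\<lambda>n. (z \<circ> \<sigma>) n i) \<longlonglongrightarrow> l i" 
        using continuous_on_tendsto_compose[OF continuous_on_product_coordinates l(2)] by simp
      then show ?thesis by (simp add: tendsto_discrete)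
    qed
    have "l \<notin> U i" if i: "\<omega> \<in> F i" for i
    proof
      assume lU: "l \<in> U i"
      have "\<forall>\<^sub>F n in sequentially. \<forall>j\<in>{..<N i}. z (\<sigma> n) j = l j"
        by (intro eventually_ball_finite) (auto intro: ev)
      moreover have "\<forall>\<^sub>F n in sequentially. n > i + N i" by (rule eventually_gt_at_top)
      ultimately have "\<forall>\<^sub>F n in sequentially. False"
      proof eventually_elim
        case (elim n)
        have "\<sigma> n \<ge> n" using l(1) by (rule strict_mono_imp_increasing)
        then have "z (\<sigma> n) \<notin> U i" using elim i by (intro z(2)) auto
        moreover have "z (\<sigma> n) \<in> U i" using lU by (rule U[rotated]) (use elim in auto)
        ultimately show False by simp
      qed
      then show False by simp
    qed
    then show "\<omega> \<in> ?B" using \<omega> by (auto simp: W_def)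
  qed
  ultimately show "\<exists>W\<in>sets P. W \<subseteq> ?B \<and> r \<le> measure P W" using Wm by (intro bexI[of _ "\<Inter>n. W n"]) auto
qed auto

section \<open>Suslin sets over a probability space and Baire space, and their projections\<close>

definition cylinder :: "nat list \<Rightarrow> (nat \<Rightarrow> nat) set" where
  "cylinder s = {z. \<forall>i<length s. z i = s ! i}"

lemma open_contains_cylinder:
  assumes "open U" "z \<in> U"
  shows "\<exists>s. z \<in> cylinder s \<and> cylinder s \<subseteq> U"
proof -
  have "openin (product_topology (\<lambda>i::nat. euclidean :: nat topology) UNIV) U"
    using assms(1) by (simp add: open_fun_def)
  from product_topology_open_contains_basis[OF this assms(2)]
  obtain V where V: "z \<in> PiE UNIV V" "finite {i. V i \<noteq> UNIV}" "PiE UNIV V \<subseteq> U" by auto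
  obtain n where n: "\<And>i. V i \<noteq> UNIV \<Longrightarrow> i < n"
    using finite_nat_set_iff_bounded V(2) by auto
  have "cylinder (map z [0..<n]) \<subseteq> PiE UNIV V"
  proof
    fix y assume "y \<in> cylinder (map z [0..<n])"
    then have "y i \<in> V i" for i using n[of i] V(1) by (cases "i < n") (auto simp: cylinder_def PiE_def Pi_def)
    then show "y \<in> PiE UNIV V" by auto
  qed
  then show ?thesis using V(3) by (intro exI[of _ "map z [0..<n]"]) (auto simp: cylinder_def)
qed

text \<open>Lists are countable, so a constraint on an open set splits into countably many
  constraints on the cylinders inside it, which fall under the version with finitely many
  coordinates.\<close>

lemma suslin_projection_open:
  fixes F :: "nat \<Rightarrow> 'w set" and U :: "nat \<Rightarrow> (nat \<Rightarrow> nat) set"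
  assumes "finite_measure P" "complete_measure P"
    and F: "\<And>i. F i \<in> sets P" and U: "\<And>i. open (U i)"
  shows "{\<omega> \<in> space P. \<exists>z. \<forall>i. \<omega> \<in> F i \<longrightarrow> z \<notin> U i} \<in> sets P"
proof -
  define ix :: "nat \<Rightarrow> nat \<times> nat list" where "ix = from_nat"
  have ix: "\<exists>n. ix n = p" for p by (metis from_nat_to_nat ix_def)
  define F' where "F' n = (case ix n of (i, s) \<Rightarrow> if cylinder s \<subseteq> U i then F i else {})" for n
  define U' where "U' n = cylinder (snd (ix n))" for n
  have "(\<forall>i. \<omega> \<in> F i \<longrightarrow> z \<notin> U i) \<longleftrightarrow> (\<forall>n. \<omega> \<in> F' n \<longrightarrow> z \<notin> U' n)" for \<omega> z
  proof
    assume "\<forall>i. \<omega> \<in> F i \<longrightarrow> z \<notin> U i"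
    then show "\<forall>n. \<omega> \<in> F' n \<longrightarrow> z \<notin> U' n" by (auto simp: F'_def U'_def split: prod.splits if_splits)
  next
    assume *: "\<forall>n. \<omega> \<in> F' n \<longrightarrow> z \<notin> U' n"
    show "\<forall>i. \<omega> \<in> F i \<longrightarrow> z \<notin> U i"
    proof (intro allI impI notI)
      fix i assume i: "\<omega> \<in> F i" "z \<in> U i"
      obtain s where s: "z \<in> cylinder s" "cylinder s \<subseteq> U i" using open_contains_cylinder[OF U i(2)] by blast
      obtain n where "ix n = (i, s)" using ix by blast
      then show False using * i s by (auto simp: F'_def U'_def dest!: spec[of _ n])
    qed
  qed
  moreover have "{\<omega> \<in> space P. \<exists>z. \<forall>n. \<omega> \<in> F' n \<longrightarrow> z \<notin> U' n} \<in> sets P"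
    by (rule suslin_projection_cylinders[OF assms(1,2), where N = "\<lambda>n. length (snd (ix n))"])
      (auto simp: F'_def U'_def cylinder_def F split: prod.splits)
  ultimately show ?thesis by simp
qed

text \<open>The projection, along a second copy of Baire space, of the complement of a countable
  union of products \<open>F i \<times> U i\<close>. Keeping the two factors apart lets the
  stability proofs act on the open parts by continuous preimages alone.\<close>

definition suslin_rep :: "'w measure \<Rightarrow> (nat \<Rightarrow> 'w set) \<Rightarrow> (nat \<Rightarrow> ((nat \<Rightarrow> nat) \<times> (nat \<Rightarrow> nat)) set) \<Rightarrow>
    ('w \<times> (nat \<Rightarrow> nat)) set \<Rightarrow> bool" where
  "suslin_rep P F U A \<longleftrightarrow> (\<forall>i. F i \<in> sets P) \<and> (\<forall>i. open (U i)) \<and>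
     A = {(\<omega>, x). \<omega> \<in> space P \<and> (\<exists>y. \<forall>i. \<omega> \<in> F i \<longrightarrow> (x, y) \<notin> U i)}"

definition suslin :: "'w measure \<Rightarrow> ('w \<times> (nat \<Rightarrow> nat)) set \<Rightarrow> bool" where
  "suslin P A \<longleftrightarrow> (\<exists>F U. suslin_rep P F U A)"

text \<open>One sequence carries the two points \<open>x\<close> and \<open>y\<close> in its even
  and odd coordinates; the decoding is continuous, so open constraints stay open.\<close>

lemma suslin_projection:
  assumes "finite_measure P" "complete_measure P" "suslin P A"
  shows "{\<omega> \<in> space P. \<exists>x. (\<omega>, x) \<in> A} \<in> sets P"
proof -
  obtain F U where FU: "\<And>i::nat. F i \<in> sets P" "\<And>i. open (U i)"
    "A = {(\<omega>, x). \<omega> \<in> space P \<and> (\<exists>y::nat\<Rightarrow>nat. \<forall>i. \<omega> \<in> F i \<longrightarrow> (x, y) \<notin> U i)}"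
    using assms(3) unfolding suslin_def suslin_rep_def by blast
  define \<phi> :: "(nat \<Rightarrow> nat) \<Rightarrow> (nat \<Rightarrow> nat) \<times> (nat \<Rightarrow> nat)"
    where "\<phi> z = (\<lambda>m. z (2 * m), \<lambda>m. z (2 * m + 1))" for z
  have cont: "continuous_on UNIV \<phi>" unfolding \<phi>_def
    by (intro continuous_intros continuous_on_coordinatewise_then_product) auto
  have surj: "\<exists>z. \<phi> z = (x, y)" for x y
    by (rule exI[of _ "\<lambda>n. if even n then x (n div 2) else y (n div 2)"]) (auto simp: \<phi>_def)
  have "{\<omega> \<in> space P. \<exists>x. (\<omega>, x) \<in> A} = {\<omega> \<in> space P. \<exists>z. \<forall>i. \<omega> \<in> F i \<longrightarrow> z \<notin> \<phi> -` U i}"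
    unfolding FU(3) by (auto, metis surj, metis surj prod.collapse)
  also have "\<dots> \<in> sets P"
    by (intro suslin_projection_open[OF assms(1,2) FU(1)] open_vimage FU(2) cont)
  finally show ?thesis .
qed

lemma continuous_on_snd_coordinate: "continuous_on UNIV (\<lambda>p::(nat \<Rightarrow> nat) \<times> (nat \<Rightarrow> nat). snd p m)"
  by (rule continuous_on_compose2[OF continuous_on_product_coordinates continuous_on_snd[OF continuous_on_id]]) simp

text \<open>Each of the sets needs its own witness. All of them are packed into a single sequence
  through \<open>prod_encode\<close>, and the constraints of the \<open>n\<close>-th set read only
  its own row.\<close>

lemma suslin_INT:
  assumes "\<And>n::nat. suslin P (A n)"
  shows "suslin P (\<Inter>n. A n)"
proof -
  obtain F U where rep: "\<And>n. suslin_rep P (F n) (U n) (A n)"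
    using assms unfolding suslin_def by metis
  have FU: "F n i \<in> sets P" "open (U n i)"
    "A n = {(\<omega>, x). \<omega> \<in> space P \<and> (\<exists>y::nat\<Rightarrow>nat. \<forall>i. \<omega> \<in> F n i \<longrightarrow> (x, y) \<notin> U n i)}" for n i
    using rep[of n] unfolding suslin_rep_def by blast+
  define \<phi> where "\<phi> n = (\<lambda>(x::nat\<Rightarrow>nat, y::nat\<Rightarrow>nat). (x, \<lambda>m. y (prod_encode (n, m))))" for n
  have cont: "continuous_on UNIV (\<phi> n)" for n unfolding \<phi>_def case_prod_beta
    by (intro continuous_on_Pair continuous_on_coordinatewise_then_product continuous_on_snd_coordinate
        continuous_on_fst continuous_on_id)
  define F' where "F' k = (case prod_decode k of (n, i) \<Rightarrow> F n i)" for k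
  define U' where "U' k = (case prod_decode k of (n, i) \<Rightarrow> \<phi> n -` U n i)" for k
  have "(\<Inter>n. A n) = {(\<omega>, x). \<omega> \<in> space P \<and> (\<exists>y. \<forall>k. \<omega> \<in> F' k \<longrightarrow> (x, y) \<notin> U' k)}"
  proof (intro set_eqI iffI; clarsimp)
    fix \<omega> x assume *: "\<forall>n. (\<omega>, x) \<in> A n"
    then have "\<forall>n. \<exists>y. \<forall>i. \<omega> \<in> F n i \<longrightarrow> (x, y) \<notin> U n i" by (auto simp: FU(3))
    then obtain y where y: "\<And>n i. \<omega> \<in> F n i \<Longrightarrow> (x, y n) \<notin> U n i" by metis
    have "\<omega> \<in> space P" using * by (auto simp: FU(3))
    then show "\<omega> \<in> space P \<and> (\<exists>y. \<forall>k. \<omega> \<in> F' k \<longrightarrow> (x, y) \<notin> U' k)"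
      using y by (auto simp: F'_def U'_def \<phi>_def split: prod.splits
        intro!: exI[of _ "\<lambda>k. case prod_decode k of (n, m) \<Rightarrow> y n m"])
  next
    fix \<omega> x y n assume *: "\<omega> \<in> space P" "\<forall>k. \<omega> \<in> F' k \<longrightarrow> (x, y) \<notin> U' k"
    have "\<omega> \<in> F n i \<longrightarrow> (x, \<lambda>m. y (prod_encode (n, m))) \<notin> U n i" for i
      using *(2)[rule_format, of "prod_encode (n, i)"] by (auto simp: F'_def U'_def \<phi>_def)
    then show "(\<omega>, x) \<in> A n" using *(1) by (auto simp: FU(3))
  qed
  moreover have "F' k \<in> sets P" "open (U' k)" for k
    by (auto simp: F'_def U'_def FU split: prod.splits intro!: open_vimage cont)
  ultimately show ?thesis unfolding suslin_def suslin_rep_def by blast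
qed

text \<open>Coordinate 0 of the witness announces which member of the union is meant, and the rest
  is a witness for that member. Fixing this coordinate is an open condition, since the naturals are
  discrete.\<close>

lemma suslin_UN:
  assumes "\<And>n::nat. suslin P (A n)"
  shows "suslin P (\<Union>n. A n)"
proof -
  obtain F U where rep: "\<And>n. suslin_rep P (F n) (U n) (A n)"
    using assms unfolding suslin_def by metis
  have FU: "F n i \<in> sets P" "open (U n i)"
    "A n = {(\<omega>, x). \<omega> \<in> space P \<and> (\<exists>y::nat\<Rightarrow>nat. \<forall>i. \<omega> \<in> F n i \<longrightarrow> (x, y) \<notin> U n i)}" for n i
    using rep[of n] unfolding suslin_rep_def by blast+
  define \<phi> where "\<phi> = (\<lambda>(x::nat\<Rightarrow>nat, y::nat\<Rightarrow>nat). (x, \<lambda>m. y (Suc m)))"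
  note coord = continuous_on_snd_coordinate
  have cont: "continuous_on UNIV \<phi>" unfolding \<phi>_def case_prod_beta
    by (intro continuous_on_Pair continuous_on_coordinatewise_then_product continuous_on_snd_coordinate
        continuous_on_fst continuous_on_id)
  define F' where "F' k = (case prod_decode k of (n, i) \<Rightarrow> F n i)" for k
  define U' where "U' k = (case prod_decode k of (n, i) \<Rightarrow> (\<lambda>p. snd p 0) -` {n} \<inter> \<phi> -` U n i)" for k
  have "(\<Union>n. A n) = {(\<omega>, x). \<omega> \<in> space P \<and> (\<exists>y. \<forall>k. \<omega> \<in> F' k \<longrightarrow> (x, y) \<notin> U' k)}"
  proof (intro set_eqI iffI; clarsimp)
    fix \<omega> x n assume *: "(\<omega>, x) \<in> A n"
    then obtain y where y: "\<omega> \<in> space P" "\<And>i. \<omega> \<in> F n i \<Longrightarrow> (x, y) \<notin> U n i" by (auto simp: FU(3))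
    then show "\<omega> \<in> space P \<and> (\<exists>y. \<forall>k. \<omega> \<in> F' k \<longrightarrow> (x, y) \<notin> U' k)"
      by (auto simp: F'_def U'_def \<phi>_def split: prod.splits
        intro!: exI[of _ "\<lambda>k. case k of 0 \<Rightarrow> n | Suc m \<Rightarrow> y m"])
  next
    fix \<omega> x y assume *: "\<omega> \<in> space P" "\<forall>k. \<omega> \<in> F' k \<longrightarrow> (x, y) \<notin> U' k"
    have "\<omega> \<in> F (y 0) i \<longrightarrow> (x, \<lambda>m. y (Suc m)) \<notin> U (y 0) i" for i
      using *(2)[rule_format, of "prod_encode (y 0, i)"] by (auto simp: F'_def U'_def \<phi>_def)
    then show "\<exists>n. (\<omega>, x) \<in> A n" using *(1) by (auto simp: FU(3))
  qed
  moreover have "F' k \<in> sets P" "open (U' k)" for k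
    by (auto simp: F'_def U'_def FU split: prod.splits intro!: open_vimage cont open_Int coord discrete_topology_class.open_discrete)
  ultimately show ?thesis unfolding suslin_def suslin_rep_def by blast
qed

text \<open>Two kinds of constraints: index 0 excludes every \<omega> outside \<open>F\<close>,
  whatever the code, and all other indices exclude the codes outside \<open>V\<close>.\<close>

lemma suslin_rectangle:
  assumes "F \<in> sets P" "closed V"
  shows "suslin P (F \<times> V)"
proof -
  have "F \<times> V = {(\<omega>, x). \<omega> \<in> space P \<and> (\<exists>y::nat\<Rightarrow>nat. \<forall>i::nat. \<omega> \<in> (if i = 0 then space P - F else space P) \<longrightarrow>
      (x, y) \<notin> (if i = 0 then UNIV else (- V) \<times> UNIV))}"
    using sets.sets_into_space[OF assms(1)] by (auto dest: spec[of _ "1::nat"] spec[of _ "0::nat"])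
  moreover have "open (if i = (0::nat) then UNIV else (- V) \<times> (UNIV :: (nat \<Rightarrow> nat) set))" for i
    using assms(2) by (auto intro: open_Times)
  moreover have "(if i = (0::nat) then space P - F else space P) \<in> sets P" for i using assms(1) by auto
  ultimately show ?thesis unfolding suslin_def suslin_rep_def
    by (intro exI[of _ "\<lambda>i::nat. if i = 0 then space P - F else space P"]
        exI[of _ "\<lambda>i::nat. if i = 0 then UNIV else (- V) \<times> UNIV"]) auto
qed

lemma suslin_Un: "suslin P A \<Longrightarrow> suslin P B \<Longrightarrow> suslin P (A \<union> B)"
  using suslin_UN[of P "\<lambda>n. if n = 0 then A else B"]
  by (subgoal_tac "(\<Union>n. if n = (0::nat) then A else B) = A \<union> B") (auto split: if_splits)

abbreviation baire :: "(nat \<Rightarrow> nat) measure" where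
  "baire \<equiv> PiM UNIV (\<lambda>_. count_space UNIV)"

text \<open>Suslin sets are in general not closed under complement. The sets that are Suslin
  together with their complement do form a sigma-algebra, and it contains the generating rectangles
  because their sides in Baire space are both open and closed.\<close>

lemma suslin_measurable:
  assumes "A \<in> sets (P \<Otimes>\<^sub>M baire)"
  shows "suslin P A"
proof -
  define \<Omega> where "\<Omega> = space P \<times> (UNIV :: (nat \<Rightarrow> nat) set)"
  define \<G> where "\<G> = {A. A \<subseteq> \<Omega> \<and> suslin P A \<and> suslin P (\<Omega> - A)}"
  have rect: "F \<times> V \<in> \<G>" if "F \<in> sets P" "closed V" "open V" for F V
  proof -
    have "\<Omega> - F \<times> V = ((space P - F) \<times> UNIV) \<union> (space P \<times> (- V))" by (auto simp: \<Omega>_def)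
    moreover have "suslin P \<dots>" using that by (intro suslin_Un suslin_rectangle) auto
    ultimately show ?thesis using that sets.sets_into_space[OF that(1)]
      by (auto simp: \<G>_def \<Omega>_def intro: suslin_rectangle)
  qed
  have sa: "sigma_algebra \<Omega> \<G>"
  proof (rule sigma_algebra_iff2[THEN iffD2], intro conjI ballI allI impI)
    show "\<G> \<subseteq> Pow \<Omega>" by (auto simp: \<G>_def)
    show "{} \<in> \<G>" using rect[of "{}" "{}"] by simp
    show "\<Omega> - s \<in> \<G>" if "s \<in> \<G>" for s using that by (auto simp: \<G>_def double_diff)
    show "\<Union> (range A) \<in> \<G>" if "range A \<subseteq> \<G>" for A :: "nat \<Rightarrow> _"
    proof -
      have A: "A n \<subseteq> \<Omega>" "suslin P (A n)" "suslin P (\<Omega> - A n)" for n using that by (auto simp: \<G>_def)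
      have "\<Omega> - (\<Union>n. A n) = (\<Inter>n. \<Omega> - A n)" by auto
      then show ?thesis using A suslin_UN[of P A] suslin_INT[of P "\<lambda>n. \<Omega> - A n"] by (auto simp: \<G>_def)
    qed
  qed
  then interpret sigma_algebra \<Omega> \<G> .
  define Q where "Q = sigma \<Omega> \<G>"
  have Q: "sets Q = \<G>" "space Q = \<Omega>" by (simp_all add: Q_def sigma_sets_eq space_closed)
  have "fst \<in> measurable Q P"
  proof (rule measurableI)
    fix A assume A: "A \<in> sets P"
    then have "fst -` A \<inter> space Q = A \<times> UNIV" using sets.sets_into_space[OF A] by (auto simp: Q \<Omega>_def)
    then show "fst -` A \<inter> space Q \<in> sets Q" using rect[OF A, of UNIV] by (simp add: Q)
  qed (auto simp: Q \<Omega>_def)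
  moreover have "snd \<in> measurable Q baire"
  proof (rule measurable_PiM_single')
    fix i :: nat
    have "(\<lambda>x. snd x i) -` {n} \<inter> space Q \<in> sets Q" for n
    proof -
      have eq: "(\<lambda>x. snd x i) -` {n} \<inter> space Q = space P \<times> {z. z i = n}" by (auto simp: Q \<Omega>_def)
      have c: "continuous_on UNIV (\<lambda>z::nat\<Rightarrow>nat. z i)" by simp
      have "closed {z. z i = n}" "open {z. z i = n}"
        using closed_vimage[of "{n}" "\<lambda>z. z i"] open_vimage[OF discrete_topology_class.open_discrete, of "\<lambda>z. z i" "{n}"] c
        by (simp_all add: vimage_def)
      then show ?thesis unfolding eq unfolding Q by (intro rect) auto
    qed
    then show "(\<lambda>x. snd x i) \<in> measurable Q (count_space UNIV)"
      by (subst measurable_count_space_eq2_countable) auto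
  qed auto
  ultimately have "(\<lambda>x. (fst x, snd x)) \<in> measurable Q (P \<Otimes>\<^sub>M baire)" by (rule measurable_Pair)
  from measurable_sets[OF this assms] have "A \<inter> \<Omega> \<in> \<G>" by (simp add: Q vimage_def Int_def conj_commute)
  moreover have "A \<inter> \<Omega> = A" using sets.sets_into_space[OF assms] by (auto simp: \<Omega>_def space_pair_measure space_PiM)
  ultimately show ?thesis by (simp add: \<G>_def)
qed

lemma measurable_projection_baire:
  assumes "finite_measure P" "complete_measure P" "A \<in> sets (P \<Otimes>\<^sub>M baire)"
  shows "{\<omega> \<in> space P. \<exists>x. (\<omega>, x) \<in> A} \<in> sets P"
  by (intro suslin_projection[OF assms(1,2)] suslin_measurable[OF assms(3)])

text \<open>The strict sublevel set of an infimum is the projection of the strict sublevel set of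
  \<open>f\<close>, whether or not the infimum is attained.\<close>

lemma borel_measurable_INF_baire:
  fixes f :: "'w \<times> (nat \<Rightarrow> nat) \<Rightarrow> ennreal"
  assumes "finite_measure P" "complete_measure P"
    and f: "f \<in> borel_measurable (P \<Otimes>\<^sub>M baire)" and S: "S \<in> sets baire"
  shows "(\<lambda>\<omega>. INF \<theta>\<in>S. f (\<omega>, \<theta>)) \<in> borel_measurable P"
proof (rule borel_measurableI_less)
  fix y
  have "{p \<in> space (P \<Otimes>\<^sub>M baire). f p < y \<and> snd p \<in> S} \<in> sets (P \<Otimes>\<^sub>M baire)"
  proof -
    have "{p \<in> space (P \<Otimes>\<^sub>M baire). f p < y \<and> snd p \<in> S} =
      {p \<in> space (P \<Otimes>\<^sub>M baire). f p < y} \<inter> (snd -` S \<inter> space (P \<Otimes>\<^sub>M baire))" by auto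
    moreover have "snd -` S \<inter> space (P \<Otimes>\<^sub>M baire) \<in> sets (P \<Otimes>\<^sub>M baire)"
      using S by (rule measurable_sets[OF measurable_snd])
    moreover have "{p \<in> space (P \<Otimes>\<^sub>M baire). f p < y} \<in> sets (P \<Otimes>\<^sub>M baire)"
      using f by (rule borel_measurable_less[OF _ borel_measurable_const])
    ultimately show ?thesis by simp
  qed
  from measurable_projection_baire[OF assms(1,2) this]
  have "{\<omega> \<in> space P. \<exists>\<theta>\<in>S. f (\<omega>, \<theta>) < y} \<in> sets P"
    by (rule back_subst[of "\<lambda>A. A \<in> sets P"]) (auto simp: space_pair_measure space_PiM)
  then show "{\<omega> \<in> space P. (INF \<theta>\<in>S. f (\<omega>, \<theta>)) < y} \<in> sets P"
    by (simp add: INF_less_iff)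
qed

section \<open>Hausdorff measure and rectangles\<close>

lemma nn_integral_lborel_translate:
  fixes c :: "'a::euclidean_space"
  assumes "h \<in> borel_measurable borel"
  shows "(\<integral>\<^sup>+x. h (c + x) \<partial>lborel) = (\<integral>\<^sup>+x. h x \<partial>lborel)"
proof -
  have "(\<integral>\<^sup>+x. h x \<partial>lborel) = (\<integral>\<^sup>+x. h x \<partial>distr lborel borel ((+) c))" by (simp add: lborel_distr_plus)
  also have "\<dots> = (\<integral>\<^sup>+x. h (c + x) \<partial>lborel)" by (rule nn_integral_distr) (use assms in auto)
  finally show ?thesis ..
qed

text \<open>Uniqueness of translation invariant measures, by Fubini; the constant is read off the unit ball.\<close>

lemma distr_lborel_orthogonal:
  fixes f :: "'a::euclidean_space \<Rightarrow> 'a"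
  assumes f: "orthogonal_transformation f"
  shows "distr lborel borel f = lborel"
proof (rule measure_eqI)
  have lin: "linear f" using f by (simp add: orthogonal_transformation)
  then have [measurable]: "f \<in> borel_measurable borel"
    by (intro borel_measurable_continuous_onI linear_continuous_on) (simp add: linear_conv_bounded_linear)
  show "sets (distr lborel borel f) = sets lborel" by simp
  fix A assume "A \<in> sets (distr lborel borel f)"
  then have [measurable]: "A \<in> sets borel" by simp
  define g where "g = inv f"
  have fg: "f (g y) = y" for y using orthogonal_transformation_bij[OF f] by (simp add: g_def bij_is_surj surj_f_inv_f)
  have shift: "f (g y + x) = y + f x" for x y using lin by (simp add: linear_add fg)
  define B where "B = ball (0::'a) 1"
  have [measurable]: "B \<in> sets borel" by (simp add: B_def)
  have iB: "indicator B (y - f x) = (indicator B (f x - y) :: ennreal)" for x y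
    by (auto simp: B_def indicator_def norm_minus_commute)
  have iB': "indicator B (- x) = (indicator B x :: ennreal)" for x
    by (auto simp: B_def indicator_def)
  \<comment> \<open>The double integral of \<open>indicator A (f x) * indicator B (y - f x)\<close>
    is evaluated in both orders; integrating over \<open>y\<close> inside gives the measure of the
    preimage times that of the ball.\<close>
  have "emeasure lborel (f -` A) * emeasure lborel B = (\<integral>\<^sup>+x. indicator A (f x) * emeasure lborel B \<partial>lborel)"
  proof -
    have "f -` A \<in> sets borel" using measurable_sets[of f borel borel A] by simp
    moreover have "indicator A (f x) = (indicator (f -` A) x :: ennreal)" for x by (simp add: indicator_def)
    ultimately show ?thesis by (simp add: nn_integral_multc)
  qed
  also have "\<dots> = (\<integral>\<^sup>+x. (\<integral>\<^sup>+y. indicator A (f x) * indicator B (y - f x) \<partial>lborel) \<partial>lborel)"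
  proof (rule nn_integral_cong)
    fix x
    have "(\<integral>\<^sup>+y. indicator B (- f x + y) \<partial>lborel) = (\<integral>\<^sup>+y. indicator B y \<partial>(lborel :: 'a measure))"
      by (rule nn_integral_lborel_translate) simp
    then show "indicator A (f x) * emeasure lborel B = (\<integral>\<^sup>+y. indicator A (f x) * indicator B (y - f x) \<partial>lborel)"
      by (subst nn_integral_cmult) (auto simp: algebra_simps)
  qed
  also have "\<dots> = (\<integral>\<^sup>+y. (\<integral>\<^sup>+x. indicator A (f x) * indicator B (y - f x) \<partial>lborel) \<partial>lborel)"
    by (rule lborel_pair.Fubini') measurable
  \<comment> \<open>Translating \<open>x\<close> by \<open>g y\<close> turns \<open>f x\<close> into
    \<open>y + f x\<close>; the symmetry of the ball under change of sign leaves
    \<open>indicator B (f x)\<close>.\<close>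
  also have "\<dots> = (\<integral>\<^sup>+y. (\<integral>\<^sup>+x. indicator A (y + f x) * indicator B (f x) \<partial>lborel) \<partial>lborel)"
  proof (rule nn_integral_cong)
    fix y
    have "(\<integral>\<^sup>+x. indicator A (f x) * indicator B (y - f x) \<partial>lborel)
      = (\<integral>\<^sup>+x. indicator A (f (g y + x)) * indicator B (y - f (g y + x)) \<partial>lborel)"
      by (rule nn_integral_lborel_translate[symmetric]) measurable
    then show "(\<integral>\<^sup>+x. indicator A (f x) * indicator B (y - f x) \<partial>lborel)
      = (\<integral>\<^sup>+x. indicator A (y + f x) * indicator B (f x) \<partial>lborel)" by (simp add: shift iB iB')
  qed
  also have "\<dots> = (\<integral>\<^sup>+x. (\<integral>\<^sup>+y. indicator A (y + f x) * indicator B (f x) \<partial>lborel) \<partial>lborel)"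
    by (rule lborel_pair.Fubini') measurable
  also have "\<dots> = (\<integral>\<^sup>+x. emeasure lborel A * indicator B (f x) \<partial>lborel)"
  proof (rule nn_integral_cong)
    fix x
    have "(\<integral>\<^sup>+y. indicator A (f x + y) \<partial>lborel) = (\<integral>\<^sup>+y. indicator A y \<partial>(lborel :: 'a measure))"
      by (rule nn_integral_lborel_translate) simp
    then show "(\<integral>\<^sup>+y. indicator A (y + f x) * indicator B (f x) \<partial>lborel) = emeasure lborel A * indicator B (f x)"
      by (subst nn_integral_multc) (auto simp: add.commute)
  qed
  also have "(\<lambda>x. indicator B (f x)) = (indicator B :: 'a \<Rightarrow> ennreal)"
    by (auto simp: B_def indicator_def fun_eq_iff orthogonal_transformation_norm[OF f])
  then have "(\<integral>\<^sup>+x. emeasure lborel A * indicator B (f x) \<partial>lborel) = emeasure lborel A * emeasure lborel B"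
    by (simp add: fun_eq_iff nn_integral_cmult)
  finally have "emeasure lborel (f -` A) * emeasure lborel B = emeasure lborel A * emeasure lborel B" .
  moreover have "emeasure lborel B \<noteq> 0" "emeasure lborel B \<noteq> \<infinity>"
    using emeasure_lborel_ball_finite[of "0::'a" 1] content_ball_pos[of 1 "0::'a"]
    by (auto simp: B_def measure_def)
  ultimately have "emeasure lborel (f -` A) = emeasure lborel A"
    by (metis ennreal_mult_divide_eq infinity_ennreal_def)
  then show "emeasure (distr lborel borel f) A = emeasure lborel A" by (simp add: emeasure_distr)
qed

text \<open>A slab of thickness \<open>h\<close> has \<open>N\<close> disjoint translates in a ball whose radius grows by only \<open>N h\<close>.\<close>

lemma slab_volume:
  fixes S :: "'a::euclidean_space set"
  assumes S: "S \<in> sets borel" "S \<subseteq> ball x r" and w: "norm w = 1"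
    and slab: "\<And>z. z \<in> S \<Longrightarrow> \<alpha> < z \<bullet> w \<and> z \<bullet> w \<le> \<alpha> + h" and h: "0 \<le> h"
  shows "real N * measure lborel S \<le> measure lborel (ball x (r + N * h))"
proof -
  define T where "T k = (\<lambda>z. - (real k * h) *\<^sub>R w + z) -` S" for k :: nat
  have Tm: "T k \<in> sets borel" for k
    using measurable_sets[of "\<lambda>z. - (real k * h) *\<^sub>R w + z" borel borel, OF _ S(1)] by (simp add: T_def)
  have em: "emeasure lborel (T k) = emeasure lborel S" for k
  proof -
    have "emeasure lborel S = emeasure (distr lborel borel ((+) (- (real k * h) *\<^sub>R w))) S"
      by (simp add: lborel_distr_plus)
    also have "\<dots> = emeasure lborel (T k)" using S(1) by (subst emeasure_distr) (auto simp: T_def vimage_def)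
    finally show ?thesis by simp
  qed
  have w1: "w \<bullet> w = 1" using w by (simp add: dot_square_norm)
  have Tz: "\<alpha> + k * h < z \<bullet> w \<and> z \<bullet> w \<le> \<alpha> + (k + 1) * h" if "z \<in> T k" for z k
    using slab[of "- (real k * h) *\<^sub>R w + z"] that w1 by (auto simp: T_def inner_add_left algebra_simps)
  \<comment> \<open>The slab is half-open; this separates its translates by consecutive multiples of
    \<open>h\<close>.\<close>
  have disj: "disjoint_family_on T {..<N}"
    unfolding disjoint_family_on_def
  proof (intro ballI impI, rule ccontr)
    fix m n assume "m \<noteq> n" "T m \<inter> T n \<noteq> {}"
    then obtain z where z: "z \<in> T m" "z \<in> T n" by auto
    have "m < n \<or> n < m" using \<open>m \<noteq> n\<close> by auto
    then have "real m + 1 \<le> real n \<or> real n + 1 \<le> real m" by auto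
    then have "(real m + 1) * h \<le> real n * h \<or> (real n + 1) * h \<le> real m * h"
      using h mult_right_mono by blast
    then show False using Tz[OF z(1)] Tz[OF z(2)] by auto
  qed
  have fin: "emeasure lborel S < \<infinity>"
    by (rule le_less_trans[OF emeasure_mono[OF S(2)] emeasure_lborel_ball_finite]) simp
  have "measure lborel (\<Union>k\<in>{..<N}. T k) = (\<Sum>k\<in>{..<N}. measure lborel (T k))"
    using Tm em fin disj by (intro measure_finite_Union) (auto simp: less_top)
  also have "\<dots> = N * measure lborel S" by (simp add: measure_def em)
  finally have "N * measure lborel S = measure lborel (\<Union>k\<in>{..<N}. T k)" ..
  also have "\<dots> \<le> measure lborel (ball x (r + N * h))"
  proof (rule measure_mono_fmeasurable)
    show "(\<Union>k\<in>{..<N}. T k) \<subseteq> ball x (r + real N * h)"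
    proof
      fix z assume "z \<in> (\<Union>k\<in>{..<N}. T k)"
      then obtain k where k: "k < N" "- (real k * h) *\<^sub>R w + z \<in> S" by (auto simp: T_def)
      then have "dist x (- (real k * h) *\<^sub>R w + z) < r" using S(2) by auto
      moreover have "dist (- (real k * h) *\<^sub>R w + z) z = real k * h" using w h by (simp add: dist_norm)
      moreover have "real k * h \<le> real N * h" using k h by (intro mult_right_mono) auto
      ultimately show "z \<in> ball x (r + real N * h)"
        using dist_triangle[of x z "- (real k * h) *\<^sub>R w + z"] by auto
    qed
  qed (use Tm emeasure_lborel_ball_finite[of x "r + real N * h"] in \<open>auto simp: fmeasurable_def\<close>)
  finally show ?thesis .
qed

section \<open>Hausdorff measure of Lipschitz graphs\<close>

lemma hausdorff_const_nonneg: "0 \<le> s \<Longrightarrow> 0 \<le> hausdorff_const s"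
  unfolding hausdorff_const_def by (auto intro!: divide_nonneg_nonneg Gamma_real_nonneg)

lemma unit_vector_large_coordinate:
  fixes w :: "real^'n"
  assumes "norm w = 1"
  shows "\<exists>i. 1 \<le> sqrt CARD('n) * \<bar>w $ i\<bar>"
proof (rule ccontr)
  assume "\<not> ?thesis"
  then have "sqrt CARD('n) * \<bar>w $ i\<bar> < 1" for i by (simp add: not_le)
  then have "(sqrt CARD('n) * \<bar>w $ i\<bar>)\<^sup>2 < 1" for i by (subst abs_square_less_1) simp
  then have "(\<Sum>i\<in>UNIV. CARD('n) * (w $ i)\<^sup>2) < (\<Sum>i\<in>(UNIV::'n set). 1)"
    by (intro sum_strict_mono) (auto simp: power_mult_distrib)
  moreover have "(\<Sum>i\<in>UNIV. (w $ i)\<^sup>2) = 1" using assms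
    by (simp add: norm_vec_def L2_set_def)
  ultimately show False by (simp flip: sum_distrib_left)
qed

text \<open>The coordinate \<open>i\<close> in which \<open>w\<close> is large can be solved from
  \<open>z \<bullet> w\<close> and the other coordinates: up to a factor sqrt d it is bounded by the
  inner product plus d times \<open>m\<close>. With the slope 1 / (2 sqrt d) the contribution of the
  inner product is half of \<open>norm z\<close> and is absorbed.\<close>

lemma cone_coordinate_bound:
  fixes z w :: "real^'n"
  assumes w: "norm w = 1" "1 \<le> sqrt CARD('n) * \<bar>w $ i\<bar>"
    and cone: "\<bar>z \<bullet> w\<bar> \<le> norm z / (2 * sqrt CARD('n))" and m: "\<And>j. j \<noteq> i \<Longrightarrow> \<bar>z $ j\<bar> \<le> m" "0 \<le> m"
  shows "norm z \<le> 4 * (real CARD('n))\<^sup>2 * m"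
proof -
  let ?d = "real CARD('n)"
  have d1: "1 \<le> ?d" by (simp add: Suc_leI)
  then have sd: "1 \<le> sqrt ?d" "sqrt ?d \<le> ?d"
    using real_sqrt_le_iff[of 1 ?d] real_le_lsqrt[of ?d ?d] by (auto simp: power2_eq_square)
  have split: "(\<Sum>j\<in>UNIV. f j) = f i + (\<Sum>j\<in>UNIV - {i}. f j)" for f :: "'n \<Rightarrow> real"
    by (subst sum.remove[of _ i]) auto
  have cardle: "real (card (UNIV - {i})) \<le> ?d" by (simp add: card_Diff_subset)
  have wj: "\<bar>w $ j\<bar> \<le> 1" for j using component_le_norm_cart[of w j] w by simp
  have "(\<Sum>j\<in>UNIV - {i}. \<bar>z $ j\<bar>) \<le> real (card (UNIV - {i})) * m" by (rule sum_bounded_above) (use m in auto)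
  also have "\<dots> \<le> ?d * m" using cardle m(2) by (rule mult_right_mono)
  finally have rest: "(\<Sum>j\<in>UNIV - {i}. \<bar>z $ j\<bar>) \<le> ?d * m" .
  have "z \<bullet> w = z $ i * w $ i + (\<Sum>j\<in>UNIV - {i}. z $ j * w $ j)"
    using split[of "\<lambda>j. z $ j * w $ j"] by (simp add: inner_vec_def)
  moreover have "\<bar>\<Sum>j\<in>UNIV - {i}. z $ j * w $ j\<bar> \<le> (\<Sum>j\<in>UNIV - {i}. \<bar>z $ j\<bar>)"
    by (rule order_trans[OF sum_abs sum_mono]) (use wj in \<open>auto simp: abs_mult intro: mult_left_le\<close>)
  ultimately have a: "\<bar>z $ i\<bar> * \<bar>w $ i\<bar> \<le> norm z / (2 * sqrt ?d) + ?d * m"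
    using cone rest by (simp add: abs_mult[symmetric])
  have "\<bar>z $ i\<bar> \<le> sqrt ?d * (\<bar>z $ i\<bar> * \<bar>w $ i\<bar>)"
    using mult_left_mono[OF w(2), of "\<bar>z $ i\<bar>"] by (simp add: algebra_simps)
  also have "\<dots> \<le> sqrt ?d * (norm z / (2 * sqrt ?d) + ?d * m)" using a by (rule mult_left_mono) simp
  also have "\<dots> = norm z / 2 + sqrt ?d * (?d * m)" using sd by (simp add: field_simps)
  also have "\<dots> \<le> norm z / 2 + ?d * (?d * m)" using sd m by (intro add_left_mono mult_right_mono) auto
  finally have "\<bar>z $ i\<bar> \<le> norm z / 2 + ?d * (?d * m)" .
  moreover have "norm z \<le> \<bar>z $ i\<bar> + ?d * m"
    using norm_le_l1_cart[of z] split[of "\<lambda>j. \<bar>z $ j\<bar>"] rest by simp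
  moreover have "?d * m \<le> ?d * (?d * m)" using mult_right_mono[OF d1, of "?d * m"] m by simp
  ultimately have "norm z \<le> 4 * (?d * (?d * m))" by linarith
  then show ?thesis by (simp add: power2_eq_square mult.assoc)
qed

text \<open>The factor \<open>4 * (real CARD('n))\<^sup>2\<close> is the constant of
  \<open>cone_coordinate_bound\<close>: it converts the mesh of a grid in d - 1 coordinates into the
  diameter of the pieces.\<close>

definition cone_const :: "'n itself \<Rightarrow> real" where
  "cone_const _ = hausdorff_const (real CARD('n) - 1) * (4 * (real CARD('n))\<^sup>2) powr (real CARD('n) - 1)"

lemma cone_const_nonneg: "0 \<le> cone_const TYPE('n::finite)"
  unfolding cone_const_def by (intro mult_nonneg_nonneg hausdorff_const_nonneg) (auto simp: Suc_leI)

text \<open>Such a set is a Lipschitz graph over the coordinates other than \<open>i\<close>. A grid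
  of mesh \<open>L / N\<close> in these coordinates cuts it into about N^(d-1) pieces of diameter at
  most \<open>c * L / N\<close>, so the cost stays bounded while the diameters tend to 0.\<close>

lemma hausdorff_outer_cone_set:
  fixes S :: "(real^'n) set"
  assumes w: "norm w = 1" and L: "0 < L" and S: "\<And>x j. x \<in> S \<Longrightarrow> \<bar>x $ j - x0 $ j\<bar> \<le> L / 2"
    and cone: "\<And>x y. x \<in> S \<Longrightarrow> y \<in> S \<Longrightarrow> \<bar>(x - y) \<bullet> w\<bar> \<le> norm (x - y) / (2 * sqrt CARD('n))"
  shows "hausdorff_outer (real CARD('n) - 1) S \<le> ennreal (cone_const TYPE('n) * L powr (real CARD('n) - 1))"
  unfolding hausdorff_outer_def
proof (rule SUP_least)
  fix \<delta> :: real assume "\<delta> \<in> {0<..}"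
  then have \<delta>: "\<delta> > 0" by simp
  let ?d = "real CARD('n)"
  define s where "s = ?d - 1"
  have s: "0 \<le> s" by (simp add: s_def Suc_leI)
  obtain i where i: "1 \<le> sqrt CARD('n) * \<bar>w $ i\<bar>" using unit_vector_large_coordinate[OF w] by blast
  define c where "c = 4 * ?d\<^sup>2"
  have c0: "c > 0" by (simp add: c_def)
  obtain N0 :: nat where N0: "c * L / \<delta> < N0" using reals_Archimedean2 by blast
  define N where "N = N0"
  have "0 < c * L / \<delta>" using c0 L \<delta> by simp
  then have "0 < real N" using N0 unfolding N_def by linarith
  then have N: "0 < N" "c * L / N \<le> \<delta>" using N0 \<delta> unfolding N_def
    by (simp_all add: field_simps)
  define cell where "cell x j = nat \<lfloor>(x $ j - x0 $ j + L / 2) * N / L\<rfloor>" for x :: "real^'n" and j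
  \<comment> \<open>There are \<open>N + 1\<close> cells in each direction, because the right end
    point of the range gets the index \<open>N\<close>.\<close>
  define K where "K = (UNIV - {i}) \<rightarrow>\<^sub>E {..N}"
  have finK: "finite K" by (simp add: K_def finite_PiE)
  have "card K = (N + 1) ^ (CARD('n) - 1)" by (simp add: K_def card_PiE)
  then have cardK: "real (card K) = (real N + 1) powr s"
    by (simp add: powr_realpow[symmetric] s_def of_nat_diff Suc_leI add.commute)
  define D where "D \<kappa> = {x\<in>S. \<forall>j\<in>UNIV - {i}. cell x j = \<kappa> j}" for \<kappa>
  obtain h where h: "bij_betw h {..<card K} K" using bij_betw_from_nat_into_finite[OF finK] by blast
  define C where "C n = (if n < card K then D (h n) else {})" for n
  have cover: "S \<subseteq> (\<Union>n. C n)"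
  proof
    fix x assume x: "x \<in> S"
    define \<kappa> where "\<kappa> = restrict (cell x) (UNIV - {i})"
    have "\<kappa> \<in> K" unfolding K_def \<kappa>_def
    proof (rule restrict_PiE_iff[THEN iffD2], intro ballI)
      fix j
      have "(x $ j - x0 $ j + L / 2) * N / L \<le> L * N / L"
        using abs_le_D1[OF S[OF x, of j]] L by (intro divide_right_mono mult_right_mono) auto
      then show "cell x j \<in> {..N}" using L by (auto simp: cell_def nat_le_iff floor_le_iff)
    qed
    then have "\<kappa> \<in> h ` {..<card K}" using h by (simp add: bij_betw_def)
    then obtain n where "n < card K" "h n = \<kappa>" by auto
    then have "x \<in> C n" using x by (auto simp: C_def D_def \<kappa>_def)
    then show "x \<in> (\<Union>n. C n)" by blast
  qed
  have diam: "bounded (D \<kappa>) \<and> diameter (D \<kappa>) \<le> c * L / N" for \<kappa>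
  proof -
    have *: "norm (x - y) \<le> c * L / N" if x: "x \<in> D \<kappa>" and y: "y \<in> D \<kappa>" for x y
    proof -
      have "norm (x - y) \<le> 4 * ?d\<^sup>2 * (L / N)"
      proof (rule cone_coordinate_bound[OF w i])
        show "\<bar>(x - y) \<bullet> w\<bar> \<le> norm (x - y) / (2 * sqrt ?d)" using cone x y by (auto simp: D_def)
        fix j assume j: "j \<noteq> i"
        have "cell x j = cell y j" using x y j by (auto simp: D_def)
        moreover have "0 \<le> (z $ j - x0 $ j + L / 2) * N / L" if "z \<in> S" for z
          using abs_le_D2[OF S[OF that, of j]] L by (intro divide_nonneg_pos mult_nonneg_nonneg) auto
        ultimately have "\<lfloor>(x $ j - x0 $ j + L / 2) * N / L\<rfloor> = \<lfloor>(y $ j - x0 $ j + L / 2) * N / L\<rfloor>"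
          using x y by (auto simp: cell_def D_def nat_eq_iff)
        then have "\<bar>(x $ j - x0 $ j + L / 2) * N / L - (y $ j - x0 $ j + L / 2) * N / L\<bar> < 1" by linarith
        moreover have "(x $ j - x0 $ j + L / 2) * N / L - (y $ j - x0 $ j + L / 2) * N / L = (x - y) $ j * (N / L)"
          using L by (simp add: field_simps)
        ultimately have "\<bar>(x - y) $ j\<bar> * (N / L) < 1" using L by (simp add: abs_mult)
        then show "\<bar>(x - y) $ j\<bar> \<le> L / N" using L N by (simp add: field_simps)
      qed (use L in simp)
      then show ?thesis by (simp add: c_def)
    qed
    then have "bounded (D \<kappa>)"
      by (intro bounded_two_points[THEN iffD2] exI[of _ "c * L / N"]) (auto simp: dist_norm)
    moreover have "diameter (D \<kappa>) \<le> c * L / N"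
      by (rule diameter_le) (use * c0 L in auto)
    ultimately show ?thesis ..
  qed
  have C: "bounded (C n) \<and> diameter (C n) \<le> c * L / N" for n
    using diam[of "h n"] c0 L by (auto simp: C_def)
  have "hausdorff_pre s \<delta> S \<le> (\<Sum>n. ennreal (hausdorff_const s * (diameter (C n) / 2) powr s))"
    unfolding hausdorff_pre_def using cover C N(2) by (intro INF_lower) (auto intro: order_trans)
  also have "\<dots> = (\<Sum>n<card K. ennreal (hausdorff_const s * (diameter (C n) / 2) powr s))"
    by (rule suminf_finite) (auto simp: C_def)
  also have "\<dots> \<le> (\<Sum>n<card K. ennreal (hausdorff_const s * (c * L / N / 2) powr s))"
    using C s by (intro sum_mono ennreal_leI mult_left_mono powr_mono2 hausdorff_const_nonneg) (auto simp: diameter_ge_0)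
  also have "\<dots> = ennreal (card K * (hausdorff_const s * (c * L / N / 2) powr s))"
    using s by (simp add: ennreal_of_nat_eq_real_of_nat ennreal_mult' flip: ennreal_mult)
  also have "\<dots> \<le> ennreal (cone_const TYPE('n) * L powr s)"
  proof (rule ennreal_leI)
    \<comment> \<open>The extra cell per direction is paid for by the halved diameter in the
      Hausdorff pre-measure: \<open>(N + 1) / (2 * N) \<le> 1\<close>.\<close>
    have "(real N + 1) powr s * (c * L / N / 2) powr s = ((real N + 1) / (2 * N) * (c * L)) powr s"
      using c0 L N by (subst powr_mult[symmetric]) (auto simp: field_simps)
    also have "\<dots> \<le> (c * L) powr s"
    proof (rule powr_mono2)
      have "(real N + 1) / (2 * N) \<le> 1" using N by (simp add: field_simps)
      from mult_right_mono[OF this, of "c * L"] show "(real N + 1) / (2 * N) * (c * L) \<le> c * L" using c0 L by simp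
    qed (use s c0 L N in auto)
    also have "(c * L) powr s = c powr s * L powr s" using c0 L by (simp add: powr_mult)
    finally have "hausdorff_const s * ((real N + 1) powr s * (c * L / N / 2) powr s) \<le> hausdorff_const s * (c powr s * L powr s)"
      using hausdorff_const_nonneg[OF s] by (rule mult_left_mono)
    then show "card K * (hausdorff_const s * (c * L / N / 2) powr s) \<le> cone_const TYPE('n) * L powr s"
      unfolding cone_const_def cardK by (simp add: mult_ac flip: c_def s_def)
  qed
  finally show "hausdorff_pre (?d - 1) \<delta> S \<le> ennreal (cone_const TYPE('n) * L powr (?d - 1))" by (simp add: s_def)
qed

text \<open>\<open>measure_of\<close> returns the given set function where this is a measure and 0
  otherwise, so the outer measure is an upper bound in either case.\<close>

lemma emeasure_hausdorff_le: "emeasure (hausdorff_measure s) A \<le> hausdorff_outer s A"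
  unfolding hausdorff_measure_def
  by (cases "A \<in> sigma_sets UNIV (sets borel)") (auto simp: emeasure_measure_of_conv)

lemma sets_hausdorff_measure[simp, measurable_cong]: "sets (hausdorff_measure s) = sets borel"
  unfolding hausdorff_measure_def using sets.sigma_sets_eq[of borel] by (simp add: sets_measure_of_conv)

lemma space_hausdorff_measure[simp]: "space (hausdorff_measure s) = UNIV"
  unfolding hausdorff_measure_def by (simp add: space_measure_of_conv)

lemma hausdorff_measure_flat:
  fixes w :: "real^'n"
  assumes "norm w = 1" "0 < L"
  shows "emeasure (hausdorff_measure (real CARD('n) - 1)) {x. x \<bullet> w = \<beta> \<and> (\<forall>j. \<bar>x $ j - x0 $ j\<bar> \<le> L / 2)}
    \<le> ennreal (cone_const TYPE('n) * L powr (real CARD('n) - 1))"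
  by (rule order_trans[OF emeasure_hausdorff_le], rule hausdorff_outer_cone_set[OF assms])
     (auto simp: inner_diff_left)

section \<open>Geometry of the rotated cell\<close>

lemma O_mat_e_last:
  fixes \<nu> :: "(real, 'n::{finite,linorder}) vec"
  assumes "norm \<nu> = 1"
  shows "O_mat \<nu> e_last = \<nu>"
proof (cases "\<nu> = - e_last")
  case False
  have e: "norm (e_last :: (real, 'n) vec) = 1" by (simp add: e_last_def)
  define n where "n = \<nu> + e_last"
  have "n \<noteq> 0" using False by (simp add: n_def add_eq_0_iff2)
  have "\<nu> \<bullet> \<nu> = 1" "(e_last :: (real, 'n) vec) \<bullet> e_last = 1" using assms e by (simp_all add: dot_square_norm)
  then have "(norm n)\<^sup>2 = 2 * (e_last \<bullet> n)"
    by (simp add: power2_norm_eq_inner n_def inner_add_left inner_add_right inner_commute)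
  moreover have "O_mat \<nu> e_last = (2 * (e_last \<bullet> n) / (norm n)\<^sup>2) *\<^sub>R n - e_last"
    using False by (simp only: O_mat_def n_def if_False)
  moreover have "(norm n)\<^sup>2 \<noteq> 0" using \<open>n \<noteq> 0\<close> by simp
  ultimately have "O_mat \<nu> e_last = n - e_last" by (metis divide_self scaleR_one)
  then show ?thesis by (simp add: n_def)
qed (auto simp: O_mat_def)

text \<open>Away from the exceptional direction \<open>O_mat\<close> is twice the orthogonal
  projection onto the line of \<open>\<nu> + e_last\<close> minus the identity, that is, a half-turn
  about this line.\<close>

lemma O_mat_inner: "O_mat \<nu> x \<bullet> O_mat \<nu> y = x \<bullet> y"
proof (cases "\<nu> = - e_last")
  case False
  define n where "n = \<nu> + e_last"
  have "n \<noteq> 0" using False by (simp add: n_def add_eq_0_iff2)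
  then have nn: "n \<bullet> n \<noteq> 0" by simp
  have O: "O_mat \<nu> x = (2 * (x \<bullet> n) / (n \<bullet> n)) *\<^sub>R n - x" for x
    using False by (simp add: O_mat_def n_def power2_norm_eq_inner)
  have "(2 * a / c) * (2 * b / c) * c = (2 * a / c) * b + (2 * b / c) * a" if "c \<noteq> 0" for a b c :: real
    using that by (simp add: field_simps)
  note key = this[OF nn, of "x \<bullet> n" "y \<bullet> n"]
  define \<alpha> \<beta> where "\<alpha> = 2 * (x \<bullet> n) / (n \<bullet> n)" and "\<beta> = 2 * (y \<bullet> n) / (n \<bullet> n)"
  have "O_mat \<nu> x \<bullet> O_mat \<nu> y = \<alpha> * \<beta> * (n \<bullet> n) - \<alpha> * (y \<bullet> n) - \<beta> * (x \<bullet> n) + x \<bullet> y"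
    unfolding O \<alpha>_def[symmetric] \<beta>_def[symmetric]
    by (simp add: inner_diff_left inner_diff_right inner_commute[of n x] inner_commute[of n y] algebra_simps)
  then show ?thesis using key unfolding \<alpha>_def[symmetric] \<beta>_def[symmetric] by linarith
qed (auto simp: O_mat_def)

lemma O_mat_self_adjoint: "O_mat \<nu> x \<bullet> y = x \<bullet> O_mat \<nu> y"
  by (auto simp: O_mat_def inner_diff_left inner_diff_right inner_commute)

lemma O_mat_orthogonal: "orthogonal_transformation (O_mat \<nu>)"
  unfolding orthogonal_transformation_def
proof
  show "linear (O_mat \<nu>)"
    by (cases "\<nu> = - e_last"; rule linearI)
       (auto simp: O_mat_def inner_add_left algebra_simps add_divide_distrib)
qed (simp add: O_mat_inner)

text \<open>\<open>O_mat\<close> is symmetric and sends \<open>e_last\<close> to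
  \<open>\<nu>\<close>, so the inner products defining the cell are coordinates of the rotated point
  and the cell is the preimage of a coordinate box.\<close>

lemma rect_eq:
  fixes \<nu> :: "(real, 'n::{finite,linorder}) vec"
  assumes "norm \<nu> = 1"
  shows "rect \<nu> t l = {x. \<forall>j. \<bar>O_mat \<nu> x $ j\<bar> < (if j = Max UNIV then l else t) / 2}"
proof -
  have "x \<bullet> \<nu> = O_mat \<nu> x $ Max UNIV" for x
    using O_mat_self_adjoint[of \<nu> x e_last] O_mat_e_last[OF assms] by (simp add: e_last_def inner_axis)
  moreover have "x \<bullet> O_mat \<nu> (axis j 1) = O_mat \<nu> x $ j" for x j
    using O_mat_self_adjoint[of \<nu> x "axis j 1"] by (simp add: inner_axis)
  ultimately show ?thesis by (auto simp: rect_def)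
qed

lemma O_mat_norm: "norm (O_mat \<nu> x) = norm x"
  by (rule orthogonal_transformation_norm[OF O_mat_orthogonal])

lemma O_mat_continuous: "continuous_on S (O_mat \<nu>)"
  using O_mat_orthogonal[of \<nu>]
  by (intro linear_continuous_on) (simp add: linear_conv_bounded_linear orthogonal_transformation)

lemma open_rect:
  fixes \<nu> :: "(real, 'n::{finite,linorder}) vec"
  assumes "norm \<nu> = 1"
  shows "open (rect \<nu> t l)"
  unfolding rect_eq[OF assms] Collect_all_eq
  by (intro open_INT ballI open_Collect_less continuous_intros O_mat_continuous) auto

lemma rect_coordinate_bound:
  fixes \<nu> :: "(real, 'n::{finite,linorder}) vec"
  assumes "norm \<nu> = 1" "l \<le> t" "x \<in> rect \<nu> t l"
  shows "\<bar>x $ j\<bar> \<le> real CARD('n) * t / 2"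
proof -
  have "\<bar>x $ j\<bar> \<le> norm (O_mat \<nu> x)" by (simp add: O_mat_norm component_le_norm_cart)
  also have "\<dots> \<le> (\<Sum>j\<in>UNIV. \<bar>O_mat \<nu> x $ j\<bar>)" by (rule norm_le_l1_cart)
  also have "\<dots> \<le> (\<Sum>j\<in>(UNIV::'n set). t / 2)"
  proof (rule sum_mono)
    fix j
    have "\<bar>O_mat \<nu> x $ j\<bar> < (if j = Max UNIV then l else t) / 2"
      using assms(3) unfolding rect_eq[OF assms(1)] by blast
    then show "\<bar>O_mat \<nu> x $ j\<bar> \<le> t / 2" using assms(2) by (simp split: if_splits)
  qed
  finally show ?thesis by simp
qed

lemma bounded_rect:
  fixes \<nu> :: "(real, 'n::{finite,linorder}) vec"
  assumes "norm \<nu> = 1" "l \<le> t"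
  shows "bounded (rect \<nu> t l)"
proof (rule boundedI)
  fix x assume x: "x \<in> rect \<nu> t l"
  have "norm x \<le> (\<Sum>j\<in>UNIV. \<bar>x $ j\<bar>)" by (rule norm_le_l1_cart)
  also have "\<dots> \<le> (\<Sum>j\<in>(UNIV::'n set). real CARD('n) * t / 2)"
    by (rule sum_mono) (rule rect_coordinate_bound[OF assms x])
  finally show "norm x \<le> (\<Sum>j\<in>(UNIV::'n set). real CARD('n) * t / 2)" .
qed

text \<open>Centres of balls meeting the cell lie in the preimage of the box enlarged by
  \<open>\<sigma>\<close> on every side, and rotations preserve volume. As all lengths are at least
  1, each enlarged side \<open>v + 2 * \<sigma>\<close> is at most \<open>3 * v * \<sigma>\<close>,
  which gives the product form.\<close>

lemma emeasure_enlarged_rect: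
  fixes \<nu> :: "(real, 'n::{finite,linorder}) vec"
  assumes "norm \<nu> = 1" "1 \<le> l" "l \<le> t" "1 \<le> \<sigma>"
  shows "\<exists>N \<in> sets borel. {x. ball x \<sigma> \<inter> rect \<nu> t l \<noteq> {}} \<subseteq> N \<and>
    emeasure lborel N \<le> ennreal (3 ^ CARD('n) * t powr (real CARD('n) - 1) * l * \<sigma> ^ CARD('n))"
proof -
  define r :: "(real, 'n) vec" where "r = (\<chi> j. (if j = Max UNIV then l else t) / 2 + \<sigma>)"
  define N where "N = O_mat \<nu> -` cbox (- r) r"
  have meas: "O_mat \<nu> \<in> borel_measurable borel"
    by (intro borel_measurable_continuous_onI O_mat_continuous)
  have "emeasure lborel N = emeasure (distr lborel borel (O_mat \<nu>)) (cbox (- r) r)"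
    using meas by (simp add: emeasure_distr N_def)
  also have "\<dots> = emeasure lborel (cbox (- r) r)" by (simp add: distr_lborel_orthogonal[OF O_mat_orthogonal])
  also have "\<dots> = ennreal (measure lborel (cbox (- r) r))"
    by (rule emeasure_eq_ennreal_measure) (use emeasure_lborel_cbox_finite[of "- r" r] in auto)
  also have "measure lborel (cbox (- r) r) = (\<Prod>j\<in>UNIV. 2 * r $ j)"
    using assms by (subst content_cbox_cart) (auto simp: r_def interval_ne_empty_cart)
  also have "\<dots> \<le> (\<Prod>j\<in>(UNIV::'n set). (if j = Max UNIV then l else t) * (3 * \<sigma>))"
  proof (rule prod_mono)
    fix j :: 'n
    define v where "v = (if j = Max UNIV then l else t)"
    have v: "1 \<le> v" using assms by (auto simp: v_def)
    have "v \<le> v * \<sigma>" "\<sigma> \<le> v * \<sigma>" using v assms mult_left_mono[of 1 \<sigma> v] mult_right_mono[of 1 v \<sigma>] by simp_all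
    moreover have "r $ j = v / 2 + \<sigma>" by (simp add: r_def v_def)
    ultimately show "0 \<le> 2 * r $ j \<and> 2 * r $ j \<le> (if j = Max UNIV then l else t) * (3 * \<sigma>)"
      using v assms(4) unfolding v_def[symmetric] by (intro conjI) linarith+
  qed
  also have "\<dots> = (\<Prod>j\<in>(UNIV::'n set). if j = Max UNIV then l else t) * (3 * \<sigma>) ^ CARD('n)"
    by (simp add: prod.distrib)
  also have "(\<Prod>j\<in>(UNIV::'n set). if j = Max UNIV then l else t) = l * t ^ (CARD('n) - 1)"
    by (subst prod.remove[of _ "Max UNIV"]) (auto simp: card_Diff_subset)
  also have "t ^ (CARD('n) - 1) = t powr (real CARD('n) - 1)"
    using assms by (simp add: powr_realpow[symmetric] of_nat_diff Suc_leI)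
  finally have "emeasure lborel N \<le> ennreal (3 ^ CARD('n) * t powr (real CARD('n) - 1) * l * \<sigma> ^ CARD('n))"
    by (simp add: ennreal_leI power_mult_distrib algebra_simps)
  moreover have "{x. ball x \<sigma> \<inter> rect \<nu> t l \<noteq> {}} \<subseteq> N"
  proof
    fix x assume "x \<in> {x. ball x \<sigma> \<inter> rect \<nu> t l \<noteq> {}}"
    then obtain y where y: "dist x y < \<sigma>" "y \<in> rect \<nu> t l" by auto
    have "\<bar>O_mat \<nu> x $ j\<bar> \<le> r $ j" for j
    proof -
      have "\<bar>O_mat \<nu> (x - y) $ j\<bar> \<le> norm (x - y)" using component_le_norm_cart[of "O_mat \<nu> (x - y)" j] by (simp add: O_mat_norm)
      moreover have "O_mat \<nu> (x - y) = O_mat \<nu> x - O_mat \<nu> y"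
        using O_mat_orthogonal[of \<nu>] by (simp add: orthogonal_transformation linear_diff)
      moreover have "\<bar>O_mat \<nu> y $ j\<bar> < (if j = Max UNIV then l else t) / 2"
        using y(2) unfolding rect_eq[OF assms(1)] by blast
      ultimately show ?thesis using y(1) by (auto simp: r_def dist_norm split: if_splits)
    qed
    then show "x \<in> N" by (auto simp: N_def mem_box_cart abs_le_iff minus_le_iff)
  qed
  moreover have "N \<in> sets borel" unfolding N_def
    using measurable_sets_borel[OF meas, of "cbox (- r) r"] by simp
  ultimately show ?thesis by blast
qed

section \<open>Functions of bounded variation\<close>

lemma DERIV_max_zero_square:
  fixes t :: real
  shows "((\<lambda>t. (max 0 t)\<^sup>2) has_real_derivative 2 * max 0 t) (at t)"
proof -
  consider "t > 0" | "t < 0" | "t = 0" by linarith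
  then show ?thesis
  proof cases
    case 1
    have "((\<lambda>t. t\<^sup>2) has_real_derivative 2 * t) (at t)" by (auto intro!: derivative_eq_intros)
    then have "((\<lambda>t. (max 0 t)\<^sup>2) has_real_derivative 2 * t) (at t)"
      by (rule has_field_derivative_transform_within_open[of _ _ _ "{0<..}"]) (use 1 in auto)
    then show ?thesis using 1 by simp
  next
    case 2
    have "((\<lambda>t. 0) has_real_derivative 0) (at t)" by simp
    then have "((\<lambda>t. (max 0 t)\<^sup>2) has_real_derivative 0) (at t)"
      by (rule has_field_derivative_transform_within_open[of _ _ _ "{..<0}"]) (use 2 in auto)
    then show ?thesis using 2 by simp
  next
    case 3
    have "((\<lambda>h::real. (max 0 h)\<^sup>2 / h) \<longlongrightarrow> 0) (at 0)"
    proof (rule tendsto_rabs_zero_cancel, rule tendsto_sandwich[of "\<lambda>_. 0" _ _ "\<lambda>h. \<bar>h\<bar>"])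
      show "\<forall>\<^sub>F h in at (0::real). \<bar>(max 0 h)\<^sup>2 / h\<bar> \<le> \<bar>h\<bar>"
        by (rule always_eventually) (auto simp: max_def power2_eq_square)
      show "((\<lambda>h::real. \<bar>h\<bar>) \<longlongrightarrow> 0) (at 0)" using tendsto_rabs[OF tendsto_ident_at[of "0::real"]] by simp
    qed auto
    then show ?thesis using 3 by (simp add: DERIV_def)
  qed
qed

text \<open>A quadratic spline rising from 0 to 1 on the unit interval, whose derivative is a hat of
  height 2. Test fields must have continuous partial derivatives, so a piecewise linear cut-off
  would not do.\<close>

definition ramp :: "real \<Rightarrow> real" where
  "ramp t = 2 * ((max 0 t)\<^sup>2 - 2 * (max 0 (t - 1/2))\<^sup>2 + (max 0 (t - 1))\<^sup>2)"

definition ramp' :: "real \<Rightarrow> real" where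
  "ramp' t = 4 * (max 0 t - 2 * max 0 (t - 1/2) + max 0 (t - 1))"

lemma DERIV_ramp: "(ramp has_real_derivative ramp' t) (at t)"
proof -
  have *: "((\<lambda>t. (max 0 (t - a))\<^sup>2) has_real_derivative 2 * max 0 (t - a)) (at t)" for a :: real
  proof -
    have "((\<lambda>t. t - a) has_real_derivative 1) (at t)" by (auto intro!: derivative_eq_intros)
    from DERIV_chain2[OF DERIV_max_zero_square this] show ?thesis by simp
  qed
  have "((\<lambda>t. 2 * ((max 0 (t - 0))\<^sup>2 - 2 * (max 0 (t - 1/2))\<^sup>2 + (max 0 (t - 1))\<^sup>2)) has_real_derivative
     2 * (2 * max 0 (t - 0) - 2 * (2 * max 0 (t - 1/2)) + 2 * max 0 (t - 1))) (at t)"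
    by (intro DERIV_cmult DERIV_add DERIV_diff *)
  then show ?thesis unfolding ramp_def[abs_def] ramp'_def by (simp add: algebra_simps)
qed

lemma continuous_ramp': "continuous_on UNIV ramp'"
  unfolding ramp'_def[abs_def] by (intro continuous_intros)

lemma ramp_le_0: "t \<le> 0 \<Longrightarrow> ramp t = 0" and ramp_ge_1: "1 \<le> t \<Longrightarrow> ramp t = 1"
  by (auto simp: ramp_def max_def power2_eq_square algebra_simps)

lemma ramp'_bounds: "0 \<le> ramp' t" "ramp' t \<le> 2" and ramp'_outside: "t \<le> 0 \<or> 1 \<le> t \<Longrightarrow> ramp' t = 0"
  by (auto simp: ramp'_def max_def)

lemma ramp_bounds: "0 \<le> ramp t" "ramp t \<le> 1"
proof -
  have mono: "ramp a \<le> ramp b" if "a \<le> b" for a b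
    by (rule DERIV_nonneg_imp_nondecreasing[OF that]) (use DERIV_ramp ramp'_bounds in blast)
  show "0 \<le> ramp t" using mono[of "min 0 t" t] ramp_le_0[of "min 0 t"] by simp
  show "ramp t \<le> 1" using mono[of t "max 1 t"] ramp_ge_1[of "max 1 t"] by simp
qed

text \<open>By translation invariance every difference quotient of \<open>F\<close> in direction
  \<open>e\<close> has integral 0; dominated convergence passes this on to the derivative.\<close>

lemma integral_partial_derivative_zero:
  fixes F :: "real^'n \<Rightarrow> real"
  assumes F: "\<And>x. (F has_derivative F' x) (at x)" and cont: "continuous_on UNIV (\<lambda>x. F' x e)"
    and K: "compact K" "\<And>x. x \<notin> K \<Longrightarrow> F x = 0" and e: "norm e = 1"
  shows "integrable lborel (\<lambda>x. F' x e)" "integral\<^sup>L lborel (\<lambda>x. F' x e) = 0"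
proof -
  define \<psi> where "\<psi> x = F' x e" for x
  have contF: "continuous_on UNIV F"
    using F by (intro has_derivative_continuous_on[where f' = F']) (auto intro: has_derivative_at_withinI)
  have \<psi>0: "\<psi> x = 0" if "x \<notin> K" for x
  proof -
    have "((\<lambda>x. 0) has_derivative (\<lambda>_. 0)) (at x)" by simp
    then have "(F has_derivative (\<lambda>_. 0)) (at x)"
      by (rule has_derivative_transform_within_open[where s = "- K"]) (use K(2) open_Compl[OF compact_imp_closed[OF K(1)]] that in auto)
    then show ?thesis using has_derivative_unique[OF F] by (simp add: \<psi>_def)
  qed
  obtain R where R: "\<And>x. x \<in> K \<Longrightarrow> norm x \<le> R" using compact_imp_bounded[OF K(1)] by (auto simp: bounded_iff)
  have "bounded (\<psi> ` K)" using compact_continuous_image[of K \<psi>] K(1) cont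
    by (auto simp: \<psi>_def[abs_def] intro: compact_imp_bounded continuous_on_subset)
  then obtain B0 where B0: "\<And>x. x \<in> K \<Longrightarrow> \<bar>\<psi> x\<bar> \<le> B0" by (auto simp: bounded_iff)
  define B where "B = max 0 B0"
  have B: "\<bar>\<psi> x\<bar> \<le> B" for x using B0[of x] \<psi>0[of x] by (cases "x \<in> K") (auto simp: B_def)
  have int: "integrable lborel f" if "continuous_on UNIV f" "\<And>x. x \<notin> K \<Longrightarrow> f x = 0" for f :: "real^'n \<Rightarrow> real"
  proof -
    have "integrable lborel (\<lambda>x. indicator K x *\<^sub>R f x)"
      using that(1) K(1) by (intro borel_integrable_compact) (auto intro: continuous_on_subset)
    also have "(\<lambda>x. indicator K x *\<^sub>R f x) = f" using that(2) by (auto simp: indicator_def fun_eq_iff)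
    finally show ?thesis .
  qed
  show int\<psi>: "integrable lborel (\<lambda>x. F' x e)" using int[of \<psi>] cont \<psi>0 by (simp add: \<psi>_def[abs_def])
  have [measurable]: "F \<in> borel_measurable borel" "\<psi> \<in> borel_measurable borel"
    using contF cont by (auto simp: \<psi>_def[abs_def] intro: borel_measurable_continuous_onI)
  define s where "s n x = real (Suc n) * (F ((1 / Suc n) *\<^sub>R e + x) - F x)" for n x
  have intF: "integrable lborel F" using int[of F] contF K by simp
  have shift: "integrable lborel (\<lambda>x. F (c + x))" "integral\<^sup>L lborel (\<lambda>x. F (c + x)) = integral\<^sup>L lborel F" for c
  proof -
    have "integrable (distr lborel borel ((+) c)) F" using intF by (simp add: lborel_distr_plus)
    then show "integrable lborel (\<lambda>x. F (c + x))" by (subst (asm) integrable_distr_eq) auto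
    have "integral\<^sup>L lborel F = integral\<^sup>L (distr lborel borel ((+) c)) F" by (simp add: lborel_distr_plus)
    also have "\<dots> = integral\<^sup>L lborel (\<lambda>x. F (c + x))" by (rule integral_distr) auto
    finally show "integral\<^sup>L lborel (\<lambda>x. F (c + x)) = integral\<^sup>L lborel F" ..
  qed
  have s0: "integral\<^sup>L lborel (s n) = 0" for n
    unfolding s_def using shift[of "(1 / Suc n) *\<^sub>R e"] intF by simp
  have line: "((\<lambda>t. F (t *\<^sub>R e + x)) has_real_derivative \<psi> (t *\<^sub>R e + x)) (at t)" for t x
  proof -
    have "((\<lambda>t. t *\<^sub>R e + x) has_derivative (\<lambda>h. h *\<^sub>R e)) (at t)" by (auto intro!: derivative_eq_intros)
    from has_derivative_compose[OF this F[of "t *\<^sub>R e + x"]]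
    have "((\<lambda>t. F (t *\<^sub>R e + x)) has_derivative (\<lambda>h. F' (t *\<^sub>R e + x) (h *\<^sub>R e))) (at t)" .
    moreover have "F' y (h *\<^sub>R e) = \<psi> y * h" for y h
      using linear_scale[OF has_derivative_linear[OF F[of y]]] by (simp add: \<psi>_def)
    ultimately show ?thesis by (simp add: has_field_derivative_def)
  qed
  \<comment> \<open>The steps have length at most 1, so all quotients vanish outside the ball of
    radius \<open>R + 1\<close>; inside, the mean value theorem bounds them by
    \<open>B\<close>.\<close>
  have "(\<lambda>n. integral\<^sup>L lborel (s n)) \<longlonglongrightarrow> integral\<^sup>L lborel \<psi>"
  proof (rule integral_dominated_convergence[where w = "\<lambda>x. indicator (cball 0 (R + 1)) x * B"])
    show "AE x in lborel. (\<lambda>n. s n x) \<longlonglongrightarrow> \<psi> x"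
    proof (rule AE_I2)
      fix x
      have "((\<lambda>h. (F ((0 + h) *\<^sub>R e + x) - F (0 *\<^sub>R e + x)) / h) \<longlongrightarrow> \<psi> (0 *\<^sub>R e + x)) (at 0)"
        using line[of x 0] by (simp add: DERIV_def)
      then have "((\<lambda>h. (F (h *\<^sub>R e + x) - F x) / h) \<longlongrightarrow> \<psi> x) (at 0)" by simp
      moreover have "filterlim (\<lambda>n. 1 / real (Suc n)) (at 0) sequentially"
        by (rule filterlim_atI) (use LIMSEQ_inverse_real_of_nat in \<open>auto simp: inverse_eq_divide\<close>)
      ultimately have "(\<lambda>n. (F ((1 / real (Suc n)) *\<^sub>R e + x) - F x) / (1 / real (Suc n))) \<longlonglongrightarrow> \<psi> x"
        by (rule filterlim_compose)
      then show "(\<lambda>n. s n x) \<longlonglongrightarrow> \<psi> x" by (simp add: s_def mult.commute)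
    qed
    show "AE x in lborel. norm (s n x) \<le> indicator (cball 0 (R + 1)) x * B" for n
    proof (rule AE_I2)
      fix x
      show "norm (s n x) \<le> indicator (cball 0 (R + 1)) x * B"
      proof (cases "x \<in> cball 0 (R + 1)")
        case True
        obtain z where "F ((1 / Suc n) *\<^sub>R e + x) - F (0 *\<^sub>R e + x) = (1 / real (Suc n) - 0) * \<psi> (z *\<^sub>R e + x)"
          using MVT2[of 0 "1 / real (Suc n)" "\<lambda>t. F (t *\<^sub>R e + x)" "\<lambda>t. \<psi> (t *\<^sub>R e + x)"] line by auto
        then have "s n x = \<psi> (z *\<^sub>R e + x)" by (simp add: s_def)
        then show ?thesis using B True by simp
      next
        case False
        then have "x \<notin> K" using R[of x] by auto
        have "norm x \<le> norm ((1 / Suc n) *\<^sub>R e + x) + norm ((1 / Suc n) *\<^sub>R e)"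
          by (metis add_diff_cancel_left' norm_triangle_ineq4 add.commute)
        also have "norm ((1 / Suc n) *\<^sub>R e) \<le> 1" using e by simp
        finally have "(1 / Suc n) *\<^sub>R e + x \<notin> K" using R[of "(1 / Suc n) *\<^sub>R e + x"] False by auto
        then show ?thesis using \<open>x \<notin> K\<close> K(2) False by (simp add: s_def)
      qed
    qed
    have "integrable lborel (indicator (cball (0::real^'n) (R + 1)) :: _ \<Rightarrow> real)"
      by (rule integrable_real_indicator) (use emeasure_lborel_cball_finite in auto)
    then show "integrable lborel (\<lambda>x. indicator (cball (0::real^'n) (R + 1)) x * B)"
      by (rule integrable_mult_left)
  qed (auto simp: s_def[abs_def])
  then have "(\<lambda>n::nat. 0::real) \<longlonglongrightarrow> integral\<^sup>L lborel \<psi>" by (simp add: s0)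
  then show "integral\<^sup>L lborel (\<lambda>x. F' x e) = 0" by (simp add: \<psi>_def[abs_def] LIMSEQ_const_iff)
qed

section \<open>Divergences of test fields\<close>

definition div_field :: "(real^'n \<Rightarrow> real^'n^'m) \<Rightarrow> real^'n \<Rightarrow> real^'m" where
  "div_field \<phi> x = (\<chi> k. div_row \<phi> k x)"

lemma div_field_nth: "div_field \<phi> x $ k = div_row \<phi> k x"
  by (simp add: div_field_def)

lemma sum_div_row: "(\<Sum>k\<in>UNIV. v $ k * div_row \<phi> k x) = v \<bullet> div_field \<phi> x"
  by (simp add: inner_vec_def div_field_def)

definition test_data :: "(real^'n \<Rightarrow> real^'n^'m) \<Rightarrow> (real^'n \<Rightarrow> real^'n \<Rightarrow> real^'n^'m) \<Rightarrow> (real^'n) set \<Rightarrow> (real^'n) set \<Rightarrow> bool" where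
  "test_data \<phi> \<phi>' K D \<longleftrightarrow> (\<forall>x. (\<phi> has_derivative \<phi>' x) (at x)) \<and> (\<forall>j. continuous_on UNIV (\<lambda>x. \<phi>' x (axis j 1))) \<and>
    compact K \<and> K \<subseteq> D \<and> (\<forall>x. x \<notin> K \<longrightarrow> \<phi> x = 0) \<and> (\<forall>x. norm (\<phi> x) \<le> 1)"

lemma test_fields_iff: "\<phi> \<in> test_fields D \<longleftrightarrow> (\<exists>\<phi>' K. test_data \<phi> \<phi>' K D)"
  unfolding test_fields_def test_data_def by blast

lemma test_dataD:
  assumes "test_data \<phi> \<phi>' K D"
  shows "(\<phi> has_derivative \<phi>' x) (at x)" "continuous_on UNIV (\<lambda>x. \<phi>' x (axis j 1))"
    "compact K" "K \<subseteq> D" "x \<notin> K \<Longrightarrow> \<phi> x = 0" "norm (\<phi> x) \<le> 1"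
    "div_row \<phi> k x = (\<Sum>j\<in>UNIV. \<phi>' x (axis j 1) $ k $ j)" "continuous_on UNIV \<phi>"
proof -
  show d: "(\<phi> has_derivative \<phi>' x) (at x)" for x using assms unfolding test_data_def by blast
  show "continuous_on UNIV (\<lambda>x. \<phi>' x (axis j 1))"
    "compact K" "K \<subseteq> D" "x \<notin> K \<Longrightarrow> \<phi> x = 0" "norm (\<phi> x) \<le> 1"
    using assms unfolding test_data_def by blast+
  show "div_row \<phi> k x = (\<Sum>j\<in>UNIV. \<phi>' x (axis j 1) $ k $ j)"
    using frechet_derivative_at[OF d[of x]] by (simp add: div_row_def)
  show "continuous_on UNIV \<phi>"
    using d by (intro has_derivative_continuous_on[where f' = \<phi>']) (auto intro: has_derivative_at_withinI)
qed

lemma div_field_continuous: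
  assumes "\<phi> \<in> test_fields D"
  shows "continuous_on UNIV (div_field \<phi>)"
proof -
  obtain \<phi>' K where td: "test_data \<phi> \<phi>' K D" using assms unfolding test_fields_iff by blast
  note * = test_dataD[OF td]
  show ?thesis unfolding div_field_def[abs_def] *(7)
    by (intro continuous_on_vec_lambda continuous_on_sum continuous_on_component *(2))
qed

lemma div_field_support:
  assumes "\<phi> \<in> test_fields D"
  shows "\<exists>K. compact K \<and> K \<subseteq> D \<and> (\<forall>x. x \<notin> K \<longrightarrow> div_field \<phi> x = 0)"
proof -
  obtain \<phi>' K where td: "test_data \<phi> \<phi>' K D" using assms unfolding test_fields_iff by blast
  note * = test_dataD[OF td]
  have "\<phi>' x = (\<lambda>_. 0)" if "x \<notin> K" for x
  proof -
    have "((\<lambda>x. 0) has_derivative (\<lambda>_. 0)) (at x)" by simp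
    then have "(\<phi> has_derivative (\<lambda>_. 0)) (at x)"
      by (rule has_derivative_transform_within_open[where s = "- K"]) (use *(5) open_Compl[OF compact_imp_closed[OF *(3)]] that in auto)
    then show ?thesis using has_derivative_unique[OF *(1)] by simp
  qed
  then have "div_field \<phi> x = 0" if "x \<notin> K" for x using that by (simp add: vec_eq_iff div_field_nth *(7))
  then show ?thesis using * by blast
qed

lemma div_field_bounded:
  assumes "\<phi> \<in> test_fields D"
  shows "\<exists>B. \<forall>x. norm (div_field \<phi> x) \<le> B"
proof -
  obtain K where K: "compact K" "\<And>x. x \<notin> K \<Longrightarrow> div_field \<phi> x = 0" using div_field_support[OF assms] by metis
  have "bounded (div_field \<phi> ` K)"
    using compact_continuous_image[of K "div_field \<phi>"] K(1) div_field_continuous[OF assms]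
    by (auto intro: compact_imp_bounded continuous_on_subset)
  then obtain B where B: "\<And>x. x \<in> K \<Longrightarrow> norm (div_field \<phi> x) \<le> B" by (auto simp: bounded_iff)
  have "norm (div_field \<phi> x) \<le> max 0 B" for x using B[of x] K(2)[of x] by (cases "x \<in> K") auto
  then show ?thesis by blast
qed

lemma total_variation_le_iff:
  "total_variation u D \<le> ereal C \<longleftrightarrow> (\<forall>\<phi>\<in>test_fields D. integral D (\<lambda>x. u x \<bullet> div_field \<phi> x) \<le> C)"
  by (simp add: total_variation_def SUP_le_iff sum_div_row)

lemma zero_test_field: "(\<lambda>_. 0) \<in> test_fields D"
  unfolding test_fields_def by (auto intro!: exI[of _ "\<lambda>_ _. 0"] exI[of _ "{}"])

lemma total_variation_nonneg:
  fixes u :: "real^'n \<Rightarrow> real^'m"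
  shows "0 \<le> total_variation u D"
proof -
  have "div_field (\<lambda>_::real^'n. 0 :: real^'n^'m) = (\<lambda>_. 0)"
    by (simp add: div_field_def div_row_def vec_eq_iff fun_eq_iff)
  then have "ereal (integral D (\<lambda>x. u x \<bullet> div_field (\<lambda>_. 0) x)) = 0" by (simp add: zero_ereal_def)
  moreover have "ereal (integral D (\<lambda>x. u x \<bullet> div_field (\<lambda>_. 0) x)) \<le> total_variation u D"
    unfolding total_variation_def sum_div_row by (rule SUP_upper[OF zero_test_field])
  ultimately show ?thesis by (metis)
qed

lemma total_variation_finite_iff: "total_variation u D < \<infinity> \<longleftrightarrow> (\<exists>C. total_variation u D \<le> ereal C)"
  using total_variation_nonneg[of u D]
  by (cases "total_variation u D") auto

lemma integral_const_div_field:
  assumes \<phi>: "\<phi> \<in> test_fields D"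
  shows "integral D (\<lambda>x. c \<bullet> div_field \<phi> x) = 0"
proof -
  obtain \<phi>' K where td: "test_data \<phi> \<phi>' K D" using \<phi> unfolding test_fields_iff by blast
  note * = test_dataD[OF td]
  obtain K' where K': "K' \<subseteq> D" "\<And>x. x \<notin> K' \<Longrightarrow> div_field \<phi> x = 0" using div_field_support[OF \<phi>] by metis
  have comp: "integrable lborel (\<lambda>x. \<phi>' x (axis j 1) $ k $ j)" "integral\<^sup>L lborel (\<lambda>x. \<phi>' x (axis j 1) $ k $ j) = 0" for j k
  proof -
    have bl: "bounded_linear (\<lambda>A :: real^'a^'b. A $ k $ j)"
      by (intro bounded_linear_compose[OF bounded_linear_vec_nth] bounded_linear_vec_nth)
    have "((\<lambda>x. \<phi> x $ k $ j) has_derivative (\<lambda>h. \<phi>' x h $ k $ j)) (at x)" for x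
      by (rule bounded_linear.has_derivative[OF bl *(1)])
    note F = integral_partial_derivative_zero[of "\<lambda>x. \<phi> x $ k $ j" "\<lambda>x h. \<phi>' x h $ k $ j" "axis j 1" K, OF this]
    show "integrable lborel (\<lambda>x. \<phi>' x (axis j 1) $ k $ j)" "integral\<^sup>L lborel (\<lambda>x. \<phi>' x (axis j 1) $ k $ j) = 0"
      using * by (auto intro!: F continuous_intros)
  qed
  have eq: "c \<bullet> div_field \<phi> x = (\<Sum>k\<in>UNIV. c $ k * (\<Sum>j\<in>UNIV. \<phi>' x (axis j 1) $ k $ j))" for x
    by (simp add: inner_vec_def div_field_nth *(7))
  have "integrable lborel (\<lambda>x. c \<bullet> div_field \<phi> x)" "integral\<^sup>L lborel (\<lambda>x. c \<bullet> div_field \<phi> x) = 0"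
    unfolding eq using comp by simp_all
  then have "((\<lambda>x. c \<bullet> div_field \<phi> x) has_integral 0) UNIV"
    using has_integral_integral_lborel by metis
  moreover have "(\<lambda>x. c \<bullet> div_field \<phi> x) = (\<lambda>x. if x \<in> D then c \<bullet> div_field \<phi> x else 0)"
  proof
    fix x
    have "div_field \<phi> x = 0" if "x \<notin> D" using K' that by blast
    then show "c \<bullet> div_field \<phi> x = (if x \<in> D then c \<bullet> div_field \<phi> x else 0)" by auto
  qed
  ultimately have "((\<lambda>x. c \<bullet> div_field \<phi> x) has_integral 0) D"
    by (metis has_integral_restrict_UNIV)
  then show ?thesis by (rule integral_unique)
qed

section \<open>Cutting and gluing along hyperplanes\<close>

lemma cut_test_field:
  fixes \<phi> :: "real^'n \<Rightarrow> real^'n^'m"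
  assumes \<phi>: "\<phi> \<in> test_fields D" and h: "\<And>t. (h has_real_derivative h' t) (at t)" "continuous_on UNIV h'"
    and h01: "\<And>t. 0 \<le> h t" "\<And>t. h t \<le> 1"
  shows "(\<lambda>x. h (x \<bullet> w) *\<^sub>R \<phi> x) \<in> test_fields D"
    and "div_field (\<lambda>x. h (x \<bullet> w) *\<^sub>R \<phi> x) x = h (x \<bullet> w) *\<^sub>R div_field \<phi> x + h' (x \<bullet> w) *\<^sub>R (\<phi> x *v w)"
proof -
  obtain \<phi>' K where td: "test_data \<phi> \<phi>' K D" using \<phi> unfolding test_fields_iff by blast
  note * = test_dataD[OF td]
  define \<psi> where "\<psi> x = h (x \<bullet> w) *\<^sub>R \<phi> x" for x
  define \<psi>' where "\<psi>' x v = h (x \<bullet> w) *\<^sub>R \<phi>' x v + (h' (x \<bullet> w) * (v \<bullet> w)) *\<^sub>R \<phi> x" for x v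
  have "((\<lambda>x. h (x \<bullet> w)) has_derivative (\<lambda>v. h' (x \<bullet> w) * (v \<bullet> w))) (at x)" for x
    by (rule has_derivative_compose[OF _ h(1)[unfolded has_field_derivative_def]])
       (auto intro!: derivative_eq_intros)
  from has_derivative_scaleR[OF this *(1)]
  have d: "(\<psi> has_derivative \<psi>' x) (at x)" for x unfolding \<psi>_def[abs_def] \<psi>'_def .
  have cont\<phi>: "continuous_on UNIV \<phi>"
    using *(1) by (intro has_derivative_continuous_on[where f' = \<phi>']) (auto intro: has_derivative_at_withinI)
  have conth: "continuous_on UNIV h" using h(1) by (meson DERIV_continuous_on has_field_derivative_at_within)
  have ch: "continuous_on UNIV (\<lambda>x. h (x \<bullet> w))" "continuous_on UNIV (\<lambda>x. h' (x \<bullet> w))"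
    by (auto intro!: continuous_on_compose2[OF conth] continuous_on_compose2[OF h(2)] continuous_intros)
  have "continuous_on UNIV (\<lambda>x. \<psi>' x (axis j 1))" for j unfolding \<psi>'_def
    by (intro continuous_intros ch *(2) cont\<phi>)
  moreover have "norm (\<psi> x) \<le> 1" for x
    using mult_mono[of "h (x \<bullet> w)" 1 "norm (\<phi> x)" 1] h01 *(6) by (simp add: \<psi>_def)
  moreover have "\<exists>K. compact K \<and> K \<subseteq> D \<and> (\<forall>x. x \<notin> K \<longrightarrow> \<psi> x = 0)"
    using *(3-5) by (intro exI[of _ K]) (auto simp: \<psi>_def)
  ultimately have t: "\<psi> \<in> test_fields D" unfolding test_fields_def using d
    by (intro CollectI exI[of _ \<psi>'] conjI allI)
  then show "(\<lambda>x. h (x \<bullet> w) *\<^sub>R \<phi> x) \<in> test_fields D" by (simp add: \<psi>_def[abs_def])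
  have fd: "frechet_derivative \<psi> (at x) = \<psi>' x" using frechet_derivative_at[OF d] by simp
  have "div_field \<psi> x = h (x \<bullet> w) *\<^sub>R div_field \<phi> x + h' (x \<bullet> w) *\<^sub>R (\<phi> x *v w)"
    unfolding vec_eq_iff
  proof
    fix k
    have "div_field \<psi> x $ k = (\<Sum>j\<in>UNIV. h (x \<bullet> w) * \<phi>' x (axis j 1) $ k $ j + h' (x \<bullet> w) * (w $ j * \<phi> x $ k $ j))"
      unfolding div_field_nth div_row_def fd \<psi>'_def by (simp add: inner_axis' mult.assoc)
    also have "\<dots> = h (x \<bullet> w) * div_row \<phi> k x + h' (x \<bullet> w) * (\<Sum>j\<in>UNIV. \<phi> x $ k $ j * w $ j)"
      by (simp add: sum.distrib sum_distrib_left *(7) mult.commute)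
    finally show "div_field \<psi> x $ k = (h (x \<bullet> w) *\<^sub>R div_field \<phi> x + h' (x \<bullet> w) *\<^sub>R (\<phi> x *v w)) $ k"
      by (simp add: div_field_nth matrix_vector_mult_def)
  qed
  then show "div_field (\<lambda>x. h (x \<bullet> w) *\<^sub>R \<phi> x) x = h (x \<bullet> w) *\<^sub>R div_field \<phi> x + h' (x \<bullet> w) *\<^sub>R (\<phi> x *v w)"
    by (simp add: \<psi>_def[abs_def])
qed

lemma continuous_mult_absolutely_integrable:
  fixes u :: "real^'n \<Rightarrow> real^'m"
  assumes u: "u absolutely_integrable_on D" and D: "D \<in> sets lebesgue"
    and g: "continuous_on UNIV g" "\<And>x. x \<in> D \<Longrightarrow> norm (g x) \<le> B"
  shows "(\<lambda>x. u x \<bullet> g x) absolutely_integrable_on D"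
proof -
  have "g \<in> borel_measurable (lebesgue_on D)"
    using g(1) by (intro continuous_imp_measurable_on_sets_lebesgue D continuous_on_subset[OF g(1)]) auto
  moreover have "bounded (g ` D)" using g(2) by (auto simp: bounded_iff)
  ultimately show ?thesis
    using absolutely_integrable_bounded_measurable_product[OF bilinear_conv_bounded_bilinear[THEN iffD2, OF bounded_bilinear_inner], of g D u] D u
    by (simp add: inner_commute)
qed

lemma norm_row_mult_le:
  fixes A :: "real^'n^'m"
  assumes "norm w = 1" "norm A \<le> 1"
  shows "norm (A *v w) \<le> real CARD('m)"
proof -
  have "norm (A *v w) \<le> (\<Sum>k\<in>UNIV. \<bar>(A *v w) $ k\<bar>)" by (rule norm_le_l1_cart)
  also have "\<dots> \<le> (\<Sum>k\<in>(UNIV::'m set). 1)"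
  proof (rule sum_mono)
    fix k
    have "\<bar>(A *v w) $ k\<bar> = \<bar>A $ k \<bullet> w\<bar>" by (simp add: matrix_vector_mul_component)
    also have "\<dots> \<le> norm (A $ k) * norm w" by (rule Cauchy_Schwarz_ineq2)
    also have "\<dots> \<le> 1" using Finite_Cartesian_Product.norm_nth_le[of A k] assms by simp
    finally show "\<bar>(A *v w) $ k\<bar> \<le> 1" .
  qed
  finally show ?thesis by simp
qed

text \<open>\<open>u div (\<eta> \<phi>) = \<eta> u div \<phi> + u \<phi> \<nabla>\<eta>\<close> for a cut-off \<open>\<eta>\<close> whose gradient is of size \<open>2 N\<close> and
  supported in a slab of thickness \<open>1 / N\<close>.\<close>

lemma cut_integral_bound:
  fixes u :: "real^'n \<Rightarrow> real^'m" and B :: real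
  assumes u: "u absolutely_integrable_on D" "total_variation u D \<le> ereal C" "\<And>x. x \<in> D \<Longrightarrow> norm (u x) \<le> B" and B: "0 \<le> B"
    and D: "open D" "D \<subseteq> ball 0 R" and w: "norm w = 1" and N: "0 < N"
    and \<phi>: "\<phi> \<in> test_fields D"
    and h: "\<And>t. (h has_real_derivative h' t) (at t)" "continuous_on UNIV h'" "\<And>t. 0 \<le> h t" "\<And>t. h t \<le> 1"
    and h': "\<And>t. \<bar>h' t\<bar> \<le> 2 * real N" "\<And>t. \<not> (\<beta> - 1 / N \<le> t \<and> t < \<beta>) \<Longrightarrow> h' t = 0"
  shows "integral D (\<lambda>x. u x \<bullet> (h (x \<bullet> w) *\<^sub>R div_field \<phi> x)) \<le> C + 2 * B * CARD('m) * measure lborel (ball (0::real^'n) (R + 1))"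
proof -
  have Dm: "D \<in> sets lebesgue" using D(1) by simp
  note cut = cut_test_field[OF \<phi> h, of w]
  obtain B1 where B1: "\<And>x. norm (div_field (\<lambda>x. h (x \<bullet> w) *\<^sub>R \<phi> x) x) \<le> B1" using div_field_bounded[OF cut(1)] by blast
  have i1: "(\<lambda>x. u x \<bullet> div_field (\<lambda>x. h (x \<bullet> w) *\<^sub>R \<phi> x) x) absolutely_integrable_on D"
    by (rule continuous_mult_absolutely_integrable[OF u(1) Dm div_field_continuous[OF cut(1)] B1])
  have \<phi>1: "norm (\<phi> x) \<le> 1" "continuous_on UNIV \<phi>" for x
    using \<phi> test_dataD(6,8) unfolding test_fields_iff by blast+
  define E where "E x = h' (x \<bullet> w) *\<^sub>R (\<phi> x *v w)" for x
  have Eb: "norm (E x) \<le> 2 * N * CARD('m)" for x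
    using mult_mono[OF h'(1)[of "x \<bullet> w"] norm_row_mult_le[OF w \<phi>1(1)[of x]]] by (simp add: E_def)
  have "continuous_on UNIV (\<lambda>x. \<phi> x *v w)"
    by (intro bounded_linear.continuous_on[OF _ \<phi>1(2)] linear_conv_bounded_linear[THEN iffD1] linearI)
       (auto simp: matrix_vector_mult_add_rdistrib scaleR_matrix_vector_assoc)
  then have Ec: "continuous_on UNIV E" unfolding E_def[abs_def]
    by (intro continuous_on_scaleR continuous_on_compose2[OF h(2)]) (auto intro!: continuous_intros)
  have i2: "(\<lambda>x. u x \<bullet> E x) absolutely_integrable_on D"
    by (rule continuous_mult_absolutely_integrable[OF u(1) Dm Ec Eb])
  define S where "S = D \<inter> {x. \<beta> - 1 / N \<le> x \<bullet> w \<and> x \<bullet> w < \<beta>}"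
  have Sb: "S \<in> sets borel"
  proof -
    have "{x. \<beta> - 1 / N \<le> x \<bullet> w \<and> x \<bullet> w < \<beta>} \<in> sets borel"
      by measurable
    then show ?thesis using D(1) by (simp add: S_def)
  qed
  \<comment> \<open>With thickness \<open>1 / N\<close> the \<open>N\<close> translates fill a ball
    of radius \<open>R + 1\<close> whatever \<open>N\<close> is, and this makes the bound uniform.
    The direction \<open>- w\<close> puts the open end of the slab on the side that
    \<open>slab_volume\<close> requires.\<close>
  have "real N * measure lborel S \<le> measure lborel (ball (0::real^'n) (R + N * (1 / N)))"
  proof (rule slab_volume[where w = "- w" and \<alpha> = "- \<beta>"])
    show "- \<beta> < z \<bullet> - w \<and> z \<bullet> - w \<le> - \<beta> + 1 / real N" if "z \<in> S" for z
      using that by (auto simp: S_def)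
  qed (use Sb D w in \<open>auto simp: S_def\<close>)
  then have Sv: "real N * measure lborel S \<le> measure lborel (ball (0::real^'n) (R + 1))" using N by simp
  have Sfin: "emeasure lborel S < \<infinity>"
    using D(2) by (intro le_less_trans[OF emeasure_mono[of S "ball 0 R"] emeasure_lborel_ball_finite]) (auto simp: S_def)
  then have Sl: "S \<in> lmeasurable" using Sb by (simp add: fmeasurable_def)
  have uE: "\<bar>u x \<bullet> E x\<bar> \<le> (B * (2 * N * CARD('m))) * indicator S x" if "x \<in> D" for x
  proof (cases "x \<in> S")
    case True
    have "\<bar>u x \<bullet> E x\<bar> \<le> norm (u x) * norm (E x)" by (rule Cauchy_Schwarz_ineq2)
    also have "\<dots> \<le> B * (2 * N * CARD('m))" using u(3)[OF that] Eb B by (intro mult_mono) auto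
    finally show ?thesis using True by simp
  next
    case False
    then have "h' (x \<bullet> w) = 0" using that by (intro h'(2)) (auto simp: S_def)
    then show ?thesis using False by (simp add: E_def)
  qed
  have "((\<lambda>x. if x \<in> S then 1 else 0) has_integral measure lborel S) D"
    using has_integral_measure_lborel[OF Sb Sfin] by (subst has_integral_restrict) (auto simp: S_def)
  from has_integral_mult_right[OF this, of "B * (2 * N * CARD('m))"]
  have iS: "((\<lambda>x. (B * (2 * N * CARD('m))) * indicator S x) has_integral (B * (2 * N * CARD('m))) * measure lborel S) D"
    by (simp only: indicator_def of_bool_def)
  have 1: "integral D (\<lambda>x. u x \<bullet> (h (x \<bullet> w) *\<^sub>R div_field \<phi> x)) =
      integral D (\<lambda>x. u x \<bullet> div_field (\<lambda>x. h (x \<bullet> w) *\<^sub>R \<phi> x) x) - integral D (\<lambda>x. u x \<bullet> E x)"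
  proof -
    have "integral D (\<lambda>x. u x \<bullet> (h (x \<bullet> w) *\<^sub>R div_field \<phi> x)) = integral D (\<lambda>x. u x \<bullet> div_field (\<lambda>x. h (x \<bullet> w) *\<^sub>R \<phi> x) x - u x \<bullet> E x)"
      by (simp add: cut(2) E_def inner_add_right)
    also have "\<dots> = integral D (\<lambda>x. u x \<bullet> div_field (\<lambda>x. h (x \<bullet> w) *\<^sub>R \<phi> x) x) - integral D (\<lambda>x. u x \<bullet> E x)"
      using i1 i2 by (intro integral_diff) (auto simp: absolutely_integrable_on_def)
    finally show ?thesis .
  qed
  have 2: "integral D (\<lambda>x. u x \<bullet> div_field (\<lambda>x. h (x \<bullet> w) *\<^sub>R \<phi> x) x) \<le> C"
    using u(2) cut(1) by (auto simp: total_variation_le_iff)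
  have 3: "norm (integral D (\<lambda>x. u x \<bullet> E x)) \<le> integral D (\<lambda>x. (B * (2 * N * CARD('m))) * indicator S x)"
    using i2 iS uE by (intro integral_norm_bound_integral) (auto simp: absolutely_integrable_on_def)
  have 4: "integral D (\<lambda>x. (B * (2 * N * CARD('m))) * indicator S x) = (2 * B * CARD('m)) * (N * measure lborel S)"
    using integral_unique[OF iS] by simp
  have 5: "(2 * B * CARD('m)) * (N * measure lborel S) \<le> (2 * B * CARD('m)) * measure lborel (ball (0::real^'n) (R + 1))"
    using Sv B by (intro mult_left_mono) auto
  show ?thesis using 1 2 3 4 5 by (simp only: real_norm_def)
qed

lemma bounded_set_absolutely_integrable:
  fixes u :: "real^'n \<Rightarrow> real^'m"
  assumes "u \<in> borel_measurable borel" "open D" "bounded D" "\<And>x. x \<in> D \<Longrightarrow> norm (u x) \<le> B"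
  shows "u absolutely_integrable_on D"
proof (rule measurable_bounded_by_integrable_imp_absolutely_integrable)
  show "u \<in> borel_measurable (lebesgue_on D)"
    using assms(1) by (intro measurable_restrict_space1 measurable_completion) simp
  show "(\<lambda>x. B) integrable_on D"
    using lmeasurable_open[OF assms(3,2)] by (intro integrable_on_const)
qed (use assms in auto)

lemma BV_M_const:
  assumes "a \<in> M" "open D" "bounded D"
  shows "(\<lambda>x. a) \<in> BV_M M D"
proof -
  have "total_variation (\<lambda>x. a) D \<le> ereal 0"
    by (auto simp: total_variation_le_iff integral_const_div_field)
  then have "total_variation (\<lambda>x. a) D < \<infinity>" unfolding total_variation_finite_iff by blast
  moreover have "(\<lambda>x. a) absolutely_integrable_on D"
    using assms by (intro bounded_set_absolutely_integrable[where B = "norm a"]) auto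
  ultimately show ?thesis using assms by (simp add: BV_M_def)
qed

lemma absolutely_integrable_on_cut:
  fixes u v :: "real^'n \<Rightarrow> real^'m"
  assumes u: "u absolutely_integrable_on D" and v: "v absolutely_integrable_on D" and D: "open D" and H: "H \<in> sets borel"
  shows "(\<lambda>x. if x \<in> H then u x else v x) absolutely_integrable_on D"
proof -
  have "u absolutely_integrable_on (D \<inter> H)" "v absolutely_integrable_on (D - H)"
    using D H by (auto intro!: set_integrable_subset[OF u] set_integrable_subset[OF v])
  moreover have "(\<lambda>x. if x \<in> H then u x else v x) absolutely_integrable_on (D \<inter> H) \<longleftrightarrow> u absolutely_integrable_on (D \<inter> H)"
    "(\<lambda>x. if x \<in> H then u x else v x) absolutely_integrable_on (D - H) \<longleftrightarrow> v absolutely_integrable_on (D - H)"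
    by (rule set_integrable_cong; simp)+
  ultimately have "(\<lambda>x. if x \<in> H then u x else v x) absolutely_integrable_on (D \<inter> H)"
    "(\<lambda>x. if x \<in> H then u x else v x) absolutely_integrable_on (D - H)" by simp_all
  then have "(\<lambda>x. if x \<in> H then u x else v x) absolutely_integrable_on ((D \<inter> H) \<union> (D - H))"
    using D H by (intro set_integrable_Un) auto
  then show ?thesis by (simp add: Int_Diff_Un)
qed

text \<open>The cut-offs \<open>h N\<close> tend pointwise to the indicator of the half space, and
  the two weighted integrals are bounded uniformly in \<open>N\<close> by
  \<open>cut_integral_bound\<close>; dominated convergence gives the sharp cut. Boundedness of
  \<open>u\<close> and \<open>v\<close> takes the place of any control of traces.\<close>

lemma total_variation_cut:
  fixes u v :: "real^'n \<Rightarrow> real^'m"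
  assumes u: "u absolutely_integrable_on D" "total_variation u D \<le> ereal C1" "\<And>x. x \<in> D \<Longrightarrow> norm (u x) \<le> B"
    and v: "v absolutely_integrable_on D" "total_variation v D \<le> ereal C2" "\<And>x. x \<in> D \<Longrightarrow> norm (v x) \<le> B"
    and D: "open D" "D \<subseteq> ball 0 R" and w: "norm w = 1" and B: "0 \<le> B"
  shows "total_variation (\<lambda>x. if x \<bullet> w < \<beta> then u x else v x) D
    \<le> ereal (C1 + C2 + 2 * (2 * B * CARD('m) * measure lborel (ball (0::real^'n) (R + 1))))"
  unfolding total_variation_le_iff
proof
  fix \<phi> :: "real^'n \<Rightarrow> real^'n^'m" assume \<phi>: "\<phi> \<in> test_fields D"
  let ?E = "2 * B * CARD('m) * measure lborel (ball (0::real^'n) (R + 1))"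
  \<comment> \<open>\<open>h N\<close> is 1 up to \<open>\<beta> - 1 / real (Suc N)\<close> and 0
    from \<open>\<beta>\<close> on. The transition lies to the left of \<open>\<beta>\<close>, so
    the limit is the indicator of the strict inequality.\<close>
  define h where "h N t = ramp (real (Suc N) * (\<beta> - t))" for N t
  define h' where "h' N t = - (real (Suc N) * ramp' (real (Suc N) * (\<beta> - t)))" for N t
  have dh: "(h N has_real_derivative h' N t) (at t)" for N t
  proof -
    have "((\<lambda>t. real (Suc N) * (\<beta> - t)) has_real_derivative - real (Suc N)) (at t)"
      by (auto intro!: derivative_eq_intros)
    from DERIV_chain2[OF DERIV_ramp this] show ?thesis unfolding h_def[abs_def] h'_def
      by (simp only: mult_minus_right mult_minus_left mult.commute)
  qed
  have ch: "continuous_on UNIV (h' N)" for N unfolding h'_def[abs_def]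
    by (intro continuous_intros continuous_on_compose2[OF continuous_ramp']) auto
  have hb: "0 \<le> h N t" "h N t \<le> 1" for N t by (simp_all add: h_def ramp_bounds)
  have h'b: "\<bar>h' N t\<bar> \<le> 2 * real (Suc N)" for N t
  proof -
    have "\<bar>h' N t\<bar> = real (Suc N) * ramp' (real (Suc N) * (\<beta> - t))"
      by (simp add: h'_def abs_mult ramp'_bounds del: of_nat_Suc)
    also have "\<dots> \<le> real (Suc N) * 2" by (intro mult_left_mono ramp'_bounds) simp
    finally show ?thesis by simp
  qed
  have h'0: "h' N t = 0" if "\<not> (\<beta> - 1 / real (Suc N) \<le> t \<and> t < \<beta>)" for N t
  proof -
    have "real (Suc N) * (\<beta> - t) \<le> 0 \<or> 1 \<le> real (Suc N) * (\<beta> - t)"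
    proof (cases "\<beta> \<le> t")
      case True
      then show ?thesis by (intro disjI1 mult_nonneg_nonpos) auto
    next
      case False
      then have "1 / real (Suc N) \<le> \<beta> - t" using that by simp
      then have "real (Suc N) * (1 / real (Suc N)) \<le> real (Suc N) * (\<beta> - t)" by (intro mult_left_mono) auto
      then show ?thesis by simp
    qed
    then show ?thesis using ramp'_outside by (simp add: h'_def)
  qed
  have d1: "((\<lambda>t. 1 - h N t) has_real_derivative - h' N t) (at t)" for N t
    using DERIV_diff[OF DERIV_const dh, of 1] by simp
  obtain B1 where B1: "\<And>x. norm (div_field \<phi> x) \<le> B1" using div_field_bounded[OF \<phi>] by blast
  have Dm: "D \<in> sets lebesgue" using D(1) by simp
  define f where "f N x = u x \<bullet> (h N (x \<bullet> w) *\<^sub>R div_field \<phi> x)" for N x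
  define g where "g N x = v x \<bullet> ((1 - h N (x \<bullet> w)) *\<^sub>R div_field \<phi> x)" for N x
  have fb: "integral D (f N) \<le> C1 + ?E" for N unfolding f_def
    by (rule cut_integral_bound[OF u B D w _ \<phi> dh ch hb h'b h'0]) simp_all
  have gb: "integral D (g N) \<le> C2 + ?E" for N unfolding g_def
    by (rule cut_integral_bound[OF v B D w _ \<phi> d1, where N = "Suc N" and \<beta> = \<beta>])
       (use ch hb h'b h'0 in \<open>auto intro: continuous_intros\<close>)
  have conth: "continuous_on UNIV (\<lambda>x. h N (x \<bullet> w))" for N
    by (rule continuous_on_compose2[OF DERIV_continuous_on[OF has_field_derivative_at_within[OF dh]]])
       (auto intro!: continuous_intros)
  have hB: "norm (a *\<^sub>R div_field \<phi> x) \<le> B1" if "0 \<le> a" "a \<le> 1" for a x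
    using mult_mono[OF that(2) B1[of x]] that by simp
  have fi: "f N absolutely_integrable_on D" for N unfolding f_def
    by (rule continuous_mult_absolutely_integrable[OF u(1) Dm _ hB])
       (auto intro!: continuous_intros conth div_field_continuous[OF \<phi>] hb)
  have gi: "g N absolutely_integrable_on D" for N unfolding g_def
    by (rule continuous_mult_absolutely_integrable[OF v(1) Dm _ hB])
       (auto intro!: continuous_intros conth div_field_continuous[OF \<phi>] simp: hb)
  have "(\<lambda>N. integral D (\<lambda>x. f N x + g N x)) \<longlonglongrightarrow> integral D (\<lambda>x. (if x \<bullet> w < \<beta> then u x else v x) \<bullet> div_field \<phi> x)"
  proof (rule dominated_convergence(2))
    show "(\<lambda>x. f N x + g N x) integrable_on D" for N
      using fi gi by (intro integrable_add) (auto simp: absolutely_integrable_on_def)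
    show "(\<lambda>x. 2 * (B * B1)) integrable_on D"
      using D by (intro integrable_on_const lmeasurable_open) (auto intro: bounded_subset)
    show "norm (f N x + g N x) \<le> 2 * (B * B1)" if "x \<in> D" for N x
    proof -
      have *: "\<bar>a \<bullet> b\<bar> \<le> B * B1" if "norm a \<le> B" "norm b \<le> B1" for a b :: "real^'m"
        using order_trans[OF Cauchy_Schwarz_ineq2 mult_mono[OF that B norm_ge_zero]] .
      have "\<bar>f N x\<bar> \<le> B * B1" unfolding f_def by (intro * u(3)[OF that] hB hb)
      moreover have "\<bar>g N x\<bar> \<le> B * B1" unfolding g_def by (intro * v(3)[OF that] hB) (simp_all add: hb)
      ultimately show ?thesis by simp
    qed
    show "(\<lambda>N. f N x + g N x) \<longlonglongrightarrow> (if x \<bullet> w < \<beta> then u x else v x) \<bullet> div_field \<phi> x" for x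
      proof (cases "x \<bullet> w < \<beta>")
        case True
        obtain N0 :: nat where N0: "1 / (\<beta> - x \<bullet> w) < N0" using reals_Archimedean2 by blast
        have "f N x + g N x = u x \<bullet> div_field \<phi> x" if "N \<ge> N0" for N
        proof -
          have "1 / (\<beta> - x \<bullet> w) < real (Suc N)" using N0 that by linarith
          then have "1 \<le> real (Suc N) * (\<beta> - x \<bullet> w)" using True by (simp add: pos_divide_less_eq less_imp_le)
          then have "h N (x \<bullet> w) = 1" unfolding h_def by (rule ramp_ge_1)
          then show ?thesis by (simp add: f_def g_def)
        qed
        then show ?thesis using True by (intro tendsto_eventually) (auto simp: eventually_sequentially)
      next
        case False
        have "real (Suc N) * (\<beta> - x \<bullet> w) \<le> 0" for N using False by (intro mult_nonneg_nonpos) auto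
        then have "h N (x \<bullet> w) = 0" for N unfolding h_def by (rule ramp_le_0)
        then show ?thesis using False by (simp add: f_def g_def)
      qed
  qed
  moreover have "integral D (\<lambda>x. f N x + g N x) \<le> C1 + C2 + 2 * ?E" for N
  proof -
    have "integral D (\<lambda>x. f N x + g N x) = integral D (f N) + integral D (g N)"
      using fi gi by (intro integral_add) (auto simp: absolutely_integrable_on_def)
    then show ?thesis using fb[of N] gb[of N] by linarith
  qed
  ultimately show "integral D (\<lambda>x. (if x \<bullet> w < \<beta> then u x else v x) \<bullet> div_field \<phi> x) \<le> C1 + C2 + 2 * ?E"
    by (intro LIMSEQ_le_const2) auto
qed

lemma BV_M_cut:
  fixes u v :: "real^'n \<Rightarrow> real^'m"
  assumes u: "u \<in> BV_M M D" and v: "v \<in> BV_M M D" and M: "finite M" and D: "open D" "bounded D" and w: "norm w = 1"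
  shows "(\<lambda>x. if x \<bullet> w < \<beta> then u x else v x) \<in> BV_M M D"
proof -
  obtain R where R: "D \<subseteq> ball 0 R" using bounded_subset_ballD[OF D(2)] by blast
  obtain B where B: "0 < B" "\<And>a. a \<in> M \<Longrightarrow> norm a \<le> B"
    using finite_imp_bounded[OF M] by (auto simp: bounded_pos)
  obtain C1 C2 where C: "total_variation u D \<le> ereal C1" "total_variation v D \<le> ereal C2"
    using u v unfolding BV_M_def total_variation_finite_iff[symmetric] using total_variation_finite_iff by blast
  have "total_variation (\<lambda>x. if x \<bullet> w < \<beta> then u x else v x) D < \<infinity>"
    unfolding total_variation_finite_iff
    using total_variation_cut[OF _ C(1) _ _ C(2) _ D(1) R w, of B \<beta>] u v B unfolding BV_M_def by auto
  moreover have "(\<lambda>x. if x \<in> {x. x \<bullet> w < \<beta>} then u x else v x) absolutely_integrable_on D"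
    using u v D by (intro absolutely_integrable_on_cut) (auto simp: BV_M_def)
  ultimately show ?thesis using u v by (simp add: BV_M_def)
qed

lemma BV_M_u_jump:
  assumes "a \<in> M" "b \<in> M" "finite M" "open D" "bounded D" "norm \<nu> = 1"
  shows "u_jump a b \<nu> \<in> BV_M M D"
proof -
  have "(\<lambda>x. if x \<bullet> (- \<nu>) < 0 then b else a) \<in> BV_M M D"
    using assms by (intro BV_M_cut BV_M_const) auto
  also have "(\<lambda>x. if x \<bullet> (- \<nu>) < 0 then b else a) = u_jump a b \<nu>" by (auto simp: u_jump_def fun_eq_iff)
  finally show ?thesis .
qed

lemma BV_M_glue_polyhedron:
  assumes "finite W" "\<And>w \<beta>. (w, \<beta>) \<in> W \<Longrightarrow> norm w = 1"
    and "u \<in> BV_M M D" "v \<in> BV_M M D" "finite M" "open D" "bounded D"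
  shows "(\<lambda>x. if \<forall>(w, \<beta>)\<in>W. x \<bullet> w < \<beta> then u x else v x) \<in> BV_M M D"
  using assms(1,2)
proof (induction W rule: finite_induct)
  case empty
  then show ?case using assms by simp
next
  case (insert p W)
  obtain w \<beta> where p: "p = (w, \<beta>)" by (cases p)
  have "(\<lambda>x. if x \<bullet> w < \<beta> then (if \<forall>(w, \<beta>)\<in>W. x \<bullet> w < \<beta> then u x else v x) else v x) \<in> BV_M M D"
    using insert assms p by (intro BV_M_cut) auto
  also have "(\<lambda>x. if x \<bullet> w < \<beta> then (if \<forall>(w, \<beta>)\<in>W. x \<bullet> w < \<beta> then u x else v x) else v x)
    = (\<lambda>x. if \<forall>(w, \<beta>)\<in>insert p W. x \<bullet> w < \<beta> then u x else v x)" by (auto simp: p)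
  finally show ?case .
qed

text \<open>A cube is cut out by finitely many half spaces, so gluing along hyperplanes suffices.
  This is the reason for enclosing balls in cubes when competitors are modified.\<close>

lemma BV_M_glue_cube:
  fixes u v :: "real^'n \<Rightarrow> real^'m"
  assumes "u \<in> BV_M M D" "v \<in> BV_M M D" "finite M" "open D" "bounded D"
  shows "(\<lambda>x. if \<forall>j. \<bar>x $ j - x0 $ j\<bar> < r then u x else v x) \<in> BV_M M D"
proof -
  define W where "W = (\<lambda>j::'n. (axis j (1::real), r + x0 $ j)) ` UNIV \<union> (\<lambda>j. (- axis j 1, r - x0 $ j)) ` UNIV"
  have "(\<lambda>x. if \<forall>(w, \<beta>)\<in>W. x \<bullet> w < \<beta> then u x else v x) \<in> BV_M M D"
    using assms by (intro BV_M_glue_polyhedron) (auto simp: W_def)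
  moreover have "(\<forall>(w, \<beta>)\<in>W. x \<bullet> w < \<beta>) \<longleftrightarrow> (\<forall>j. \<bar>x $ j - x0 $ j\<bar> < r)" for x
    unfolding W_def by (auto simp: inner_axis abs_less_iff ball_Un algebra_simps)
  ultimately show ?thesis by simp
qed

section \<open>Jump sets and modification of competitors\<close>

lemma half_ball_contains_ball:
  assumes "norm \<nu> = 1" "0 < r"
  shows "ball (x + (r / 2) *\<^sub>R \<nu>) (r / 2) \<subseteq> half_ball x r \<nu>"
proof
  fix y assume "y \<in> ball (x + (r / 2) *\<^sub>R \<nu>) (r / 2)"
  then have y: "norm (y - x - (r / 2) *\<^sub>R \<nu>) < r / 2" by (simp add: dist_norm norm_minus_commute algebra_simps)
  have "norm (y - x) \<le> norm (y - x - (r / 2) *\<^sub>R \<nu>) + norm ((r / 2) *\<^sub>R \<nu>)"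
    by (rule norm_triangle_sub[of "y - x" "(r / 2) *\<^sub>R \<nu>", unfolded add.commute[of "norm ((r / 2) *\<^sub>R \<nu>)"]])
  then have "norm (y - x) < r" using y assms by simp
  moreover have "(y - x - (r / 2) *\<^sub>R \<nu>) \<bullet> \<nu> > - (r / 2)"
    using Cauchy_Schwarz_ineq2[of "y - x - (r / 2) *\<^sub>R \<nu>" \<nu>] y assms by (simp add: abs_le_iff)
  then have "(y - x) \<bullet> \<nu> > 0" using assms by (simp add: inner_diff_left dot_square_norm)
  ultimately show "y \<in> half_ball x r \<nu>" by (simp add: half_ball_def dist_norm norm_minus_commute)
qed

lemma half_ball_subset: "half_ball x r \<nu> \<subseteq> ball x r"
  by (auto simp: half_ball_def)

lemma open_half_ball: "open (half_ball x r \<nu>)"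
proof -
  have "half_ball x r \<nu> = ball x r \<inter> {y. 0 < (y - x) \<bullet> \<nu>}" by (auto simp: half_ball_def)
  moreover have "open {y. 0 < (y - x) \<bullet> \<nu>}" by (intro open_Collect_less continuous_intros)
  ultimately show ?thesis by auto
qed

lemma half_ball_borel[measurable]: "half_ball x r \<nu> \<in> sets borel"
  using open_half_ball by (rule borel_open)

text \<open>The defining limits involve only arbitrarily small half balls, and the integrals ignore
  null sets.\<close>

lemma jump_triple_cong:
  fixes u v :: "real^'n \<Rightarrow> real^'m"
  assumes U: "open U" "x \<in> U" and eq: "AE y in lborel. y \<in> U \<longrightarrow> u y = v y"
  shows "jump_triple u x a b \<nu> \<longleftrightarrow> jump_triple v x a b \<nu>"
proof -
  obtain e where e: "0 < e" "ball x e \<subseteq> U" using U openE by blast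
  have *: "\<forall>\<^sub>F r in at_right 0. (\<integral>\<^sup>+ y \<in> half_ball x r w. ennreal (norm (u y - c)) \<partial>lborel) / ennreal (r ^ CARD('n))
      = (\<integral>\<^sup>+ y \<in> half_ball x r w. ennreal (norm (v y - c)) \<partial>lborel) / ennreal (r ^ CARD('n))" for w c
  proof (rule eventually_at_rightI[of 0 e])
    fix r assume r: "r \<in> {0<..<e}"
    have "half_ball x r w \<subseteq> U" using r e half_ball_subset[of x r w] by (auto simp: subset_iff)
    then have "(\<integral>\<^sup>+ y \<in> half_ball x r w. ennreal (norm (u y - c)) \<partial>lborel) = (\<integral>\<^sup>+ y \<in> half_ball x r w. ennreal (norm (v y - c)) \<partial>lborel)"
    proof (intro nn_integral_cong_AE)
      show "AE y in lborel. ennreal (norm (u y - c)) * indicator (half_ball x r w) y = ennreal (norm (v y - c)) * indicator (half_ball x r w) y"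
        using eq
      proof eventually_elim
        case (elim y)
        then show ?case using \<open>half_ball x r w \<subseteq> U\<close> by (cases "y \<in> half_ball x r w") auto
      qed
    qed
    then show "(\<integral>\<^sup>+ y \<in> half_ball x r w. ennreal (norm (u y - c)) \<partial>lborel) / ennreal (r ^ CARD('n))
      = (\<integral>\<^sup>+ y \<in> half_ball x r w. ennreal (norm (v y - c)) \<partial>lborel) / ennreal (r ^ CARD('n))" by simp
  qed (use e in auto)
  show ?thesis unfolding jump_triple_def by (simp only: tendsto_cong[OF *])
qed

text \<open>\<open>jump_data\<close> is a choice among all triples at \<open>x\<close>. Equality of
  the whole predicate, and not only of its solvability, makes the two choices coincide.\<close>

lemma jump_cong:
  assumes U: "open U" "x \<in> U" and eq: "AE y in lborel. y \<in> U \<longrightarrow> u y = v y"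
  shows "jump_data u x = jump_data v x" "x \<in> jump_set u \<longleftrightarrow> x \<in> jump_set v"
proof -
  have "jump_triple u x = jump_triple v x" by (intro ext jump_triple_cong[OF assms])
  then show "jump_data u x = jump_data v x" "x \<in> jump_set u \<longleftrightarrow> x \<in> jump_set v"
    by (simp_all add: jump_data_def jump_set_def)
qed

lemma emeasure_ball_scale:
  fixes p :: "real^'n"
  assumes "0 < r"
  shows "emeasure lborel (ball p r) = ennreal (unit_ball_vol (real CARD('n)) * r ^ CARD('n))"
  using emeasure_ball[of r p] assms by simp

text \<open>On a ball of radius \<open>k * r\<close> inside both regions the triangle inequality
  bounds \<open>norm (a - b)\<close> by the sum of the two deviations. If
  \<open>a \<noteq> b\<close>, the rescaled integrals therefore cannot both tend to 0.\<close>

lemma density_limit_unique: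
  fixes u :: "real^'n \<Rightarrow> real^'m"
  assumes u[measurable]: "u \<in> borel_measurable borel"
    and A: "((\<lambda>r. (\<integral>\<^sup>+ y \<in> A r. ennreal (norm (u y - a)) \<partial>lborel) / ennreal (r ^ CARD('n))) \<longlongrightarrow> 0) (at_right 0)"
    and B: "((\<lambda>r. (\<integral>\<^sup>+ y \<in> B r. ennreal (norm (u y - b)) \<partial>lborel) / ennreal (r ^ CARD('n))) \<longlongrightarrow> 0) (at_right 0)"
    and k: "0 < k" "\<And>r. 0 < r \<Longrightarrow> ball (p r) (k * r) \<subseteq> A r \<inter> B r"
  shows "a = b"
proof (rule ccontr)
  assume "a \<noteq> b"
  let ?d = "CARD('n)"
  define \<epsilon> where "\<epsilon> = norm (a - b) * (unit_ball_vol (real ?d) * k ^ ?d)"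
  have \<epsilon>: "0 < \<epsilon>" using \<open>a \<noteq> b\<close> k by (auto simp: \<epsilon>_def)
  have "((\<lambda>r. (\<integral>\<^sup>+ y \<in> A r. ennreal (norm (u y - a)) \<partial>lborel) / ennreal (r ^ ?d)
      + (\<integral>\<^sup>+ y \<in> B r. ennreal (norm (u y - b)) \<partial>lborel) / ennreal (r ^ ?d)) \<longlongrightarrow> 0 + 0) (at_right 0)"
    using A B by (rule tendsto_add)
  then have "\<forall>\<^sub>F r in at_right 0. (\<integral>\<^sup>+ y \<in> A r. ennreal (norm (u y - a)) \<partial>lborel) / ennreal (r ^ ?d)
      + (\<integral>\<^sup>+ y \<in> B r. ennreal (norm (u y - b)) \<partial>lborel) / ennreal (r ^ ?d) < ennreal \<epsilon>"
    using \<epsilon> by (intro order_tendstoD(2)) auto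
  moreover have "\<forall>\<^sub>F r in at_right (0::real). 0 < r" by (rule eventually_at_right_less)
  ultimately have "\<forall>\<^sub>F r in at_right (0::real). False"
  proof eventually_elim
    case (elim r)
    have r: "0 < r ^ ?d" using elim by simp
    have [measurable]: "ball (p r) (k * r) \<in> sets borel" by simp
    have "\<epsilon> * r ^ ?d = norm (a - b) * (unit_ball_vol (real ?d) * (k * r) ^ ?d)"
      by (simp add: \<epsilon>_def power_mult_distrib)
    then have "ennreal (\<epsilon> * r ^ ?d) = ennreal (norm (a - b)) * emeasure lborel (ball (p r) (k * r))"
      using elim k by (simp add: emeasure_ball_scale ennreal_mult)
    also have "\<dots> = (\<integral>\<^sup>+ y. ennreal (norm (a - b)) * indicator (ball (p r) (k * r)) y \<partial>lborel)"
      by (rule nn_integral_cmult_indicator[symmetric]) simp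
    also have "\<dots> \<le> (\<integral>\<^sup>+ y. ennreal (norm (u y - a)) * indicator (ball (p r) (k * r)) y + ennreal (norm (u y - b)) * indicator (ball (p r) (k * r)) y \<partial>lborel)"
    proof (rule nn_integral_mono)
      fix y
      have "norm (a - b) \<le> norm (u y - a) + norm (u y - b)"
        using norm_triangle_ineq4[of "u y - b" "u y - a"] unfolding diff_diff_eq2 by (simp add: add.commute)
      then show "ennreal (norm (a - b)) * indicator (ball (p r) (k * r)) y
        \<le> ennreal (norm (u y - a)) * indicator (ball (p r) (k * r)) y + ennreal (norm (u y - b)) * indicator (ball (p r) (k * r)) y"
        by (simp add: indicator_def ennreal_plus[symmetric] ennreal_leI del: ennreal_plus)
    qed
    also have "\<dots> = (\<integral>\<^sup>+ y. ennreal (norm (u y - a)) * indicator (ball (p r) (k * r)) y \<partial>lborel) + (\<integral>\<^sup>+ y. ennreal (norm (u y - b)) * indicator (ball (p r) (k * r)) y \<partial>lborel)"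
      by (rule nn_integral_add) measurable
    also have "\<dots> \<le> (\<integral>\<^sup>+ y \<in> A r. ennreal (norm (u y - a)) \<partial>lborel) + (\<integral>\<^sup>+ y \<in> B r. ennreal (norm (u y - b)) \<partial>lborel)"
      using k(2)[of r] elim by (intro add_mono nn_integral_mono) (auto simp: indicator_def)
    finally have "ennreal (\<epsilon> * r ^ ?d) / ennreal (r ^ ?d) \<le> ((\<integral>\<^sup>+ y \<in> A r. ennreal (norm (u y - a)) \<partial>lborel) + (\<integral>\<^sup>+ y \<in> B r. ennreal (norm (u y - b)) \<partial>lborel)) / ennreal (r ^ ?d)"
      by (rule divide_right_mono_ennreal)
    also have "\<dots> = (\<integral>\<^sup>+ y \<in> A r. ennreal (norm (u y - a)) \<partial>lborel) / ennreal (r ^ ?d) + (\<integral>\<^sup>+ y \<in> B r. ennreal (norm (u y - b)) \<partial>lborel) / ennreal (r ^ ?d)"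
      by (rule add_divide_distrib_ennreal)
    also have "\<dots> < ennreal \<epsilon>" using elim by simp
    also have "ennreal (\<epsilon> * r ^ ?d) / ennreal (r ^ ?d) = ennreal \<epsilon>" using r \<epsilon> elim by (subst divide_ennreal) auto
    finally show False by simp
  qed
  then show False by simp
qed

lemma const_no_jump: "x \<notin> jump_set (\<lambda>_. c)"
proof
  assume "x \<in> jump_set (\<lambda>_. c)"
  then obtain a b \<nu> where *: "jump_triple (\<lambda>_. c) x a b \<nu>" by (auto simp: jump_set_def)
  have z: "((\<lambda>r. (\<integral>\<^sup>+ y \<in> half_ball x r w. ennreal (norm (c - c)) \<partial>lborel) / ennreal (r ^ n)) \<longlongrightarrow> 0) (at_right (0::real))" for w n
    by simp
  have sub: "ball (x + (r / 2) *\<^sub>R w) (1 / 2 * r) \<subseteq> half_ball x r w \<inter> half_ball x r w" if "0 < r" "norm w = 1" for w r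
    using half_ball_contains_ball[of w r x] that by simp
  have "b = c"
    by (rule density_limit_unique[where u = "\<lambda>_. c" and A = "\<lambda>r. half_ball x r \<nu>" and B = "\<lambda>r. half_ball x r \<nu>"
          and k = "1/2" and p = "\<lambda>r. x + (r / 2) *\<^sub>R \<nu>"])
       (use * z sub in \<open>auto simp: jump_triple_def\<close>)
  moreover have "a = c"
    by (rule density_limit_unique[where u = "\<lambda>_. c" and A = "\<lambda>r. half_ball x r (- \<nu>)" and B = "\<lambda>r. half_ball x r (- \<nu>)"
          and k = "1/2" and p = "\<lambda>r. x + (r / 2) *\<^sub>R (- \<nu>)"])
       (use * z sub[of _ "- \<nu>"] in \<open>auto simp: jump_triple_def\<close>)
  ultimately show False using * by (simp add: jump_triple_def)
qed

lemma u_jump_no_jump: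
  assumes "x \<bullet> \<nu> \<noteq> 0"
  shows "x \<notin> jump_set (u_jump a b \<nu>)"
proof -
  define U where "U = (if x \<bullet> \<nu> > 0 then {y. y \<bullet> \<nu> > 0} else {y. y \<bullet> \<nu> < 0})"
  have "open {y. y \<bullet> \<nu> > 0}" "open {y. y \<bullet> \<nu> < 0}" by (intro open_Collect_less continuous_intros)+
  then have "open U" by (simp add: U_def)
  then have "x \<in> jump_set (u_jump a b \<nu>) \<longleftrightarrow> x \<in> jump_set (\<lambda>_. if x \<bullet> \<nu> > 0 then b else a)"
    using assms by (intro jump_cong(2)[of U]) (auto simp: U_def u_jump_def)
  then show ?thesis using const_no_jump by blast
qed

section \<open>Energy densities and their comparison\<close>

definition jump_energy :: "('n::finite, 'm::finite) tension \<Rightarrow> (real^'n \<Rightarrow> real^'m) \<Rightarrow> real^'n \<Rightarrow> ennreal" where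
  "jump_energy g u x = (if x \<in> jump_set u then (case jump_data u x of (a, b, \<nu>) \<Rightarrow> ennreal (g x (b - a) \<nu>)) else 0)"

lemma energy_eq:
  fixes g :: "('n::finite, 'm::finite) tension"
  assumes "u \<in> BV_M M D"
  shows "energy M g u D = (\<integral>\<^sup>+ x \<in> D. jump_energy g u x \<partial>hausdorff_measure (real CARD('n) - 1))"
  unfolding energy_def using assms
  by (auto intro!: nn_integral_cong simp: jump_energy_def indicator_def)

lemma jump_data_triple:
  assumes "x \<in> jump_set u" "jump_data u x = (a, b, \<nu>)"
  shows "jump_triple u x a b \<nu>"
proof -
  have "\<exists>p. (case p of (a, b, \<nu>) \<Rightarrow> jump_triple u x a b \<nu>)" using assms(1) by (auto simp: jump_set_def)
  from someI_ex[OF this] show ?thesis using assms(2) by (simp add: jump_data_def)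
qed

lemma jump_energy_cong:
  assumes "\<And>\<zeta> \<nu>. norm \<nu> = 1 \<Longrightarrow> g x \<zeta> \<nu> = g' x \<zeta> \<nu>" "open U" "x \<in> U" "AE y in lborel. y \<in> U \<longrightarrow> u y = v y"
  shows "jump_energy g u x = jump_energy g' v x"
proof (cases "x \<in> jump_set u")
  case True
  obtain a b \<nu> where d: "jump_data u x = (a, b, \<nu>)" by (cases "jump_data u x")
  then have "norm \<nu> = 1" using jump_data_triple[OF True] by (simp add: jump_triple_def)
  then show ?thesis using True d assms(1) jump_cong[OF assms(2-4)] by (simp add: jump_energy_def)
qed (use jump_cong[OF assms(2-4)] in \<open>simp add: jump_energy_def\<close>)

lemma adm_class_le:
  assumes "g \<in> adm_class c" "norm \<nu> = 1"
  shows "g x \<zeta> \<nu> \<le> c"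
proof -
  have "\<forall>x \<zeta> \<nu>. \<nu> \<in> sphere 0 1 \<longrightarrow> 1 / c \<le> g x \<zeta> \<nu> \<and> g x \<zeta> \<nu> \<le> c \<and> g x \<zeta> \<nu> = g x (-\<zeta>) (-\<nu>)"
    using assms(1) unfolding adm_class_def by blast
  moreover have "\<nu> \<in> sphere 0 1" using assms(2) by simp
  ultimately show ?thesis by blast
qed

lemma jump_energy_le:
  assumes "g \<in> adm_class c"
  shows "jump_energy g u x \<le> ennreal c"
proof (cases "x \<in> jump_set u")
  case True
  obtain a b \<nu> where d: "jump_data u x = (a, b, \<nu>)" by (cases "jump_data u x")
  then have "norm \<nu> = 1" using jump_data_triple[OF True] by (simp add: jump_triple_def)
  then have "g x (b - a) \<nu> \<le> c" using adm_class_le[OF assms] by blast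
  then show ?thesis using True d by (simp add: jump_energy_def ennreal_leI)
qed (simp add: jump_energy_def)

text \<open>The integral of a non-measurable function is a lower integral, so subadditivity needs one measurable summand.\<close>

lemma nn_integral_add_le:
  assumes g[measurable]: "g \<in> borel_measurable M"
  shows "(\<integral>\<^sup>+x. f x + g x \<partial>M) \<le> (\<integral>\<^sup>+x. f x \<partial>M) + (\<integral>\<^sup>+x. g x \<partial>M)"
  unfolding nn_integral_def[of M "\<lambda>x. f x + g x"]
proof (rule SUP_least)
  fix s assume "s \<in> {s. simple_function M s \<and> s \<le> (\<lambda>x. f x + g x)}"
  then have s: "simple_function M s" "\<And>x. s x \<le> f x + g x" by (auto simp: le_fun_def)
  have [measurable]: "s \<in> borel_measurable M" using s(1) by (rule borel_measurable_simple_function)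
  define s' where "s' x = (if g x = top then 0 else s x - g x)" for x
  have [measurable]: "s' \<in> borel_measurable M" unfolding s'_def[abs_def] by measurable
  have "integral\<^sup>S M s = (\<integral>\<^sup>+x. s x \<partial>M)" using s(1) by (simp add: nn_integral_eq_simple_integral)
  also have "\<dots> \<le> (\<integral>\<^sup>+x. s' x + g x \<partial>M)"
  proof (rule nn_integral_mono)
    fix x
    have "s x \<le> (s x - g x) + g x"
    proof (cases "g x \<le> s x")
      case False
      then have "s x \<le> g x" by simp
      also have "g x \<le> (s x - g x) + g x" by (simp add: add_increasing)
      finally show ?thesis .
    qed (simp add: diff_add_cancel_ennreal)
    then show "s x \<le> s' x + g x" by (auto simp: s'_def)
  qed
  also have "\<dots> = (\<integral>\<^sup>+x. s' x \<partial>M) + (\<integral>\<^sup>+x. g x \<partial>M)" by (rule nn_integral_add) measurable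
  also have "\<dots> \<le> (\<integral>\<^sup>+x. f x \<partial>M) + (\<integral>\<^sup>+x. g x \<partial>M)"
    using s(2) by (intro add_right_mono nn_integral_mono) (auto simp: s'_def ennreal_minus_le_iff add.commute)
  finally show "integral\<^sup>S M s \<le> (\<integral>\<^sup>+x. f x \<partial>M) + (\<integral>\<^sup>+x. g x \<partial>M)" .
qed

text \<open>The exceptional set of the modified competitor: the faces, where gluing may create
  jumps, and the section of the closed cube by the interface hyperplane.\<close>

definition cube_faces :: "real^'n \<Rightarrow> real \<Rightarrow> real^'n \<Rightarrow> (real^'n) set" where
  "cube_faces x0 \<sigma> \<nu> = {x. (\<forall>j. \<bar>x $ j - x0 $ j\<bar> \<le> \<sigma>) \<and> (x \<bullet> \<nu> = 0 \<or> (\<exists>j. \<bar>x $ j - x0 $ j\<bar> = \<sigma>))}"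

lemma cube_faces_measure:
  fixes \<nu> x0 :: "real^'n"
  assumes \<nu>: "norm \<nu> = 1" and \<sigma>: "0 < \<sigma>"
  shows "cube_faces x0 \<sigma> \<nu> \<in> sets borel"
    and "emeasure (hausdorff_measure (real CARD('n) - 1)) (cube_faces x0 \<sigma> \<nu>)
      \<le> ennreal ((2 * real CARD('n) + 1) * (cone_const TYPE('n) * (2 * \<sigma>) powr (real CARD('n) - 1)))"
proof -
  let ?H = "hausdorff_measure (real CARD('n) - 1) :: (real^'n) measure"
  let ?K = "cone_const TYPE('n) * (2 * \<sigma>) powr (real CARD('n) - 1)"
  define F where "F w \<beta> = {x. x \<bullet> w = \<beta> \<and> (\<forall>j. \<bar>x $ j - x0 $ j\<bar> \<le> 2 * \<sigma> / 2)}" for w :: "real^'n" and \<beta>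
  have Fc: "closed (F w \<beta>)" for w \<beta> unfolding F_def Collect_conj_eq Collect_all_eq
    by (intro closed_Int closed_INT ballI closed_Collect_eq closed_Collect_le continuous_intros)
  have FK: "emeasure ?H (F w \<beta>) \<le> ennreal ?K" if "norm w = 1" for w \<beta>
    unfolding F_def by (rule hausdorff_measure_flat[OF that]) (use \<sigma> in simp)
  define A where "A = (\<Union>j. F (axis j 1) (x0 $ j + \<sigma>)) \<union> (\<Union>j. F (axis j 1) (x0 $ j - \<sigma>))"
  have "\<bar>x $ j - x0 $ j\<bar> = \<sigma> \<longleftrightarrow> x $ j = x0 $ j + \<sigma> \<or> x $ j = x0 $ j - \<sigma>" for x j using \<sigma> by auto
  then have eq: "cube_faces x0 \<sigma> \<nu> = F \<nu> 0 \<union> A"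
    unfolding cube_faces_def F_def A_def by (auto simp: inner_axis)
  have cA: "closed (\<Union>j\<in>(UNIV::'n set). F (axis j 1) (b j))" for b by (intro closed_UN ballI Fc finite)
  have "closed A" unfolding A_def by (intro closed_Un cA)
  then show "cube_faces x0 \<sigma> \<nu> \<in> sets borel" unfolding eq using Fc by (intro borel_closed closed_Un)
  have un: "emeasure ?H (\<Union>j\<in>(UNIV::'n set). F (axis j 1) (b j)) \<le> real CARD('n) * ennreal ?K" for b
  proof -
    have "emeasure ?H (\<Union>j\<in>(UNIV::'n set). F (axis j 1) (b j)) \<le> (\<Sum>j\<in>(UNIV::'n set). emeasure ?H (F (axis j 1) (b j)))"
      using Fc by (intro emeasure_subadditive_finite) auto
    also have "\<dots> \<le> (\<Sum>j\<in>(UNIV::'n set). ennreal ?K)" by (intro sum_mono FK) simp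
    finally show ?thesis by (simp add: ennreal_of_nat_eq_real_of_nat)
  qed
  have "emeasure ?H (cube_faces x0 \<sigma> \<nu>) \<le> emeasure ?H (F \<nu> 0) + emeasure ?H A"
    unfolding eq using Fc \<open>closed A\<close> by (intro emeasure_subadditive) auto
  also have "emeasure ?H A \<le> real CARD('n) * ennreal ?K + real CARD('n) * ennreal ?K"
    unfolding A_def using cA by (intro order_trans[OF emeasure_subadditive add_mono] un) (auto intro: borel_closed)
  also have "emeasure ?H (F \<nu> 0) \<le> ennreal ?K" by (rule FK[OF \<nu>])
  finally have "emeasure ?H (cube_faces x0 \<sigma> \<nu>) \<le> ennreal ?K + (real CARD('n) * ennreal ?K + real CARD('n) * ennreal ?K)"
    by (simp add: add_mono)
  also have "\<dots> = ennreal ((2 * real CARD('n) + 1) * ?K)"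
    using cone_const_nonneg[where 'n = 'n] \<sigma>
    by (simp add: ennreal_mult[symmetric] ennreal_plus[symmetric] algebra_simps del: ennreal_plus)
  finally show "emeasure ?H (cube_faces x0 \<sigma> \<nu>) \<le> ennreal ((2 * real CARD('n) + 1) * ?K)" .
qed

text \<open>The upper bound \<open>c\<close> of the tension times the area bound for the 2 d faces
  and the one interface section of a cube with \<open>\<sigma> = 1\<close>; the scaling
  \<sigma>^(d-1) is split off.\<close>

definition osc_const :: "'n itself \<Rightarrow> real \<Rightarrow> real" where
  "osc_const _ c = c * ((2 * real CARD('n) + 1) * (cone_const TYPE('n) * 2 powr (real CARD('n) - 1)))"

text \<open>Competitor: replace \<open>u\<close> by the pure jump function inside the cube containing the ball.\<close>

lemma energy_modify:
  fixes g g' :: "('n::finite, 'm::finite) tension" and \<nu> :: "real^'n"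
  assumes g': "g' \<in> adm_class c" and c: "0 \<le> c"
    and eq: "\<And>x \<zeta> \<nu>. x \<notin> ball x0 \<sigma> \<Longrightarrow> norm \<nu> = 1 \<Longrightarrow> g' x \<zeta> \<nu> = g x \<zeta> \<nu>"
    and D: "open D" "bounded D" and M: "finite M" "a \<in> M" "b \<in> M" and \<nu>: "norm \<nu> = 1" and \<sigma>: "0 < \<sigma>"
    and u: "u \<in> admissible M (u_jump a b \<nu>) D"
  shows "\<exists>v\<in>admissible M (u_jump a b \<nu>) D. energy M g' v D \<le> energy M g u D + ennreal (osc_const TYPE('n) c * \<sigma> powr (real CARD('n) - 1))"
proof -
  let ?H = "hausdorff_measure (real CARD('n) - 1) :: (real^'n) measure"
  define v where "v x = (if \<forall>j. \<bar>x $ j - x0 $ j\<bar> < \<sigma> then u_jump a b \<nu> x else u x)" for x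
  have uBV: "u \<in> BV_M M D" using u by (simp add: admissible_def)
  have vBV: "v \<in> BV_M M D" unfolding v_def[abs_def]
    by (rule BV_M_glue_cube[OF BV_M_u_jump[OF M(2,3,1) D \<nu>] uBV M(1) D])
  obtain U where "open U" "frontier D \<subseteq> U" "\<forall>x\<in>U \<inter> D. u x = u_jump a b \<nu> x"
    using u by (auto simp: admissible_def)
  then have vadm: "v \<in> admissible M (u_jump a b \<nu>) D"
    using vBV by (auto simp: admissible_def v_def intro!: exI[of _ U])
  let ?N = "cube_faces x0 \<sigma> \<nu>"
  note N = cube_faces_measure[OF \<nu> \<sigma>, of x0]
  \<comment> \<open>Three regions: on the faces and the interface the density is at most
    \<open>c\<close>; elsewhere inside the cube \<open>v\<close> is locally constant; outside the
    closed cube \<open>v = u\<close> nearby, and the tensions agree there because the ball lies in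
    the cube.\<close>
  have pt: "jump_energy g' v x \<le> jump_energy g u x + ennreal c * indicator ?N x" for x
  proof (cases "x \<in> ?N")
    case True
    then show ?thesis using jump_energy_le[OF g', of v x] by (simp add: add_increasing)
  next
    case False
    show ?thesis
    proof (cases "\<forall>j. \<bar>x $ j - x0 $ j\<bar> < \<sigma>")
      case True
      define Q where "Q = {y. \<forall>j. \<bar>y $ j - x0 $ j\<bar> < \<sigma>}"
      have "open Q" unfolding Q_def Collect_all_eq by (intro open_INT ballI open_Collect_less continuous_intros) auto
      then have "x \<in> jump_set v \<longleftrightarrow> x \<in> jump_set (u_jump a b \<nu>)"
        using True by (intro jump_cong(2)[of Q]) (auto simp: Q_def v_def)
      moreover have "x \<bullet> \<nu> \<noteq> 0" using False True by (auto simp: cube_faces_def less_imp_le)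
      ultimately have "x \<notin> jump_set v" using u_jump_no_jump by blast
      then have "jump_energy g' v x = 0" by (simp add: jump_energy_def)
      then show ?thesis by simp
    next
      case notin: False
      define Q where "Q = {y. \<exists>j. \<sigma> < \<bar>y $ j - x0 $ j\<bar>}"
      have "open Q" unfolding Q_def Collect_ex_eq by (intro open_UN ballI open_Collect_less continuous_intros)
      moreover have "x \<in> Q"
      proof (rule ccontr)
        assume "x \<notin> Q"
        then have "\<forall>j. \<bar>x $ j - x0 $ j\<bar> \<le> \<sigma>" by (auto simp: Q_def not_less)
        moreover obtain j where "\<sigma> \<le> \<bar>x $ j - x0 $ j\<bar>" using notin by (auto simp: not_less)
        ultimately show False using False by (auto simp: cube_faces_def dest!: spec[of _ j])
      qed
      moreover have "v y = u y" if yQ: "y \<in> Q" for y 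
      proof -
        obtain j where "\<sigma> < \<bar>y $ j - x0 $ j\<bar>" using yQ by (auto simp: Q_def)
        then have "\<not> (\<forall>j. \<bar>y $ j - x0 $ j\<bar> < \<sigma>)" by (meson less_asym)
        then show ?thesis unfolding v_def by (rule if_not_P)
      qed
      moreover have "x \<notin> ball x0 \<sigma>"
      proof -
        obtain j where j: "\<sigma> \<le> \<bar>x $ j - x0 $ j\<bar>" using notin by (auto simp: not_less)
        also have "\<dots> \<le> norm (x - x0)" using component_le_norm_cart[of "x - x0" j] by simp
        finally show ?thesis by (simp add: dist_norm norm_minus_commute)
      qed
      ultimately have "jump_energy g' v x = jump_energy g u x"
        using eq by (intro jump_energy_cong[of g' x g Q]) auto
      then show ?thesis by simp
    qed
  qed
  have "energy M g' v D = (\<integral>\<^sup>+ x \<in> D. jump_energy g' v x \<partial>?H)" by (rule energy_eq[OF vBV])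
  also have "\<dots> \<le> (\<integral>\<^sup>+ x. jump_energy g u x * indicator D x + ennreal c * indicator ?N x \<partial>?H)"
    using pt by (intro nn_integral_mono) (auto simp: indicator_def)
  also have "\<dots> \<le> (\<integral>\<^sup>+ x. jump_energy g u x * indicator D x \<partial>?H) + (\<integral>\<^sup>+ x. ennreal c * indicator ?N x \<partial>?H)"
    by (rule nn_integral_add_le) (use N in \<open>auto intro!: borel_measurable_times borel_measurable_indicator\<close>)
  also have "(\<integral>\<^sup>+ x. ennreal c * indicator ?N x \<partial>?H) = ennreal c * emeasure ?H ?N"
    using N by (intro nn_integral_cmult_indicator) auto
  also have "\<dots> \<le> ennreal c * ennreal ((2 * real CARD('n) + 1) * (cone_const TYPE('n) * (2 * \<sigma>) powr (real CARD('n) - 1)))"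
    using N by (intro mult_left_mono) auto
  also have "\<dots> = ennreal (osc_const TYPE('n) c * \<sigma> powr (real CARD('n) - 1))"
    using c \<sigma> cone_const_nonneg[where 'n = 'n] by (simp add: ennreal_mult[symmetric] osc_const_def powr_mult mult_ac)
  also have "(\<integral>\<^sup>+ x. jump_energy g u x * indicator D x \<partial>?H) = energy M g u D" by (rule energy_eq[OF uBV, symmetric])
  finally show ?thesis using vadm by (intro bexI[of _ v]) (auto simp: add_left_mono)
qed

lemma energy_cong_rect:
  fixes g g' :: "('n::finite, 'm::finite) tension"
  assumes "\<And>x \<zeta> \<nu>. x \<in> D \<Longrightarrow> norm \<nu> = 1 \<Longrightarrow> g' x \<zeta> \<nu> = g x \<zeta> \<nu>"
  shows "energy M g' u D = energy M g u D"
proof (cases "u \<in> BV_M M D")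
  case True
  have "jump_energy g' u x = jump_energy g u x" if "x \<in> D" for x
    using assms[OF that] by (intro jump_energy_cong[of _ _ _ UNIV]) auto
  then show ?thesis unfolding energy_eq[OF True] by (intro nn_integral_cong) (auto simp: indicator_def)
qed (simp add: energy_def)

section \<open>The minimal energy and its response to local changes\<close>

definition min_energy where
  "min_energy M g a b \<nu> D = (INF u \<in> admissible M (u_jump a b \<nu>) D. energy M g u D)"

text \<open>The interface function is itself a competitor and pays at most \<open>c\<close> on a
  hyperplane section of a bounded set; this bound is common to the whole class.\<close>

lemma min_energy_finite:
  fixes g :: "('n::finite, 'm::finite) tension"
  assumes g: "g \<in> adm_class c" and c: "0 \<le> c"
    and D: "open D" "bounded D" and M: "finite M" "a \<in> M" "b \<in> M" and \<nu>: "norm \<nu> = 1"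
  shows "\<exists>B. \<forall>g\<in>(adm_class c :: ('n, 'm) tension set). min_energy M g a b \<nu> D \<le> ennreal B"
proof -
  let ?H = "hausdorff_measure (real CARD('n) - 1) :: (real^'n) measure"
  obtain L where L: "\<And>x. x \<in> D \<Longrightarrow> norm x \<le> L" "0 < L" using D(2) by (auto simp: bounded_pos)
  define S where "S = {x::real^'n. x \<bullet> \<nu> = 0 \<and> (\<forall>j. \<bar>x $ j - 0 $ j\<bar> \<le> 2 * L / 2)}"
  have S: "closed S" unfolding S_def Collect_conj_eq Collect_all_eq
    by (intro closed_Int closed_INT ballI closed_Collect_eq closed_Collect_le continuous_intros)
  have HS: "emeasure ?H S \<le> ennreal (cone_const TYPE('n) * (2 * L) powr (real CARD('n) - 1))"
    unfolding S_def by (rule hausdorff_measure_flat[OF \<nu>]) (use L in simp)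
  let ?u = "u_jump a b \<nu> :: real^'n \<Rightarrow> real^'m"
  have uBV: "?u \<in> BV_M M D" by (rule BV_M_u_jump[OF M(2,3,1) D \<nu>])
  then have adm: "?u \<in> admissible M ?u D" by (auto simp: admissible_def intro!: exI[of _ UNIV])
  have "min_energy M g a b \<nu> D \<le> ennreal (c * (cone_const TYPE('n) * (2 * L) powr (real CARD('n) - 1)))"
    if g: "g \<in> (adm_class c :: ('n, 'm) tension set)" for g
  proof -
    have "min_energy M g a b \<nu> D \<le> energy M g ?u D" unfolding min_energy_def by (rule INF_lower[OF adm])
    also have "\<dots> = (\<integral>\<^sup>+ x \<in> D. jump_energy g ?u x \<partial>?H)" by (rule energy_eq[OF uBV])
    also have "\<dots> \<le> (\<integral>\<^sup>+ x. ennreal c * indicator S x \<partial>?H)"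
    proof (rule nn_integral_mono)
      fix x
      show "jump_energy g ?u x * indicator D x \<le> ennreal c * indicator S x"
      proof (cases "x \<in> D \<and> x \<bullet> \<nu> = 0")
        case True
        then have "x \<in> S" using L(1)[of x] component_le_norm_cart[of x] by (auto simp: S_def intro: order_trans)
        then show ?thesis using jump_energy_le[OF g] by (simp add: indicator_def)
      next
        case False
        then show ?thesis using u_jump_no_jump[of x \<nu> a b] by (auto simp: jump_energy_def indicator_def)
      qed
    qed
    also have "\<dots> = ennreal c * emeasure ?H S" using S by (intro nn_integral_cmult_indicator) auto
    also have "\<dots> \<le> ennreal c * ennreal (cone_const TYPE('n) * (2 * L) powr (real CARD('n) - 1))"
      using HS by (rule mult_left_mono) simp
    finally show ?thesis using c cone_const_nonneg[where 'n = 'n] by (simp add: ennreal_mult[symmetric])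
  qed
  then show ?thesis by blast
qed

lemma min_energy_modify:
  fixes g g' :: "('n::finite, 'm::finite) tension" and \<nu> :: "real^'n"
  assumes "g' \<in> adm_class c" "0 \<le> c"
    and "\<And>x \<zeta> \<nu>. x \<notin> ball x0 \<sigma> \<Longrightarrow> norm \<nu> = 1 \<Longrightarrow> g' x \<zeta> \<nu> = g x \<zeta> \<nu>"
    and "open D" "bounded D" "finite M" "a \<in> M" "b \<in> M" "norm \<nu> = 1" "0 < \<sigma>"
  shows "min_energy M g' a b \<nu> D \<le> min_energy M g a b \<nu> D + ennreal (osc_const TYPE('n) c * \<sigma> powr (real CARD('n) - 1))"
proof -
  let ?K = "ennreal (osc_const TYPE('n) c * \<sigma> powr (real CARD('n) - 1))"
  have "min_energy M g' a b \<nu> D - ?K \<le> min_energy M g a b \<nu> D"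
    unfolding min_energy_def[of M g]
  proof (rule INF_greatest)
    fix u assume "u \<in> admissible M (u_jump a b \<nu>) D"
    then obtain v where v: "v \<in> admissible M (u_jump a b \<nu>) D" "energy M g' v D \<le> energy M g u D + ?K"
      using energy_modify[OF assms] by blast
    have "min_energy M g' a b \<nu> D \<le> energy M g u D + ?K"
      using INF_lower[OF v(1), of "\<lambda>u. energy M g' u D"] v(2) unfolding min_energy_def by (rule order_trans)
    then show "min_energy M g' a b \<nu> D - ?K \<le> energy M g u D"
      by (simp add: ennreal_minus_le_iff add.commute)
  qed
  then show ?thesis by (simp add: ennreal_minus_le_iff add.commute)
qed

lemma X_cell_eq:
  "X_cell M t l a b \<nu> g = t powr (1 - real CARD('n)) * enn2real (min_energy M g a b \<nu> (rect \<nu> t l))"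
  for g :: "('n::{finite,linorder}, 'm::finite) tension"
  by (simp add: X_cell_def min_energy_def)

lemma X_cell_modify:
  fixes g g' :: "('n::{finite,linorder}, 'm::finite) tension"
  assumes g: "g \<in> adm_class c" and g': "g' \<in> adm_class c" and c: "0 \<le> c"
    and eq: "\<And>x \<zeta> \<nu>. x \<notin> ball x0 \<sigma> \<Longrightarrow> norm \<nu> = 1 \<Longrightarrow> g' x \<zeta> \<nu> = g x \<zeta> \<nu>"
    and M: "finite M" "a \<in> M" "b \<in> M" and \<nu>: "norm \<nu> = 1" and \<sigma>: "0 < \<sigma>" and lt: "l \<le> t"
  shows "X_cell M t l a b \<nu> g' \<le> X_cell M t l a b \<nu> g + t powr (1 - real CARD('n)) *
    (if ball x0 \<sigma> \<inter> rect \<nu> t l = {} then 0 else osc_const TYPE('n) c * \<sigma> powr (real CARD('n) - 1))"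
proof -
  let ?D = "rect \<nu> t l"
  have D: "open ?D" "bounded ?D" using open_rect[OF \<nu>] bounded_rect[OF \<nu> lt] by auto
  have K0: "0 \<le> osc_const TYPE('n) c" unfolding osc_const_def using c cone_const_nonneg[where 'n = 'n] by simp
  show ?thesis
  proof (cases "ball x0 \<sigma> \<inter> ?D = {}")
    case True
    then have "g' x \<zeta> \<mu> = g x \<zeta> \<mu>" if "x \<in> ?D" "norm \<mu> = 1" for x \<zeta> \<mu>
      using eq that by blast
    then have "energy M g' u ?D = energy M g u ?D" for u by (intro energy_cong_rect) auto
    then show ?thesis using True by (simp add: X_cell_eq min_energy_def)
  next
    case False
    let ?K = "osc_const TYPE('n) c * \<sigma> powr (real CARD('n) - 1)"
    obtain B where B: "\<And>g. g \<in> (adm_class c :: ('n, 'm) tension set) \<Longrightarrow> min_energy M g a b \<nu> ?D \<le> ennreal B"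
      using min_energy_finite[OF g c D M \<nu>] by blast
    \<comment> \<open>\<open>enn2real\<close> sends infinity to 0, so monotonicity and additivity
      may be used only after finiteness is known.\<close>
    have fin: "min_energy M g a b \<nu> ?D < top" using B[OF g] by (rule le_less_trans) simp
    have "enn2real (min_energy M g' a b \<nu> ?D) \<le> enn2real (min_energy M g a b \<nu> ?D + ennreal ?K)"
      using fin by (intro enn2real_mono min_energy_modify[OF g' c eq D M \<nu> \<sigma>]) auto
    also have "\<dots> = enn2real (min_energy M g a b \<nu> ?D) + ?K"
      using fin K0 by (subst enn2real_plus) auto
    finally show ?thesis using False
      by (simp add: X_cell_eq distrib_left[symmetric] mult_left_mono)
  qed
qed

lemma X_cell_bounded:
  assumes "0 \<le> c" "finite M" "a \<in> M" "b \<in> M" "norm \<nu> = 1" "l \<le> t"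
  shows "\<exists>B. \<forall>g\<in>(adm_class c :: ('n::{finite,linorder}, 'm::finite) tension set). 0 \<le> X_cell M t l a b \<nu> g \<and> X_cell M t l a b \<nu> g \<le> B"
proof (cases "adm_class c = ({} :: ('n, 'm) tension set)")
  case False
  then obtain g where g: "g \<in> (adm_class c :: ('n, 'm) tension set)" by blast
  obtain B where B: "\<And>g. g \<in> (adm_class c :: ('n, 'm) tension set) \<Longrightarrow> min_energy M g a b \<nu> (rect \<nu> t l) \<le> ennreal B"
    using min_energy_finite[OF g assms(1) open_rect[OF assms(5)] bounded_rect[OF assms(5,6)] assms(2-5)] by blast
  have "enn2real (min_energy M g a b \<nu> (rect \<nu> t l)) \<le> max 0 B" if "g \<in> (adm_class c :: ('n, 'm) tension set)" for g
    by (rule enn2real_leI) (auto intro: order_trans[OF B[OF that]] ennreal_leI)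
  then show ?thesis by (intro exI[of _ "t powr (1 - real CARD('n)) * max 0 B"]) (auto simp: X_cell_eq intro!: mult_left_mono)
qed simp

section \<open>Moments from the multiscale inequality\<close>

lemma powr_diff_le:
  fixes a b p :: real
  assumes "0 \<le> b" "b \<le> a" "1 \<le> p"
  shows "a powr p - b powr p \<le> p * a powr (p - 1) * (a - b)"
proof (cases "b = 0 \<or> a = b")
  case True
  show ?thesis
  proof (cases "a = b")
    case False
    then have "b = 0" "a > 0" using True assms by auto
    then have "a powr p = a powr (p - 1) * a" by (simp add: powr_mult_base powr_diff)
    also have "\<dots> \<le> p * a powr (p - 1) * a" using assms \<open>a > 0\<close> by (simp add: mult_right_mono mult_le_cancel_right1)
    finally show ?thesis using \<open>b = 0\<close> assms by simp
  qed simp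
next
  case False
  then have ab: "0 < b" "b < a" using assms by auto
  have "\<exists>z. b < z \<and> z < a \<and> a powr p - b powr p = (a - b) * (p * z powr (p - 1))"
    using ab by (intro MVT2) (auto intro!: derivative_eq_intros simp: mult.commute)
  then obtain z where z: "b < z" "z < a" "a powr p - b powr p = (a - b) * (p * z powr (p - 1))" by blast
  have "z powr (p - 1) \<le> a powr (p - 1)" using z ab assms by (intro powr_mono2) auto
  then have "(a - b) * (p * z powr (p - 1)) \<le> (a - b) * (p * a powr (p - 1))"
    using ab assms by (intro mult_left_mono) auto
  then show ?thesis using z(3) by (simp add: mult_ac)
qed

text \<open>To be read with \<open>m\<close> the mean of the functional, \<open>Y\<close> the size
  of its deviation from \<open>m\<close> at the given realisation, \<open>x\<close> and
  \<open>y\<close> its values at two tensions that agree with this realisation off a ball, and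
  \<open>K\<close> the oscillation for that ball.\<close>

lemma abs_powr_diff_le:
  fixes x y m K p :: real
  assumes "\<bar>x - m\<bar> \<le> Y + K" "\<bar>x - y\<bar> \<le> K" "\<bar>y - m\<bar> \<le> Y + K" "1 \<le> p" "0 \<le> Y"
  shows "\<bar>x - m\<bar> powr p - \<bar>y - m\<bar> powr p \<le> p * (Y + K) powr (p - 1) * K"
proof (cases "\<bar>y - m\<bar> \<le> \<bar>x - m\<bar>")
  case True
  have K: "0 \<le> K" using assms(2) by linarith
  have "\<bar>x - m\<bar> powr p - \<bar>y - m\<bar> powr p \<le> p * \<bar>x - m\<bar> powr (p - 1) * (\<bar>x - m\<bar> - \<bar>y - m\<bar>)"
    using True assms by (intro powr_diff_le) auto
  also have "\<dots> \<le> p * (Y + K) powr (p - 1) * K"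
    using assms True K by (intro mult_mono powr_mono2) auto
  finally show ?thesis .
next
  case False
  have "\<bar>x - m\<bar> powr p \<le> \<bar>y - m\<bar> powr p" using False assms by (intro powr_mono2) auto
  moreover have "0 \<le> p * (Y + K) powr (p - 1) * K" using assms by (intro mult_nonneg_nonneg) auto
  ultimately show ?thesis by linarith
qed

text \<open>The tension \<open>g\<close> is among the admissible modifications; together with the
  bound on pairs this makes supremum and infimum finite, so that \<open>e2ennreal\<close> acts on an
  ordinary difference.\<close>

lemma oscillation_sq_le:
  assumes g: "g \<in> adm_class c" and K: "0 \<le> K"
    and osc: "\<And>g' g''. g' \<in> adm_class c \<Longrightarrow> g'' \<in> adm_class c \<Longrightarrow>
      (\<And>x \<zeta> \<nu>. x \<notin> U \<Longrightarrow> norm \<nu> = 1 \<Longrightarrow> g' x \<zeta> \<nu> = g x \<zeta> \<nu>) \<Longrightarrow>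
      (\<And>x \<zeta> \<nu>. x \<notin> U \<Longrightarrow> norm \<nu> = 1 \<Longrightarrow> g'' x \<zeta> \<nu> = g x \<zeta> \<nu>) \<Longrightarrow> X g' - X g'' \<le> K"
  shows "(oscillation c X g U)\<^sup>2 \<le> ennreal (K\<^sup>2)"
proof -
  define S where "S = {g' \<in> adm_class c. \<forall>x \<in> - U. \<forall>\<zeta>. \<forall>\<nu> \<in> sphere 0 1. g' x \<zeta> \<nu> = g x \<zeta> \<nu>}"
  have gS: "g \<in> S" using g by (simp add: S_def)
  have XK: "X g' - X g'' \<le> K" if "g' \<in> S" "g'' \<in> S" for g' g''
    using that by (intro osc) (auto simp: S_def)
  have "(SUP g' \<in> S. ereal (X g')) \<le> ereal (X g + K)"
    using XK[OF _ gS] by (intro SUP_least) (auto simp: algebra_simps)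
  moreover have "ereal (X g) \<le> (SUP g' \<in> S. ereal (X g'))" by (rule SUP_upper[OF gS])
  ultimately obtain s where s: "(SUP g' \<in> S. ereal (X g')) = ereal s"
    by (cases "(SUP g' \<in> S. ereal (X g'))") auto
  have "ereal (s - K) \<le> (INF g' \<in> S. ereal (X g'))"
  proof (rule INF_greatest)
    fix g'' assume g'': "g'' \<in> S"
    have "(SUP g' \<in> S. ereal (X g')) \<le> ereal (X g'' + K)"
      using XK[OF _ g''] by (intro SUP_least) (auto simp: algebra_simps)
    then show "ereal (s - K) \<le> ereal (X g'')" using s by simp
  qed
  moreover have "(INF g' \<in> S. ereal (X g')) \<le> ereal (X g)" by (rule INF_lower[OF gS])
  ultimately obtain i where i: "(INF g' \<in> S. ereal (X g')) = ereal i" "s - K \<le> i"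
    by (cases "(INF g' \<in> S. ereal (X g'))") auto
  have "oscillation c X g U = e2ennreal (ereal s - ereal i)"
    unfolding oscillation_def Let_def S_def[symmetric] s i ..
  also have "\<dots> = ennreal (s - i)" by simp
  also have "\<dots> \<le> ennreal K" using i(2) by (intro ennreal_leI) simp
  finally have "(oscillation c X g U)\<^sup>2 \<le> (ennreal K)\<^sup>2" by (rule power_mono) simp
  also have "\<dots> = ennreal (K\<^sup>2)" using K by (simp add: ennreal_power)
  finally show ?thesis .
qed

lemma outer_nn_integral_le:
  assumes "h \<in> borel_measurable M" "\<And>x. x \<in> space M \<Longrightarrow> f x \<le> h x"
  shows "outer_nn_integral M f \<le> (\<integral>\<^sup>+x. h x \<partial>M)"
  unfolding outer_nn_integral_def using assms by (intro INF_lower) auto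

text \<open>An outer integral is at most the integral of any measurable majorant: the indicator of
  \<open>N s\<close> in the centre variable, scaled by the square of \<open>\<kappa>\<close>. The
  volume growth (s + 1)^d cancels the weight of the inequality. \<open>\<kappa>\<close> may depend
  on the realisation, as it does for powers of the fluctuation.\<close>

lemma multiscale_FI_deterministic:
  fixes G :: "'w \<Rightarrow> ('n::finite, 'm::finite) tension" and X :: "('n, 'm) tension \<Rightarrow> real"
  assumes FI: "\<And>X :: ('n, 'm) tension \<Rightarrow> real. (\<lambda>\<omega>. X (G \<omega>)) \<in> borel_measurable P \<Longrightarrow>
        variance_enn P (\<lambda>\<omega>. X (G \<omega>)) \<le> ennreal C * outer_nn_integral P (\<lambda>\<omega>.
           outer_nn_integral lborel (\<lambda>s. indicator {0<..} s *
             outer_nn_integral lborel (\<lambda>x. (oscillation c X (G \<omega>) (ball x (s + 1)))\<^sup>2)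
             * ennreal ((s + 1) powr (- real CARD('n)) * \<pi> s)))"
    and X: "(\<lambda>\<omega>. X (G \<omega>)) \<in> borel_measurable P"
    and G: "\<And>\<omega>. \<omega> \<in> space P \<Longrightarrow> G \<omega> \<in> adm_class c"
    and N: "\<And>s. 0 < s \<Longrightarrow> N s \<in> sets borel"
      "\<And>s. 0 < s \<Longrightarrow> emeasure lborel (N s) \<le> ennreal (V * (s + 1) ^ CARD('n))"
    and V: "0 \<le> V" and \<kappa>: "case_prod \<kappa> \<in> borel_measurable (P \<Otimes>\<^sub>M lborel)" "\<And>\<omega> s. 0 < s \<Longrightarrow> 0 \<le> \<kappa> \<omega> s"
    and osc: "\<And>\<omega> s x g' g''. \<omega> \<in> space P \<Longrightarrow> 0 < s \<Longrightarrow> g' \<in> adm_class c \<Longrightarrow> g'' \<in> adm_class c \<Longrightarrow>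
      (\<And>y \<zeta> \<nu>. y \<notin> ball x (s + 1) \<Longrightarrow> norm \<nu> = 1 \<Longrightarrow> g' y \<zeta> \<nu> = G \<omega> y \<zeta> \<nu>) \<Longrightarrow>
      (\<And>y \<zeta> \<nu>. y \<notin> ball x (s + 1) \<Longrightarrow> norm \<nu> = 1 \<Longrightarrow> g'' y \<zeta> \<nu> = G \<omega> y \<zeta> \<nu>) \<Longrightarrow>
      X g' - X g'' \<le> (if x \<in> N s then \<kappa> \<omega> s else 0)"
    and \<pi>: "set_borel_measurable lborel {0<..} \<pi>" "\<And>s. 0 < s \<Longrightarrow> 0 \<le> \<pi> s" and "sigma_finite_measure P"
  shows "variance_enn P (\<lambda>\<omega>. X (G \<omega>)) \<le>
    ennreal C * (\<integral>\<^sup>+\<omega>. (\<integral>\<^sup>+s\<in>{0<..}. ennreal (V * (\<kappa> \<omega> s)\<^sup>2 * \<pi> s) \<partial>lborel) \<partial>P)"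
proof (rule order_trans[OF FI[OF X]], rule mult_left_mono, rule outer_nn_integral_le)
  interpret sigma_finite_measure P by fact
  note [measurable] = \<kappa>(1)
  have pim: "(\<lambda>s. indicator {0<..} s * \<pi> s) \<in> borel_measurable lborel"
    using \<pi>(1) by (simp add: set_borel_measurable_def)
  have eq: "ennreal (V * (\<kappa> \<omega> s)\<^sup>2 * \<pi> s) * indicator {0<..} s = ennreal (V * (\<kappa> \<omega> s)\<^sup>2 * (indicator {0<..} s * \<pi> s))" for \<omega> s
    by (simp add: indicator_def)
  have joint: "(\<lambda>(\<omega>, s). ennreal (V * (\<kappa> \<omega> s)\<^sup>2 * (indicator {0<..} s * \<pi> s))) \<in> borel_measurable (P \<Otimes>\<^sub>M lborel)"
  proof -
    define \<pi>' where "\<pi>' s = indicator {0<..} s * \<pi> s" for s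
    have [measurable]: "\<pi>' \<in> borel_measurable lborel" using pim by (simp add: \<pi>'_def[abs_def])
    show ?thesis unfolding \<pi>'_def[symmetric] by measurable
  qed
  show "(\<lambda>\<omega>. \<integral>\<^sup>+s\<in>{0<..}. ennreal (V * (\<kappa> \<omega> s)\<^sup>2 * \<pi> s) \<partial>lborel) \<in> borel_measurable P"
    unfolding eq using joint by (rule lborel.borel_measurable_nn_integral)
  fix \<omega> assume \<omega>: "\<omega> \<in> space P"
  show "outer_nn_integral lborel (\<lambda>s. indicator {0<..} s *
             outer_nn_integral lborel (\<lambda>x. (oscillation c X (G \<omega>) (ball x (s + 1)))\<^sup>2)
             * ennreal ((s + 1) powr (- real CARD('n)) * \<pi> s))
      \<le> (\<integral>\<^sup>+s\<in>{0<..}. ennreal (V * (\<kappa> \<omega> s)\<^sup>2 * \<pi> s) \<partial>lborel)"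
  proof (rule outer_nn_integral_le)
    show "(\<lambda>s. ennreal (V * (\<kappa> \<omega> s)\<^sup>2 * \<pi> s) * indicator {0<..} s) \<in> borel_measurable lborel"
      unfolding eq using measurable_compose[OF measurable_Pair1'[OF \<omega>, of lborel] joint] by simp
    fix s :: real
    show "indicator {0<..} s * outer_nn_integral lborel (\<lambda>x. (oscillation c X (G \<omega>) (ball x (s + 1)))\<^sup>2)
             * ennreal ((s + 1) powr (- real CARD('n)) * \<pi> s) \<le> ennreal (V * (\<kappa> \<omega> s)\<^sup>2 * \<pi> s) * indicator {0<..} s"
    proof (cases "0 < s")
      case True
      let ?d = "CARD('n)"
      have pt: "(oscillation c X (G \<omega>) (ball x (s + 1)))\<^sup>2 \<le> ennreal ((\<kappa> \<omega> s)\<^sup>2) * indicator (N s) x" for x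
      proof -
        have "(oscillation c X (G \<omega>) (ball x (s + 1)))\<^sup>2 \<le> ennreal ((if x \<in> N s then \<kappa> \<omega> s else 0)\<^sup>2)"
          using \<kappa>(2)[OF True] by (intro oscillation_sq_le[OF G[OF \<omega>]] osc[OF \<omega> True]) auto
        then show ?thesis by (auto simp: indicator_def)
      qed
      have "outer_nn_integral lborel (\<lambda>x. (oscillation c X (G \<omega>) (ball x (s + 1)))\<^sup>2)
        \<le> (\<integral>\<^sup>+x. ennreal ((\<kappa> \<omega> s)\<^sup>2) * indicator (N s) x \<partial>lborel)"
        using N(1)[OF True] pt by (intro outer_nn_integral_le) auto
      also have "\<dots> = ennreal ((\<kappa> \<omega> s)\<^sup>2) * emeasure lborel (N s)" using N(1)[OF True] by (simp add: nn_integral_cmult_indicator)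
      also have "\<dots> \<le> ennreal ((\<kappa> \<omega> s)\<^sup>2) * ennreal (V * (s + 1) ^ ?d)" by (intro mult_left_mono N(2) True) simp
      finally have "outer_nn_integral lborel (\<lambda>x. (oscillation c X (G \<omega>) (ball x (s + 1)))\<^sup>2) * ennreal ((s + 1) powr (- real ?d) * \<pi> s)
        \<le> ennreal ((\<kappa> \<omega> s)\<^sup>2) * ennreal (V * (s + 1) ^ ?d) * ennreal ((s + 1) powr (- real ?d) * \<pi> s)"
        by (rule mult_right_mono) simp
      also have "\<dots> = ennreal ((\<kappa> \<omega> s)\<^sup>2 * (V * (s + 1) ^ ?d) * ((s + 1) powr (- real ?d) * \<pi> s))"
        using V \<pi>(2)[OF True] True by (simp add: ennreal_mult)
      also have "(\<kappa> \<omega> s)\<^sup>2 * (V * (s + 1) ^ ?d) * ((s + 1) powr (- real ?d) * \<pi> s) = V * (\<kappa> \<omega> s)\<^sup>2 * \<pi> s"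
        using True by (simp add: powr_minus powr_realpow field_simps)
      finally show ?thesis using True by simp
    qed simp
  qed
qed simp

text \<open>Split at \<open>Y = p * K\<close>: above it \<open>(1 + 1 / p) powr (2 * p - 2)\<close>
  is at most \<open>exp 2\<close> for every \<open>p\<close>, below it \<open>Y + K\<close> is at
  most \<open>(p + 1) * K\<close>. This separates the random quantity \<open>Y\<close> from a purely
  deterministic remainder.\<close>

lemma powr_sum_split:
  fixes Y K p :: real
  assumes "0 \<le> Y" "0 \<le> K" "1 \<le> p"
  shows "((Y + K) powr (p - 1))\<^sup>2 * K\<^sup>2 \<le> exp 2 * Y powr (2 * p - 2) * K\<^sup>2 + (p + 1) powr (2 * p - 2) * K powr (2 * p)"
proof (cases "K = 0")
  case False
  then have K: "0 < K" using assms by simp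
  have sq: "((Y + K) powr (p - 1))\<^sup>2 = (Y + K) powr (2 * p - 2)"
    using assms K by (simp add: powr_power algebra_simps)
  have Kp: "K powr (2 * p) = K powr (2 * p - 2) * K\<^sup>2"
    using K by (simp add: powr_diff powr_numeral)
  show ?thesis
  proof (cases "p * K \<le> Y")
    case True
    then have Y: "0 < Y" using K assms by (meson less_le_trans mult_pos_pos zero_less_one)
    have "Y + K \<le> Y * (1 + 1 / p)" using True assms by (simp add: field_simps)
    also have "\<dots> \<le> Y * exp (1 / p)" using Y by (intro mult_left_mono exp_ge_add_one_self) auto
    finally have "(Y + K) powr (2 * p - 2) \<le> (Y * exp (1 / p)) powr (2 * p - 2)"
      using assms by (intro powr_mono2) auto
    also have "\<dots> = Y powr (2 * p - 2) * exp ((1 / p) * (2 * p - 2))" using Y by (simp add: powr_mult exp_powr_real)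
    also have "\<dots> \<le> Y powr (2 * p - 2) * exp 2"
      using assms by (intro mult_left_mono) (auto simp: field_simps)
    finally have "(Y + K) powr (2 * p - 2) * K\<^sup>2 \<le> Y powr (2 * p - 2) * exp 2 * K\<^sup>2" by (rule mult_right_mono) simp
    moreover have "0 \<le> (p + 1) powr (2 * p - 2) * K powr (2 * p)" by simp
    ultimately show ?thesis unfolding sq by (simp add: mult_ac add_increasing2)
  next
    case False
    then have "Y + K \<le> (p + 1) * K" by (simp add: algebra_simps)
    then have "(Y + K) powr (2 * p - 2) \<le> ((p + 1) * K) powr (2 * p - 2)"
      using assms by (intro powr_mono2) auto
    also have "\<dots> = (p + 1) powr (2 * p - 2) * K powr (2 * p - 2)" using assms by (simp add: powr_mult)
    finally have "(Y + K) powr (2 * p - 2) * K\<^sup>2 \<le> (p + 1) powr (2 * p - 2) * K powr (2 * p - 2) * K\<^sup>2" by (rule mult_right_mono) simp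
    moreover have "0 \<le> exp 2 * Y powr (2 * p - 2) * K\<^sup>2" by simp
    ultimately show ?thesis unfolding sq Kp by (simp add: mult_ac add_increasing)
  qed
qed (use assms in simp)

text \<open>Split at \<open>4 * q = y\<^sup>2\<close>: a form of Young's inequality in which the
  coefficient of the highest power is prescribed as 1/4.\<close>

lemma powr_absorb:
  fixes y q p :: real
  assumes "0 \<le> y" "0 \<le> q" "1 \<le> p"
  shows "q * y powr (2 * p - 2) \<le> y powr (2 * p) / 4 + (4 * q) powr p / 4"
proof (cases "4 * q \<le> y\<^sup>2")
  case True
  have "q * y powr (2 * p - 2) \<le> y\<^sup>2 / 4 * y powr (2 * p - 2)" using True by (intro mult_right_mono) auto
  also have "\<dots> = y powr (2 * p) / 4"
    using assms by (cases "y = 0") (auto simp: powr_diff powr_numeral)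
  finally show ?thesis by (simp add: add_increasing2)
next
  case False
  then have q: "0 < q" using assms by (smt (verit) zero_le_power2)
  have "y powr (2 * p - 2) \<le> (4 * q) powr (p - 1)"
  proof (cases "y = 0")
    case False
    then have "y powr (2 * p - 2) = (y powr 2) powr (p - 1)" by (simp add: powr_powr algebra_simps)
    also have "\<dots> \<le> (4 * q) powr (p - 1)" using \<open>\<not> 4 * q \<le> y\<^sup>2\<close> assms False by (intro powr_mono2) (auto simp: powr_numeral)
    finally show ?thesis .
  qed simp
  then have "q * y powr (2 * p - 2) \<le> q * (4 * q) powr (p - 1)" using q by (intro mult_left_mono) auto
  also have "\<dots> = (4 * q) powr p / 4" using q by (simp add: powr_diff)
  finally show ?thesis by (simp add: add_increasing)
qed

section \<open>Closing the moment inequality\<close>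

lemma (in prob_space) bounded_integrable:
  fixes f :: "'a \<Rightarrow> real"
  assumes "f \<in> borel_measurable M" "\<And>\<omega>. \<omega> \<in> space M \<Longrightarrow> \<bar>f \<omega>\<bar> \<le> B"
  shows "integrable M f"
  using assms by (intro integrable_const_bound[of _ B]) (auto intro: AE_I2)

text \<open>The moment x of order 2 p is the variance of \<open>\<bar>Y\<bar> powr p\<close> plus
  the square of its mean. The variance returns x / 4 through \<open>powr_absorb\<close>; the squared
  mean, interpolated between the moments of order 2 and 2 p, returns another x / 4. Half of x is
  thus absorbed, and the remaining terms are doubled.\<close>

lemma (in prob_space) moment_bound:
  fixes Y :: "'a \<Rightarrow> real"
  assumes Y[measurable]: "Y \<in> borel_measurable M" and B: "\<And>\<omega>. \<omega> \<in> space M \<Longrightarrow> \<bar>Y \<omega>\<bar> \<le> B"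
    and p: "1 \<le> p" and q: "0 \<le> q" and v: "0 \<le> v" and Z: "0 \<le> Z"
    and var2: "expectation (\<lambda>\<omega>. (Y \<omega>)\<^sup>2) \<le> v"
    and varp: "expectation (\<lambda>\<omega>. \<bar>Y \<omega>\<bar> powr (2 * p)) - (expectation (\<lambda>\<omega>. \<bar>Y \<omega>\<bar> powr p))\<^sup>2
      \<le> q * expectation (\<lambda>\<omega>. \<bar>Y \<omega>\<bar> powr (2 * p - 2)) + Z"
  shows "expectation (\<lambda>\<omega>. \<bar>Y \<omega>\<bar> powr (2 * p)) \<le> (4 * q) powr p / 2 + 2 * Z + 4 * (8 * v) powr p"
proof -
  have ip: "integrable M (\<lambda>\<omega>. \<bar>Y \<omega>\<bar> powr a)" if "0 \<le> a" for a
  proof (rule bounded_integrable)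
    show "\<bar>\<bar>Y \<omega>\<bar> powr a\<bar> \<le> B powr a" if "\<omega> \<in> space M" for \<omega>
      using B[OF that] \<open>0 \<le> a\<close> by (simp add: powr_mono2)
  qed measurable
  have i2: "integrable M (\<lambda>\<omega>. (Y \<omega>)\<^sup>2)"
  proof (rule bounded_integrable)
    show "\<bar>(Y \<omega>)\<^sup>2\<bar> \<le> B\<^sup>2" if "\<omega> \<in> space M" for \<omega>
      using power_mono[OF B[OF that] abs_ge_zero, of 2] by simp
  qed measurable
  define x where "x = expectation (\<lambda>\<omega>. \<bar>Y \<omega>\<bar> powr (2 * p))"
  have x0: "0 \<le> x" by (simp add: x_def)
  show ?thesis
  proof (cases "x = 0")
    case True
    then show ?thesis using Z by (simp add: x_def)
  next
    case False
    then have x: "0 < x" using x0 by simp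
    \<comment> \<open>For \<open>v = 0\<close> the variable \<open>Y\<close> vanishes almost surely,
      against \<open>0 < x\<close>; so the threshold \<open>lam\<close> below is positive.\<close>
    have vpos: "0 < v"
    proof (rule ccontr)
      assume "\<not> 0 < v"
      then have "expectation (\<lambda>\<omega>. (Y \<omega>)\<^sup>2) = 0" using v var2 by (intro antisym) auto
      then have "AE \<omega> in M. (Y \<omega>)\<^sup>2 = 0" using i2 by (subst (asm) integral_nonneg_eq_0_iff_AE) auto
      then have "x = expectation (\<lambda>\<omega>. 0)" unfolding x_def
        by (intro integral_cong_AE) (auto elim!: eventually_mono)
      then show False using x by simp
    qed
    \<comment> \<open>With this threshold and \<open>\<alpha> = 1 / sqrt (8 * x)\<close> both error
      terms equal \<open>\<alpha> * x\<close>, since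
      \<open>v / (lam\<^sup>2 * \<alpha>) = \<alpha> * x\<close>, and
      \<open>(\<alpha> * x)\<^sup>2 = x / 8\<close> is small enough to be absorbed.\<close>
    define lam where "lam = sqrt (8 * v)"
    have lam: "0 < lam" "lam\<^sup>2 = 8 * v" using vpos by (auto simp: lam_def)
    define \<alpha> where "\<alpha> = 1 / sqrt (8 * x)"
    have \<alpha>: "0 < \<alpha>" using x by (simp add: \<alpha>_def)
    have pt: "\<bar>y\<bar> powr p \<le> lam powr p + (\<alpha> * \<bar>y\<bar> powr (2 * p) + y\<^sup>2 / (lam\<^sup>2 * \<alpha>)) / 2" for y
    proof (cases "\<bar>y\<bar> \<le> lam")
      case True
      then have "\<bar>y\<bar> powr p \<le> lam powr p" using p by (intro powr_mono2) auto
      moreover have "0 \<le> (\<alpha> * \<bar>y\<bar> powr (2 * p) + y\<^sup>2 / (lam\<^sup>2 * \<alpha>)) / 2" using \<alpha> by simp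
      ultimately show ?thesis by linarith
    next
      case False
      \<comment> \<open>Above the threshold one more factor \<open>\<bar>y\<bar> / lam\<close> may
        be inserted; the product is split by the arithmetic-geometric mean inequality with weight
        \<open>\<alpha>\<close>.\<close>
      define a where "a = sqrt \<alpha> * \<bar>y\<bar> powr p"
      define b where "b = \<bar>y\<bar> / (lam * sqrt \<alpha>)"
      have "1 \<le> \<bar>y\<bar> / lam" using False lam by (simp add: field_simps)
      then have "\<bar>y\<bar> powr p \<le> \<bar>y\<bar> powr p * (\<bar>y\<bar> / lam)" using mult_left_mono[of 1 "\<bar>y\<bar> / lam" "\<bar>y\<bar> powr p"] by simp
      also have "\<dots> = a * b" using \<alpha> by (simp add: a_def b_def)
      also have "\<dots> \<le> (a\<^sup>2 + b\<^sup>2) / 2" using sum_squares_bound[of a b] by simp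
      also have "a\<^sup>2 = \<alpha> * \<bar>y\<bar> powr (2 * p)" using \<alpha> powr_add[of "\<bar>y\<bar>" p p]
        by (simp add: a_def power_mult_distrib power2_eq_square[of "\<bar>y\<bar> powr p"])
      also have "b\<^sup>2 = y\<^sup>2 / (lam\<^sup>2 * \<alpha>)" using \<alpha> by (simp add: b_def power_mult_distrib power_divide)
      finally show ?thesis by (simp add: add_increasing)
    qed
    define e where "e = expectation (\<lambda>\<omega>. \<bar>Y \<omega>\<bar> powr p)"
    have e0: "0 \<le> e" by (simp add: e_def)
    have "e \<le> expectation (\<lambda>\<omega>. lam powr p + (\<alpha> * \<bar>Y \<omega>\<bar> powr (2 * p) + (Y \<omega>)\<^sup>2 / (lam\<^sup>2 * \<alpha>)) / 2)"
      unfolding e_def using p ip i2 pt by (intro integral_mono) auto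
    also have "\<dots> = lam powr p + (\<alpha> * x + expectation (\<lambda>\<omega>. (Y \<omega>)\<^sup>2) / (lam\<^sup>2 * \<alpha>)) / 2"
      using ip[of "2 * p"] i2 p by (simp add: x_def prob_space)
    also have "\<dots> \<le> lam powr p + (\<alpha> * x + v / (lam\<^sup>2 * \<alpha>)) / 2"
      using var2 \<alpha> by (intro add_left_mono divide_right_mono) auto
    also have "v / (lam\<^sup>2 * \<alpha>) = \<alpha> * x" using vpos x by (simp add: lam(2) \<alpha>_def field_simps)
    also have "(\<alpha> * x + \<alpha> * x) / 2 = \<alpha> * x" by simp
    finally have e: "e \<le> lam powr p + \<alpha> * x" .
    have "e\<^sup>2 \<le> (lam powr p + \<alpha> * x)\<^sup>2" using e e0 by (rule power_mono)
    also have "\<dots> \<le> 2 * (lam powr p)\<^sup>2 + 2 * (\<alpha> * x)\<^sup>2"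
      using sum_squares_bound[of "lam powr p" "\<alpha> * x"] by (simp add: power2_sum)
    also have "(lam powr p)\<^sup>2 = (8 * v) powr p"
    proof -
      have "(8 * v) powr p = (lam powr 2) powr p" unfolding lam(2)[symmetric] using lam by (simp add: powr_numeral)
      also have "\<dots> = lam powr (p + p)" by (simp add: powr_powr)
      also have "\<dots> = (lam powr p)\<^sup>2" using powr_add[of lam p p] by (simp add: power2_eq_square)
      finally show ?thesis ..
    qed
    also have "(\<alpha> * x)\<^sup>2 = x / 8" using x by (simp add: \<alpha>_def power2_eq_square field_simps)
    finally have e2: "e\<^sup>2 \<le> 2 * (8 * v) powr p + x / 4" by simp
    have "q * expectation (\<lambda>\<omega>. \<bar>Y \<omega>\<bar> powr (2 * p - 2)) = expectation (\<lambda>\<omega>. q * \<bar>Y \<omega>\<bar> powr (2 * p - 2))" by simp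
    also have "\<dots> \<le> expectation (\<lambda>\<omega>. \<bar>Y \<omega>\<bar> powr (2 * p) / 4 + (4 * q) powr p / 4)"
      using p q ip by (intro integral_mono powr_absorb integrable_mult_right Bochner_Integration.integrable_add integrable_divide) auto
    also have "\<dots> = x / 4 + (4 * q) powr p / 4" using ip[of "2 * p"] p by (simp add: x_def prob_space)
    finally have "x \<le> (x / 4 + (4 * q) powr p / 4) + Z + (2 * (8 * v) powr p + x / 4)"
      using varp e2 unfolding x_def[symmetric] e_def[symmetric] by linarith
    then show ?thesis unfolding x_def[symmetric] by linarith
  qed
qed

text \<open>Jensen's inequality up to a constant, from \<open>w \<le> \<lambda> + w powr p * \<lambda> powr (1 - p)\<close>.\<close>

lemma nn_integral_weight_powr:
  fixes \<pi> w :: "real \<Rightarrow> real"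
  assumes \<pi>: "(\<lambda>s. indicator S s * \<pi> s) \<in> borel_measurable lborel" "\<And>s. s \<in> S \<Longrightarrow> 0 \<le> \<pi> s"
    and w[measurable]: "w \<in> borel_measurable borel" "\<And>s. s \<in> S \<Longrightarrow> 1 \<le> w s" and p: "1 \<le> p"
    and fin: "(\<integral>\<^sup>+s\<in>S. ennreal (w s powr p * \<pi> s) \<partial>lborel) < top"
  shows "(enn2real (\<integral>\<^sup>+s\<in>S. ennreal (w s * \<pi> s) \<partial>lborel)) powr p
    \<le> 2 * (2 * max 1 (enn2real (\<integral>\<^sup>+s\<in>S. ennreal (\<pi> s) \<partial>lborel))) powr p * enn2real (\<integral>\<^sup>+s\<in>S. ennreal (w s powr p * \<pi> s) \<partial>lborel)"
    and "(\<integral>\<^sup>+s\<in>S. ennreal (w s * \<pi> s) \<partial>lborel) < top"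
proof -
  define \<pi>' where "\<pi>' s = indicator S s * \<pi> s" for s
  have [measurable]: "\<pi>' \<in> borel_measurable borel" using \<pi>(1) by (simp add: \<pi>'_def[abs_def])
  have \<pi>'0: "0 \<le> \<pi>' s" for s using \<pi>(2) by (simp add: \<pi>'_def indicator_def)
  define I where "I f = (\<integral>\<^sup>+s. ennreal (f s * \<pi>' s) \<partial>lborel)" for f
  have I: "(\<integral>\<^sup>+s\<in>S. ennreal (f s * \<pi> s) \<partial>lborel) = I f" for f
    unfolding I_def by (intro nn_integral_cong) (auto simp: \<pi>'_def indicator_def)
  have I1: "(\<integral>\<^sup>+s\<in>S. ennreal (\<pi> s) \<partial>lborel) = I (\<lambda>_. 1)" using I[of "\<lambda>_. 1"] by simp
  have wle: "w s \<le> w s powr p" if "s \<in> S" for s using powr_mono[of 1 p "w s"] w(2)[OF that] p by simp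
  have mono: "I f \<le> I g" if "\<And>s. s \<in> S \<Longrightarrow> f s \<le> g s" for f g
    unfolding I_def using that \<pi>(2) by (intro nn_integral_mono ennreal_leI) (auto simp: \<pi>'_def indicator_def mult_right_mono)
  have finp: "I (\<lambda>s. w s powr p) < top" using fin I[of "\<lambda>s. w s powr p"] by simp
  have fin1: "I w < top" using mono[of w "\<lambda>s. w s powr p"] wle finp by (meson le_less_trans)
  have fin0: "I (\<lambda>_. 1) < top" using mono[of "\<lambda>_. 1" w] w(2) fin1 by (meson le_less_trans)
  show "(\<integral>\<^sup>+s\<in>S. ennreal (w s * \<pi> s) \<partial>lborel) < top" using fin1 I by simp
  define A where "A = enn2real (I w)"
  define Bp where "Bp = enn2real (I (\<lambda>s. w s powr p))"
  define m0 where "m0 = max 1 (enn2real (I (\<lambda>_. 1)))"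
  have e: "I w = ennreal A" "I (\<lambda>s. w s powr p) = ennreal Bp" "I (\<lambda>_. 1) \<le> ennreal m0" "0 \<le> A" "0 \<le> Bp" "1 \<le> m0"
    using fin1 finp fin0 by (auto simp: A_def Bp_def m0_def intro: order_trans[OF eq_refl[OF ennreal_enn2real[symmetric]] ennreal_leI])
  have "A powr p \<le> 2 * (2 * m0) powr p * Bp"
  proof (cases "A = 0")
    case False
    then have A: "0 < A" using e by simp
    \<comment> \<open>At this level the constant part \<open>lam * m0\<close> is
      \<open>A / 2\<close> and is absorbed by the left-hand side.\<close>
    define lam where "lam = A / (2 * m0)"
    have lam: "0 < lam" using A e by (simp add: lam_def)
    have wl: "w s \<le> lam + w s powr p * lam powr (1 - p)" if "s \<in> S" for s
    proof (cases "w s \<le> lam")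
      case False
      have ws: "0 < w s" using w(2)[OF that] by simp
      have "1 \<le> (w s / lam) powr (p - 1)" using False lam p by (intro ge_one_powr_ge_zero) auto
      then have "w s * 1 \<le> w s * (w s / lam) powr (p - 1)" using ws by (intro mult_left_mono) auto
      also have "\<dots> = w s powr p * lam powr (1 - p)" using ws lam by (simp add: powr_divide powr_diff field_simps)
      finally show ?thesis using lam by simp
    qed (simp add: add_increasing2)
    have "I w \<le> I (\<lambda>s. lam + w s powr p * lam powr (1 - p))" by (rule mono[OF wl])
    also have "\<dots> = (\<integral>\<^sup>+s. ennreal lam * ennreal (1 * \<pi>' s) + ennreal (lam powr (1 - p)) * ennreal (w s powr p * \<pi>' s) \<partial>lborel)"
      unfolding I_def using \<pi>'0 lam
      by (intro nn_integral_cong) (simp add: ennreal_mult[symmetric] ennreal_plus[symmetric] algebra_simps del: ennreal_plus)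
    also have "\<dots> = ennreal lam * I (\<lambda>_. 1) + ennreal (lam powr (1 - p)) * I (\<lambda>s. w s powr p)"
      unfolding I_def by (subst nn_integral_add) (auto simp: nn_integral_cmult)
    also have "\<dots> \<le> ennreal lam * ennreal m0 + ennreal (lam powr (1 - p)) * ennreal Bp"
      using e by (intro add_mono mult_left_mono) auto
    also have "\<dots> = ennreal (lam * m0 + lam powr (1 - p) * Bp)" using lam e by (simp add: ennreal_mult ennreal_plus)
    finally have "ennreal A \<le> ennreal (lam * m0 + lam powr (1 - p) * Bp)" using e(1) by simp
    then have "A \<le> lam * m0 + lam powr (1 - p) * Bp" by (rule ennreal_le_iff[THEN iffD1, rotated]) (use e lam in simp)
    moreover have "lam * m0 = A / 2" using e by (simp add: lam_def)
    ultimately have "A \<le> 2 * (lam powr (1 - p) * Bp)" by linarith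
    then have "A * lam powr (p - 1) \<le> 2 * (lam powr (1 - p) * Bp) * lam powr (p - 1)" by (rule mult_right_mono) simp
    also have "\<dots> = 2 * Bp" using lam by (simp add: powr_diff field_simps)
    finally have *: "A * lam powr (p - 1) \<le> 2 * Bp" .
    have "A powr p = A * lam powr (p - 1) * (2 * m0) powr (p - 1)"
      using A e by (simp add: lam_def powr_divide powr_diff field_simps)
    also have "\<dots> \<le> 2 * Bp * (2 * m0) powr p" by (rule mult_mono[OF * powr_mono]) (use e p in auto)
    finally show ?thesis by (simp add: mult_ac)
  qed (use e in simp)
  then show "(enn2real (\<integral>\<^sup>+s\<in>S. ennreal (w s * \<pi> s) \<partial>lborel)) powr p
    \<le> 2 * (2 * max 1 (enn2real (\<integral>\<^sup>+s\<in>S. ennreal (\<pi> s) \<partial>lborel))) powr p * enn2real (\<integral>\<^sup>+s\<in>S. ennreal (w s powr p * \<pi> s) \<partial>lborel)"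
    unfolding I I1 A_def Bp_def m0_def .
qed

text \<open>Here \<open>384 = 3 * 128\<close>: three terms are each bounded by the same p-th power
  with factor 128, and their number 3 is put under the power as well.\<close>

definition moment_const :: "real \<Rightarrow> real \<Rightarrow> real" where
  "moment_const C m0 = 384 * exp 2 * max 1 C * max 1 m0"

text \<open>Because \<open>p \<ge> 1\<close>, every factor \<open>b \<ge> 1\<close> is at most
  \<open>b powr p\<close> and can be moved under the power. The growth in \<open>p\<close> is that
  of \<open>(p + 1) powr (2 * p)\<close>, at most \<open>(4 * p\<^sup>2) powr p\<close>.\<close>

lemma moment_const_bound:
  fixes C k V p A Bp m0 :: real
  assumes C: "0 < C" and k: "0 < k" and V: "1 \<le> V" and p: "1 \<le> p" and A: "0 \<le> A" and Bp: "0 \<le> Bp"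
    and AB: "A powr p \<le> 2 * (2 * max 1 m0) powr p * Bp"
  defines "q \<equiv> C * (V * p\<^sup>2 * exp 2 * k\<^sup>2 * A)" and "v \<equiv> C * (V * k\<^sup>2 * A)"
    and "Z \<equiv> C * (V * p\<^sup>2 * (p + 1) powr (2 * p - 2) * k powr (2 * p) * Bp)"
  shows "(4 * q) powr p / 2 + 2 * Z + 4 * (8 * v) powr p \<le> (moment_const C m0 * p\<^sup>2 * (V * k\<^sup>2)) powr p * Bp"
proof -
  define C' where "C' = max 1 C"
  define m where "m = max 1 m0"
  define \<theta> where "\<theta> = V * k\<^sup>2"
  have pos: "1 \<le> C'" "C \<le> C'" "1 \<le> m" "0 < \<theta>" "1 \<le> exp (2::real)" "1 \<le> p\<^sup>2" "0 < p"
    using k V p by (auto simp: C'_def m_def \<theta>_def one_le_power)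
  define Q where "Q = 128 * exp 2 * C' * m * p\<^sup>2 * \<theta>"
  have Q: "0 < Q" using pos by (simp add: Q_def)
  have gen: "a powr p * Bp \<le> Q powr p * Bp" if "0 \<le> a" "a \<le> Q" for a
    using that p Bp by (intro mult_right_mono powr_mono2) auto
  have two: "b \<le> b powr p" if "1 \<le> b" for b using powr_mono[of 1 p b] that p by simp
  have prodle: "x * y \<le> x' * y'" if "x \<le> x'" "y \<le> y'" "0 \<le> x" "0 \<le> y" for x y x' y' :: real
    using that by (intro mult_mono) auto
  have 1: "(4 * q) powr p / 2 \<le> Q powr p * Bp"
  proof -
    have "(4 * q) powr p / 2 = (4 * C * exp 2 * p\<^sup>2 * \<theta>) powr p * A powr p / 2"
      using pos C A by (subst powr_mult[symmetric]) (auto simp: q_def \<theta>_def mult_ac)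
    also have "\<dots> \<le> (4 * C * exp 2 * p\<^sup>2 * \<theta>) powr p * (2 * (2 * m) powr p * Bp) / 2"
      using AB by (intro divide_right_mono mult_left_mono) (auto simp: m_def)
    also have "\<dots> = (4 * C * exp 2 * p\<^sup>2 * \<theta> * (2 * m)) powr p * Bp"
      using pos C by (subst powr_mult[of _ "2 * m"]) auto
    also have "\<dots> \<le> Q powr p * Bp"
    proof (rule gen)
      have "8 * exp 2 * p\<^sup>2 * \<theta> * m * C \<le> 128 * exp 2 * p\<^sup>2 * \<theta> * m * C'"
        using pos C by (intro prodle mult_nonneg_nonneg) auto
      then show "4 * C * exp 2 * p\<^sup>2 * \<theta> * (2 * m) \<le> Q" by (simp add: Q_def mult_ac)
    qed (use pos C in simp)
    finally show ?thesis .
  qed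
  have 2: "4 * (8 * v) powr p \<le> Q powr p * Bp"
  proof -
    have "4 * (8 * v) powr p = 4 * ((8 * C * \<theta>) powr p * A powr p)"
      using pos C A by (subst powr_mult[symmetric]) (auto simp: v_def \<theta>_def mult_ac)
    also have "\<dots> \<le> 4 * ((8 * C * \<theta>) powr p * (2 * (2 * m) powr p * Bp))"
      using AB by (intro mult_left_mono) (auto simp: m_def)
    also have "\<dots> = 8 * ((16 * C * \<theta> * m) powr p * Bp)"
      using pos C powr_mult[of "8 * C * \<theta>" "2 * m" p] by (simp add: mult_ac)
    also have "\<dots> \<le> 8 powr p * ((16 * C * \<theta> * m) powr p * Bp)" using two[of 8] Bp by (intro mult_right_mono) auto
    also have "\<dots> = (8 * (16 * C * \<theta> * m)) powr p * Bp" using pos C by (subst powr_mult[of 8]) auto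
    also have "\<dots> \<le> Q powr p * Bp"
    proof (rule gen)
      have e: "1 \<le> exp 2 * p\<^sup>2" using pos mult_mono[of 1 "exp 2" 1 "p\<^sup>2"] by simp
      have "128 * C * \<theta> * m * 1 \<le> 128 * C' * \<theta> * m * (exp 2 * p\<^sup>2)"
        using pos C e by (intro prodle mult_nonneg_nonneg) auto
      then show "8 * (16 * C * \<theta> * m) \<le> Q" by (simp add: Q_def mult_ac)
    qed (use pos C in simp)
    finally show ?thesis .
  qed
  have 3: "2 * Z \<le> Q powr p * Bp"
  proof -
    have k2: "k powr (2 * p) = (k\<^sup>2) powr p" using k by (simp add: powr_powr[symmetric] powr_numeral)
    have "p\<^sup>2 * (p + 1) powr (2 * p - 2) \<le> (p + 1) powr 2 * (p + 1) powr (2 * p - 2)"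
      using p by (intro mult_right_mono) (auto simp: powr_numeral power_mono)
    also have "\<dots> = (p + 1) powr (2 * p)" by (simp add: powr_add[symmetric])
    also have "\<dots> \<le> (2 * p) powr (2 * p)" using p by (intro powr_mono2) auto
    also have "\<dots> = (4 * p\<^sup>2) powr p" using p by (simp add: powr_powr[symmetric] powr_numeral power_mult_distrib)
    finally have p1: "p\<^sup>2 * (p + 1) powr (2 * p - 2) \<le> (4 * p\<^sup>2) powr p" .
    have "2 * Z = 2 * C * V * (p\<^sup>2 * (p + 1) powr (2 * p - 2)) * (k\<^sup>2) powr p * Bp"
      unfolding Z_def k2 by (simp add: mult_ac)
    also have "\<dots> \<le> 2 powr p * C' powr p * V powr p * (4 * p\<^sup>2) powr p * (k\<^sup>2) powr p * Bp"
      using C V Bp p1 two[of 2] order_trans[OF pos(2) two[OF pos(1)]] two[OF V] p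
      by (intro mult_right_mono[of _ _ "Bp"] mult_right_mono[of _ _ "(k\<^sup>2) powr p"] prodle mult_nonneg_nonneg) auto
    also have "\<dots> = (2 * C' * V * (4 * p\<^sup>2) * k\<^sup>2) powr p * Bp"
      using pos V powr_mult[of 2 4 p] by (simp add: powr_mult)
    also have "\<dots> \<le> Q powr p * Bp"
    proof (rule gen)
      have "8 * C' * p\<^sup>2 * \<theta> * 1 * 1 \<le> 128 * C' * p\<^sup>2 * \<theta> * exp 2 * m"
        using pos by (intro prodle mult_nonneg_nonneg) auto
      then show "2 * C' * V * (4 * p\<^sup>2) * k\<^sup>2 \<le> Q" by (simp add: Q_def \<theta>_def mult_ac)
    qed (use pos V in simp)
    finally show ?thesis .
  qed
  have "(4 * q) powr p / 2 + 2 * Z + 4 * (8 * v) powr p \<le> 3 * (Q powr p * Bp)" using 1 2 3 by linarith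
  also have "\<dots> \<le> 3 powr p * (Q powr p * Bp)" using two[of 3] Bp by (intro mult_right_mono) auto
  also have "\<dots> = (3 * Q) powr p * Bp" using Q by (simp add: powr_mult)
  also have "3 * Q = moment_const C m0 * p\<^sup>2 * (V * k\<^sup>2)" by (simp add: Q_def moment_const_def C'_def m_def \<theta>_def mult_ac)
  finally show ?thesis .
qed

text \<open>The inequality is used twice, for \<open>X\<close> with a deterministic majorant and for
  the centred p-th power with a majorant that depends on the realisation. The bound \<open>B\<close>
  provides integrability and does not enter the constants.\<close>

lemma multiscale_moments:
  fixes G :: "'w \<Rightarrow> ('n::finite, 'm::finite) tension" and X :: "('n, 'm) tension \<Rightarrow> real"
  assumes P: "prob_space P" and C: "0 < C"
    and FI: "\<And>X :: ('n, 'm) tension \<Rightarrow> real. (\<lambda>\<omega>. X (G \<omega>)) \<in> borel_measurable P \<Longrightarrow>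
        variance_enn P (\<lambda>\<omega>. X (G \<omega>)) \<le> ennreal C * outer_nn_integral P (\<lambda>\<omega>.
           outer_nn_integral lborel (\<lambda>s. indicator {0<..} s *
             outer_nn_integral lborel (\<lambda>x. (oscillation c X (G \<omega>) (ball x (s + 1)))\<^sup>2)
             * ennreal ((s + 1) powr (- real CARD('n)) * \<pi> s)))"
    and X[measurable]: "(\<lambda>\<omega>. X (G \<omega>)) \<in> borel_measurable P"
    and G: "\<And>\<omega>. \<omega> \<in> space P \<Longrightarrow> G \<omega> \<in> adm_class c"
    and XB: "\<And>g. g \<in> adm_class c \<Longrightarrow> \<bar>X g\<bar> \<le> B"
    and N: "\<And>s. 0 < s \<Longrightarrow> N s \<in> sets borel"
      "\<And>s. 0 < s \<Longrightarrow> emeasure lborel (N s) \<le> ennreal (V * (s + 1) ^ CARD('n))"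
    and V: "1 \<le> V" and k: "0 < k"
    and osc: "\<And>g g' s x. 0 < s \<Longrightarrow> g \<in> adm_class c \<Longrightarrow> g' \<in> adm_class c \<Longrightarrow>
      (\<And>y \<zeta> \<nu>. y \<notin> ball x (s + 1) \<Longrightarrow> norm \<nu> = 1 \<Longrightarrow> g' y \<zeta> \<nu> = g y \<zeta> \<nu>) \<Longrightarrow>
      X g' - X g \<le> (if x \<in> N s then k * (s + 1) powr e else 0)"
    and e: "0 \<le> e"
    and \<pi>: "set_borel_measurable lborel {0<..} \<pi>" "\<And>s. 0 < s \<Longrightarrow> 0 \<le> \<pi> s"
  shows "variance_enn P (\<lambda>\<omega>. X (G \<omega>)) \<le> ennreal (C * (V * k\<^sup>2)) * (\<integral>\<^sup>+s\<in>{0<..}. ennreal ((s + 1) powr (2 * e) * \<pi> s) \<partial>lborel)"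
    and "1 \<le> p \<Longrightarrow> (\<integral>\<^sup>+\<omega>. ennreal (\<bar>X (G \<omega>) - (\<integral>\<omega>'. X (G \<omega>') \<partial>P)\<bar> powr (2 * p)) \<partial>P) \<le>
      ennreal ((moment_const C (enn2real (\<integral>\<^sup>+s\<in>{0<..}. ennreal (\<pi> s) \<partial>lborel)) * p\<^sup>2 * (V * k\<^sup>2)) powr p)
        * (\<integral>\<^sup>+s\<in>{0<..}. ennreal ((s + 1) powr (2 * p * e) * \<pi> s) \<partial>lborel)"
proof -
  interpret prob_space P by fact
  have sf: "sigma_finite_measure P" by unfold_locales
  define K where "K s = k * (s + 1) powr e" for s
  have K0: "0 \<le> K s" for s using k by (simp add: K_def)
  have [measurable]: "K \<in> borel_measurable borel" unfolding K_def[abs_def] by measurable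
  have V0: "0 \<le> V" using V by simp
  have osc2: "X g' - X g'' \<le> (if x \<in> N s then K s else 0)"
    if "\<omega> \<in> space P" "0 < s" "g' \<in> adm_class c" "g'' \<in> adm_class c"
      "\<And>y \<zeta> \<nu>. y \<notin> ball x (s + 1) \<Longrightarrow> norm \<nu> = 1 \<Longrightarrow> g' y \<zeta> \<nu> = G \<omega> y \<zeta> \<nu>"
      "\<And>y \<zeta> \<nu>. y \<notin> ball x (s + 1) \<Longrightarrow> norm \<nu> = 1 \<Longrightarrow> g'' y \<zeta> \<nu> = G \<omega> y \<zeta> \<nu>" for \<omega> s x g' g''
    using osc[OF that(2,4,3), of x] that(5,6) unfolding K_def by simp
  define A where "A q = (\<integral>\<^sup>+s\<in>{0<..}. ennreal ((s + 1) powr (2 * q * e) * \<pi> s) \<partial>lborel)" for q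
  define \<pi>' where "\<pi>' s = indicator {0<..} s * \<pi> s" for s
  have [measurable]: "\<pi>' \<in> borel_measurable borel" using \<pi>(1) by (simp add: \<pi>'_def[abs_def] set_borel_measurable_def)
  have \<pi>'0: "0 \<le> \<pi>' s" for s using \<pi>(2) by (simp add: \<pi>'_def indicator_def)
  have A': "A q = (\<integral>\<^sup>+s. ennreal (indicator {0<..} s * (s + 1) powr (2 * q * e) * \<pi>' s) \<partial>lborel)" for q
    unfolding A_def by (intro nn_integral_cong) (auto simp: \<pi>'_def indicator_def)
  have Kp: "K s powr (2 * q) = k powr (2 * q) * (s + 1) powr (2 * q * e)" if "0 < s" for s q
    using that k by (simp add: K_def powr_mult powr_powr mult_ac)
  have K2: "(K s)\<^sup>2 = k\<^sup>2 * (s + 1) powr (2 * e)" if "0 < s" for s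
    using that k powr_add[of "s + 1" e e] by (simp add: K_def power_mult_distrib power2_eq_square)
  have inner: "(\<integral>\<^sup>+s\<in>{0<..}. ennreal (a * (s + 1) powr (2 * q * e) * \<pi> s) \<partial>lborel) = ennreal a * A q" if "0 \<le> a" for a q
  proof -
    have "(\<integral>\<^sup>+s\<in>{0<..}. ennreal (a * (s + 1) powr (2 * q * e) * \<pi> s) \<partial>lborel)
      = (\<integral>\<^sup>+s. ennreal a * ennreal (indicator {0<..} s * (s + 1) powr (2 * q * e) * \<pi>' s) \<partial>lborel)"
      using that by (intro nn_integral_cong) (auto simp: \<pi>'_def indicator_def ennreal_mult'[symmetric] mult_ac)
    then show ?thesis unfolding A' by (subst (asm) nn_integral_cmult) auto
  qed
  have "variance_enn P (\<lambda>\<omega>. X (G \<omega>)) \<le> ennreal C * (\<integral>\<^sup>+\<omega>. (\<integral>\<^sup>+s\<in>{0<..}. ennreal (V * (K s)\<^sup>2 * \<pi> s) \<partial>lborel) \<partial>P)"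
    by (rule multiscale_FI_deterministic[OF FI X G N V0 _ _ _ \<pi> sf, where \<kappa> = "\<lambda>_. K"])
       (use K0 osc2 in auto)
  also have "(\<integral>\<^sup>+s\<in>{0<..}. ennreal (V * (K s)\<^sup>2 * \<pi> s) \<partial>lborel) = (\<integral>\<^sup>+s\<in>{0<..}. ennreal (V * k\<^sup>2 * (s + 1) powr (2 * 1 * e) * \<pi> s) \<partial>lborel)"
    by (intro nn_integral_cong) (auto simp: K2 indicator_def mult.assoc)
  also have "\<dots> = ennreal (V * k\<^sup>2) * A 1" using V0 by (intro inner) simp
  also have "ennreal C * (\<integral>\<^sup>+\<omega>. ennreal (V * k\<^sup>2) * A 1 \<partial>P) = ennreal (C * (V * k\<^sup>2)) * A 1"
    using C V0 by (simp add: emeasure_space_1 ennreal_mult mult.assoc)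
  finally have var: "variance_enn P (\<lambda>\<omega>. X (G \<omega>)) \<le> ennreal (C * (V * k\<^sup>2)) * A 1" .
  then show "variance_enn P (\<lambda>\<omega>. X (G \<omega>)) \<le> ennreal (C * (V * k\<^sup>2)) * (\<integral>\<^sup>+s\<in>{0<..}. ennreal ((s + 1) powr (2 * e) * \<pi> s) \<partial>lborel)"
    by (simp add: A_def)
  assume p: "1 \<le> p"
  define m where "m = (\<integral>\<omega>'. X (G \<omega>') \<partial>P)"
  define Y where "Y \<omega> = X (G \<omega>) - m" for \<omega>
  have [measurable]: "Y \<in> borel_measurable P" unfolding Y_def[abs_def] by measurable
  have YB: "\<bar>Y \<omega>\<bar> \<le> B + \<bar>m\<bar>" if "\<omega> \<in> space P" for \<omega>
    using XB[OF G[OF that]] by (simp add: Y_def)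
  let ?m0 = "enn2real (\<integral>\<^sup>+s\<in>{0<..}. ennreal (\<pi> s) \<partial>lborel)"
  let ?M = "(moment_const C ?m0 * p\<^sup>2 * (V * k\<^sup>2)) powr p"
  have "0 < moment_const C ?m0" by (simp add: moment_const_def)
  then have Mpos: "0 < ?M" using p V k by simp
  \<comment> \<open>An infinite weighted integral makes the claim trivial, as the factor
    \<open>?M\<close> is positive; a finite one controls \<open>A 1\<close> as well, because the
    weight \<open>w\<close> is at least 1.\<close>
  have goal: "(\<integral>\<^sup>+\<omega>. ennreal (\<bar>Y \<omega>\<bar> powr (2 * p)) \<partial>P) \<le> ennreal ?M * A p"
  proof (cases "A p = top")
    case True
    then show ?thesis using Mpos by (simp add: ennreal_mult_top)
  next
    case False
    define w where "w s = (s + 1) powr (2 * e)" for s :: real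
    have w1: "1 \<le> w s" if "s \<in> {0<..}" for s using that e by (simp add: w_def ge_one_powr_ge_zero)
    have wp: "w s powr p = (s + 1) powr (2 * p * e)" for s by (simp add: w_def powr_powr mult_ac)
    have wm: "w \<in> borel_measurable borel" unfolding w_def[abs_def] by measurable
    have Ap: "A p = (\<integral>\<^sup>+s\<in>{0<..}. ennreal (w s powr p * \<pi> s) \<partial>lborel)" by (simp add: A_def wp)
    have A1: "A 1 = (\<integral>\<^sup>+s\<in>{0<..}. ennreal (w s * \<pi> s) \<partial>lborel)" by (simp add: A_def w_def)
    have pim: "(\<lambda>s. indicator {0<..} s * \<pi> s) \<in> borel_measurable lborel"
      using \<pi>(1) by (simp add: set_borel_measurable_def)
    have fin: "(\<integral>\<^sup>+s\<in>{0<..}. ennreal (w s powr p * \<pi> s) \<partial>lborel) < top"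
      using False unfolding Ap by (simp add: less_top)
    have \<pi>2: "\<And>s. s \<in> {0<..} \<Longrightarrow> 0 \<le> \<pi> s" using \<pi>(2) by simp
    note wj = nn_integral_weight_powr[OF pim \<pi>2 wm w1 p fin]
    define A1r where "A1r = enn2real (A 1)"
    define Apr where "Apr = enn2real (A p)"
    have A1e: "A 1 = ennreal A1r" "0 \<le> A1r" using wj(2) unfolding A1[symmetric] by (auto simp: A1r_def)
    have Ape: "A p = ennreal Apr" "0 \<le> Apr" using False by (auto simp: Apr_def less_top)
    have AB: "A1r powr p \<le> 2 * (2 * max 1 ?m0) powr p * Apr"
      using wj(1) unfolding A1[symmetric] Ap[symmetric] A1r_def Apr_def .
    have ip: "integrable P (\<lambda>\<omega>. \<bar>Y \<omega>\<bar> powr a)" if "0 \<le> a" for a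
    proof (rule bounded_integrable)
      show "\<bar>\<bar>Y \<omega>\<bar> powr a\<bar> \<le> (B + \<bar>m\<bar>) powr a" if "\<omega> \<in> space P" for \<omega>
        using YB[OF that] \<open>0 \<le> a\<close> by (simp add: powr_mono2)
    qed measurable
    have iX: "integrable P (\<lambda>\<omega>. X (G \<omega>))" by (rule bounded_integrable[OF X XB[OF G]])
    have i2: "integrable P (\<lambda>\<omega>. (Y \<omega>)\<^sup>2)"
    proof (rule bounded_integrable)
      show "\<bar>(Y \<omega>)\<^sup>2\<bar> \<le> (B + \<bar>m\<bar>)\<^sup>2" if "\<omega> \<in> space P" for \<omega>
        using power_mono[OF YB[OF that] abs_ge_zero, of 2] by simp
    qed measurable
    define v where "v = C * (V * k\<^sup>2 * A1r)"
    define q where "q = C * (V * p\<^sup>2 * exp 2 * k\<^sup>2 * A1r)"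
    define Z where "Z = C * (V * p\<^sup>2 * (p + 1) powr (2 * p - 2) * k powr (2 * p) * Apr)"
    have nn: "0 \<le> v" "0 \<le> q" "0 \<le> Z" using C V0 A1e Ape by (simp_all add: v_def q_def Z_def)
    have v2: "expectation (\<lambda>\<omega>. (Y \<omega>)\<^sup>2) \<le> v"
    proof -
      have "ennreal (expectation (\<lambda>\<omega>. (Y \<omega>)\<^sup>2)) = variance_enn P (\<lambda>\<omega>. X (G \<omega>))"
        using iX nn_integral_eq_integral[OF i2] by (simp add: variance_enn_def Y_def m_def)
      also have "\<dots> \<le> ennreal v" using var C V0 A1e(2) unfolding A1e(1)
        by (simp add: v_def ennreal_mult[symmetric] mult.assoc)
      finally show ?thesis using nn by (simp add: ennreal_le_iff)
    qed
    define X' where "X' g = \<bar>X g - m\<bar> powr p" for g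
    have X'm: "(\<lambda>\<omega>. X' (G \<omega>)) \<in> borel_measurable P" unfolding X'_def by measurable
    \<comment> \<open>Mean value bound for the p-th power:
      \<open>\<bar>Y \<omega>\<bar> + K s\<close> dominates the deviation from \<open>m\<close> for
      every tension obtained from \<open>G \<omega>\<close> by a change on the ball.\<close>
    define \<kappa> where "\<kappa> \<omega> s = p * (\<bar>Y \<omega>\<bar> + K s) powr (p - 1) * K s" for \<omega> s
    have \<kappa>m: "case_prod \<kappa> \<in> borel_measurable (P \<Otimes>\<^sub>M lborel)"
      unfolding \<kappa>_def[abs_def] by measurable
    have \<kappa>0: "0 \<le> \<kappa> \<omega> s" for \<omega> s unfolding \<kappa>_def using p K0[of s] by simp
    have osc': "X' g' - X' g'' \<le> (if x \<in> N s then \<kappa> \<omega> s else 0)"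
      if \<omega>: "\<omega> \<in> space P" and s: "0 < s" and g: "g' \<in> adm_class c" "g'' \<in> adm_class c"
        and eq': "\<And>y \<zeta> \<nu>. y \<notin> ball x (s + 1) \<Longrightarrow> norm \<nu> = 1 \<Longrightarrow> g' y \<zeta> \<nu> = G \<omega> y \<zeta> \<nu>"
        and eq'': "\<And>y \<zeta> \<nu>. y \<notin> ball x (s + 1) \<Longrightarrow> norm \<nu> = 1 \<Longrightarrow> g'' y \<zeta> \<nu> = G \<omega> y \<zeta> \<nu>" for \<omega> s x g' g''
    proof -
      define K' where "K' = (if x \<in> N s then K s else 0)"
      have d: "\<bar>X h - X h'\<bar> \<le> K'" if "h \<in> adm_class c" "h' \<in> adm_class c"
        "\<And>y \<zeta> \<nu>. y \<notin> ball x (s + 1) \<Longrightarrow> norm \<nu> = 1 \<Longrightarrow> h y \<zeta> \<nu> = G \<omega> y \<zeta> \<nu>"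
        "\<And>y \<zeta> \<nu>. y \<notin> ball x (s + 1) \<Longrightarrow> norm \<nu> = 1 \<Longrightarrow> h' y \<zeta> \<nu> = G \<omega> y \<zeta> \<nu>" for h h'
        using osc2[OF \<omega> s that] osc2[OF \<omega> s that(2,1,4,3)] unfolding K'_def by (simp add: abs_le_iff)
      have dG: "\<bar>X h - X (G \<omega>)\<bar> \<le> K'" if "h \<in> adm_class c"
        "\<And>y \<zeta> \<nu>. y \<notin> ball x (s + 1) \<Longrightarrow> norm \<nu> = 1 \<Longrightarrow> h y \<zeta> \<nu> = G \<omega> y \<zeta> \<nu>" for h
        using that G[OF \<omega>] by (intro d) auto
      have "X' g' - X' g'' \<le> p * (\<bar>Y \<omega>\<bar> + K') powr (p - 1) * K'"
        unfolding X'_def using dG[OF g(1) eq'] dG[OF g(2) eq''] d[OF g eq' eq''] p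
        by (intro abs_powr_diff_le) (auto simp: Y_def)
      then show ?thesis by (auto simp: K'_def \<kappa>_def)
    qed
    have ptw: "V * (\<kappa> \<omega> s)\<^sup>2 * \<pi> s \<le> (V * p\<^sup>2 * exp 2 * k\<^sup>2 * \<bar>Y \<omega>\<bar> powr (2 * p - 2)) * (s + 1) powr (2 * 1 * e) * \<pi> s
        + (V * p\<^sup>2 * (p + 1) powr (2 * p - 2) * k powr (2 * p)) * (s + 1) powr (2 * p * e) * \<pi> s" if "0 < s" for \<omega> s
    proof -
      have "V * (\<kappa> \<omega> s)\<^sup>2 * \<pi> s = V * p\<^sup>2 * \<pi> s * (((\<bar>Y \<omega>\<bar> + K s) powr (p - 1))\<^sup>2 * (K s)\<^sup>2)"
        by (simp add: \<kappa>_def power_mult_distrib mult_ac)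
      also have "\<dots> \<le> V * p\<^sup>2 * \<pi> s * (exp 2 * \<bar>Y \<omega>\<bar> powr (2 * p - 2) * (K s)\<^sup>2 + (p + 1) powr (2 * p - 2) * K s powr (2 * p))"
        using V0 \<pi>(2)[OF that] K0 p by (intro mult_left_mono powr_sum_split mult_nonneg_nonneg) auto
      finally show ?thesis unfolding K2[OF that] Kp[OF that] by (simp add: algebra_simps)
    qed
    have innerle: "(\<integral>\<^sup>+s\<in>{0<..}. ennreal (V * (\<kappa> \<omega> s)\<^sup>2 * \<pi> s) \<partial>lborel)
      \<le> ennreal (V * p\<^sup>2 * exp 2 * k\<^sup>2 * A1r * \<bar>Y \<omega>\<bar> powr (2 * p - 2) + V * p\<^sup>2 * (p + 1) powr (2 * p - 2) * k powr (2 * p) * Apr)" for \<omega>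
    proof -
      let ?a = "V * p\<^sup>2 * exp 2 * k\<^sup>2 * \<bar>Y \<omega>\<bar> powr (2 * p - 2)" and ?b = "V * p\<^sup>2 * (p + 1) powr (2 * p - 2) * k powr (2 * p)"
      have "(\<integral>\<^sup>+s\<in>{0<..}. ennreal (V * (\<kappa> \<omega> s)\<^sup>2 * \<pi> s) \<partial>lborel)
        \<le> (\<integral>\<^sup>+s. ennreal (?a * (s + 1) powr (2 * 1 * e) * \<pi>' s) * indicator {0<..} s + ennreal (?b * (s + 1) powr (2 * p * e) * \<pi>' s) * indicator {0<..} s \<partial>lborel)"
      proof (rule nn_integral_mono)
        fix s :: real
        have "ennreal (V * (\<kappa> \<omega> s)\<^sup>2 * \<pi> s) \<le> ennreal (?a * (s + 1) powr (2 * 1 * e) * \<pi> s) + ennreal (?b * (s + 1) powr (2 * p * e) * \<pi> s)" if "0 < s"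
          using ennreal_leI[OF ptw[OF that, of \<omega>]] V0 \<pi>(2)[OF that] by (subst (asm) ennreal_plus) auto
        then show "ennreal (V * (\<kappa> \<omega> s)\<^sup>2 * \<pi> s) * indicator {0<..} s \<le> ennreal (?a * (s + 1) powr (2 * 1 * e) * \<pi>' s) * indicator {0<..} s + ennreal (?b * (s + 1) powr (2 * p * e) * \<pi>' s) * indicator {0<..} s"
          by (simp add: indicator_def \<pi>'_def)
      qed
      also have "\<dots> = (\<integral>\<^sup>+s\<in>{0<..}. ennreal (?a * (s + 1) powr (2 * 1 * e) * \<pi>' s) \<partial>lborel) + (\<integral>\<^sup>+s\<in>{0<..}. ennreal (?b * (s + 1) powr (2 * p * e) * \<pi>' s) \<partial>lborel)"
        by (rule nn_integral_add) measurable
      also have "\<dots> = (\<integral>\<^sup>+s\<in>{0<..}. ennreal (?a * (s + 1) powr (2 * 1 * e) * \<pi> s) \<partial>lborel) + (\<integral>\<^sup>+s\<in>{0<..}. ennreal (?b * (s + 1) powr (2 * p * e) * \<pi> s) \<partial>lborel)"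
        by (intro arg_cong2[of _ _ _ _ "(+)"] nn_integral_cong) (auto simp: \<pi>'_def indicator_def)
      also have "\<dots> = ennreal ?a * ennreal A1r + ennreal ?b * ennreal Apr"
        using V0 by (subst inner, simp, subst inner, simp, simp add: A1e Ape)
      also have "\<dots> = ennreal (?a * A1r + ?b * Apr)" using V0 A1e Ape by (simp add: ennreal_mult ennreal_plus)
      finally show ?thesis by (simp add: mult_ac)
    qed
    have X'i: "integrable P (\<lambda>\<omega>. X' (G \<omega>))" using ip[of p] p by (simp add: X'_def Y_def)
    define x where "x = expectation (\<lambda>\<omega>. \<bar>Y \<omega>\<bar> powr (2 * p))"
    define e1 where "e1 = expectation (\<lambda>\<omega>. \<bar>Y \<omega>\<bar> powr p)"
    have sq: "(\<bar>Y \<omega>\<bar> powr p - e1)\<^sup>2 = \<bar>Y \<omega>\<bar> powr (2 * p) - 2 * e1 * \<bar>Y \<omega>\<bar> powr p + e1\<^sup>2" for \<omega>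
      using powr_add[of "\<bar>Y \<omega>\<bar>" p p] by (simp add: power2_eq_square algebra_simps)
    have isq: "integrable P (\<lambda>\<omega>. (\<bar>Y \<omega>\<bar> powr p - e1)\<^sup>2)"
      unfolding sq using ip p by (intro Bochner_Integration.integrable_add Bochner_Integration.integrable_diff integrable_mult_right) auto
    have Esq: "expectation (\<lambda>\<omega>. (\<bar>Y \<omega>\<bar> powr p - e1)\<^sup>2) = x - e1\<^sup>2"
      unfolding sq using ip[of p] ip[of "2 * p"] p by (simp add: x_def[symmetric] e1_def[symmetric] prob_space power2_eq_square)
    \<comment> \<open>The variance of the p-th power is \<open>x - e1\<^sup>2\<close>, the
      combination in which \<open>moment_bound\<close> states its hypothesis.\<close>
    have "ennreal (x - e1\<^sup>2) = variance_enn P (\<lambda>\<omega>. X' (G \<omega>))"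
      using X'i nn_integral_eq_integral[OF isq] unfolding Esq by (simp add: variance_enn_def X'_def Y_def e1_def)
    also have "\<dots> \<le> ennreal C * (\<integral>\<^sup>+\<omega>. (\<integral>\<^sup>+s\<in>{0<..}. ennreal (V * (\<kappa> \<omega> s)\<^sup>2 * \<pi> s) \<partial>lborel) \<partial>P)"
      by (rule multiscale_FI_deterministic[OF FI X'm G N V0 \<kappa>m \<kappa>0 osc' \<pi> sf])
    also have "\<dots> \<le> ennreal C * (\<integral>\<^sup>+\<omega>. ennreal (V * p\<^sup>2 * exp 2 * k\<^sup>2 * A1r * \<bar>Y \<omega>\<bar> powr (2 * p - 2) + V * p\<^sup>2 * (p + 1) powr (2 * p - 2) * k powr (2 * p) * Apr) \<partial>P)"
      by (intro mult_left_mono nn_integral_mono innerle) simp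
    also have "\<dots> = ennreal C * ennreal (V * p\<^sup>2 * exp 2 * k\<^sup>2 * A1r * expectation (\<lambda>\<omega>. \<bar>Y \<omega>\<bar> powr (2 * p - 2)) + V * p\<^sup>2 * (p + 1) powr (2 * p - 2) * k powr (2 * p) * Apr)"
      using ip[of "2 * p - 2"] p V0 A1e Ape by (subst nn_integral_eq_integral) (auto simp: prob_space)
    also have "\<dots> = ennreal (q * expectation (\<lambda>\<omega>. \<bar>Y \<omega>\<bar> powr (2 * p - 2)) + Z)"
      using C by (simp add: ennreal_mult'[symmetric] q_def Z_def algebra_simps)
    finally have varp: "x - e1\<^sup>2 \<le> q * expectation (\<lambda>\<omega>. \<bar>Y \<omega>\<bar> powr (2 * p - 2)) + Z"
      by (rule ennreal_le_iff[THEN iffD1, rotated]) (use nn in simp)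
    have "x \<le> (4 * q) powr p / 2 + 2 * Z + 4 * (8 * v) powr p"
      unfolding x_def by (rule moment_bound[OF _ YB p nn(2,1,3) v2]) (use varp in \<open>simp_all add: x_def e1_def\<close>)
    also have "\<dots> \<le> ?M * Apr"
      unfolding q_def v_def Z_def by (rule moment_const_bound[OF C k V p A1e(2) Ape(2) AB])
    finally have "ennreal x \<le> ennreal (?M * Apr)" by (rule ennreal_leI)
    then show ?thesis
      using nn_integral_eq_integral[OF ip[of "2 * p"]] p Ape by (simp add: x_def ennreal_mult)
  qed
  then show "(\<integral>\<^sup>+\<omega>. ennreal (\<bar>X (G \<omega>) - (\<integral>\<omega>'. X (G \<omega>') \<partial>P)\<bar> powr (2 * p)) \<partial>P) \<le> ennreal ?M
        * (\<integral>\<^sup>+s\<in>{0<..}. ennreal ((s + 1) powr (2 * p * e) * \<pi> s) \<partial>lborel)"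
    unfolding A_def Y_def m_def .
qed

section \<open>Hausdorff measure of random compact sets\<close>

lemma infdist_neighbourhood_diameter:
  fixes A :: "'a::euclidean_space set"
  assumes A: "bounded A" and \<rho>: "0 \<le> \<rho>" and B: "B \<subseteq> (\<Union>a\<in>A. ball a \<rho>)"
  shows "bounded B" "diameter B \<le> diameter A + 2 * \<rho>"
proof -
  have *: "dist x y \<le> diameter A + 2 * \<rho>" if xy: "x \<in> B" "y \<in> B" for x y
  proof -
    obtain a b where ab: "a \<in> A" "b \<in> A" "dist a x < \<rho>" "dist b y < \<rho>" 
      using subsetD[OF B xy(1)] subsetD[OF B xy(2)] by auto
    have "dist x y \<le> dist a x + dist a b + dist b y" 
      using dist_triangle[of x y a] dist_triangle[of a y b] by (simp add: dist_commute)
    moreover have "dist a b \<le> diameter A" using A ab by (intro diameter_bounded_bound) auto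
    ultimately show ?thesis using ab by linarith
  qed
  then show "bounded B" by (intro bounded_two_points[THEN iffD2]) blast
  have "0 \<le> diameter A" using A by (rule diameter_ge_0)
  then show "diameter B \<le> diameter A + 2 * \<rho>"
    using * \<rho> by (intro diameter_le) (auto simp: dist_norm)
qed

text \<open>Positivity of \<open>s\<close> makes the power continuous at 0 too, so even a single
  point can be enlarged at small cost.\<close>

lemma small_enlargement:
  fixes c s D \<eta> \<delta> :: real
  assumes "0 < s" "0 \<le> D" "0 < \<eta>" "0 < \<delta>" "0 \<le> c"
  shows "\<exists>\<rho>>0. 2 * \<rho> \<le> \<delta> \<and> c * ((D + 2 * \<rho>) / 2) powr s \<le> c * (D / 2) powr s + \<eta>"
proof -
  have "((\<lambda>\<rho>. c * ((D + 2 * \<rho>) / 2) powr s) \<longlongrightarrow> c * ((D + 2 * 0) / 2) powr s) (at_right 0)"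
    by (intro tendsto_intros tendsto_powr') (use assms in \<open>auto simp: eventually_at_right_less intro!: always_eventually eventually_mono[OF eventually_at_right_less[of 0]]\<close>)
  then have "\<forall>\<^sub>F \<rho> in at_right 0. c * ((D + 2 * \<rho>) / 2) powr s < c * (D / 2) powr s + \<eta>"
    using assms by (intro order_tendstoD(2)) auto
  moreover have "\<forall>\<^sub>F \<rho> in at_right (0::real). 0 < \<rho>" by (rule eventually_at_right_less)
  moreover have "\<forall>\<^sub>F \<rho> in at_right 0. \<rho> < \<delta> / 2" 
    unfolding eventually_at_right_field by (intro exI[of _ "\<delta> / 2"]) (use assms in auto)
  ultimately have "\<forall>\<^sub>F \<rho> in at_right 0. 0 < \<rho> \<and> 2 * \<rho> \<le> \<delta> \<and> c * ((D + 2 * \<rho>) / 2) powr s \<le> c * (D / 2) powr s + \<eta>"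
    by eventually_elim auto
  then show ?thesis using eventually_happens'[OF trivial_limit_at_right_real] by blast
qed

text \<open>Finite unions of a countable basis suffice, since \<open>A\<close> is compact.\<close>

lemma countable_open_interpolation:
  "\<exists>\<B> :: 'a::euclidean_space set set. countable \<B> \<and> (\<forall>B\<in>\<B>. open B) \<and>
    (\<forall>A O'. compact A \<longrightarrow> open O' \<longrightarrow> A \<subseteq> O' \<longrightarrow> (\<exists>B\<in>\<B>. A \<subseteq> B \<and> B \<subseteq> O'))"
proof -
  obtain \<B>0 :: "'a set set" where \<B>0: "countable \<B>0" "topological_basis \<B>0" using ex_countable_basis by blast
  define \<B> where "\<B> = Union ` {\<F>. finite \<F> \<and> \<F> \<subseteq> \<B>0}"
  have "countable \<B>" unfolding \<B>_def using countable_Collect_finite_subset[OF \<B>0(1)] by (rule countable_image)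
  moreover have "open B" if "B \<in> \<B>" for B
    using that topological_basis_open[OF \<B>0(2)] by (auto simp: \<B>_def)
  moreover have "\<exists>B\<in>\<B>. A \<subseteq> B \<and> B \<subseteq> O'" if A: "compact A" "open O'" "A \<subseteq> O'" for A O'
  proof -
    define \<C> where "\<C> = {b\<in>\<B>0. b \<subseteq> O'}"
    have "A \<subseteq> \<Union>\<C>"
    proof
      fix a assume "a \<in> A"
      then have "a \<in> O'" using A(3) by blast
      then obtain b where "b \<in> \<B>0" "a \<in> b" "b \<subseteq> O'" using topological_basisE[OF \<B>0(2) A(2)] by metis
      then show "a \<in> \<Union>\<C>" by (auto simp: \<C>_def)
    qed
    moreover have "\<forall>b\<in>\<C>. open b" using topological_basis_open[OF \<B>0(2)] by (auto simp: \<C>_def)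
    ultimately obtain \<F> where "\<F> \<subseteq> \<C>" "finite \<F>" "A \<subseteq> \<Union>\<F>" using compactE[OF A(1)] by metis
    then show ?thesis by (intro bexI[of _ "\<Union>\<F>"]) (auto simp: \<B>_def \<C>_def)
  qed
  ultimately show ?thesis by blast
qed

definition cover_cost :: "real \<Rightarrow> 'a::euclidean_space set list \<Rightarrow> ennreal" where
  "cover_cost s L = (\<Sum>B\<leftarrow>L. ennreal (hausdorff_const s * (diameter B / 2) powr s))"

lemma hausdorff_pre_le_cover_cost:
  assumes "K \<subseteq> \<Union>(set L)" "\<And>B. B \<in> set L \<Longrightarrow> bounded B \<and> diameter B \<le> \<delta>" "0 < \<delta>"
  shows "hausdorff_pre s \<delta> K \<le> cover_cost s L"
proof -
  define C where "C i = (if i < length L then L ! i else {})" for i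
  have "hausdorff_pre s \<delta> K \<le> (\<Sum>i. ennreal (hausdorff_const s * (diameter (C i) / 2) powr s))"
    unfolding hausdorff_pre_def
  proof (intro INF_lower CollectI conjI allI)
    show "K \<subseteq> (\<Union>i. C i)"
    proof
      fix x assume "x \<in> K"
      then obtain B where "B \<in> set L" "x \<in> B" using assms(1) by blast
      then obtain i where "i < length L" "x \<in> L ! i" by (metis in_set_conv_nth)
      then have "x \<in> C i" by (simp add: C_def)
      then show "x \<in> (\<Union>i. C i)" by blast
    qed
    show "bounded (C i)" "diameter (C i) \<le> \<delta>" for i using assms(2)[of "L ! i"] assms(3) by (auto simp: C_def)
  qed
  also have "\<dots> = (\<Sum>i<length L. ennreal (hausdorff_const s * (diameter (C i) / 2) powr s))"
    by (rule suminf_finite) (auto simp: C_def)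
  also have "\<dots> = (\<Sum>i<length L. ennreal (hausdorff_const s * (diameter (L ! i) / 2) powr s))"
    by (intro sum.cong) (auto simp: C_def)
  also have "\<dots> = cover_cost s L" by (simp add: cover_cost_def sum_list_sum_nth atLeast0LessThan)
  finally show ?thesis .
qed

text \<open>A nearly optimal countable cover is enlarged set by set into the family, the
  \<open>n\<close>-th set at extra cost \<open>\<eta> * (1 / 2) ^ Suc n\<close>; as the enlarged
  sets are open, compactness leaves finitely many. Over a countable family there are only countably
  many lists, so the right-hand side is a countable condition.\<close>

lemma hausdorff_outer_compact_le_iff:
  fixes K :: "'a::euclidean_space set"
  assumes K: "compact K" and s: "0 < s"
    and \<B>: "\<And>B. B \<in> \<B> \<Longrightarrow> open B" "\<And>A O'. compact A \<Longrightarrow> open O' \<Longrightarrow> A \<subseteq> O' \<Longrightarrow> \<exists>B\<in>\<B>. A \<subseteq> B \<and> B \<subseteq> O'"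
  shows "hausdorff_outer s K \<le> y \<longleftrightarrow> (\<forall>i j. \<exists>L\<in>lists \<B>. (\<forall>B\<in>set L. bounded B \<and> diameter B \<le> 1 / real (Suc j)) \<and>
    cover_cost s L \<le> y + ennreal (1 / real (Suc i)) \<and> K \<subseteq> \<Union>(set L))" (is "_ \<longleftrightarrow> ?R")
proof
  assume R: ?R
  show "hausdorff_outer s K \<le> y"
    unfolding hausdorff_outer_def
  proof (rule SUP_least)
    fix \<delta> :: real assume "\<delta> \<in> {0<..}"
    then obtain j where j: "1 / real (Suc j) < \<delta>" using nat_approx_posE[of \<delta>] by (auto simp: )
    show "hausdorff_pre s \<delta> K \<le> y"
    proof (rule ennreal_le_epsilon)
      fix e :: real assume "0 < e"
      then obtain i where i: "1 / real (Suc i) < e" using nat_approx_posE[of e] by auto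
      obtain L where L: "\<forall>B\<in>set L. bounded B \<and> diameter B \<le> 1 / real (Suc j)" "cover_cost s L \<le> y + ennreal (1 / real (Suc i))" "K \<subseteq> \<Union>(set L)"
        using R by blast
      have "hausdorff_pre s \<delta> K \<le> cover_cost s L"
        using L j \<open>\<delta> \<in> {0<..}\<close> by (intro hausdorff_pre_le_cover_cost) auto
      also have "\<dots> \<le> y + ennreal e" using L(2) i by (meson add_left_mono ennreal_leI less_imp_le order_trans)
      finally show "hausdorff_pre s \<delta> K \<le> y + ennreal e" .
    qed
  qed
next
  assume le: "hausdorff_outer s K \<le> y"
  show ?R
  proof (intro allI)
    fix i j :: nat
    let ?c = "hausdorff_const s"
    have c: "0 \<le> ?c" using s by (intro hausdorff_const_nonneg) simp
    \<comment> \<open>Half of the admissible cost and half of the admissible diameter are reserved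
      for the enlargement.\<close>
    define \<eta> where "\<eta> = 1 / (2 * real (Suc i))"
    define \<delta> where "\<delta> = 1 / (2 * real (Suc j))"
    have pos: "0 < \<eta>" "0 < \<delta>" by (auto simp: \<eta>_def \<delta>_def)
    show "\<exists>L\<in>lists \<B>. (\<forall>B\<in>set L. bounded B \<and> diameter B \<le> 1 / real (Suc j)) \<and>
      cover_cost s L \<le> y + ennreal (1 / real (Suc i)) \<and> K \<subseteq> \<Union>(set L)"
    proof -
      define y' where "y' = hausdorff_pre s \<delta> K"
      have y'y: "y' \<le> y" using pos le unfolding hausdorff_outer_def y'_def by (auto simp: SUP_le_iff)
      have "\<exists>C. K \<subseteq> (\<Union>n. C n) \<and> (\<forall>n. bounded (C n) \<and> diameter (C n) \<le> \<delta>) \<and>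
        (\<Sum>n. ennreal (?c * (diameter (C n) / 2) powr s)) \<le> y + ennreal \<eta>"
      proof (cases "y = top")
        case True
        obtain F where F: "finite F" "K \<subseteq> (\<Union>x\<in>F. ball x (\<delta> / 2))"
          using compact_imp_seq_compact[OF K, THEN seq_compact_imp_totally_bounded] pos by (metis half_gt_zero)
        obtain f :: "nat \<Rightarrow> 'a" and n where f: "F = f ` {i. i < n}" using finite_imp_nat_seg_image_inj_on[OF F(1)] by auto
        show ?thesis using F(2) pos unfolding f True
          by (intro exI[of _ "\<lambda>n. ball (f n) (\<delta> / 2)"]) auto
      next
        case False
        then have "y' < y + ennreal \<eta>" using y'y pos
          by (cases y rule: ennreal_cases) (auto simp: ennreal_plus[symmetric] ennreal_less_iff simp del: ennreal_plus intro: le_less_trans)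
        then show ?thesis unfolding y'_def hausdorff_pre_def INF_less_iff by (auto intro: less_imp_le)
      qed
      then obtain C where C: "K \<subseteq> (\<Union>n. C n)" "\<And>n. bounded (C n)" "\<And>n. diameter (C n) \<le> \<delta>"
        "(\<Sum>n. ennreal (?c * (diameter (C n) / 2) powr s)) \<le> y + ennreal \<eta>" by blast
      have "\<exists>B\<in>\<B>. C n \<subseteq> B \<and> bounded B \<and> diameter B \<le> 1 / real (Suc j) \<and>
        ?c * (diameter B / 2) powr s \<le> ?c * (diameter (C n) / 2) powr s + \<eta> * (1 / 2) ^ Suc n" for n
      proof -
        define A where "A = closure (C n)"
        have dA: "diameter A = diameter (C n)" "bounded A" "compact A" using C(2)[of n] by (auto simp: A_def diameter_closure)
        obtain \<rho> where \<rho>: "0 < \<rho>" "2 * \<rho> \<le> \<delta>" "?c * ((diameter A + 2 * \<rho>) / 2) powr s \<le> ?c * (diameter A / 2) powr s + \<eta> * (1 / 2) ^ Suc n"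
          using small_enlargement[OF s diameter_ge_0[OF dA(2)], of "\<eta> * (1 / 2) ^ Suc n" \<delta> ?c] pos c by auto
        have "A \<subseteq> (\<Union>a\<in>A. ball a \<rho>)" using \<rho> by auto
        then obtain B where B: "B \<in> \<B>" "A \<subseteq> B" "B \<subseteq> (\<Union>a\<in>A. ball a \<rho>)" using \<B>(2)[OF dA(3), of "\<Union>a\<in>A. ball a \<rho>"] by auto
        have dB: "bounded B" "diameter B \<le> diameter A + 2 * \<rho>"
          using infdist_neighbourhood_diameter[OF dA(2) _ B(3)] \<rho> by auto
        have "?c * (diameter B / 2) powr s \<le> ?c * ((diameter A + 2 * \<rho>) / 2) powr s"
          using dB c s diameter_ge_0[OF dB(1)] by (intro mult_left_mono powr_mono2) auto
        moreover have "diameter A + 2 * \<rho> \<le> 1 / real (Suc j)" using C(3)[of n] \<rho>(2) dA by (simp add: \<delta>_def field_simps)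
        moreover have "C n \<subseteq> A" by (simp add: A_def closure_subset)
        ultimately show ?thesis using B dB \<rho>(3) dA(1) by (intro bexI[of _ B]) auto
      qed
      then obtain B where B: "\<And>n. B n \<in> \<B>" "\<And>n. C n \<subseteq> B n" "\<And>n. bounded (B n)" "\<And>n. diameter (B n) \<le> 1 / real (Suc j)"
        "\<And>n. ?c * (diameter (B n) / 2) powr s \<le> ?c * (diameter (C n) / 2) powr s + \<eta> * (1 / 2) ^ Suc n" by metis
      have "K \<subseteq> (\<Union>n\<in>UNIV. B n)" by (rule order_trans[OF C(1) UN_mono[OF subset_refl B(2)]])
      then obtain I where I: "finite I" "K \<subseteq> (\<Union>n\<in>I. B n)"
        using compactE_image[OF K, of UNIV B] \<B>(1) B(1) by (metis (no_types, lifting))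
      obtain xs where xs: "set xs = I" "distinct xs" using finite_distinct_list[OF I(1)] by blast
      define L where "L = map B xs"
      have "cover_cost s L = (\<Sum>n\<in>I. ennreal (?c * (diameter (B n) / 2) powr s))"
        unfolding cover_cost_def L_def using xs by (simp add: sum_list_distinct_conv_sum_set comp_def)
      also have "\<dots> \<le> (\<Sum>n\<in>I. ennreal (?c * (diameter (C n) / 2) powr s) + ennreal (\<eta> * (1 / 2) ^ Suc n))"
        using B(5) c pos by (intro sum_mono) (auto simp: ennreal_plus[symmetric] ennreal_leI simp del: ennreal_plus)
      also have "\<dots> = (\<Sum>n\<in>I. ennreal (?c * (diameter (C n) / 2) powr s)) + (\<Sum>n\<in>I. ennreal (\<eta> * (1 / 2) ^ Suc n))"
        by (rule sum.distrib)
      also have "\<dots> \<le> (\<Sum>n. ennreal (?c * (diameter (C n) / 2) powr s)) + (\<Sum>n. ennreal (\<eta> * (1 / 2) ^ Suc n))"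
        using I(1) by (intro add_mono sum_le_suminf) auto
      also have "(\<Sum>n. ennreal (\<eta> * (1 / 2) ^ Suc n)) = ennreal \<eta>"
        using sums_mult[OF power_half_series, of \<eta>] pos by (intro suminf_ennreal_eq) (auto simp: mult.commute)
      also have "(\<Sum>n. ennreal (?c * (diameter (C n) / 2) powr s)) + ennreal \<eta> \<le> (y + ennreal \<eta>) + ennreal \<eta>"
        using C(4) by (rule add_right_mono)
      also have "\<dots> = y + ennreal (1 / real (Suc i))"
        using pos by (simp add: add.assoc ennreal_plus[symmetric] \<eta>_def field_simps del: ennreal_plus)
      finally have "cover_cost s L \<le> y + ennreal (1 / real (Suc i))" .
      moreover have "K \<subseteq> \<Union>(set L)" using I(2) xs by (auto simp: L_def)
      moreover have "L \<in> lists \<B>" using B(1) by (auto simp: L_def)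
      moreover have "\<forall>b\<in>set L. bounded b \<and> diameter b \<le> 1 / real (Suc j)" using B(3,4) by (auto simp: L_def)
      ultimately show ?thesis by blast
    qed
  qed
qed

text \<open>Random compact sets described by countably many functions, continuous in the point and
  measurable in the parameter; the set itself is \<open>sublevel\<close>.\<close>

definition compact_family :: "'t measure \<Rightarrow> ('a::euclidean_space) set \<Rightarrow> (nat \<Rightarrow> 't \<Rightarrow> 'a \<Rightarrow> real) \<Rightarrow> bool" where
  "compact_family T K J \<longleftrightarrow> compact K \<and> (\<forall>j. \<forall>\<theta>\<in>space T. continuous_on K (J j \<theta>)) \<and>
    (\<forall>j. \<forall>x\<in>K. (\<lambda>\<theta>. J j \<theta> x) \<in> borel_measurable T)"

definition sublevel :: "'a set \<Rightarrow> (nat \<Rightarrow> 't \<Rightarrow> 'a \<Rightarrow> real) \<Rightarrow> 't \<Rightarrow> 'a set" where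
  "sublevel K J \<theta> = {x\<in>K. \<forall>j. J j \<theta> x \<le> 0}"

lemma compact_sublevel:
  assumes "compact_family T K J" "\<theta> \<in> space T"
  shows "compact (sublevel K J \<theta>)"
proof -
  have K: "closed K" using assms compact_imp_closed by (auto simp: compact_family_def)
  have "sublevel K J \<theta> = K \<inter> (\<Inter>j. {x\<in>K. J j \<theta> x \<le> 0})" by (auto simp: sublevel_def)
  moreover have "closed {x\<in>K. J j \<theta> x \<le> 0}" for j
  proof -
    have "closed (K \<inter> J j \<theta> -` {..0})"
      using assms K unfolding compact_family_def by (intro continuous_closed_preimage) auto
    moreover have "K \<inter> J j \<theta> -` {..0} = {x\<in>K. J j \<theta> x \<le> 0}" by auto
    ultimately show ?thesis by simp
  qed
  ultimately show ?thesis using assms K by (auto simp: compact_family_def intro!: compact_Int_closed closed_INT)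
qed

text \<open>Effros measurability. By compactness the set meets \<open>C\<close> exactly when, for
  each \<open>n\<close>, the constraints up to index \<open>n\<close> can be satisfied up to
  \<open>1 / Suc n\<close>; continuity allows such approximate solutions to be sought in a countable
  dense set.\<close>

lemma sublevel_hits_closed:
  assumes fam: "compact_family T K J" and C: "closed C"
  shows "{\<theta> \<in> space T. sublevel K J \<theta> \<inter> C \<noteq> {}} \<in> sets T"
proof -
  have K: "compact (K \<inter> C)" using fam unfolding compact_family_def by (intro compact_Int_closed[OF _ C]) blast
  obtain Q where Q: "countable Q" "Q \<subseteq> K \<inter> C" "K \<inter> C \<subseteq> closure Q" using separable[of "K \<inter> C"] by metis
  have "sublevel K J \<theta> \<inter> C \<noteq> {} \<longleftrightarrow> (\<forall>n. \<exists>x\<in>Q. \<forall>j\<in>{..n}. J j \<theta> x < 1 / real (Suc n))" (is "?l \<longleftrightarrow> ?r")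
    if \<theta>: "\<theta> \<in> space T" for \<theta>
  proof
    have cont: "continuous_on (K \<inter> C) (J j \<theta>)" for j
      using fam \<theta> by (auto simp: compact_family_def intro: continuous_on_subset)
    assume ?l
    then obtain x where x: "x \<in> K \<inter> C" "\<And>j. J j \<theta> x \<le> 0" by (auto simp: sublevel_def)
    then obtain q where q: "\<And>i. q i \<in> Q" "q \<longlonglongrightarrow> x" using Q(3) closure_sequential by (metis subsetD)
    show ?r
    proof
      fix n
      have "\<forall>\<^sub>F i in sequentially. \<forall>j\<in>{..n}. J j \<theta> (q i) < 1 / real (Suc n)"
      proof (intro eventually_ball_finite ballI)
        fix j
        have "(\<lambda>i. J j \<theta> (q i)) \<longlonglongrightarrow> J j \<theta> x"
          using continuous_on_tendsto_compose[OF cont q(2) x(1)] q(1) Q(2) by (auto simp: subset_iff)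
        moreover have "J j \<theta> x < 1 / real (Suc n)" using x(2)[of j] by (smt (verit) divide_pos_pos of_nat_0_less_iff zero_less_Suc)
        ultimately show "\<forall>\<^sub>F i in sequentially. J j \<theta> (q i) < 1 / real (Suc n)" by (rule order_tendstoD(2))
      qed simp
      then obtain i where "\<forall>j\<in>{..n}. J j \<theta> (q i) < 1 / real (Suc n)" using eventually_happens'[OF sequentially_bot] by blast
      then show "\<exists>x\<in>Q. \<forall>j\<in>{..n}. J j \<theta> x < 1 / real (Suc n)" using q(1) by blast
    qed
  next
    have cont: "continuous_on (K \<inter> C) (J j \<theta>)" for j
      using fam \<theta> by (auto simp: compact_family_def intro: continuous_on_subset)
    assume ?r
    then obtain x where x: "\<And>n. x n \<in> Q" "\<And>n j. j \<in> {..n} \<Longrightarrow> J j \<theta> (x n) < 1 / real (Suc n)" by metis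
    have xK: "x n \<in> K \<inter> C" for n using x(1) Q(2) by blast
    obtain l \<sigma> where l: "l \<in> K \<inter> C" "strict_mono \<sigma>" "(x \<circ> \<sigma>) \<longlonglongrightarrow> l"
      using compact_imp_seq_compact[OF K] xK by (elim seq_compactE[where f = x]) auto
    have "J j \<theta> l \<le> 0" for j
    proof (rule LIMSEQ_le)
      show "(\<lambda>n. J j \<theta> ((x \<circ> \<sigma>) n)) \<longlonglongrightarrow> J j \<theta> l"
        using xK by (intro continuous_on_tendsto_compose[OF cont l(3) l(1)]) auto
      show "(\<lambda>n. 1 / real (Suc (\<sigma> n))) \<longlonglongrightarrow> 0"
        using LIMSEQ_subseq_LIMSEQ[OF LIMSEQ_inverse_real_of_nat l(2)] by (simp add: comp_def inverse_eq_divide)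
      show "\<exists>N. \<forall>n\<ge>N. J j \<theta> ((x \<circ> \<sigma>) n) \<le> 1 / real (Suc (\<sigma> n))"
      proof (intro exI[of _ j] allI impI)
        fix n assume "j \<le> n"
        then have "j \<le> \<sigma> n" using strict_mono_imp_increasing[OF l(2), of n] by simp
        then show "J j \<theta> ((x \<circ> \<sigma>) n) \<le> 1 / real (Suc (\<sigma> n))" using x(2) by (simp add: less_imp_le)
      qed
    qed
    then show ?l using l(1) by (auto simp: sublevel_def)
  qed
  then have "{\<theta> \<in> space T. sublevel K J \<theta> \<inter> C \<noteq> {}} = {\<theta> \<in> space T. \<forall>n. \<exists>x\<in>Q. \<forall>j\<in>{..n}. J j \<theta> x < 1 / real (Suc n)}" by blast
  also have "\<dots> \<in> sets T"
  proof (intro sets.sets_Collect_countable_All sets.sets_Collect_countable_Ex'[OF _ Q(1)] sets.sets_Collect_finite_All)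
    fix n x j assume "x \<in> Q"
    then have "x \<in> K" using Q(2) by blast
    then have [measurable]: "(\<lambda>\<theta>. J j \<theta> x) \<in> borel_measurable T" using fam unfolding compact_family_def by blast
    show "{\<theta> \<in> space T. J j \<theta> x < 1 / real (Suc n)} \<in> sets T" by measurable
  qed simp
  finally show ?thesis .
qed

lemma emeasure_hausdorff_measure:
  "emeasure (hausdorff_measure s) A =
    (if A \<in> sets borel \<and> measure_space (UNIV :: 'a set) (sets borel) (hausdorff_outer s) then hausdorff_outer s A else 0)"
  for A :: "'a::euclidean_space set"
proof -
  have "sigma_sets UNIV (sets (borel :: 'a measure)) = sets borel"
    using sets.sigma_sets_eq[of "borel :: 'a measure"] by (simp only: space_borel)
  then show ?thesis unfolding hausdorff_measure_def emeasure_measure_of_conv by simp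
qed

text \<open>Containment in an open set is failure to meet a closed set, so the criterion by finite
  covers reduces the claim to hitting events. The case distinction is the one in
  \<open>measure_of\<close>, which yields 0 where the outer measure is not a measure.\<close>

lemma hausdorff_measure_sublevel_measurable:
  fixes K :: "'a::euclidean_space set"
  assumes fam: "compact_family T K J" and C: "closed C" and s: "0 < s"
  shows "(\<lambda>\<theta>. emeasure (hausdorff_measure s) (sublevel K J \<theta> \<inter> C)) \<in> borel_measurable T"
proof (cases "measure_space UNIV (sets (borel :: 'a measure)) (hausdorff_outer s :: 'a set \<Rightarrow> ennreal)")
  case False
  then have "emeasure (hausdorff_measure s) A = 0" for A :: "'a set"
    by (simp add: emeasure_hausdorff_measure)
  then show ?thesis by simp
next
  case True
  obtain \<B> :: "'a set set" where \<B>: "countable \<B>" "\<And>B. B \<in> \<B> \<Longrightarrow> open B"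
    "\<And>A O'. compact A \<Longrightarrow> open O' \<Longrightarrow> A \<subseteq> O' \<Longrightarrow> \<exists>B\<in>\<B>. A \<subseteq> B \<and> B \<subseteq> O'"
    using countable_open_interpolation by metis
  have comp: "compact (sublevel K J \<theta> \<inter> C)" if "\<theta> \<in> space T" for \<theta>
    using compact_sublevel[OF fam that] C by (rule compact_Int_closed)
  have em: "emeasure (hausdorff_measure s) (sublevel K J \<theta> \<inter> C) = hausdorff_outer s (sublevel K J \<theta> \<inter> C)" if "\<theta> \<in> space T" for \<theta>
  proof -
    have "sublevel K J \<theta> \<inter> C \<in> sets borel" using comp[OF that] by (intro borel_compact)
    then show ?thesis using True by (simp add: emeasure_hausdorff_measure)
  qed
  show ?thesis
  proof (rule borel_measurableI_le)
    fix y
    define good where "good i j L \<longleftrightarrow> (\<forall>B\<in>set L. bounded B \<and> diameter B \<le> 1 / real (Suc j)) \<and> cover_cost s L \<le> y + ennreal (1 / real (Suc i))"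
      for i j :: nat and L :: "'a set list"
    have "{\<theta> \<in> space T. emeasure (hausdorff_measure s) (sublevel K J \<theta> \<inter> C) \<le> y} =
      {\<theta> \<in> space T. \<forall>i j. \<exists>L\<in>lists \<B>. good i j L \<and> sublevel K J \<theta> \<inter> C \<subseteq> \<Union>(set L)}"
      using em hausdorff_outer_compact_le_iff[OF comp s \<B>(2,3)] unfolding good_def by (auto simp: conj_assoc)
    also have "\<dots> \<in> sets T"
    proof (intro sets.sets_Collect_countable_All sets.sets_Collect_countable_Ex'[OF _ countable_lists[OF \<B>(1)]])
      fix i j and L assume L: "L \<in> lists \<B>"
      have "open (\<Union>(set L))" using L \<B>(2) by auto
      then have cl: "closed (C - \<Union>(set L))" using C by (rule closed_Diff[rotated])
      have "{\<theta> \<in> space T. good i j L \<and> sublevel K J \<theta> \<inter> C \<subseteq> \<Union>(set L)} =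
        (if good i j L then space T - {\<theta> \<in> space T. sublevel K J \<theta> \<inter> (C - \<Union>(set L)) \<noteq> {}} else {})" by auto
      also have "\<dots> \<in> sets T" using sublevel_hits_closed[OF fam cl] by auto
      finally show "{\<theta> \<in> space T. good i j L \<and> sublevel K J \<theta> \<inter> C \<subseteq> \<Union>(set L)} \<in> sets T" .
    qed
    finally show "{\<theta> \<in> space T. emeasure (hausdorff_measure s) (sublevel K J \<theta> \<inter> C) \<le> y} \<in> sets T" .
  qed
qed

text \<open>Division by \<open>c\<close> turns the restricted Hausdorff measures into
  subprobabilities. Closed sets are an intersection-stable generator, so these form a measurable
  kernel, and integrals against a kernel depend measurably on the parameter.\<close>

lemma sublevel_kernel_integral_measurable:
  fixes K :: "'a::euclidean_space set" and f :: "'b \<Rightarrow> 'a \<Rightarrow> ennreal"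
  assumes fam: "compact_family T K J" and s: "0 < s"
    and Kb: "\<And>\<theta>. \<theta> \<in> space T \<Longrightarrow> emeasure (hausdorff_measure s) (sublevel K J \<theta>) \<le> ennreal c" and c: "0 < c"
    and f: "(\<lambda>(p, x). f p x) \<in> borel_measurable (N \<Otimes>\<^sub>M borel)" and \<tau>: "\<tau> \<in> measurable N T"
  shows "(\<lambda>p. \<integral>\<^sup>+x\<in>sublevel K J (\<tau> p). f p x \<partial>hausdorff_measure s) \<in> borel_measurable N"
proof -
  let ?H = "hausdorff_measure s :: 'a measure"
  define \<kappa> where "\<kappa> \<theta> = density ?H (\<lambda>x. indicator (sublevel K J \<theta>) x / ennreal c)" for \<theta>
  have sb: "sublevel K J \<theta> \<in> sets borel" if "\<theta> \<in> space T" for \<theta>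
    using compact_sublevel[OF fam that] by (rule borel_compact)
  have em: "emeasure (\<kappa> \<theta>) A = emeasure ?H (sublevel K J \<theta> \<inter> A) / ennreal c" if "\<theta> \<in> space T" "A \<in> sets borel" for \<theta> A
  proof -
    have [measurable]: "sublevel K J \<theta> \<in> sets ?H" "A \<in> sets ?H" using sb that by auto
    have "emeasure (\<kappa> \<theta>) A = (\<integral>\<^sup>+x. indicator (sublevel K J \<theta>) x / ennreal c * indicator A x \<partial>?H)"
      unfolding \<kappa>_def by (rule emeasure_density) measurable
    also have "\<dots> = (\<integral>\<^sup>+x. indicator (sublevel K J \<theta> \<inter> A) x / ennreal c \<partial>?H)"
      by (intro nn_integral_cong) (auto simp: indicator_def)
    also have "\<dots> = emeasure ?H (sublevel K J \<theta> \<inter> A) / ennreal c" by (subst nn_integral_divide) auto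
    finally show ?thesis .
  qed
  have \<kappa>: "\<kappa> \<in> measurable T (subprob_algebra borel)"
  proof (rule measurable_subprob_algebra_generated[where \<Omega> = UNIV and G = "Collect closed"])
    show "sets borel = sigma_sets UNIV (Collect closed :: 'a set set)" by (simp add: borel_eq_closed)
    show "Int_stable (Collect closed :: 'a set set)" by (auto simp: Int_stable_def)
    fix \<theta> assume \<theta>: "\<theta> \<in> space T"
    show "sets (\<kappa> \<theta>) = sets borel" by (simp add: \<kappa>_def)
    show "subprob_space (\<kappa> \<theta>)"
    proof
      have "emeasure (\<kappa> \<theta>) (space (\<kappa> \<theta>)) = emeasure ?H (sublevel K J \<theta>) / ennreal c"
        using em[OF \<theta>, of UNIV] by (simp add: \<kappa>_def)
      also have "\<dots> \<le> ennreal c / ennreal c" by (intro divide_right_mono_ennreal Kb \<theta>)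
      also have "\<dots> = 1" using c by (simp add: divide_ennreal)
      finally show "emeasure (\<kappa> \<theta>) (space (\<kappa> \<theta>)) \<le> 1" .
      show "space (\<kappa> \<theta>) \<noteq> {}" by (simp add: \<kappa>_def)
    qed
  next
    have *: "(\<lambda>\<theta>. emeasure (\<kappa> \<theta>) A) \<in> borel_measurable T" if "closed A" for A
    proof -
      have "(\<lambda>\<theta>. emeasure ?H (sublevel K J \<theta> \<inter> A) / ennreal c) \<in> borel_measurable T"
        using hausdorff_measure_sublevel_measurable[OF fam that s] by measurable
      then show ?thesis by (rule measurable_cong[THEN iffD2, rotated]) (use em that in auto)
    qed
    show "(\<lambda>\<theta>. emeasure (\<kappa> \<theta>) A) \<in> borel_measurable T" if "A \<in> Collect closed" for A using * that by simp
    show "(\<lambda>\<theta>. emeasure (\<kappa> \<theta>) UNIV) \<in> borel_measurable T" by (rule *) simp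
  qed auto
  have "(\<lambda>p. \<kappa> (\<tau> p)) \<in> measurable N (subprob_algebra borel)" using \<tau> \<kappa> by (rule measurable_compose)
  from nn_integral_measurable_subprob_algebra2[OF f this]
  have "(\<lambda>p. ennreal c * (\<integral>\<^sup>+x. f p x \<partial>\<kappa> (\<tau> p))) \<in> borel_measurable N" by measurable
  moreover have "ennreal c * (\<integral>\<^sup>+x. f p x \<partial>\<kappa> (\<tau> p)) = (\<integral>\<^sup>+x\<in>sublevel K J (\<tau> p). f p x \<partial>?H)" if p: "p \<in> space N" for p
  proof -
    have \<theta>: "\<tau> p \<in> space T" using \<tau> p by (rule measurable_space)
    have [measurable]: "sublevel K J (\<tau> p) \<in> sets borel" by (rule sb[OF \<theta>])
    have [measurable]: "f p \<in> borel_measurable borel"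
      using measurable_compose[OF measurable_Pair1'[OF p] f] by simp
    have "ennreal c * (\<integral>\<^sup>+x. f p x \<partial>\<kappa> (\<tau> p)) = ennreal c * (\<integral>\<^sup>+x. indicator (sublevel K J (\<tau> p)) x / ennreal c * f p x \<partial>?H)"
      unfolding \<kappa>_def by (subst nn_integral_density) auto
    also have "\<dots> = (\<integral>\<^sup>+x. ennreal c * (indicator (sublevel K J (\<tau> p)) x / ennreal c * f p x) \<partial>?H)"
      by (rule nn_integral_cmult[symmetric]) measurable
    also have "\<dots> = (\<integral>\<^sup>+x\<in>sublevel K J (\<tau> p). f p x \<partial>?H)"
    proof (rule nn_integral_cong)
      fix x
      have "ennreal c * (1 / ennreal c * f p x) = f p x"
        using c by (metis ennreal_times_divide divide_self_if mult.assoc mult.commute mult.right_neutral ennreal_divide_self ennreal_less_top ennreal_eq_0_iff not_le top_neq_ennreal)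
      then show "ennreal c * (indicator (sublevel K J (\<tau> p)) x / ennreal c * f p x) = f p x * indicator (sublevel K J (\<tau> p)) x"
        by (simp add: indicator_def)
    qed
    finally show ?thesis .
  qed
  ultimately show ?thesis by (rule measurable_cong[THEN iffD1, rotated]) auto
qed

section \<open>Approximate jump points\<close>

definition half_ball_dev :: "(real^'n \<Rightarrow> real^'m) \<Rightarrow> real^'m \<Rightarrow> real \<Rightarrow> real^'n \<Rightarrow> real^'n \<Rightarrow> real" where
  "half_ball_dev v b r x w = (\<integral>y. (if dist x y < r \<and> 0 < (y - x) \<bullet> w then norm (v y - b) else 0) \<partial>lborel)"

definition ball_moment :: "(real^'n \<Rightarrow> real^'m) \<Rightarrow> real^'m \<Rightarrow> real \<Rightarrow> real^'n \<Rightarrow> real^'n" where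
  "ball_moment v b r x = (\<integral>y. (if dist x y < r \<and> v y = b then y - x else 0) \<partial>lborel)"

abbreviation rad :: "nat \<Rightarrow> real" where
  "rad k \<equiv> 1 / real (Suc k)"

lemma rad_pos: "0 < rad k" by simp

lemma ennreal_tendsto_0I:
  fixes f :: "'a \<Rightarrow> ennreal"
  assumes "\<And>e::real. 0 < e \<Longrightarrow> \<forall>\<^sub>F r in F. f r \<le> ennreal e"
  shows "(f \<longlongrightarrow> 0) F"
proof (rule order_tendstoI)
  fix a :: ennreal assume "0 < a"
  then obtain x where x: "0 < x" "x < a" using dense by blast
  then obtain e where e: "x = ennreal e" "0 < e" by (cases x rule: ennreal_cases) (auto simp: top_unique dest: less_imp_le)
  from assms[OF e(2)] show "\<forall>\<^sub>F r in F. f r < a"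
    by eventually_elim (use x e in \<open>auto intro: le_less_trans\<close>)
qed simp

lemma tendsto_eventually_less_iff:
  fixes f :: "'b \<Rightarrow> 'a::linorder_topology"
  assumes "(f \<longlongrightarrow> a) F" "a \<noteq> c"
  shows "\<forall>\<^sub>F n in F. f n < c \<longleftrightarrow> a < c" "\<forall>\<^sub>F n in F. c < f n \<longleftrightarrow> c < a"
proof -
  have "\<forall>\<^sub>F n in F. (f n < c \<longleftrightarrow> a < c) \<and> (c < f n \<longleftrightarrow> c < a)"
  proof (cases "a < c")
    case True
    from order_tendstoD(2)[OF assms(1) True] show ?thesis by eventually_elim (use True in auto)
  next
    case False
    then have "c < a" using assms(2) by auto
    from order_tendstoD(1)[OF assms(1) this] show ?thesis by eventually_elim (use \<open>c < a\<close> in auto)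
  qed
  then show "\<forall>\<^sub>F n in F. f n < c \<longleftrightarrow> a < c" "\<forall>\<^sub>F n in F. c < f n \<longleftrightarrow> c < a"
    by (auto elim: eventually_mono)
qed

text \<open>The limits over all radii become countable conditions with radii \<open>rad k\<close>
  and tolerances \<open>rad m\<close>; in this form being a jump is a measurable property of the
  function, the point and the normal.\<close>

definition seq_triple :: "(real^'n \<Rightarrow> real^'m) \<Rightarrow> real^'n \<Rightarrow> real^'m \<Rightarrow> real^'m \<Rightarrow> real^'n \<Rightarrow> bool" where
  "seq_triple v x a b \<nu> \<longleftrightarrow> a \<noteq> b \<and> norm \<nu> = 1 \<and> (\<forall>m. \<exists>j. \<forall>k\<ge>j.
     half_ball_dev v b (rad k) x \<nu> \<le> rad m * rad k ^ CARD('n) \<and> half_ball_dev v a (rad k) x (- \<nu>) \<le> rad m * rad k ^ CARD('n))"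
  for \<nu> :: "real^'n"

text \<open>If \<open>v\<close> jumps at \<open>x\<close> to the value \<open>b\<close> on the side of \<open>\<nu>\<close>, the first moment of \<open>{v = b}\<close> around \<open>x\<close>
  points asymptotically in direction \<open>\<nu>\<close>.\<close>

definition jump_normal :: "(real^'n \<Rightarrow> real^'m) \<Rightarrow> real^'m \<Rightarrow> real^'n \<Rightarrow> real^'n" where
  "jump_normal v b x = lim (\<lambda>k. sgn (ball_moment v b (rad k) x))"

lemma integrable_bounded_support:
  fixes f :: "real^'n \<Rightarrow> 'b::{banach, second_countable_topology}"
  assumes "f \<in> borel_measurable borel" "\<And>y. norm (f y) \<le> B" "\<And>y. y \<notin> ball x r \<Longrightarrow> f y = 0"
  shows "integrable lborel f"
proof (rule Bochner_Integration.integrable_bound)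
  have "integrable lborel (indicator (ball x r) :: real^'n \<Rightarrow> real)"
    by (rule integrable_real_indicator) (use emeasure_lborel_ball_finite in auto)
  then show "integrable lborel (\<lambda>y. indicator (ball x r) y * B)" by (rule integrable_mult_left)
  show "AE y in lborel. norm (f y) \<le> norm (indicator (ball x r) y * B)"
  proof (rule AE_I2)
    fix y
    show "norm (f y) \<le> norm (indicator (ball x r) y * B)"
      using assms(2)[of y] assms(3)[of y] by (cases "y \<in> ball x r") auto
  qed
qed (use assms in simp)

section \<open>Half-ball deviations of a bounded function\<close>

context
  fixes v :: "real^'n \<Rightarrow> real^'m" and B :: real
  assumes v[measurable]: "v \<in> borel_measurable borel" and B: "\<And>y. norm (v y) \<le> B"
begin

lemma bound_nonneg: "0 \<le> B + norm b"
  using order_trans[OF norm_ge_zero B[of 0]] by simp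

lemma dev_integrable:
  "integrable lborel (\<lambda>y. if dist x y < r \<and> 0 < (y - x) \<bullet> w then norm (v y - b) else 0)"
proof (rule integrable_bounded_support[where x = x and r = r])
  show "norm (if dist x y < r \<and> 0 < (y - x) \<bullet> w then norm (v y - b) else 0) \<le> B + norm b" for y
    using norm_triangle_ineq4[of "v y" b] B[of y] bound_nonneg[of b] by auto
  have "(\<lambda>y. (y - x) \<bullet> w) \<in> borel_measurable borel"
    by (intro borel_measurable_continuous_onI continuous_intros)
  then have [measurable]: "Measurable.pred borel (\<lambda>y. 0 < (y - x) \<bullet> w)" by measurable
  show "(\<lambda>y. if dist x y < r \<and> 0 < (y - x) \<bullet> w then norm (v y - b) else 0) \<in> borel_measurable borel"
    by measurable
qed auto

lemma dev_nn_integral: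
  "(\<integral>\<^sup>+ y \<in> half_ball x r w. ennreal (norm (v y - b)) \<partial>lborel) = ennreal (half_ball_dev v b r x w)"
proof -
  have "(\<integral>\<^sup>+ y \<in> half_ball x r w. ennreal (norm (v y - b)) \<partial>lborel)
    = (\<integral>\<^sup>+ y. ennreal (if dist x y < r \<and> 0 < (y - x) \<bullet> w then norm (v y - b) else 0) \<partial>lborel)"
    by (intro nn_integral_cong) (auto simp: half_ball_def indicator_def)
  also have "\<dots> = ennreal (half_ball_dev v b r x w)" unfolding half_ball_dev_def
    by (rule nn_integral_eq_integral[OF dev_integrable]) auto
  finally show ?thesis .
qed

lemma dev_nonneg: "0 \<le> half_ball_dev v b r x w"
  unfolding half_ball_dev_def by (intro integral_nonneg_AE) auto

lemma dev_mono: "r \<le> r' \<Longrightarrow> half_ball_dev v b r x w \<le> half_ball_dev v b r' x w"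
  unfolding half_ball_dev_def by (intro integral_mono dev_integrable) auto

text \<open>The deviation is monotone in the radius, and every small radius is within a factor 2 of
  some \<open>rad k\<close>; the comparison costs a factor 2^d, which is taken into the choice of
  \<open>m\<close>.\<close>

lemma dev_limit_iff:
  "((\<lambda>r. (\<integral>\<^sup>+ y \<in> half_ball x r w. ennreal (norm (v y - b)) \<partial>lborel) / ennreal (r ^ CARD('n))) \<longlongrightarrow> 0) (at_right 0)
    \<longleftrightarrow> (\<forall>m. \<exists>j. \<forall>k\<ge>j. half_ball_dev v b (rad k) x w \<le> rad m * rad k ^ CARD('n))" (is "?l \<longleftrightarrow> ?r")
proof
  assume ?l
  show ?r
  proof
    fix m
    have "\<forall>\<^sub>F r in at_right 0. ennreal (half_ball_dev v b r x w) / ennreal (r ^ CARD('n)) < ennreal (rad m)"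
      using \<open>?l\<close> unfolding dev_nn_integral by (rule order_tendstoD(2)) simp
    then obtain e where e: "0 < e" "\<And>r. 0 < r \<Longrightarrow> r < e \<Longrightarrow> ennreal (half_ball_dev v b r x w) / ennreal (r ^ CARD('n)) < ennreal (rad m)"
      unfolding eventually_at_right_field by auto
    obtain j where j: "rad j < e" using nat_approx_posE[OF e(1)] by auto
    have "half_ball_dev v b (rad k) x w \<le> rad m * rad k ^ CARD('n)" if "j \<le> k" for k
    proof -
      have "rad k \<le> rad j" using that by (simp add: frac_le)
      then have "ennreal (half_ball_dev v b (rad k) x w) / ennreal (rad k ^ CARD('n)) < ennreal (rad m)"
        using j by (intro e(2)) auto
      then have "half_ball_dev v b (rad k) x w / rad k ^ CARD('n) < rad m"
        using dev_nonneg by (simp add: divide_ennreal ennreal_less_iff)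
      moreover have "0 < rad k ^ CARD('n)" by simp
      ultimately show ?thesis by (simp only: pos_divide_less_eq less_imp_le)
    qed
    then show "\<exists>j. \<forall>k\<ge>j. half_ball_dev v b (rad k) x w \<le> rad m * rad k ^ CARD('n)" by blast
  qed
next
  assume r: ?r
  show ?l
    unfolding dev_nn_integral
  proof (rule ennreal_tendsto_0I)
    fix e :: real assume e: "0 < e"
    then obtain m where m: "rad m < e / 2 ^ CARD('n)" using nat_approx_posE[of "e / 2 ^ CARD('n)"] by auto
    obtain j where j: "\<And>k. j \<le> k \<Longrightarrow> half_ball_dev v b (rad k) x w \<le> rad m * rad k ^ CARD('n)" using r by blast
    show "\<forall>\<^sub>F r in at_right 0. ennreal (half_ball_dev v b r x w) / ennreal (r ^ CARD('n)) \<le> ennreal e"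
      unfolding eventually_at_right_field
    proof (intro exI[of _ "rad j"] conjI allI impI)
      fix r :: real assume r: "0 < r" "r < rad j"
      \<comment> \<open>The index with \<open>rad (Suc k) < r \<le> rad k\<close>; the subtraction
        of 1 compensates the shift in \<open>rad k = 1 / real (Suc k)\<close>.\<close>
      define k where "k = nat \<lfloor>1 / r\<rfloor> - 1"
      have jr: "real (Suc j) < 1 / r" using r by (simp add: pos_less_divide_eq mult.commute del: of_nat_Suc)
      have fl: "real (nat \<lfloor>1 / r\<rfloor>) \<le> 1 / r" "1 / r < real (nat \<lfloor>1 / r\<rfloor>) + 1" using r by (auto simp: of_nat_nat)
      have "Suc j \<le> nat \<lfloor>1 / r\<rfloor>" using jr by (simp add: le_nat_floor)
      then have k: "j \<le> k" "Suc k = nat \<lfloor>1 / r\<rfloor>" by (auto simp: k_def)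
      have "real (Suc k) \<le> 1 / r" using fl(1) unfolding k(2)[symmetric] .
      then have r1: "r \<le> rad k" using r by (simp add: pos_le_divide_eq mult.commute del: of_nat_Suc)
      have "1 / r < 2 * real (Suc k)" using fl(2) unfolding k(2)[symmetric] by simp
      then have r2: "rad k \<le> 2 * r" using r by (simp add: pos_divide_less_eq pos_divide_le_eq mult_ac less_imp_le del: of_nat_Suc)
      have "half_ball_dev v b r x w \<le> half_ball_dev v b (rad k) x w" by (rule dev_mono[OF r1])
      also have "\<dots> \<le> rad m * rad k ^ CARD('n)" by (rule j[OF k(1)])
      also have "\<dots> \<le> (e / 2 ^ CARD('n)) * (2 * r) ^ CARD('n)"
        using m r2 e by (intro mult_mono power_mono) auto
      also have "\<dots> = e * r ^ CARD('n)" by (simp add: power_mult_distrib)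
      finally have "half_ball_dev v b r x w / r ^ CARD('n) \<le> e" using r by (simp add: pos_divide_le_eq)
      then show "ennreal (half_ball_dev v b r x w) / ennreal (r ^ CARD('n)) \<le> ennreal e"
        using r dev_nonneg by (simp add: divide_ennreal ennreal_leI)
    qed simp
  qed
qed

lemma jump_triple_iff_seq: "jump_triple v x a b \<nu> \<longleftrightarrow> seq_triple v x a b \<nu>"
proof -
  have "(\<forall>m. \<exists>j. \<forall>k\<ge>j. P m k) \<and> (\<forall>m. \<exists>j. \<forall>k\<ge>j. Q m k) \<longleftrightarrow> (\<forall>m. \<exists>j. \<forall>k\<ge>j. P m k \<and> Q m k)" for P Q :: "nat \<Rightarrow> nat \<Rightarrow> bool"
    using eventually_conj_iff[of _ _ sequentially] unfolding eventually_sequentially by metis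
  then show ?thesis unfolding jump_triple_def seq_triple_def dev_limit_iff by simp
qed

text \<open>When the centre moves, the integrand converges at every point off the limiting sphere
  and hyperplane, which are null sets; dominated convergence applies.\<close>

lemma dev_continuous:
  assumes "bounded K" "norm w = 1"
  shows "continuous_on K (\<lambda>x. half_ball_dev v b r x w)"
  unfolding continuous_on_sequentially
proof (intro allI ballI impI)
  fix xs x assume x: "x \<in> K" and xs: "(\<forall>n. xs n \<in> K) \<and> xs \<longlonglongrightarrow> x"
  obtain R where R: "\<And>z. z \<in> K \<Longrightarrow> norm z \<le> R" using assms(1) by (auto simp: bounded_iff)
  let ?f = "\<lambda>x y. if dist x y < r \<and> 0 < (y - x) \<bullet> w then norm (v y - b) else 0"
  have w0: "w \<noteq> 0" using assms(2) by auto
  have "(\<lambda>n. integral\<^sup>L lborel (?f (xs n))) \<longlonglongrightarrow> integral\<^sup>L lborel (?f x)"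
  proof (rule integral_dominated_convergence[where w = "\<lambda>y. indicator (ball 0 (R + r)) y * (B + norm b)"])
    have "integrable lborel (indicator (ball (0::real^'n) (R + r)) :: _ \<Rightarrow> real)"
      by (rule integrable_real_indicator) (use emeasure_lborel_ball_finite in auto)
    then show "integrable lborel (\<lambda>y::real^'n. indicator (ball 0 (R + r)) y * (B + norm b))" by (rule integrable_mult_left)
    have "negligible (sphere x r \<union> {y. w \<bullet> y = w \<bullet> x})"
      using w0 by (intro negligible_Un negligible_sphere negligible_hyperplane) auto
    then have "AE y in lebesgue. y \<notin> sphere x r \<union> {y. w \<bullet> y = w \<bullet> x}"
      unfolding negligible_iff_null_sets by (rule AE_not_in)
    then have "AE y in lborel. y \<notin> sphere x r \<union> {y. w \<bullet> y = w \<bullet> x}"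
      by (simp add: AE_completion_iff)
    then show "AE y in lborel. (\<lambda>n. ?f (xs n) y) \<longlonglongrightarrow> ?f x y"
    proof eventually_elim
      case (elim y)
      have l1: "(\<lambda>n. dist (xs n) y) \<longlonglongrightarrow> dist x y" using xs by (intro tendsto_intros) auto
      have l2: "(\<lambda>n. (y - xs n) \<bullet> w) \<longlonglongrightarrow> (y - x) \<bullet> w" using xs by (intro tendsto_intros) auto
      have "(y - x) \<bullet> w = w \<bullet> y - w \<bullet> x" by (simp add: inner_diff_right inner_commute[of _ w])
      then have "dist x y \<noteq> r" "(y - x) \<bullet> w \<noteq> 0" using elim by auto
      then have "\<forall>\<^sub>F n in sequentially. (dist (xs n) y < r \<longleftrightarrow> dist x y < r)" "\<forall>\<^sub>F n in sequentially. (0 < (y - xs n) \<bullet> w \<longleftrightarrow> 0 < (y - x) \<bullet> w)"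
        using tendsto_eventually_less_iff[OF l1] tendsto_eventually_less_iff[OF l2] by blast+
      then have "\<forall>\<^sub>F n in sequentially. ?f (xs n) y = ?f x y" by eventually_elim simp
      then show ?case by (rule tendsto_eventually)
    qed
    show "AE y in lborel. norm (?f (xs n) y) \<le> indicator (ball 0 (R + r)) y * (B + norm b)" for n
    proof (rule AE_I2)
      fix y
      have "norm (v y - b) \<le> B + norm b" using norm_triangle_ineq4[of "v y" b] B[of y] by linarith
      moreover have "y \<in> ball 0 (R + r)" if "dist (xs n) y < r"
        using that R[of "xs n"] xs norm_triangle_ineq2[of y "xs n"] by (auto simp: dist_norm norm_minus_commute)
      ultimately show "norm (?f (xs n) y) \<le> indicator (ball 0 (R + r)) y * (B + norm b)"
        using bound_nonneg[of b] by (auto simp: indicator_def)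
    qed
  qed measurable
  then show "((\<lambda>x. half_ball_dev v b r x w) \<circ> xs) \<longlonglongrightarrow> half_ball_dev v b r x w"
    by (simp add: half_ball_dev_def comp_def)
qed

lemma dev_lower_bound:
  assumes "ball p \<rho> \<subseteq> half_ball x r w" "ball p \<rho> \<subseteq> half_ball x' r' w'" "0 < \<rho>"
  shows "norm (a - b) * (unit_ball_vol (real CARD('n)) * \<rho> ^ CARD('n)) \<le> half_ball_dev v a r x w + half_ball_dev v b r' x' w'"
proof -
  let ?b = "indicator (ball p \<rho>) :: real^'n \<Rightarrow> real"
  have ib: "integrable lborel ?b" by (rule integrable_real_indicator) (use emeasure_lborel_ball_finite in auto)
  have "norm (a - b) * (unit_ball_vol (real CARD('n)) * \<rho> ^ CARD('n)) = (\<integral>y. ?b y * norm (a - b) \<partial>lborel)"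
    using emeasure_ball_scale[OF assms(3), of p] assms(3) by (simp add: measure_def)
  also have "\<dots> \<le> (\<integral>y. (if dist x y < r \<and> 0 < (y - x) \<bullet> w then norm (v y - a) else 0) + (if dist x' y < r' \<and> 0 < (y - x') \<bullet> w' then norm (v y - b) else 0) \<partial>lborel)"
  proof (intro integral_mono integrable_mult_left ib Bochner_Integration.integrable_add dev_integrable)
    fix y
    have "norm (a - b) \<le> norm (v y - a) + norm (v y - b)"
      using norm_triangle_ineq4[of "v y - b" "v y - a"] unfolding diff_diff_eq2 by (simp add: add.commute)
    moreover have "(dist x y < r \<and> 0 < (y - x) \<bullet> w) \<and> (dist x' y < r' \<and> 0 < (y - x') \<bullet> w')" if "y \<in> ball p \<rho>"
      using subsetD[OF assms(1) that] subsetD[OF assms(2) that] by (simp add: half_ball_def)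
    ultimately show "?b y * norm (a - b) \<le> (if dist x y < r \<and> 0 < (y - x) \<bullet> w then norm (v y - a) else 0) + (if dist x' y < r' \<and> 0 < (y - x') \<bullet> w' then norm (v y - b) else 0)"
      by (auto simp: indicator_def)
  qed
  also have "\<dots> = half_ball_dev v a r x w + half_ball_dev v b r' x' w'"
    unfolding half_ball_dev_def by (intro Bochner_Integration.integral_add dev_integrable)
  finally show ?thesis .
qed

text \<open>Two points satisfying the deviation bounds below cannot be far apart in direction \<open>w\<close>: between them lies a ball which
  belongs to the positive half ball of one and to the negative half ball of the other.\<close>

lemma dev_cone_aux:
  assumes w: "norm w = 1" and \<theta>: "0 < \<theta>" "\<theta> \<le> 1" and ab: "a \<noteq> b"
    and \<epsilon>: "2 * \<epsilon> < norm (a - b) * (unit_ball_vol (real CARD('n)) * (\<theta> / 8) ^ CARD('n))"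
    and x: "\<And>k. k \<ge> j \<Longrightarrow> half_ball_dev v b (rad k) x w \<le> \<epsilon> * rad k ^ CARD('n)"
    and x': "\<And>k. k \<ge> j \<Longrightarrow> half_ball_dev v a (rad k) x' (- w) \<le> \<epsilon> * rad k ^ CARD('n)"
    and close: "norm (x' - x) \<le> 1 / (4 * real (Suc j))"
  shows "(x' - x) \<bullet> w \<le> \<theta> * norm (x' - x)"
proof (rule ccontr)
  assume "\<not> ?thesis"
  then have far: "\<theta> * norm (x' - x) < (x' - x) \<bullet> w" by simp
  define \<rho> where "\<rho> = norm (x' - x)"
  have \<rho>: "0 < \<rho>" using far by (cases "x' = x") (auto simp: \<rho>_def)
  \<comment> \<open>The radius \<open>r = rad k\<close> is selected with
    \<open>2 * \<rho> \<le> r\<close> and \<open>r \<le> 4 * \<rho>\<close>. The second bound makes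
    \<open>\<theta> * \<rho> / 2\<close> at least \<open>\<theta> * r / 8\<close>, which is the
    origin of the 8 in the assumption on \<open>\<epsilon>\<close>.\<close>
  define k where "k = nat \<lfloor>1 / (2 * \<rho>)\<rfloor> - 1"
  have big: "2 * real (Suc j) \<le> 1 / (2 * \<rho>)" using close \<rho> unfolding \<rho>_def[symmetric] by (simp add: field_simps)
  have fl: "real (nat \<lfloor>1 / (2 * \<rho>)\<rfloor>) \<le> 1 / (2 * \<rho>)" "1 / (2 * \<rho>) < real (nat \<lfloor>1 / (2 * \<rho>)\<rfloor>) + 1"
    using \<rho> by (auto simp: of_nat_nat)
  have "Suc j \<le> nat \<lfloor>1 / (2 * \<rho>)\<rfloor>" using big by (intro le_nat_floor) (simp add: )
  then have k: "j \<le> k" "Suc k = nat \<lfloor>1 / (2 * \<rho>)\<rfloor>" by (auto simp: k_def)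
  define r where "r = rad k"
  have r0: "0 < r" by (simp add: r_def)
  have sk: "real (Suc k) \<le> 1 / (2 * \<rho>)" "1 / (2 * \<rho>) < real (Suc k) + 1" using fl unfolding k(2)[symmetric] by auto
  have r1: "2 * \<rho> \<le> r" using sk(1) \<rho> unfolding r_def by (simp add: field_simps)
  have "1 / (2 * \<rho>) < 2 * real (Suc k)" using sk(2) by simp
  then have r2: "r \<le> 4 * \<rho>" using \<rho> unfolding r_def by (simp add: field_simps)
  \<comment> \<open>Centre of the common ball. In direction \<open>w\<close> the point
    \<open>x'\<close> lies more than \<open>\<theta> * \<rho>\<close> beyond \<open>x\<close>, so
    stepping back by half of this leaves room for radius \<open>\<theta> * \<rho> / 2\<close> on
    both sides.\<close>
  define p where "p = x' - (\<theta> * \<rho> / 2) *\<^sub>R w"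
  have ww: "w \<bullet> w = 1" using w by (simp add: dot_square_norm)
  have sub1: "ball p (\<theta> * \<rho> / 2) \<subseteq> half_ball x r w"
  proof
    fix y assume y: "y \<in> ball p (\<theta> * \<rho> / 2)"
    define z where "z = y - p"
    have z: "norm z < \<theta> * \<rho> / 2" using y by (simp add: z_def dist_norm norm_minus_commute)
    have yx: "y - x = (x' - x) - (\<theta> * \<rho> / 2) *\<^sub>R w + z" by (simp add: z_def p_def)
    have "norm (y - x) \<le> \<rho> + \<theta> * \<rho> / 2 + norm z"
      unfolding yx using norm_triangle_ineq[of "(x' - x) - (\<theta> * \<rho> / 2) *\<^sub>R w" z] norm_triangle_ineq4[of "x' - x" "(\<theta> * \<rho> / 2) *\<^sub>R w"] w \<theta> \<rho>
      by (simp add: \<rho>_def)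
    also have "\<dots> < \<rho> + \<theta> * \<rho>" using z by simp
    also have "\<dots> \<le> r" using r1 mult_right_mono[OF \<theta>(2) less_imp_le[OF \<rho>]] \<rho> by linarith
    finally have "norm (y - x) < r" .
    moreover have "\<bar>z \<bullet> w\<bar> \<le> norm z" using Cauchy_Schwarz_ineq2[of z w] w by simp
    then have "0 < (y - x) \<bullet> w"
      unfolding yx using far z ww unfolding \<rho>_def[symmetric] by (simp add: inner_add_left inner_diff_left abs_le_iff)
    ultimately show "y \<in> half_ball x r w" by (simp add: half_ball_def dist_norm norm_minus_commute)
  qed
  have sub2: "ball p (\<theta> * \<rho> / 2) \<subseteq> half_ball x' r (- w)"
  proof
    fix y assume y: "y \<in> ball p (\<theta> * \<rho> / 2)"
    define z where "z = y - p"
    have z: "norm z < \<theta> * \<rho> / 2" using y by (simp add: z_def dist_norm norm_minus_commute)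
    have yx: "y - x' = z - (\<theta> * \<rho> / 2) *\<^sub>R w" by (simp add: z_def p_def)
    have "norm (y - x') \<le> norm z + \<theta> * \<rho> / 2"
      unfolding yx using norm_triangle_ineq4[of z "(\<theta> * \<rho> / 2) *\<^sub>R w"] w \<theta> \<rho> by simp
    also have "\<dots> < \<theta> * \<rho>" using z by simp
    also have "\<dots> \<le> r" using r1 mult_right_mono[OF \<theta>(2) less_imp_le[OF \<rho>]] \<rho> by linarith
    finally have "norm (y - x') < r" .
    moreover have "\<bar>z \<bullet> w\<bar> \<le> norm z" using Cauchy_Schwarz_ineq2[of z w] w by simp
    then have "(y - x') \<bullet> w < 0"
      unfolding yx using z ww by (simp add: inner_diff_left abs_le_iff)
    ultimately show "y \<in> half_ball x' r (- w)" by (simp add: half_ball_def dist_norm norm_minus_commute)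
  qed
  let ?V = "unit_ball_vol (real CARD('n))"
  have "norm (b - a) * (?V * (\<theta> * \<rho> / 2) ^ CARD('n)) \<le> half_ball_dev v b r x w + half_ball_dev v a r x' (- w)"
    using \<theta> \<rho> by (intro dev_lower_bound[OF sub1 sub2]) simp
  also have "\<dots> \<le> 2 * \<epsilon> * r ^ CARD('n)" using x[OF k(1)] x'[OF k(1)] unfolding r_def by simp
  also have "\<dots> < norm (a - b) * (?V * (\<theta> / 8) ^ CARD('n)) * r ^ CARD('n)"
    using \<epsilon> r0 by (intro mult_strict_right_mono) auto
  also have "\<dots> = norm (a - b) * (?V * (\<theta> * r / 8) ^ CARD('n))" by (simp add: power_mult_distrib power_divide)
  also have "\<dots> \<le> norm (a - b) * (?V * (\<theta> * \<rho> / 2) ^ CARD('n))"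
    using r2 \<theta> \<rho> r0 by (intro mult_left_mono power_mono) auto
  finally show False by (simp add: norm_minus_commute)
qed

text \<open>The points gained by tilting the half ball lie in a slab of thickness
  \<open>r / N\<close>, whose volume is at most 1 / N of that of the ball with doubled
  radius.\<close>

lemma dev_tilt:
  assumes \<nu>: "norm \<nu> = 1" and w: "norm w = 1" and N: "0 < N" "norm (w - \<nu>) \<le> 1 / real N" and r: "0 < r"
  shows "half_ball_dev v b r x w \<le> half_ball_dev v b r x \<nu> + (B + norm b) * (unit_ball_vol (real CARD('n)) * 2 ^ CARD('n) / N) * r ^ CARD('n)"
proof -
  define S where "S = {z \<in> ball x r. x \<bullet> \<nu> - r / N < z \<bullet> \<nu> \<and> z \<bullet> \<nu> \<le> x \<bullet> \<nu> - r / N + r / N}"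
  have Sb: "S \<in> sets borel" unfolding S_def by measurable
  note B0 = bound_nonneg[of b]
  have "real N * measure lborel S \<le> measure lborel (ball x (r + N * (r / N)))"
    by (rule slab_volume[OF Sb _ \<nu>]) (use r N in \<open>auto simp: S_def\<close>)
  also have "ball x (r + N * (r / N)) = ball x (2 * r)" using N by simp
  also have "measure lborel (ball x (2 * r)) = unit_ball_vol (real CARD('n)) * (2 * r) ^ CARD('n)"
    using emeasure_ball_scale[of "2 * r" x] r by (simp add: measure_def)
  finally have Sv: "measure lborel S \<le> unit_ball_vol (real CARD('n)) * 2 ^ CARD('n) / N * r ^ CARD('n)"
    using N by (simp add: field_simps power_mult_distrib)
  have iS: "integrable lborel (indicator S :: _ \<Rightarrow> real)"
  proof (rule integrable_real_indicator)
    show "emeasure lborel S < \<infinity>"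
      by (rule le_less_trans[OF emeasure_mono emeasure_lborel_ball_finite[of x r]]) (auto simp: S_def)
  qed (use Sb in simp)
  have "half_ball_dev v b r x w \<le> (\<integral>y. (if dist x y < r \<and> 0 < (y - x) \<bullet> \<nu> then norm (v y - b) else 0) + (B + norm b) * indicator S y \<partial>lborel)"
    unfolding half_ball_dev_def
  proof (intro integral_mono dev_integrable Bochner_Integration.integrable_add integrable_mult_right iS)
    fix y
    have nb: "norm (v y - b) \<le> B + norm b" using norm_triangle_ineq4[of "v y" b] B[of y] by linarith
    have "y \<in> S" if y: "dist x y < r" "0 < (y - x) \<bullet> w" "\<not> 0 < (y - x) \<bullet> \<nu>"
    proof -
      have "\<bar>(y - x) \<bullet> (w - \<nu>)\<bar> \<le> norm (y - x) * norm (w - \<nu>)" by (rule Cauchy_Schwarz_ineq2)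
      also have "\<dots> \<le> norm (y - x) * (1 / N)" using N by (intro mult_left_mono) auto
      also have "\<dots> < r * (1 / N)" using y(1) N by (intro mult_strict_right_mono) (auto simp: dist_norm norm_minus_commute)
      finally have "(y - x) \<bullet> w - (y - x) \<bullet> \<nu> < r / N" by (simp add: inner_diff_right)
      then show ?thesis using y by (auto simp: S_def inner_diff_left)
    qed
    then show "(if dist x y < r \<and> 0 < (y - x) \<bullet> w then norm (v y - b) else 0)
      \<le> (if dist x y < r \<and> 0 < (y - x) \<bullet> \<nu> then norm (v y - b) else 0) + (B + norm b) * indicator S y"
      using nb B0 by (auto simp: indicator_def)
  qed
  also have "\<dots> = half_ball_dev v b r x \<nu> + (B + norm b) * measure lborel S"
    using iS dev_integrable Sb unfolding half_ball_dev_def by (subst Bochner_Integration.integral_add) auto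
  also have "\<dots> \<le> half_ball_dev v b r x \<nu> + (B + norm b) * (unit_ball_vol (real CARD('n)) * 2 ^ CARD('n) / N * r ^ CARD('n))"
    using Sv B0 by (intro add_left_mono mult_left_mono) auto
  finally show ?thesis by (simp add: mult.assoc)
qed

end

section \<open>Jumps of functions with finitely many values\<close>

lemma finite_separated:
  fixes M :: "'a::real_normed_vector set"
  assumes "finite M"
  shows "\<exists>\<delta>>0. \<forall>a\<in>M. \<forall>b\<in>M. a \<noteq> b \<longrightarrow> \<delta> \<le> norm (a - b)"
proof -
  define S where "S = insert 1 ((\<lambda>(a, b). norm (a - b)) ` {(a, b). (a, b) \<in> M \<times> M \<and> a \<noteq> b})"
  have "finite ({(a, b). (a, b) \<in> M \<times> M \<and> a \<noteq> b})" by (rule finite_subset[OF _ finite_cartesian_product[OF assms assms]]) auto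
  then have S: "finite S" "S \<noteq> {}" by (auto simp: S_def)
  have "0 < Min S" using S by (subst Min_gr_iff) (auto simp: S_def)
  moreover have "Min S \<le> norm (a - b)" if "a \<in> M" "b \<in> M" "a \<noteq> b" for a b
    using S that by (intro Min_le) (auto simp: S_def)
  ultimately show ?thesis by blast
qed

context
  fixes v :: "real^'n \<Rightarrow> real^'m" and M :: "(real^'m) set"
  assumes v[measurable]: "v \<in> borel_measurable borel" and vM: "\<And>y. v y \<in> M" and M: "finite M"
begin

lemma v_bounded: "\<exists>B. \<forall>y. norm (v y) \<le> B"
  using finite_imp_bounded[OF M] vM by (auto simp: bounded_iff)

text \<open>A finite set is closed. A limit value outside \<open>M\<close> would have positive
  distance from all values of \<open>v\<close>, and the deviation on a ball inside the half ball
  would stay of full order.\<close>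

lemma jump_value_in_M:
  assumes "jump_triple v x a b \<nu>"
  shows "a \<in> M" "b \<in> M"
proof -
  obtain B where B: "\<And>y. norm (v y) \<le> B" using v_bounded by blast
  have *: "c \<in> M" if w: "norm w = 1" and small: "\<forall>m. \<exists>j. \<forall>k\<ge>j. half_ball_dev v c (rad k) x w \<le> rad m * rad k ^ CARD('n)" for c w
  proof (rule ccontr)
    assume "c \<notin> M"
    obtain \<delta> where \<delta>: "0 < \<delta>" "\<And>z. z \<in> M \<Longrightarrow> \<delta> \<le> norm (z - c)"
    proof -
      have "closed M" using M by (rule finite_imp_closed)
      then obtain d where d: "0 < d" "\<And>y. y \<in> M \<Longrightarrow> d \<le> dist c y" using separate_point_closed[OF _ \<open>c \<notin> M\<close>] by blast
      show ?thesis by (rule that[OF d(1)]) (use d(2) in \<open>auto simp: dist_norm norm_minus_commute\<close>)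
    qed
    let ?V = "unit_ball_vol (real CARD('n)) * (1 / 2) ^ CARD('n)"
    have V: "0 < ?V" by simp
    obtain m where m: "rad m < \<delta> * ?V" using nat_approx_posE[of "\<delta> * ?V"] \<delta> V by (metis mult_pos_pos)
    obtain j where j: "half_ball_dev v c (rad j) x w \<le> rad m * rad j ^ CARD('n)" using small by blast
    define p where "p = x + (rad j / 2) *\<^sub>R w"
    have sub: "ball p (rad j / 2) \<subseteq> half_ball x (rad j) w" unfolding p_def
      by (rule half_ball_contains_ball[OF w rad_pos])
    have ib: "integrable lborel (indicator (ball p (rad j / 2)) :: _ \<Rightarrow> real)"
      by (rule integrable_real_indicator) (use emeasure_lborel_ball_finite in auto)
    have "\<delta> * (?V * rad j ^ CARD('n)) = \<delta> * measure lborel (ball p (rad j / 2))"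
      using emeasure_ball_scale[of "rad j / 2" p] by (simp add: measure_def power_divide del: of_nat_Suc)
    also have "\<dots> = (\<integral>y. indicator (ball p (rad j / 2)) y * \<delta> \<partial>lborel)" by simp
    also have "\<dots> \<le> half_ball_dev v c (rad j) x w" unfolding half_ball_dev_def
    proof (intro integral_mono integrable_mult_left ib dev_integrable[OF v B])
      fix y
      have "dist x y < rad j \<and> 0 < (y - x) \<bullet> w" if "y \<in> ball p (rad j / 2)"
        using subsetD[OF sub that] by (simp add: half_ball_def)
      then show "indicator (ball p (rad j / 2)) y * \<delta> \<le> (if dist x y < rad j \<and> 0 < (y - x) \<bullet> w then norm (v y - c) else 0)"
        using \<delta>(2)[OF vM[of y]] by (auto simp: indicator_def)
    qed
    also have "\<dots> \<le> rad m * rad j ^ CARD('n)" by (rule j)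
    also have "\<dots> < (\<delta> * ?V) * rad j ^ CARD('n)" using m by (intro mult_strict_right_mono) auto
    finally show False by (simp add: mult.assoc)
  qed
  have t: "seq_triple v x a b \<nu>" using assms jump_triple_iff_seq[OF v B] by simp
  have s1: "\<forall>m. \<exists>j. \<forall>k\<ge>j. half_ball_dev v b (rad k) x \<nu> \<le> rad m * rad k ^ CARD('n)"
    and s2: "\<forall>m. \<exists>j. \<forall>k\<ge>j. half_ball_dev v a (rad k) x (- \<nu>) \<le> rad m * rad k ^ CARD('n)"
    and n: "norm \<nu> = 1"
    using t unfolding seq_triple_def by blast+
  show "b \<in> M" by (rule *[OF n s1])
  show "a \<in> M" by (rule *[OF _ s2]) (use n in simp)
qed

text \<open>The half ball is invariant under the half-turn \<open>R\<close> about the axis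
  \<open>\<nu>\<close>, so its first moment is fixed by \<open>R\<close> and hence parallel to
  \<open>\<nu>\<close>. The lower bound comes from a small ball on which the component along
  \<open>\<nu>\<close> is at least \<open>r / 4\<close>.\<close>

lemma half_ball_integral_direction:
  fixes x \<nu> :: "real^'n"
  assumes \<nu>: "norm \<nu> = 1" and r: "0 < r"
  shows "\<exists>\<kappa>. unit_ball_vol (real CARD('n)) * (1 / 4) ^ CARD('n) / 4 * (r * r ^ CARD('n)) \<le> \<kappa> \<and>
    (\<integral>y. (if dist x y < r \<and> 0 < (y - x) \<bullet> \<nu> then y - x else 0) \<partial>lborel) = \<kappa> *\<^sub>R \<nu>"
proof -
  define h where "h z = (if norm z < r \<and> 0 < z \<bullet> \<nu> then z else 0)" for z :: "real^'n"
  have [measurable]: "h \<in> borel_measurable borel" unfolding h_def[abs_def] by measurable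
  have ih: "integrable lborel h"
    by (rule integrable_bounded_support[where x = 0 and r = r and B = r]) (use r in \<open>auto simp: h_def\<close>)
  have "(\<integral>y. (if dist x y < r \<and> 0 < (y - x) \<bullet> \<nu> then y - x else 0) \<partial>lborel) = (\<integral>y. h (- x + y) \<partial>lborel)"
    by (intro Bochner_Integration.integral_cong) (auto simp: h_def dist_norm norm_minus_commute)
  also have "\<dots> = integral\<^sup>L (distr lborel borel ((+) (- x))) h" by (rule integral_distr[symmetric]) auto
  also have "\<dots> = integral\<^sup>L lborel h" by (simp only: lborel_distr_plus)
  finally have shift: "(\<integral>y. (if dist x y < r \<and> 0 < (y - x) \<bullet> \<nu> then y - x else 0) \<partial>lborel) = integral\<^sup>L lborel h" .
  define R where "R z = (2 * (z \<bullet> \<nu>)) *\<^sub>R \<nu> - z" for z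
  have nn: "\<nu> \<bullet> \<nu> = 1" using \<nu> by (simp add: dot_square_norm)
  have R: "orthogonal_transformation R" unfolding orthogonal_transformation_def
  proof
    show "linear R" unfolding R_def by (rule linearI) (auto simp: inner_add_left algebra_simps)
    show "\<forall>z w. R z \<bullet> R w = z \<bullet> w"
      by (simp add: R_def inner_diff_left inner_diff_right nn inner_commute algebra_simps)
  qed
  have Rm[measurable]: "R \<in> borel_measurable borel" unfolding R_def[abs_def] by measurable
  have hR: "h (R z) = (2 * (h z \<bullet> \<nu>)) *\<^sub>R \<nu> - h z" for z
  proof -
    have "norm (R z) = norm z" by (rule orthogonal_transformation_norm[OF R])
    moreover have "R z \<bullet> \<nu> = z \<bullet> \<nu>" by (simp add: R_def inner_diff_left nn)
    ultimately show ?thesis by (simp add: h_def) (simp add: R_def)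
  qed
  have "integral\<^sup>L lborel h = integral\<^sup>L (distr lborel borel R) h" by (simp only: distr_lborel_orthogonal[OF R])
  also have "\<dots> = (\<integral>z. h (R z) \<partial>lborel)" by (rule integral_distr) auto
  also have "\<dots> = (\<integral>z. (2 * (h z \<bullet> \<nu>)) *\<^sub>R \<nu> - h z \<partial>lborel)" by (simp only: hR)
  also have "\<dots> = (2 * (\<integral>z. h z \<bullet> \<nu> \<partial>lborel)) *\<^sub>R \<nu> - integral\<^sup>L lborel h"
    using ih by (subst Bochner_Integration.integral_diff) auto
  finally have "2 *\<^sub>R integral\<^sup>L lborel h = (2 * (\<integral>z. h z \<bullet> \<nu> \<partial>lborel)) *\<^sub>R \<nu>" by (simp add: scaleR_2 eq_diff_eq)
  then have eq: "integral\<^sup>L lborel h = (\<integral>z. h z \<bullet> \<nu> \<partial>lborel) *\<^sub>R \<nu>"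
    by (metis (no_types, lifting) scaleR_scaleR scaleR_left_imp_eq zero_neq_numeral)
  define p where "p = (r / 2) *\<^sub>R \<nu>"
  have sub: "norm z < r \<and> r / 4 \<le> z \<bullet> \<nu>" if "z \<in> ball p (r / 4)" for z
  proof -
    define e where "e = z - p"
    have e: "norm e < r / 4" "z = p + e" using that by (auto simp: e_def dist_norm norm_minus_commute)
    have "norm z \<le> norm p + norm e" unfolding e(2) by (rule norm_triangle_ineq)
    moreover have "norm p = r / 2" using \<nu> r by (simp add: p_def)
    moreover have "\<bar>e \<bullet> \<nu>\<bar> \<le> norm e" using Cauchy_Schwarz_ineq2[of e \<nu>] \<nu> by simp
    moreover have "z \<bullet> \<nu> = r / 2 + e \<bullet> \<nu>" unfolding e(2) by (simp add: p_def inner_add_left nn)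
    ultimately show ?thesis using e(1) r by auto
  qed
  have ib: "integrable lborel (indicator (ball p (r / 4)) :: _ \<Rightarrow> real)"
    by (rule integrable_real_indicator) (use emeasure_lborel_ball_finite in auto)
  have "unit_ball_vol (real CARD('n)) * (1 / 4) ^ CARD('n) / 4 * (r * r ^ CARD('n)) = measure lborel (ball p (r / 4)) * (r / 4)"
    using emeasure_ball_scale[of "r / 4" p] r by (simp add: measure_def power_divide)
  also have "\<dots> = (\<integral>z. indicator (ball p (r / 4)) z * (r / 4) \<partial>lborel)" by simp
  also have "\<dots> \<le> (\<integral>z. h z \<bullet> \<nu> \<partial>lborel)"
  proof (intro integral_mono integrable_mult_left ib integrable_inner_left ih)
    fix z
    show "indicator (ball p (r / 4)) z * (r / 4) \<le> h z \<bullet> \<nu>"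
    proof (cases "z \<in> ball p (r / 4)")
      case True
      then show ?thesis using sub[OF True] r by (simp add: h_def)
    qed (simp add: h_def less_imp_le)
  qed
  finally show ?thesis using eq shift by auto
qed

text \<open>Distinct values in \<open>M\<close> are at distance at least \<open>\<delta>\<close>, so
  each point where the set {v = b} disagrees with the half ball adds at least
  \<open>\<delta>\<close> to one of the deviations. The two first moments therefore differ by
  o(r^(d+1)), while that of the half ball is at least of order r^(d+1).\<close>

lemma jump_normal_eq:
  assumes "jump_triple v x a b \<nu>"
  shows "(\<lambda>k. sgn (ball_moment v b (rad k) x)) \<longlonglongrightarrow> \<nu>" "jump_normal v b x = \<nu>"
proof -
  obtain B where B: "\<And>y. norm (v y) \<le> B" using v_bounded by blast
  obtain \<delta> where \<delta>: "0 < \<delta>" "\<And>a b. a \<in> M \<Longrightarrow> b \<in> M \<Longrightarrow> a \<noteq> b \<Longrightarrow> \<delta> \<le> norm (a - b)" using finite_separated[OF M] by blast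
  have t: "seq_triple v x a b \<nu>" using assms jump_triple_iff_seq[OF v B] by simp
  then have ab: "a \<noteq> b" and \<nu>: "norm \<nu> = 1" by (auto simp: seq_triple_def)
  have abM: "a \<in> M" "b \<in> M" using jump_value_in_M[OF assms] by auto
  let ?c = "unit_ball_vol (real CARD('n)) * (1 / 4) ^ CARD('n) / 4"
  have c: "0 < ?c" by simp
  have "\<exists>\<kappa>. ?c * (rad k * rad k ^ CARD('n)) \<le> \<kappa> \<and>
    (\<integral>y. (if dist x y < rad k \<and> 0 < (y - x) \<bullet> \<nu> then y - x else 0) \<partial>lborel) = \<kappa> *\<^sub>R \<nu>" for k
    by (rule half_ball_integral_direction[OF \<nu> rad_pos])
  then obtain \<kappa> where \<kappa>: "\<And>k. ?c * (rad k * rad k ^ CARD('n)) \<le> \<kappa> k"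
    "\<And>k. (\<integral>y. (if dist x y < rad k \<and> 0 < (y - x) \<bullet> \<nu> then y - x else 0) \<partial>lborel) = \<kappa> k *\<^sub>R \<nu>" by metis
  have \<kappa>0: "0 < \<kappa> k" for k using \<kappa>(1)[of k] c by (metis less_le_trans mult_pos_pos rad_pos zero_less_power)
  define dv where "dv k = half_ball_dev v b (rad k) x \<nu> + half_ball_dev v a (rad k) x (- \<nu>)" for k
  have dv0: "0 \<le> dv k" for k unfolding dv_def by (intro add_nonneg_nonneg dev_nonneg[OF v B])
  have close: "norm (ball_moment v b (rad k) x - \<kappa> k *\<^sub>R \<nu>) \<le> rad k / \<delta> * dv k" for k
  proof -
    let ?r = "rad k"
    let ?f = "\<lambda>y. if dist x y < ?r \<and> v y = b then y - x else 0"
    let ?g = "\<lambda>y. if dist x y < ?r \<and> 0 < (y - x) \<bullet> \<nu> then y - x else 0"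
    have i1: "integrable lborel ?f" and i2: "integrable lborel ?g"
      by (rule integrable_bounded_support[where x = x and r = ?r and B = ?r], measurable, auto simp: dist_norm norm_minus_commute)+
    let ?e = "\<lambda>y. (if dist x y < ?r \<and> 0 < (y - x) \<bullet> \<nu> then norm (v y - b) else 0) + (if dist x y < ?r \<and> 0 < (y - x) \<bullet> (- \<nu>) then norm (v y - a) else 0)"
    have ie: "integrable lborel ?e" by (intro Bochner_Integration.integrable_add dev_integrable[OF v B])
    have "\<nu> \<noteq> 0" using \<nu> by auto
    then have "negligible {y. \<nu> \<bullet> y = \<nu> \<bullet> x}" by (intro negligible_hyperplane) auto
    then have "AE y in lebesgue. y \<notin> {y. \<nu> \<bullet> y = \<nu> \<bullet> x}" unfolding negligible_iff_null_sets by (rule AE_not_in)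
    then have ae: "AE y in lborel. y \<notin> {y. \<nu> \<bullet> y = \<nu> \<bullet> x}" by (simp add: AE_completion_iff)
    have "norm (integral\<^sup>L lborel ?f - integral\<^sup>L lborel ?g) = norm (\<integral>y. ?f y - ?g y \<partial>lborel)"
      using i1 i2 by (subst Bochner_Integration.integral_diff) auto
    also have "\<dots> \<le> (\<integral>y. norm (?f y - ?g y) \<partial>lborel)" by (rule integral_norm_bound)
    also have "\<dots> \<le> (\<integral>y. ?r / \<delta> * ?e y \<partial>lborel)"
    proof (rule integral_mono_AE)
      show "integrable lborel (\<lambda>y. norm (?f y - ?g y))" using i1 i2 by auto
      show "integrable lborel (\<lambda>y. ?r / \<delta> * ?e y)" using ie by (rule integrable_mult_right)
      show "AE y in lborel. norm (?f y - ?g y) \<le> ?r / \<delta> * ?e y"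
        using ae
      proof eventually_elim
        case (elim y)
        have "(y - x) \<bullet> \<nu> \<noteq> 0" using elim by (auto simp: inner_diff_right inner_diff_left inner_commute[of _ \<nu>])
        then have side: "0 < (y - x) \<bullet> \<nu> \<or> 0 < (y - x) \<bullet> (- \<nu>)" by auto
        have big: "?r \<le> ?r / \<delta> * norm (v y - c)" if "v y \<noteq> c" "c \<in> M" for c
        proof -
          have "?r / \<delta> * \<delta> \<le> ?r / \<delta> * norm (v y - c)" using \<delta>(2)[OF vM that(2) that(1)] \<delta>(1) by (intro mult_left_mono) auto
          then show ?thesis using \<delta>(1) by simp
        qed
        have e0: "0 \<le> ?r / \<delta> * ?e y" using \<delta>(1) by (intro mult_nonneg_nonneg) auto
        show ?case
        proof (cases "dist x y < ?r")
          case True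
          then have yr: "norm (y - x) \<le> ?r" "norm (x - y) \<le> ?r" by (simp_all add: dist_norm norm_minus_commute)
          show ?thesis
          proof (cases "0 < (y - x) \<bullet> \<nu>")
            case pos: True
            then show ?thesis using True yr big[of b] abM e0 by (cases "v y = b") (auto intro: order_trans)
          next
            case neg: False
            then have "0 < (y - x) \<bullet> (- \<nu>)" using side by blast
            then show ?thesis using True neg yr big[of a] abM ab e0 by (cases "v y = b") (auto intro: order_trans)
          qed
        next
          case False
          then show ?thesis by simp
        qed
      qed
    qed
    also have "\<dots> = ?r / \<delta> * dv k" unfolding dv_def half_ball_dev_def
      by (subst integral_mult_right_zero, subst Bochner_Integration.integral_add[OF dev_integrable[OF v B] dev_integrable[OF v B]]) simp
    finally show ?thesis unfolding ball_moment_def \<kappa>(2) .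
  qed
  have dvlim: "(\<lambda>k. dv k / rad k ^ CARD('n)) \<longlonglongrightarrow> 0"
  proof (rule LIMSEQ_I)
    fix e :: real assume "0 < e"
    then have "0 < e / 2" by simp
    then obtain m where m: "rad m < e / 2" by (rule nat_approx_posE)
    obtain j where j: "\<And>k. k \<ge> j \<Longrightarrow> half_ball_dev v b (rad k) x \<nu> \<le> rad m * rad k ^ CARD('n) \<and> half_ball_dev v a (rad k) x (- \<nu>) \<le> rad m * rad k ^ CARD('n)"
      using t unfolding seq_triple_def by blast
    show "\<exists>j. \<forall>k\<ge>j. norm (dv k / rad k ^ CARD('n) - 0) < e"
    proof (intro exI[of _ j] allI impI)
      fix k assume "j \<le> k"
      have rk: "0 < rad k ^ CARD('n)" by simp
      have "dv k \<le> 2 * rad m * rad k ^ CARD('n)" using j[OF \<open>j \<le> k\<close>] unfolding dv_def by linarith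
      then have "dv k / rad k ^ CARD('n) \<le> 2 * rad m" using rk by (simp only: pos_divide_le_eq)
      then show "norm (dv k / rad k ^ CARD('n) - 0) < e" using m dv0[of k] by simp
    qed
  qed
  define z where "z k = (1 / \<kappa> k) *\<^sub>R ball_moment v b (rad k) x" for k
  have "(\<lambda>k. z k - \<nu>) \<longlonglongrightarrow> 0"
  proof (rule Lim_null_comparison)
    show "(\<lambda>k. 1 / (\<delta> * ?c) * (dv k / rad k ^ CARD('n))) \<longlonglongrightarrow> 0" by (rule tendsto_mult_right_zero[OF dvlim])
    show "\<forall>\<^sub>F k in sequentially. norm (z k - \<nu>) \<le> 1 / (\<delta> * ?c) * (dv k / rad k ^ CARD('n))"
    proof (rule always_eventually, rule allI)
      fix k
      have "z k - \<nu> = (1 / \<kappa> k) *\<^sub>R (ball_moment v b (rad k) x - \<kappa> k *\<^sub>R \<nu>)" using \<kappa>0[of k] by (simp add: z_def scaleR_diff_right)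
      then have "norm (z k - \<nu>) = (1 / \<kappa> k) * norm (ball_moment v b (rad k) x - \<kappa> k *\<^sub>R \<nu>)" using \<kappa>0[of k] by simp
      also have "\<dots> \<le> (1 / (?c * (rad k * rad k ^ CARD('n)))) * (rad k / \<delta> * dv k)"
        using \<kappa>(1)[of k] \<kappa>0[of k] c close[of k] by (intro mult_mono frac_le) auto
      also have "\<dots> = 1 / (\<delta> * ?c) * (dv k / rad k ^ CARD('n))" by (simp add: field_simps del: of_nat_Suc)
      finally show "norm (z k - \<nu>) \<le> 1 / (\<delta> * ?c) * (dv k / rad k ^ CARD('n))" .
    qed
  qed
  then have "z \<longlonglongrightarrow> \<nu>" by (rule LIM_zero_cancel)
  then have "(\<lambda>k. sgn (z k)) \<longlonglongrightarrow> sgn \<nu>" using \<nu> by (intro tendsto_sgn) auto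
  moreover have "sgn (z k) = sgn (ball_moment v b (rad k) x)" for k using \<kappa>0[of k] by (simp add: z_def sgn_scaleR)
  moreover have "sgn \<nu> = \<nu>" using \<nu> by (simp add: sgn_div_norm)
  ultimately show lim: "(\<lambda>k. sgn (ball_moment v b (rad k) x)) \<longlonglongrightarrow> \<nu>" by simp
  show "jump_normal v b x = \<nu>" unfolding jump_normal_def by (rule limI[OF lim])
qed

text \<open>Equal values \<open>b\<close> force equal normals, since the normal is a function of
  \<open>b\<close>. For different values the normals must be opposite: otherwise their sum points
  into both positive half balls, which then share a ball of comparable radius, and the values would
  agree.\<close>

lemma jump_triple_unique:
  assumes t: "jump_triple v x a b \<nu>" and t': "jump_triple v x a' b' \<nu>'"
  shows "(a' = a \<and> b' = b \<and> \<nu>' = \<nu>) \<or> (a' = b \<and> b' = a \<and> \<nu>' = - \<nu>)"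
proof -
  have n: "norm \<nu> = 1" "norm \<nu>' = 1" using t t' by (auto simp: jump_triple_def)
  have L: "((\<lambda>r. (\<integral>\<^sup>+ y \<in> half_ball x r \<nu>. ennreal (norm (v y - b)) \<partial>lborel) / ennreal (r ^ CARD('n))) \<longlongrightarrow> 0) (at_right 0)"
    "((\<lambda>r. (\<integral>\<^sup>+ y \<in> half_ball x r (-\<nu>). ennreal (norm (v y - a)) \<partial>lborel) / ennreal (r ^ CARD('n))) \<longlongrightarrow> 0) (at_right 0)"
    "((\<lambda>r. (\<integral>\<^sup>+ y \<in> half_ball x r \<nu>'. ennreal (norm (v y - b')) \<partial>lborel) / ennreal (r ^ CARD('n))) \<longlongrightarrow> 0) (at_right 0)"
    "((\<lambda>r. (\<integral>\<^sup>+ y \<in> half_ball x r (-\<nu>'). ennreal (norm (v y - a')) \<partial>lborel) / ennreal (r ^ CARD('n))) \<longlongrightarrow> 0) (at_right 0)"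
    using t t' by (auto simp: jump_triple_def)
  have same: "c = c'" if w: "norm w = 1"
    and l: "((\<lambda>r. (\<integral>\<^sup>+ y \<in> half_ball x r w. ennreal (norm (v y - c)) \<partial>lborel) / ennreal (r ^ CARD('n))) \<longlongrightarrow> 0) (at_right 0)"
    and l': "((\<lambda>r. (\<integral>\<^sup>+ y \<in> half_ball x r w. ennreal (norm (v y - c')) \<partial>lborel) / ennreal (r ^ CARD('n))) \<longlongrightarrow> 0) (at_right 0)" for w c c'
    by (rule density_limit_unique[OF v l l', where k = "1/2" and p = "\<lambda>r. x + (r / 2) *\<^sub>R w"])
       (use half_ball_contains_ball[OF w] in auto)
  show ?thesis
  proof (cases "b = b'")
    case True
    then have "\<nu>' = \<nu>" using jump_normal_eq(2)[OF t] jump_normal_eq(2)[OF t'] by simp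
    moreover have "a = a'" using L(2,4) n unfolding \<open>\<nu>' = \<nu>\<close> by (intro same[of "- \<nu>"]) auto
    ultimately show ?thesis using True by simp
  next
    case False
    have op: "\<nu>' = - \<nu>"
    proof (rule ccontr)
      assume "\<nu>' \<noteq> - \<nu>"
      define s where "s = \<nu> + \<nu>'"
      have s0: "0 < norm s" using \<open>\<nu>' \<noteq> - \<nu>\<close> by (auto simp: s_def add_eq_0_iff)
      have s2: "norm s \<le> 2" using norm_triangle_ineq[of \<nu> \<nu>'] n by (simp add: s_def)
      have nn: "\<nu> \<bullet> \<nu> = 1" "\<nu>' \<bullet> \<nu>' = 1" using n by (simp_all add: dot_square_norm)
      have sv: "s \<bullet> \<nu> = (norm s)\<^sup>2 / 2" "s \<bullet> \<nu>' = (norm s)\<^sup>2 / 2"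
        unfolding power2_norm_eq_inner s_def by (simp_all add: inner_add_left inner_add_right nn inner_commute)
      have sub: "ball (x + (r / (2 * norm s)) *\<^sub>R s) (norm s / 4 * r) \<subseteq> half_ball x r w"
        if r: "0 < r" and w: "norm w = 1" "s \<bullet> w = (norm s)\<^sup>2 / 2" for r w
      proof
        fix y assume y: "y \<in> ball (x + (r / (2 * norm s)) *\<^sub>R s) (norm s / 4 * r)"
        define e where "e = y - (x + (r / (2 * norm s)) *\<^sub>R s)"
        have e: "norm e < norm s / 4 * r" using y by (simp add: e_def dist_norm norm_minus_commute)
        have yx: "y - x = (r / (2 * norm s)) *\<^sub>R s + e" by (simp add: e_def)
        have "norm (y - x) \<le> r / 2 + norm e"
          unfolding yx using norm_triangle_ineq[of "(r / (2 * norm s)) *\<^sub>R s" e] s0 r by simp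
        also have "\<dots> < r / 2 + norm s / 4 * r" using e by simp
        also have "\<dots> \<le> r" using mult_right_mono[OF s2, of r] r by linarith
        finally have "norm (y - x) < r" .
        moreover have "(y - x) \<bullet> w = (r / (2 * norm s)) * ((norm s)\<^sup>2 / 2) + e \<bullet> w"
          unfolding yx by (simp add: inner_add_left w(2))
        moreover have "(r / (2 * norm s)) * ((norm s)\<^sup>2 / 2) = norm s / 4 * r" using s0 by (simp add: power2_eq_square)
        moreover have "\<bar>e \<bullet> w\<bar> \<le> norm e" using Cauchy_Schwarz_ineq2[of e w] w(1) by simp
        ultimately have "norm (y - x) < r" "0 < (y - x) \<bullet> w" using e by linarith+
        then show "y \<in> half_ball x r w" by (simp add: half_ball_def dist_norm norm_minus_commute)
      qed
      have "b = b'"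
        by (rule density_limit_unique[OF v L(1) L(3), where k = "norm s / 4" and p = "\<lambda>r. x + (r / (2 * norm s)) *\<^sub>R s"])
           (use s0 sub n sv in auto)
      then show False using False by simp
    qed
    have "a' = b" using L(1,4) n unfolding op by (intro same[of \<nu>, symmetric]) auto
    moreover have "b' = a" using L(2,3) n unfolding op by (intro same[of "- \<nu>", symmetric]) auto
    ultimately show ?thesis using op by simp
  qed
qed

text \<open>Removes the Hilbert choice. At a jump point exactly two triples occur, which differ by
  exchanging the values and reversing the normal; the symmetry of the tension gives both the same
  energy, so a supremum over all pairs selects it.\<close>

lemma jump_energy_formula:
  assumes g: "g \<in> adm_class c"
  shows "jump_energy g v x = (SUP p\<in>M \<times> M. if seq_triple v x (fst p) (snd p) (jump_normal v (snd p) x)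
    then ennreal (g x (snd p - fst p) (jump_normal v (snd p) x)) else 0)" (is "_ = (SUP p\<in>_. ?F p)")
proof -
  obtain B where B: "\<And>y. norm (v y) \<le> B" using v_bounded by blast
  note iff = jump_triple_iff_seq[OF v B]
  have sym: "g x (- \<zeta>) (- \<nu>) = g x \<zeta> \<nu>" if "norm \<nu> = 1" for \<zeta> \<nu>
  proof -
    have "\<forall>x \<zeta> \<nu>. \<nu> \<in> sphere 0 1 \<longrightarrow> 1 / c \<le> g x \<zeta> \<nu> \<and> g x \<zeta> \<nu> \<le> c \<and> g x \<zeta> \<nu> = g x (-\<zeta>) (-\<nu>)"
      using g unfolding adm_class_def by blast
    moreover have "\<nu> \<in> sphere 0 1" using that by simp
    ultimately show ?thesis by metis
  qed
  show ?thesis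
  proof (cases "x \<in> jump_set v")
    case False
    then have "\<not> seq_triple v x a b w" for a b w using iff by (auto simp: jump_set_def)
    then have "?F p = 0" for p by simp
    then show ?thesis using False by (simp add: jump_energy_def SUP_constant bot_ennreal)
  next
    case True
    obtain a0 b0 \<nu>0 where d: "jump_data v x = (a0, b0, \<nu>0)" by (cases "jump_data v x")
    have t0: "jump_triple v x a0 b0 \<nu>0" by (rule jump_data_triple[OF True d])
    have n0: "norm \<nu>0 = 1" using t0 by (simp add: jump_triple_def)
    have je: "jump_energy g v x = ennreal (g x (b0 - a0) \<nu>0)" using True d by (simp add: jump_energy_def)
    have le: "?F p \<le> ennreal (g x (b0 - a0) \<nu>0)" for p
    proof (cases "seq_triple v x (fst p) (snd p) (jump_normal v (snd p) x)")
      case True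
      then have t: "jump_triple v x (fst p) (snd p) (jump_normal v (snd p) x)" using iff by simp
      from jump_triple_unique[OF t0 t] show ?thesis
      proof
        assume "fst p = a0 \<and> snd p = b0 \<and> jump_normal v (snd p) x = \<nu>0"
        then have "g x (snd p - fst p) (jump_normal v (snd p) x) = g x (b0 - a0) \<nu>0" by (elim conjE) (simp only:)
        then show ?thesis by simp
      next
        assume *: "fst p = b0 \<and> snd p = a0 \<and> jump_normal v (snd p) x = - \<nu>0"
        then have "g x (snd p - fst p) (jump_normal v (snd p) x) = g x (a0 - b0) (- \<nu>0)" by (elim conjE) (simp only:)
        also have "\<dots> = g x (- (b0 - a0)) (- \<nu>0)" by simp
        also have "\<dots> = g x (b0 - a0) \<nu>0" by (rule sym[OF n0])
        finally show ?thesis by simp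
      qed
    qed simp
    have "jump_normal v b0 x = \<nu>0" by (rule jump_normal_eq(2)[OF t0])
    then have "?F (a0, b0) = ennreal (g x (b0 - a0) \<nu>0)" using t0 iff by simp
    moreover have "(a0, b0) \<in> M \<times> M" using jump_value_in_M[OF t0] by simp
    ultimately have "ennreal (g x (b0 - a0) \<nu>0) \<le> (SUP p\<in>M \<times> M. ?F p)"
      using SUP_upper[of "(a0, b0)" "M \<times> M" ?F] by (simp only:)
    moreover have "(SUP p\<in>M \<times> M. ?F p) \<le> ennreal (g x (b0 - a0) \<nu>0)" by (rule SUP_least) (rule le)
    ultimately show ?thesis unfolding je by (rule antisym)
  qed
qed

end

section \<open>Measurability of the surface energy\<close>

locale random_partition =
  fixes T :: "'t measure" and u :: "'t \<Rightarrow> real^'n \<Rightarrow> real^'m" and M :: "(real^'m) set"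
  assumes u_joint: "(\<lambda>p. u (fst p) (snd p)) \<in> borel_measurable (T \<Otimes>\<^sub>M borel)"
    and uM: "\<And>\<theta> y. u \<theta> y \<in> M" and M: "finite M"
begin

lemma u_compose:
  assumes "\<Theta> \<in> measurable N T"
  shows "(\<lambda>q. u (\<Theta> (fst q)) (snd q)) \<in> borel_measurable (N \<Otimes>\<^sub>M borel)"
proof -
  have "(\<lambda>q. (\<Theta> (fst q), snd q)) \<in> measurable (N \<Otimes>\<^sub>M borel) (T \<Otimes>\<^sub>M borel)" using assms by measurable
  from measurable_compose[OF this u_joint] show ?thesis by simp
qed

lemma u_borel: "\<theta> \<in> space T \<Longrightarrow> u \<theta> \<in> borel_measurable borel"
  using measurable_compose[OF measurable_Pair1' u_joint, of \<theta>] by simp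

lemma u_bounded: "\<exists>B. \<forall>\<theta> y. norm (u \<theta> y) \<le> B"
  using finite_imp_bounded[OF M] uM by (auto simp: bounded_iff)

lemma dev_joint:
  assumes \<Theta>: "\<Theta> \<in> measurable N T" and [measurable]: "X \<in> borel_measurable N" "W \<in> borel_measurable N"
  shows "(\<lambda>p. half_ball_dev (u (\<Theta> p)) b r (X p) (W p)) \<in> borel_measurable N"
  unfolding half_ball_dev_def
proof (rule lborel.borel_measurable_lebesgue_integral)
  have [measurable]: "(\<lambda>q. u (\<Theta> (fst q)) (snd q)) \<in> borel_measurable (N \<Otimes>\<^sub>M lborel)"
    using u_compose[OF \<Theta>] by (simp cong: measurable_cong_sets sets_pair_measure_cong)
  show "(\<lambda>(p, y). if dist (X p) y < r \<and> 0 < (y - X p) \<bullet> W p then norm (u (\<Theta> p) y - b) else 0) \<in> borel_measurable (N \<Otimes>\<^sub>M lborel)"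
    unfolding case_prod_beta by measurable
qed

lemma moment_joint:
  assumes \<Theta>: "\<Theta> \<in> measurable N T" and [measurable]: "X \<in> borel_measurable N"
  shows "(\<lambda>p. ball_moment (u (\<Theta> p)) b r (X p)) \<in> borel_measurable N"
  unfolding ball_moment_def
proof (rule lborel.borel_measurable_lebesgue_integral)
  have [measurable]: "(\<lambda>q. u (\<Theta> (fst q)) (snd q)) \<in> borel_measurable (N \<Otimes>\<^sub>M lborel)"
    using u_compose[OF \<Theta>] by (simp cong: measurable_cong_sets sets_pair_measure_cong)
  show "(\<lambda>(p, y). if dist (X p) y < r \<and> u (\<Theta> p) y = b then y - X p else 0) \<in> borel_measurable (N \<Otimes>\<^sub>M lborel)"
    unfolding case_prod_beta by measurable
qed

lemma jump_normal_joint: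
  assumes "\<Theta> \<in> measurable N T" "X \<in> borel_measurable N"
  shows "(\<lambda>p. jump_normal (u (\<Theta> p)) b (X p)) \<in> borel_measurable N"
  unfolding jump_normal_def
proof (rule borel_measurable_lim_metric)
  fix k
  note [measurable] = moment_joint[OF assms, of b "rad k"]
  show "(\<lambda>p. sgn (ball_moment (u (\<Theta> p)) b (rad k) (X p))) \<in> borel_measurable N"
    unfolding sgn_div_norm by measurable
qed

lemma seq_triple_joint:
  assumes \<Theta>: "\<Theta> \<in> measurable N T" and X[measurable]: "X \<in> borel_measurable N" and W[measurable]: "W \<in> borel_measurable N"
  shows "Measurable.pred N (\<lambda>p. seq_triple (u (\<Theta> p)) (X p) a b (W p))"
proof -
  have W': "(\<lambda>p. - W p) \<in> borel_measurable N" by measurable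
  note [measurable] = dev_joint[OF \<Theta> X W] dev_joint[OF \<Theta> X W']
  show ?thesis unfolding seq_triple_def by measurable
qed

text \<open>The slope for which \<open>hausdorff_outer_cone_set\<close> controls the Hausdorff
  measure.\<close>

definition cone_slope :: real where "cone_slope = 1 / (2 * sqrt (real CARD('n)))"

text \<open>A quarter of the threshold in \<open>dev_cone_aux\<close> for the angle
  \<open>cone_slope\<close>; a half would give equality where that lemma asks for a strict
  inequality.\<close>

definition dev_tol :: "real^'m \<Rightarrow> real^'m \<Rightarrow> real" where
  "dev_tol a b = norm (a - b) * (unit_ball_vol (real CARD('n)) * (cone_slope / 8) ^ CARD('n)) / 4"

text \<open>Nonpositive for all \<open>k\<close> exactly when both deviations stay within the
  tolerance at every radius from \<open>rad j\<close> downwards.\<close>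

definition excess :: "real^'m \<Rightarrow> real^'m \<Rightarrow> real^'n \<Rightarrow> nat \<Rightarrow> nat \<Rightarrow> 't \<Rightarrow> real^'n \<Rightarrow> real" where
  "excess a b w j k \<theta> x = max (half_ball_dev (u \<theta>) b (rad (j + k)) x w) (half_ball_dev (u \<theta>) a (rad (j + k)) x (- w))
     - dev_tol a b * rad (j + k) ^ CARD('n)"

lemma cone_slope: "0 < cone_slope" "cone_slope \<le> 1"
proof -
  have "1 \<le> real CARD('n)" by (simp add: Suc_leI)
  then have "1 \<le> sqrt (real CARD('n))" by simp
  then have *: "1 \<le> 2 * sqrt (real CARD('n))" by linarith
  then have "1 / (2 * sqrt (real CARD('n))) \<le> 1" by (subst divide_le_eq_1_pos) linarith+
  then show "0 < cone_slope" "cone_slope \<le> 1" using * by (simp_all add: cone_slope_def)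
qed

lemma dev_tol_pos: "a \<noteq> b \<Longrightarrow> 0 < dev_tol a b"
  using cone_slope by (simp add: dev_tol_def)

lemma excess_family:
  assumes "norm w = 1"
  shows "compact_family T (cball q \<rho>) (excess a b w j)"
  unfolding compact_family_def
proof (intro conjI allI ballI)
  obtain B where B: "\<And>\<theta> y. norm (u \<theta> y) \<le> B" using u_bounded by blast
  show "continuous_on (cball q \<rho>) (excess a b w j k \<theta>)" if "\<theta> \<in> space T" for k \<theta>
    unfolding excess_def[abs_def]
    using assms by (intro continuous_intros dev_continuous[OF u_borel[OF that] B]) auto
  show "(\<lambda>\<theta>. excess a b w j k \<theta> x) \<in> borel_measurable T" for k x
  proof -
    note [measurable] = dev_joint[OF measurable_ident borel_measurable_const borel_measurable_const]
    show ?thesis unfolding excess_def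
      by (intro borel_measurable_diff borel_measurable_max borel_measurable_const)
         (use dev_joint[OF measurable_ident borel_measurable_const borel_measurable_const] in simp_all)
  qed
qed simp

text \<open>The radius \<open>1 / (8 * real (Suc j))\<close> keeps any two points within the
  distance that \<open>dev_cone_aux\<close> allows; exchanging the two points gives the two-sided
  cone condition.\<close>

lemma excess_sublevel_measure:
  assumes w: "norm w = 1" and ab: "a \<noteq> b" and \<theta>: "\<theta> \<in> space T"
  shows "emeasure (hausdorff_measure (real CARD('n) - 1)) (sublevel (cball q (1 / (8 * real (Suc j)))) (excess a b w j) \<theta>)
    \<le> ennreal (cone_const TYPE('n) * (2 * (1 / (8 * real (Suc j)))) powr (real CARD('n) - 1))"
proof (rule order_trans[OF emeasure_hausdorff_le], rule hausdorff_outer_cone_set[OF w])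
  obtain B where B: "\<And>\<theta> y. norm (u \<theta> y) \<le> B" using u_bounded by blast
  let ?S = "sublevel (cball q (1 / (8 * real (Suc j)))) (excess a b w j) \<theta>"
  show "0 < 2 * (1 / (8 * real (Suc j)))" by simp
  show "\<bar>x $ i - q $ i\<bar> \<le> 2 * (1 / (8 * real (Suc j))) / 2" if "x \<in> ?S" for x i
  proof -
    have "\<bar>x $ i - q $ i\<bar> \<le> norm (x - q)" using component_le_norm_cart[of "x - q" i] by simp
    also have "\<dots> \<le> 1 / (8 * real (Suc j))" using that by (simp add: sublevel_def dist_norm norm_minus_commute)
    also have "\<dots> = 2 * (1 / (8 * real (Suc j))) / 2" by (simp del: of_nat_Suc)
    finally show ?thesis .
  qed
  have *: "(y - x) \<bullet> w \<le> cone_slope * norm (y - x)" if x: "x \<in> ?S" and y: "y \<in> ?S" for x y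
  proof (rule dev_cone_aux[OF u_borel[OF \<theta>] B w cone_slope ab, where \<epsilon> = "dev_tol a b" and j = j])
    have "0 < norm (a - b) * (unit_ball_vol (real CARD('n)) * (cone_slope / 8) ^ CARD('n))"
      using ab cone_slope by (intro mult_pos_pos zero_less_power) auto
    then show "2 * dev_tol a b < norm (a - b) * (unit_ball_vol (real CARD('n)) * (cone_slope / 8) ^ CARD('n))"
      by (simp only: dev_tol_def)
    show "half_ball_dev (u \<theta>) b (rad k) x w \<le> dev_tol a b * rad k ^ CARD('n)" if "k \<ge> j" for k
    proof -
      have "excess a b w j (k - j) \<theta> x \<le> 0" using x by (auto simp: sublevel_def)
      then show ?thesis using that by (simp add: excess_def)
    qed
    show "half_ball_dev (u \<theta>) a (rad k) y (- w) \<le> dev_tol a b * rad k ^ CARD('n)" if "k \<ge> j" for k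
    proof -
      have "excess a b w j (k - j) \<theta> y \<le> 0" using y by (auto simp: sublevel_def)
      then show ?thesis using that by (simp add: excess_def)
    qed
    have "norm (y - x) \<le> dist q x + dist q y"
      using dist_triangle2[of y x q] by (simp add: dist_norm[symmetric] dist_commute)
    also have "\<dots> \<le> 1 / (8 * real (Suc j)) + 1 / (8 * real (Suc j))" using x y by (intro add_mono) (auto simp: sublevel_def)
    also have "\<dots> = 1 / (4 * real (Suc j))" by (simp add: field_simps del: of_nat_Suc)
    finally show "norm (y - x) \<le> 1 / (4 * real (Suc j))" .
  qed
  show "\<bar>(x - y) \<bullet> w\<bar> \<le> norm (x - y) / (2 * sqrt CARD('n))" if "x \<in> ?S" "y \<in> ?S" for x y
    using *[OF that] *[OF that(2,1)] by (simp add: abs_le_iff cone_slope_def inner_diff_left norm_minus_commute)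
qed

text \<open>At small radii the deviations for the true normal are below half of the tolerance. A
  direction \<open>w\<close> of the dense set, close enough to \<open>\<nu>\<close>, spends at most
  the other half on the tilt.\<close>

lemma jump_in_sublevel:
  assumes \<theta>: "\<theta> \<in> space T" and t: "jump_triple (u \<theta>) x a b \<nu>"
    and Q: "sphere 0 1 \<subseteq> closure Q" "Q \<subseteq> sphere 0 1" and Q': "closure Q' = UNIV"
  shows "\<exists>w\<in>Q. \<exists>j. \<exists>q\<in>Q'. x \<in> sublevel (cball q (1 / (8 * real (Suc j)))) (excess a b w j) \<theta>"
proof -
  obtain B where B: "\<And>\<theta> y. norm (u \<theta> y) \<le> B" using u_bounded by blast
  note v = u_borel[OF \<theta>]
  have st: "seq_triple (u \<theta>) x a b \<nu>" using t jump_triple_iff_seq[OF v B] by simp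
  then have ab: "a \<noteq> b" and \<nu>: "norm \<nu> = 1" by (auto simp: seq_triple_def)
  define \<epsilon> where "\<epsilon> = dev_tol a b"
  have \<epsilon>: "0 < \<epsilon>" using dev_tol_pos[OF ab] by (simp add: \<epsilon>_def)
  have B0: "0 \<le> B" using B norm_ge_zero order_trans by blast
  define C where "C = (B + norm a + norm b) * (unit_ball_vol (real CARD('n)) * 2 ^ CARD('n))"
  have C0: "0 \<le> C" using B0 by (simp add: C_def)
  obtain N0 :: nat where N0: "2 * C / \<epsilon> < N0" using reals_Archimedean2 by blast
  define N where "N = Suc N0"
  have N: "0 < N" "C / N \<le> \<epsilon> / 2"
  proof -
    have "2 * C / \<epsilon> < N" using N0 by (simp add: N_def)
    then show "C / N \<le> \<epsilon> / 2" using \<epsilon> by (simp add: N_def field_simps)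
  qed (simp add: N_def)
  have "\<nu> \<in> closure Q" using \<nu> Q(1) by auto
  then obtain w where w: "w \<in> Q" "dist w \<nu> < 1 / real N" using N unfolding closure_approachable by (metis of_nat_0_less_iff zero_less_divide_1_iff)
  then have w1: "norm w = 1" and wn: "norm (w - \<nu>) \<le> 1 / real N" using Q(2) by (auto simp: dist_norm)
  obtain m where m: "rad m < \<epsilon> / 2" using nat_approx_posE[of "\<epsilon> / 2"] \<epsilon> by auto
  obtain j where j: "\<And>k. k \<ge> j \<Longrightarrow> half_ball_dev (u \<theta>) b (rad k) x \<nu> \<le> rad m * rad k ^ CARD('n) \<and> half_ball_dev (u \<theta>) a (rad k) x (- \<nu>) \<le> rad m * rad k ^ CARD('n)"
    using st unfolding seq_triple_def by blast
  have "x \<in> closure Q'" using Q' by simp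
  then obtain q where q: "q \<in> Q'" "dist q x < 1 / (8 * real (Suc j))"
    unfolding closure_approachable by (metis of_nat_0_less_iff zero_less_Suc zero_less_divide_1_iff mult_pos_pos zero_less_numeral)
  have le: "half_ball_dev (u \<theta>) c (rad k) x w' \<le> \<epsilon> * rad k ^ CARD('n)"
    if c: "c \<in> {a, b}" and d: "half_ball_dev (u \<theta>) c (rad k) x \<nu>' \<le> rad m * rad k ^ CARD('n)"
      and nw: "norm \<nu>' = 1" "norm w' = 1" "norm (w' - \<nu>') \<le> 1 / real N" for c k w' \<nu>'
  proof -
    have rk: "0 < rad k ^ CARD('n)" by simp
    have "(B + norm c) * (unit_ball_vol (real CARD('n)) * 2 ^ CARD('n) / N) \<le> C / N"
      using c N unfolding C_def by (auto simp: field_simps intro!: mult_right_mono divide_right_mono)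
    also have "\<dots> \<le> \<epsilon> / 2" by (rule N(2))
    finally have "(B + norm c) * (unit_ball_vol (real CARD('n)) * 2 ^ CARD('n) / N) * rad k ^ CARD('n) \<le> \<epsilon> / 2 * rad k ^ CARD('n)"
      using rk by (intro mult_right_mono) auto
    moreover have "rad m * rad k ^ CARD('n) \<le> \<epsilon> / 2 * rad k ^ CARD('n)" using m rk by (intro mult_right_mono) auto
    moreover have "\<epsilon> / 2 * rad k ^ CARD('n) + \<epsilon> / 2 * rad k ^ CARD('n) = \<epsilon> * rad k ^ CARD('n)" by simp
    ultimately show ?thesis using dev_tilt[OF v B nw(1,2) N(1) nw(3) rad_pos, where x = x and b = c and k1 = k] d by linarith
  qed
  have "excess a b w j k \<theta> x \<le> 0" for k
  proof -
    have "half_ball_dev (u \<theta>) b (rad (j + k)) x w \<le> \<epsilon> * rad (j + k) ^ CARD('n)"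
      using j[of "j + k"] \<nu> w1 wn by (intro le[where \<nu>' = \<nu>]) auto
    moreover have "half_ball_dev (u \<theta>) a (rad (j + k)) x (- w) \<le> \<epsilon> * rad (j + k) ^ CARD('n)"
      using j[of "j + k"] \<nu> w1 wn by (intro le[where \<nu>' = "- \<nu>"]) (auto simp: norm_minus_commute)
    ultimately show ?thesis by (simp add: excess_def \<epsilon>_def)
  qed
  then have "x \<in> sublevel (cball q (1 / (8 * real (Suc j)))) (excess a b w j) \<theta>"
    using q(2) by (simp add: sublevel_def)
  then show ?thesis using w(1) q(1) by blast
qed

text \<open>The supremum formula contains no choice and runs over a finite set; its terms are built
  from ball averages, which are measurable by Fubini.\<close>

lemma jump_energy_joint:
  fixes G :: "'w \<Rightarrow> ('n, 'm) tension"
  assumes G: "random_surface_tension P c G"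
  shows "(\<lambda>q. jump_energy (G (fst (fst q))) (u (snd (fst q))) (snd q)) \<in> borel_measurable ((P \<Otimes>\<^sub>M T) \<Otimes>\<^sub>M borel)"
proof -
  let ?N = "(P \<Otimes>\<^sub>M T) \<Otimes>\<^sub>M (borel :: (real^'n) measure)"
  have Gm: "(\<lambda>(\<omega>, x, \<zeta>, \<nu>). G \<omega> x \<zeta> \<nu>) \<in> borel_measurable (P \<Otimes>\<^sub>M (borel \<Otimes>\<^sub>M (borel \<Otimes>\<^sub>M restrict_space borel (sphere 0 1))))"
    and Ga: "\<And>\<omega>. \<omega> \<in> space P \<Longrightarrow> G \<omega> \<in> adm_class c" using G by (auto simp: random_surface_tension_def)
  have \<Theta>: "(\<lambda>q. snd (fst q)) \<in> measurable ?N T" by measurable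
  have X: "snd \<in> borel_measurable ?N" by measurable
  define \<nu>f where "\<nu>f b q = jump_normal (u (snd (fst q))) b (snd q)" for b and q :: "('w \<times> 't) \<times> (real^'n)"
  have \<nu>m[measurable]: "\<nu>f b \<in> borel_measurable ?N" for b unfolding \<nu>f_def by (rule jump_normal_joint[OF \<Theta> X])
  \<comment> \<open>A default unit vector, so that the normal is a measurable map into the sphere,
    where the tension is jointly measurable. It is never evaluated, because
    \<open>seq_triple\<close> demands a unit normal.\<close>
  define e0 :: "real^'n" where "e0 = axis undefined 1"
  define \<nu>s where "\<nu>s b q = (if norm (\<nu>f b q) = 1 then \<nu>f b q else e0)" for b q
  have \<nu>s: "\<nu>s b \<in> measurable ?N (restrict_space borel (sphere 0 1))" for b
  proof (rule measurable_restrict_space2)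
    show "\<nu>s b \<in> borel_measurable ?N" unfolding \<nu>s_def[abs_def] by measurable
    show "\<nu>s b \<in> space ?N \<rightarrow> sphere 0 1" by (auto simp: \<nu>s_def e0_def)
  qed
  have t[measurable]: "Measurable.pred ?N (\<lambda>q. seq_triple (u (snd (fst q))) (snd q) a b (\<nu>f b q))" for a b
    by (rule seq_triple_joint[OF \<Theta> X \<nu>m])
  have g[measurable]: "(\<lambda>q. G (fst (fst q)) (snd q) \<zeta> (\<nu>s b q)) \<in> borel_measurable ?N" for \<zeta> b
  proof -
    have "(\<lambda>q. (fst (fst q), snd q, \<zeta>, \<nu>s b q)) \<in> measurable ?N (P \<Otimes>\<^sub>M (borel \<Otimes>\<^sub>M (borel \<Otimes>\<^sub>M restrict_space borel (sphere 0 1))))"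
      by (intro measurable_Pair \<nu>s) measurable
    from measurable_compose[OF this Gm] show ?thesis by simp
  qed
  define F where "F p q = (if seq_triple (u (snd (fst q))) (snd q) (fst p) (snd p) (\<nu>f (snd p) q)
    then ennreal (G (fst (fst q)) (snd q) (snd p - fst p) (\<nu>s (snd p) q)) else 0)" for p q
  have Fm: "F p \<in> borel_measurable ?N" for p unfolding F_def[abs_def] by measurable
  have "(\<lambda>q. SUP p\<in>M \<times> M. F p q) \<in> borel_measurable ?N"
    using M by (intro borel_measurable_SUP Fm) (auto intro: countable_finite)
  moreover have "(SUP p\<in>M \<times> M. F p q) = jump_energy (G (fst (fst q))) (u (snd (fst q))) (snd q)" if q: "q \<in> space ?N" for q
  proof -
    have sp: "fst (fst q) \<in> space P" "snd (fst q) \<in> space T" using q by (auto simp: space_pair_measure)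
    have "F p q = (if seq_triple (u (snd (fst q))) (snd q) (fst p) (snd p) (jump_normal (u (snd (fst q))) (snd p) (snd q))
      then ennreal (G (fst (fst q)) (snd q) (snd p - fst p) (jump_normal (u (snd (fst q))) (snd p) (snd q))) else 0)" for p
    proof (cases "seq_triple (u (snd (fst q))) (snd q) (fst p) (snd p) (\<nu>f (snd p) q)")
      case True
      then have "norm (\<nu>f (snd p) q) = 1" by (simp add: seq_triple_def)
      then show ?thesis using True by (simp add: F_def \<nu>s_def flip: \<nu>f_def)
    qed (simp add: F_def flip: \<nu>f_def)
    then show ?thesis using jump_energy_formula[OF u_borel[OF sp(2)] uM M Ga[OF sp(1)], of "snd q"] by simp
  qed
  ultimately show ?thesis by (rule measurable_cong[THEN iffD1, rotated]) auto
qed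

text \<open>One countable family of pieces serves all codes, and each piece has Hausdorff measure
  bounded uniformly in the code, so the kernel argument applies piece by piece.\<close>

lemma energy_integral_measurable:
  fixes G :: "'w \<Rightarrow> ('n, 'm) tension"
  assumes G: "random_surface_tension P c G" and D: "D \<in> sets borel" and d: "2 \<le> CARD('n)"
  shows "(\<lambda>p. \<integral>\<^sup>+x\<in>D. jump_energy (G (fst p)) (u (snd p)) x \<partial>hausdorff_measure (real CARD('n) - 1))
    \<in> borel_measurable (P \<Otimes>\<^sub>M T)"
proof -
  let ?H = "hausdorff_measure (real CARD('n) - 1) :: (real^'n) measure"
  let ?N = "P \<Otimes>\<^sub>M T"
  obtain Q :: "(real^'n) set" where Q: "countable Q" "Q \<subseteq> sphere 0 1" "sphere 0 1 \<subseteq> closure Q"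
    using separable[of "sphere 0 1"] by metis
  obtain Q' :: "(real^'n) set" where Q': "countable Q'" "UNIV \<subseteq> closure Q'"
    using separable[of UNIV] by metis
  then have Q'2: "closure Q' = UNIV" by auto
  define I where "I = {(a, b, w, j, q). a \<in> M \<and> b \<in> M \<and> a \<noteq> b \<and> w \<in> Q \<and> q \<in> Q'} \<inter> (M \<times> M \<times> Q \<times> (UNIV :: nat set) \<times> Q')"
  have cI: "countable I" unfolding I_def
    by (rule countable_Int2) (intro countable_SIGMA countable_finite M Q(1) Q'(1) countableI_type)
  define S where "S i \<theta> = (case i of (a, b, w, j, q) \<Rightarrow> sublevel (cball q (1 / (8 * real (Suc j)))) (excess a b w j) \<theta>)" for i \<theta>
  define e where "e p x = jump_energy (G (fst p)) (u (snd p)) x * indicator D x" for p x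
  have em: "(\<lambda>(p, x). e p x) \<in> borel_measurable (?N \<Otimes>\<^sub>M borel)"
    unfolding e_def case_prod_beta using jump_energy_joint[OF G] D by measurable
  have cover: "\<exists>i\<in>I. x \<in> S i (snd p)" if "p \<in> space ?N" "e p x \<noteq> 0" for p x
  proof -
    have \<theta>: "snd p \<in> space T" using that by (auto simp: space_pair_measure)
    have "x \<in> jump_set (u (snd p))" using that(2) by (auto simp: e_def jump_energy_def split: if_splits)
    then obtain a b \<nu> where t: "jump_triple (u (snd p)) x a b \<nu>" by (auto simp: jump_set_def)
    have ab: "a \<in> M" "b \<in> M" using jump_value_in_M[OF u_borel[OF \<theta>] uM M t] by auto
    have "a \<noteq> b" using t by (simp add: jump_triple_def)
    obtain w j q where "w \<in> Q" "q \<in> Q'" "x \<in> sublevel (cball q (1 / (8 * real (Suc j)))) (excess a b w j) (snd p)"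
      using jump_in_sublevel[OF \<theta> t Q(3,2) Q'2] by blast
    then show ?thesis using ab \<open>a \<noteq> b\<close> by (intro bexI[of _ "(a, b, w, j, q)"]) (auto simp: S_def I_def)
  qed
  have Sm: "{q \<in> space (?N \<Otimes>\<^sub>M borel). snd q \<in> S i (snd (fst q))} \<in> sets (?N \<Otimes>\<^sub>M borel)" for i
  proof -
    obtain a b w j q where i: "i = (a, b, w, j, q)" by (cases i)
    have \<Theta>: "(\<lambda>q. snd (fst q)) \<in> measurable (?N \<Otimes>\<^sub>M (borel :: (real^'n) measure)) T" by measurable
    have X: "snd \<in> borel_measurable (?N \<Otimes>\<^sub>M (borel :: (real^'n) measure))" by measurable
    have [measurable]: "(\<lambda>p. excess a b w j k (snd (fst p)) (snd p)) \<in> borel_measurable (?N \<Otimes>\<^sub>M (borel :: (real^'n) measure))" for k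
      unfolding excess_def by (intro borel_measurable_diff borel_measurable_max borel_measurable_const dev_joint[OF \<Theta> X])
    show ?thesis unfolding i S_def prod.case sublevel_def mem_Collect_eq mem_cball by measurable
  qed
  show ?thesis
  proof (cases "I = {}")
    case True
    then have "e p x = 0" if "p \<in> space ?N" for p x using cover[OF that] by auto
    then have "(\<lambda>p. \<integral>\<^sup>+x. e p x \<partial>?H) \<in> borel_measurable ?N \<longleftrightarrow> (\<lambda>p. 0::ennreal) \<in> borel_measurable ?N"
      by (intro measurable_cong) simp
    then show ?thesis by (simp add: e_def)
  next
    case False
    define f where "f = from_nat_into I"
    have fI: "f n \<in> I" for n unfolding f_def by (rule from_nat_into[OF False])
    have fr: "\<exists>n. f n = i" if "i \<in> I" for i unfolding f_def using from_nat_into_surj[OF cI that] by blast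
    \<comment> \<open>The pieces are made disjoint inside the integrand, so that each domain of
      integration remains a compact sublevel set.\<close>
    define g where "g n p x = e p x * (if \<exists>m<n. x \<in> S (f m) (snd p) then 0 else 1)" for n p x
    have gm: "(\<lambda>(p, x). g n p x) \<in> borel_measurable (?N \<Otimes>\<^sub>M borel)" for n
    proof -
      have [measurable]: "Measurable.pred (?N \<Otimes>\<^sub>M borel) (\<lambda>q. snd q \<in> S i (snd (fst q)))" for i
        using Sm[of i] by (simp add: pred_def)
      note em[measurable]
      show ?thesis unfolding g_def case_prod_beta using em[unfolded case_prod_beta] by measurable
    qed
    have gint: "(\<lambda>p. \<integral>\<^sup>+x\<in>S (f n) (snd p). g n p x \<partial>?H) \<in> borel_measurable ?N" for n
    proof -
      obtain a b w j q where fn: "f n = (a, b, w, j, q)" by (cases "f n")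
      then have ab: "a \<noteq> b" and w: "norm w = 1" using fI[of n] Q(2) by (auto simp: I_def)
      show ?thesis unfolding fn S_def prod.case
      proof (rule sublevel_kernel_integral_measurable[OF excess_family[OF w] _ _ _ gm])
        show "0 < real CARD('n) - 1" using d by simp
        \<comment> \<open>The added 1 makes the bound strictly positive, as the normalisation of the
          kernel requires.\<close>
        show "emeasure ?H (sublevel (cball q (1 / (8 * real (Suc j)))) (excess a b w j) \<theta>)
            \<le> ennreal (cone_const TYPE('n) * (2 * (1 / (8 * real (Suc j)))) powr (real CARD('n) - 1) + 1)" if "\<theta> \<in> space T" for \<theta>
          by (rule order_trans[OF excess_sublevel_measure[OF w ab that] ennreal_leI]) simp
        show "0 < cone_const TYPE('n) * (2 * (1 / (8 * real (Suc j)))) powr (real CARD('n) - 1) + 1"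
          using cone_const_nonneg[where 'n = 'n] by (intro add_nonneg_pos mult_nonneg_nonneg) auto
      qed measurable
    qed
    have split: "(\<integral>\<^sup>+x. e p x \<partial>?H) = (\<Sum>n. \<integral>\<^sup>+x\<in>S (f n) (snd p). g n p x \<partial>?H)" if p: "p \<in> space ?N" for p
    proof -
      have Sb: "S (f n) (snd p) \<in> sets borel" for n
      proof -
        obtain a b w j q where fn: "f n = (a, b, w, j, q)" by (cases "f n")
        then have w: "norm w = 1" using fI[of n] Q(2) by (auto simp: I_def)
        have "snd p \<in> space T" using p by (auto simp: space_pair_measure)
        then show ?thesis unfolding fn S_def prod.case by (intro borel_compact compact_sublevel[OF excess_family[OF w]])
      qed
      have gp: "g n p \<in> borel_measurable borel" for n
        using measurable_compose[OF measurable_Pair1'[OF p] gm[of n]] by simp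
      have "e p x = (\<Sum>n. g n p x * indicator (S (f n) (snd p)) x)" for x
      proof (cases "\<exists>n. x \<in> S (f n) (snd p)")
        case True
        define n where "n = (LEAST n. x \<in> S (f n) (snd p))"
        have n: "x \<in> S (f n) (snd p)" "\<And>m. m < n \<Longrightarrow> x \<notin> S (f m) (snd p)"
          unfolding n_def using True by (auto intro: LeastI_ex dest: not_less_Least)
        have "(\<Sum>k. g k p x * indicator (S (f k) (snd p)) x) = (\<Sum>k\<in>{n}. g k p x * indicator (S (f k) (snd p)) x)"
        proof (rule suminf_finite)
          fix k assume "k \<notin> {n}"
          then have "k < n \<or> n < k" by auto
          then show "g k p x * indicator (S (f k) (snd p)) x = 0"
            using n by (auto simp: g_def indicator_def)
        qed simp
        also have "\<dots> = e p x" using n(1) by (auto simp: g_def dest: n(2))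
        finally show ?thesis ..
      next
        case False
        then have "e p x = 0" using cover[OF p, of x] fr by blast
        moreover have "(\<Sum>n. g n p x * indicator (S (f n) (snd p)) x) = 0" using False by (simp add: indicator_def)
        ultimately show ?thesis by simp
      qed
      then have "(\<integral>\<^sup>+x. e p x \<partial>?H) = (\<integral>\<^sup>+x. (\<Sum>n. g n p x * indicator (S (f n) (snd p)) x) \<partial>?H)" by simp
      also have "\<dots> = (\<Sum>n. \<integral>\<^sup>+x\<in>S (f n) (snd p). g n p x \<partial>?H)"
        using gp Sb by (intro nn_integral_suminf borel_measurable_times_ennreal borel_measurable_indicator) auto
      finally show ?thesis .
    qed
    have "(\<lambda>p. \<Sum>n. \<integral>\<^sup>+x\<in>S (f n) (snd p). g n p x \<partial>?H) \<in> borel_measurable ?N"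
      using gint by (rule borel_measurable_suminf_order)
    then have "(\<lambda>p. \<integral>\<^sup>+x. e p x \<partial>?H) \<in> borel_measurable ?N"
      by (rule measurable_cong[THEN iffD2, rotated]) (rule split)
    then show ?thesis by (simp add: e_def)
  qed
qed

end

section \<open>Coding of competitors\<close>

lemma total_variation_cong_AE:
  fixes u v :: "real^'n \<Rightarrow> real^'m"
  assumes "AE y in lborel. y \<in> D \<longrightarrow> u y = v y"
  shows "total_variation u D = total_variation v D"
proof -
  obtain N where N: "N \<in> null_sets lborel" "{y. \<not> (y \<in> D \<longrightarrow> u y = v y)} \<subseteq> N"
    using assms by (auto simp: eventually_ae_filter)
  have neg: "negligible N" using N(1) unfolding negligible_iff_null_sets by (rule null_sets_completionI)
  have "integral D (\<lambda>x. u x \<bullet> div_field \<phi> x) = integral D (\<lambda>x. v x \<bullet> div_field \<phi> x)" for \<phi> :: "real^'n \<Rightarrow> real^'n^'m"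
    by (rule integral_spike[OF neg]) (use N(2) in auto)
  then show ?thesis by (simp add: total_variation_def sum_div_row)
qed

text \<open>Finite sets of pairs, a basic open set with a value from a countable dense set, describe
  a continuous function on the compact closure of \<open>D\<close> up to error 1/2. For each
  description that occurs one representative from \<open>F\<close> itself is kept, so the net still
  consists of divergences of test fields in the application.\<close>

lemma countable_uniform_net:
  fixes F :: "(real^'n \<Rightarrow> real^'m) set"
  assumes D: "bounded D" and F: "\<And>f. f \<in> F \<Longrightarrow> continuous_on UNIV f"
  shows "\<exists>Q \<subseteq> F. countable Q \<and> (\<forall>f\<in>F. \<exists>q\<in>Q. \<forall>x\<in>D. dist (f x) (q x) \<le> 1)"
proof -
  obtain \<B> :: "(real^'n) set set" where \<B>: "countable \<B>" "topological_basis \<B>"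
    using ex_countable_basis by blast
  obtain Z :: "(real^'m) set" where Z: "countable Z" "UNIV \<subseteq> closure Z"
    using separable[of UNIV] by metis
  define ok where "ok L f \<longleftrightarrow> D \<subseteq> \<Union>(fst ` L) \<and> (\<forall>p\<in>L. \<forall>x\<in>fst p. dist (f x) (snd p) < 1/2)"
    for L :: "((real^'n) set \<times> (real^'m)) set" and f
  define I where "I = {L. finite L \<and> L \<subseteq> \<B> \<times> Z}"
  have "countable I" unfolding I_def using \<B>(1) Z(1) by (intro countable_Collect_finite_subset countable_SIGMA) auto
  define rep where "rep L = (SOME f. f \<in> F \<and> ok L f)" for L
  have rep: "rep L \<in> F" "ok L (rep L)" if "f \<in> F" "ok L f" for L f
    using someI[of "\<lambda>f. f \<in> F \<and> ok L f" f] that unfolding rep_def by auto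
  have ex: "\<exists>L\<in>I. ok L f" if f: "f \<in> F" for f
  proof -
    define C where "C = {U \<in> \<B>. \<exists>z\<in>Z. \<forall>x\<in>U. dist (f x) z < 1/2}"
    have "closure D \<subseteq> \<Union>C"
    proof
      fix x assume "x \<in> closure D"
      have "f x \<in> closure Z" using Z(2) by auto
      then have "\<forall>e>0. \<exists>z\<in>Z. dist z (f x) < e" unfolding closure_approachable .
      then obtain z where z: "z \<in> Z" "dist z (f x) < 1/2" using half_gt_zero[OF zero_less_one] by blast
      have "open {y. dist (f y) z < 1/2}"
        by (rule open_Collect_less) (intro continuous_intros F[OF f])+
      moreover have "x \<in> {y. dist (f y) z < 1/2}" using z(2) by (simp add: dist_commute)
      ultimately obtain U where "U \<in> \<B>" "x \<in> U" "U \<subseteq> {y. dist (f y) z < 1/2}"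
        using topological_basisE[OF \<B>(2)] by metis
      then show "x \<in> \<Union>C" using z(1) unfolding C_def by blast
    qed
    moreover have "open U" if "U \<in> C" for U using that topological_basis_open[OF \<B>(2)] by (auto simp: C_def)
    ultimately obtain C' where C': "C' \<subseteq> C" "finite C'" "closure D \<subseteq> \<Union>C'"
      using compactE[of "closure D" C] D by (metis compact_closure)
    have "\<forall>U\<in>C. \<exists>z. z \<in> Z \<and> (\<forall>x\<in>U. dist (f x) z < 1/2)" unfolding C_def by blast
    then obtain zf where zf: "\<And>U. U \<in> C \<Longrightarrow> zf U \<in> Z \<and> (\<forall>x\<in>U. dist (f x) (zf U) < 1/2)" by metis
    define L where "L = (\<lambda>U. (U, zf U)) ` C'"
    have "(U, zf U) \<in> \<B> \<times> Z" if "U \<in> C'" for U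
      using that C'(1) zf[of U] by (auto simp: C_def)
    then have "L \<in> I" using C'(2) by (auto simp: L_def I_def)
    moreover have "fst ` L = C'" by (simp add: L_def image_image)
    then have "ok L f" using C' zf closure_subset[of D] by (auto simp: ok_def L_def)
    ultimately show ?thesis by blast
  qed
  define Q where "Q = rep ` {L \<in> I. \<exists>f\<in>F. ok L f}"
  have "countable Q" unfolding Q_def using \<open>countable I\<close> by (intro countable_image) (auto intro: countable_subset)
  moreover have "Q \<subseteq> F" using rep unfolding Q_def by blast
  moreover have "\<exists>q\<in>Q. \<forall>x\<in>D. dist (f x) (q x) \<le> 1" if f: "f \<in> F" for f
  proof -
    obtain L where L: "L \<in> I" "ok L f" using ex[OF f] by blast
    have "rep L \<in> Q" using L f unfolding Q_def by blast
    moreover have "dist (f x) (rep L x) \<le> 1" if x: "x \<in> D" for x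
    proof -
      obtain p where p: "p \<in> L" "x \<in> fst p" using L(2) x unfolding ok_def by blast
      have "dist (f x) (snd p) < 1/2" "dist (rep L x) (snd p) < 1/2"
        using L(2) rep(2)[OF f L(2)] p unfolding ok_def by blast+
      then show ?thesis using dist_triangle2[of "f x" "rep L x" "snd p"] by linarith
    qed
    ultimately show ?thesis by blast
  qed
  ultimately show ?thesis by blast
qed

text \<open>Only finiteness is tested, so a net with uniform error 1 is fine enough: passing to the
  nearest field in \<open>Q\<close> changes the integral by at most the integral of \<open>B\<close>
  over \<open>D\<close>.\<close>

lemma total_variation_finite_countable:
  fixes D :: "(real^'n) set"
  assumes D: "open D" "bounded D"
  shows "\<exists>Q. countable Q \<and> (\<forall>q\<in>Q. continuous_on UNIV q \<and> (\<exists>B. \<forall>x. norm (q x) \<le> B)) \<and>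
    (\<forall>u :: real^'n \<Rightarrow> real^'m. \<forall>B. u \<in> borel_measurable borel \<longrightarrow> (\<forall>y. norm (u y) \<le> B) \<longrightarrow>
      (total_variation u D < \<infinity> \<longleftrightarrow> (\<exists>C::nat. \<forall>q\<in>Q. integral D (\<lambda>x. u x \<bullet> q x) \<le> real C)))"
proof -
  let ?F = "div_field ` (test_fields D :: (real^'n \<Rightarrow> real^'n^'m) set)"
  have Fc: "continuous_on UNIV f" if "f \<in> ?F" for f using that div_field_continuous by blast
  have Fb: "\<exists>B. \<forall>x. norm (f x) \<le> B" if "f \<in> ?F" for f using that div_field_bounded by blast
  have net: "\<exists>Q \<subseteq> ?F. countable Q \<and> (\<forall>f\<in>?F. \<exists>q\<in>Q. \<forall>x\<in>D. dist (f x) (q x) \<le> 1)"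
    by (rule countable_uniform_net[OF D(2)]) (rule Fc)
  obtain Q where Q: "Q \<subseteq> ?F" "countable Q" "\<forall>f\<in>?F. \<exists>q\<in>Q. \<forall>x\<in>D. dist (f x) (q x) \<le> 1"
    using net by (elim exE conjE) (rule that; assumption)
  have "total_variation u D < \<infinity> \<longleftrightarrow> (\<exists>C::nat. \<forall>q\<in>Q. integral D (\<lambda>x. u x \<bullet> q x) \<le> real C)"
    if u: "u \<in> borel_measurable borel" and B: "\<And>y. norm (u y) \<le> B" for u :: "real^'n \<Rightarrow> real^'m" and B
  proof
    assume "total_variation u D < \<infinity>"
    then obtain C where C: "total_variation u D \<le> ereal C" unfolding total_variation_finite_iff by blast
    obtain n :: nat where n: "C \<le> real n" using real_arch_simple by blast
    have "integral D (\<lambda>x. u x \<bullet> q x) \<le> real n" if q: "q \<in> Q" for q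
    proof -
      obtain \<phi> where \<phi>: "\<phi> \<in> test_fields D" "q = div_field \<phi>" using q Q(1) by blast
      have "integral D (\<lambda>x. u x \<bullet> q x) \<le> C" using C[unfolded total_variation_le_iff] \<phi> by blast
      then show ?thesis using n by linarith
    qed
    then show "\<exists>C::nat. \<forall>q\<in>Q. integral D (\<lambda>x. u x \<bullet> q x) \<le> real C" by blast
  next
    assume "\<exists>C::nat. \<forall>q\<in>Q. integral D (\<lambda>x. u x \<bullet> q x) \<le> real C"
    then obtain C :: nat where C: "\<And>q. q \<in> Q \<Longrightarrow> integral D (\<lambda>x. u x \<bullet> q x) \<le> real C" by blast
    have B0: "0 \<le> B" using order_trans[OF norm_ge_zero B[of 0]] .
    have ai: "u absolutely_integrable_on D" by (rule bounded_set_absolutely_integrable[OF u D B])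
    have int: "(\<lambda>x. u x \<bullet> f x) integrable_on D" if f: "f \<in> ?F" for f
    proof -
      obtain K where "\<And>x. norm (f x) \<le> K" using Fb[OF f] by blast
      then have "(\<lambda>x. u x \<bullet> f x) absolutely_integrable_on D"
        using D(1) by (intro continuous_mult_absolutely_integrable[OF ai _ Fc[OF f]]) auto
      then show ?thesis by (rule set_lebesgue_integral_eq_integral(1))
    qed
    have "integral D (\<lambda>x. u x \<bullet> div_field \<phi> x) \<le> real C + integral D (\<lambda>_. B)" if "\<phi> \<in> test_fields D" for \<phi>
    proof -
      have f: "div_field \<phi> \<in> ?F" using that by blast
      obtain q where q: "q \<in> Q" "\<And>x. x \<in> D \<Longrightarrow> dist (div_field \<phi> x) (q x) \<le> 1" using bspec[OF Q(3) f] by blast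
      have iB: "(\<lambda>_::real^'n. B) integrable_on D" by (rule integrable_on_const[OF lmeasurable_open[OF D(2,1)]])
      have iq: "(\<lambda>x. u x \<bullet> q x) integrable_on D" using q(1) Q(1) by (intro int) auto
      have "integral D (\<lambda>x. u x \<bullet> div_field \<phi> x) \<le> integral D (\<lambda>x. u x \<bullet> q x + B)"
      proof (rule integral_le[OF int[OF f] integrable_add[OF iq iB]])
        fix x assume "x \<in> D"
        have "u x \<bullet> (div_field \<phi> x - q x) \<le> norm (u x) * norm (div_field \<phi> x - q x)" by (rule norm_cauchy_schwarz)
        also have "\<dots> \<le> B * 1" using B q(2)[OF \<open>x \<in> D\<close>] B0 by (intro mult_mono) (auto simp: dist_norm)
        finally show "u x \<bullet> div_field \<phi> x \<le> u x \<bullet> q x + B" by (simp add: inner_diff_right)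
      qed
      also have "\<dots> = integral D (\<lambda>x. u x \<bullet> q x) + integral D (\<lambda>_. B)" by (rule Henstock_Kurzweil_Integration.integral_add[OF iq iB])
      finally show ?thesis using C[OF q(1)] by linarith
    qed
    then show "total_variation u D < \<infinity>" unfolding total_variation_finite_iff total_variation_le_iff by blast
  qed
  moreover have "\<forall>q\<in>Q. continuous_on UNIV q \<and> (\<exists>B. \<forall>x. norm (q x) \<le> B)"
    using Q(1) Fc Fb by (meson subsetD)
  ultimately show ?thesis using Q(2) by (intro exI[of _ Q] conjI allI impI) auto
qed

lemma (in random_partition) total_variation_finite_measurable:
  assumes D: "open D" "bounded D"
  shows "Measurable.pred T (\<lambda>\<theta>. total_variation (u \<theta>) D < \<infinity>)"
proof -
  obtain B where B: "\<And>\<theta> y. norm (u \<theta> y) \<le> B" using u_bounded by blast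
  obtain Q where Q0: "countable Q" "\<forall>q\<in>Q. continuous_on UNIV q \<and> (\<exists>B. \<forall>x. norm (q x) \<le> B)"
    and iff: "\<forall>u :: real^'n \<Rightarrow> real^'m. \<forall>B. u \<in> borel_measurable borel \<longrightarrow> (\<forall>y. norm (u y) \<le> B) \<longrightarrow>
      (total_variation u D < \<infinity> \<longleftrightarrow> (\<exists>C::nat. \<forall>q\<in>Q. integral D (\<lambda>x. u x \<bullet> q x) \<le> real C))"
    using total_variation_finite_countable[OF D, where 'm = 'm] by (elim exE conjE) (rule that; assumption)
  have Q: "countable Q" "\<And>q. q \<in> Q \<Longrightarrow> continuous_on UNIV q" "\<And>q. q \<in> Q \<Longrightarrow> \<exists>B. \<forall>x. norm (q x) \<le> B"
    using Q0 by simp_all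
  have m: "(\<lambda>\<theta>. integral D (\<lambda>x. u \<theta> x \<bullet> q x)) \<in> borel_measurable T" if q: "q \<in> Q" for q
  proof -
    obtain K where K: "\<And>x. norm (q x) \<le> K" using Q(3)[OF q] by blast
    have qb: "q \<in> borel_measurable borel" using Q(2)[OF q] by (rule borel_measurable_continuous_onI)
    have "integral D (\<lambda>x. u \<theta> x \<bullet> q x) = (\<integral>x. indicator D x *\<^sub>R (u \<theta> x \<bullet> q x) \<partial>lborel)" if \<theta>: "\<theta> \<in> space T" for \<theta>
    proof -
      have "(\<lambda>x. u \<theta> x \<bullet> q x) absolutely_integrable_on D"
        using D(1) K by (intro continuous_mult_absolutely_integrable[OF bounded_set_absolutely_integrable[OF u_borel[OF \<theta>] D B] _ Q(2)[OF q]]) auto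
      then have "integral D (\<lambda>x. u \<theta> x \<bullet> q x) = (\<integral>x. indicator D x *\<^sub>R (u \<theta> x \<bullet> q x) \<partial>lebesgue)"
        using set_lebesgue_integral_eq_integral(2) unfolding set_lebesgue_integral_def by metis
      also have "\<dots> = (\<integral>x. indicator D x *\<^sub>R (u \<theta> x \<bullet> q x) \<partial>lborel)"
      proof (rule integral_completion)
        show "(\<lambda>x. indicator D x *\<^sub>R (u \<theta> x \<bullet> q x)) \<in> borel_measurable lborel"
          using D(1) u_borel[OF \<theta>] qb by (intro borel_measurable_scaleR borel_measurable_indicator borel_measurable_inner) auto
      qed
      finally show ?thesis .
    qed
    moreover have "(\<lambda>\<theta>. \<integral>x. indicator D x *\<^sub>R (u \<theta> x \<bullet> q x) \<partial>lborel) \<in> borel_measurable T"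
    proof (rule lborel.borel_measurable_lebesgue_integral)
      have [measurable]: "(\<lambda>p. u (fst p) (snd p)) \<in> borel_measurable (T \<Otimes>\<^sub>M lborel)"
        using u_joint by (simp cong: measurable_cong_sets sets_pair_measure_cong)
      have [measurable]: "(\<lambda>p. q (snd p)) \<in> borel_measurable (T \<Otimes>\<^sub>M lborel)"
        using measurable_compose[OF measurable_snd, of q lborel borel T] qb by simp
      have [measurable]: "(\<lambda>p. indicator D (snd p) :: real) \<in> borel_measurable (T \<Otimes>\<^sub>M lborel)"
        using measurable_compose[OF measurable_snd, of "indicator D" lborel borel T] D(1) by simp
      show "(\<lambda>(\<theta>, x). indicator D x *\<^sub>R (u \<theta> x \<bullet> q x)) \<in> borel_measurable (T \<Otimes>\<^sub>M lborel)"
        unfolding case_prod_beta by (intro borel_measurable_scaleR borel_measurable_inner) measurable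
    qed
    ultimately show ?thesis by (simp cong: measurable_cong)
  qed
  have "Measurable.pred T (\<lambda>\<theta>. \<forall>q\<in>Q. integral D (\<lambda>x. u \<theta> x \<bullet> q x) \<le> real C)" for C
  unfolding pred_def
  proof -
    have "{\<theta> \<in> space T. integral D (\<lambda>x. u \<theta> x \<bullet> q x) \<le> real C} \<in> sets T" if "q \<in> Q" for q
      by (rule borel_measurable_le[OF m[OF that]]) simp
    then have "(\<Inter>q\<in>Q. {\<theta> \<in> space T. integral D (\<lambda>x. u \<theta> x \<bullet> q x) \<le> real C}) \<inter> space T \<in> sets T"
      using Q(1) by (cases "Q = {}") (auto intro!: sets.Int sets.countable_INT')
    moreover have "(\<Inter>q\<in>Q. {\<theta> \<in> space T. integral D (\<lambda>x. u \<theta> x \<bullet> q x) \<le> real C}) \<inter> space T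
      = {\<theta> \<in> space T. \<forall>q\<in>Q. integral D (\<lambda>x. u \<theta> x \<bullet> q x) \<le> real C}" by auto
    ultimately show "{\<theta> \<in> space T. (\<forall>q\<in>Q. integral D (\<lambda>x. u \<theta> x \<bullet> q x) \<le> real C)} \<in> sets T" by simp
  qed
  then have *: "Measurable.pred T (\<lambda>\<theta>. \<exists>C::nat. \<forall>q\<in>Q. integral D (\<lambda>x. u \<theta> x \<bullet> q x) \<le> real C)"
    by (rule pred_intros_countable)
  have "(total_variation (u \<theta>) D < \<infinity>) = (\<exists>C::nat. \<forall>q\<in>Q. integral D (\<lambda>x. u \<theta> x \<bullet> q x) \<le> real C)" if "\<theta> \<in> space T" for \<theta>
    by (rule iff[rule_format, OF u_borel[OF that] B])
  then show ?thesis using * by (subst measurable_cong)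
qed

text \<open>The almost everywhere statement is the vanishing of an integral over the point, and this
  integral is measurable in the code by Fubini.\<close>

lemma (in random_partition) AE_eq_measurable:
  assumes w: "w \<in> borel_measurable borel" and A: "A \<in> sets borel"
  shows "Measurable.pred T (\<lambda>\<theta>. AE y in lborel. y \<in> A \<longrightarrow> u \<theta> y = w y)"
proof -
  note [measurable] = w A
  have [measurable]: "(\<lambda>p. u (fst p) (snd p)) \<in> borel_measurable (T \<Otimes>\<^sub>M lborel)"
    using u_joint by (simp cong: measurable_cong_sets sets_pair_measure_cong)
  have nn: "(\<lambda>\<theta>. \<integral>\<^sup>+y. (if y \<in> A \<and> u \<theta> y \<noteq> w y then 1 else 0) \<partial>lborel) \<in> borel_measurable T"
  proof (rule lborel.borel_measurable_nn_integral)
    show "(\<lambda>(\<theta>, y). if y \<in> A \<and> u \<theta> y \<noteq> w y then 1 else 0 :: ennreal) \<in> borel_measurable (T \<Otimes>\<^sub>M lborel)"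
      unfolding case_prod_beta by measurable
  qed
  have "(AE y in lborel. y \<in> A \<longrightarrow> u \<theta> y = w y) \<longleftrightarrow> (\<integral>\<^sup>+y. (if y \<in> A \<and> u \<theta> y \<noteq> w y then 1 else 0) \<partial>lborel) = 0"
    if \<theta>: "\<theta> \<in> space T" for \<theta>
  proof -
    note [measurable] = u_borel[OF \<theta>]
    have "(\<lambda>y. if y \<in> A \<and> u \<theta> y \<noteq> w y then 1 else 0 :: ennreal) \<in> borel_measurable lborel" by measurable
    from nn_integral_0_iff_AE[OF this] show ?thesis by (auto elim!: eventually_mono split: if_splits)
  qed
  moreover have "Measurable.pred T (\<lambda>\<theta>. (\<integral>\<^sup>+y. (if y \<in> A \<and> u \<theta> y \<noteq> w y then 1 else 0) \<partial>lborel) = 0)"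
    using nn by measurable
  ultimately show ?thesis by (subst measurable_cong)
qed

section \<open>Codes for measurable partitions\<close>

lemma u_jump_borel: "u_jump a b \<nu> \<in> borel_measurable borel"
proof -
  have "Measurable.pred borel (\<lambda>x. 0 < x \<bullet> \<nu>)"
    using borel_measurable_continuous_onI[of "\<lambda>x. x \<bullet> \<nu>"] by (auto intro!: borel_measurable_pred_less continuous_intros)
  then show ?thesis unfolding u_jump_def[abs_def] by measurable
qed

text \<open>For each \<open>i\<close> and \<open>n\<close> the code lists the indices of basic open
  sets whose union is the \<open>n\<close>-th open set; the intersection over \<open>n\<close> is
  the \<open>i\<close>-th G-delta set.\<close>

definition coded_set :: "(nat \<Rightarrow> 'a set) \<Rightarrow> (nat \<Rightarrow> nat) \<Rightarrow> nat \<Rightarrow> 'a set" where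
  "coded_set B \<theta> i = (\<Inter>n. \<Union>k. B (\<theta> (prod_encode (i, prod_encode (n, k)))))"

text \<open>If \<open>y\<close> lies in no coded set, \<open>LEAST\<close> is a junk index; the value is still in \<open>M\<close>.\<close>

definition coded_function :: "(nat \<Rightarrow> 'a set) \<Rightarrow> 'b set \<Rightarrow> (nat \<Rightarrow> nat) \<Rightarrow> 'a \<Rightarrow> 'b" where
  "coded_function B M \<theta> y = from_nat_into M (LEAST i. y \<in> coded_set B \<theta> i)"

lemma coded_function_in: "M \<noteq> {} \<Longrightarrow> coded_function B M \<theta> y \<in> M"
  by (simp add: coded_function_def from_nat_into)

lemma coded_function_joint:
  fixes M :: "(real^'m) set"
  assumes B[measurable]: "\<And>i. B i \<in> sets (borel :: (real^'n) measure)"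
  shows "(\<lambda>p. coded_function B M (fst p) (snd p)) \<in> borel_measurable (baire \<Otimes>\<^sub>M borel)"
proof -
  have [measurable]: "(\<lambda>p. fst p m) \<in> measurable (baire \<Otimes>\<^sub>M (borel :: (real^'n) measure)) (count_space UNIV)" for m
    using measurable_compose[OF measurable_fst measurable_component_singleton[of m UNIV]] by simp
  have "Measurable.pred (baire \<Otimes>\<^sub>M borel) (\<lambda>p. \<exists>j. fst p m = j \<and> snd p \<in> B j)" for m by measurable
  then have [measurable]: "Measurable.pred (baire \<Otimes>\<^sub>M borel) (\<lambda>p. snd p \<in> B (fst p m))" for m by simp
  have "Measurable.pred (baire \<Otimes>\<^sub>M borel) (\<lambda>p. snd p \<in> coded_set B (fst p) i)" for i
    unfolding coded_set_def INT_iff UN_iff ball_UNIV bex_UNIV by measurable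
  then have "(\<lambda>p. LEAST i. snd p \<in> coded_set B (fst p) i) \<in> measurable (baire \<Otimes>\<^sub>M borel) (count_space UNIV)"
    by (rule measurable_Least)
  from measurable_compose[OF this, of "from_nat_into M" borel] show ?thesis by (simp add: coded_function_def)
qed

lemma gdelta_coding:
  "\<exists>B :: nat \<Rightarrow> (real^'n) set. (\<forall>i. open (B i)) \<and> (\<forall>C. (\<forall>i. gdelta (C i)) \<longrightarrow> (\<exists>\<theta>. \<forall>i. C i = coded_set B \<theta> i))"
proof -
  obtain \<B>0 :: "(real^'n) set set" where \<B>0: "countable \<B>0" "topological_basis \<B>0"
    using ex_countable_basis by blast
  \<comment> \<open>The empty set is added so that every open set, the empty one included, is the
    union of a full sequence of members.\<close>
  define \<B> where "\<B> = insert {} \<B>0"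
  have \<B>: "countable \<B>" "\<B> \<noteq> {}" using \<B>0(1) by (auto simp: \<B>_def)
  define B where "B = from_nat_into \<B>"
  have "open (B i)" for i
    using from_nat_into[OF \<B>(2), of i] topological_basis_open[OF \<B>0(2)] by (auto simp: B_def \<B>_def)
  moreover have "\<exists>\<theta>. \<forall>i. C i = coded_set B \<theta> i" if C: "\<And>i. gdelta (C i)" for C
  proof -
    have "\<exists>F. (\<forall>n::nat. open (F n)) \<and> C i = (\<Inter>n. F n)" for i using C[of i] by (auto elim!: gdelta.cases)
    then obtain F where F: "\<And>i n. open (F i n)" "\<And>i. C i = (\<Inter>n::nat. F i n)" by metis
    have "\<exists>f :: nat \<Rightarrow> nat. F i n = (\<Union>k. B (f k))" for i n
    proof -
      obtain X where X: "X \<subseteq> \<B>0" "\<Union>X = F i n" using \<B>0(2) F(1)[of i n] unfolding topological_basis_def by metis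
      define Y where "Y = insert {} X"
      have Y: "countable Y" "Y \<noteq> {}" "Y \<subseteq> \<B>" using X(1) \<B>0(1) by (auto simp: Y_def \<B>_def intro: countable_subset)
      have "B (to_nat_on \<B> (from_nat_into Y k)) = from_nat_into Y k" for k
        unfolding B_def using from_nat_into[OF Y(2), of k] Y(3) by (intro from_nat_into_to_nat_on \<B>(1)) auto
      then have "(\<Union>k. B (to_nat_on \<B> (from_nat_into Y k))) = \<Union>(range (from_nat_into Y))" by simp
      also have "\<dots> = F i n" using range_from_nat_into[OF Y(2,1)] X(2) by (simp add: Y_def)
      finally show ?thesis by (intro exI[of _ "\<lambda>k. to_nat_on \<B> (from_nat_into Y k)"]) simp
    qed
    then obtain f :: "nat \<Rightarrow> nat \<Rightarrow> nat \<Rightarrow> nat" where f: "\<And>i n. F i n = (\<Union>k. B (f i n k))" by metis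
    define \<theta> where "\<theta> m = (case prod_decode m of (i, m') \<Rightarrow> case prod_decode m' of (n, k) \<Rightarrow> f i n k)" for m
    have "C i = coded_set B \<theta> i" for i unfolding coded_set_def F(2) f by (simp add: \<theta>_def)
    then show ?thesis by blast
  qed
  ultimately show ?thesis by blast
qed

text \<open>Lebesgue measurable sets are G-delta up to null sets. Coding the level sets of
  \<open>v\<close> one by one recovers \<open>v\<close> almost everywhere, and this is enough,
  because variation and energy on the open set \<open>D\<close> see only such classes.\<close>

lemma coded_function_dense:
  fixes M :: "(real^'m) set"
  shows "\<exists>B :: nat \<Rightarrow> (real^'n) set. (\<forall>i. open (B i)) \<and>
    (\<forall>v D. open D \<longrightarrow> v absolutely_integrable_on D \<longrightarrow> (\<forall>y\<in>D. v y \<in> M) \<longrightarrow> countable M \<longrightarrow>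
      (\<exists>\<theta>. AE y in lborel. y \<in> D \<longrightarrow> coded_function B M \<theta> y = v y))"
proof -
  obtain B :: "nat \<Rightarrow> (real^'n) set" where B: "\<forall>i. open (B i)"
    and cod: "\<forall>C. (\<forall>i. gdelta (C i)) \<longrightarrow> (\<exists>\<theta>. \<forall>i. C i = coded_set B \<theta> i)"
    using gdelta_coding[where 'n = 'n] by (elim exE conjE) (rule that; assumption)
  have key: "\<exists>\<theta>. AE y in lborel. y \<in> D \<longrightarrow> coded_function B M \<theta> y = v y"
    if D: "open D" and v: "v absolutely_integrable_on D" "\<And>y. y \<in> D \<Longrightarrow> v y \<in> M" and M: "countable M" for v D
  proof -
    have Dl: "D \<in> sets lebesgue" using D by auto
    have vm: "v \<in> borel_measurable (lebesgue_on D)" using v(1) absolutely_integrable_measurable[OF Dl] by blast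
    define A where "A i = {y \<in> D. v y = from_nat_into M i}" for i
    have A: "A i \<in> sets lebesgue" for i
    proof -
      have "v -` {from_nat_into M i} \<inter> space (lebesgue_on D) \<in> sets (lebesgue_on D)" by (rule measurable_sets[OF vm]) simp
      also have "v -` {from_nat_into M i} \<inter> space (lebesgue_on D) = A i" by (auto simp: A_def space_restrict_space)
      finally show ?thesis using Dl by (simp add: sets_restrict_space_iff)
    qed
    have "\<exists>C T. gdelta C \<and> negligible T \<and> A i \<union> T = C" for i
      using lebesgue_set_almost_gdelta[OF A[of i]] unfolding negligible_iff_null_sets by metis
    then obtain C T where CT: "\<And>i. gdelta (C i)" "\<And>i. negligible (T i)" "\<And>i. A i \<union> T i = C i" by metis
    obtain \<theta> where \<theta>: "\<And>i. C i = coded_set B \<theta> i" using cod[rule_format, of C, OF CT(1)] by (elim exE) (rule that; simp)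
    have "AE y in lebesgue. \<forall>i. y \<notin> T i"
      using CT(2) unfolding AE_all_countable negligible_iff_null_sets by (blast intro: AE_not_in)
    then have "AE y in lborel. \<forall>i. y \<notin> T i" by (simp add: AE_completion_iff)
    then have "AE y in lborel. y \<in> D \<longrightarrow> coded_function B M \<theta> y = v y"
    proof eventually_elim
      case (elim y)
      show ?case
      proof
        assume y: "y \<in> D"
        have iff: "y \<in> coded_set B \<theta> i \<longleftrightarrow> v y = from_nat_into M i" for i
          using elim y CT(3)[of i] unfolding \<theta>[symmetric] A_def by blast
        have "\<exists>i. v y = from_nat_into M i" using from_nat_into_surj[OF M v(2)[OF y]] by metis
        then show "coded_function B M \<theta> y = v y" unfolding coded_function_def iff by (metis (mono_tags, lifting) LeastI_ex)
      qed
    qed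
    then show ?thesis by blast
  qed
  show ?thesis
  proof (intro exI[of _ B] conjI allI impI)
    show "open (B i)" for i using B by blast
    show "\<exists>\<theta>. AE y in lborel. y \<in> D \<longrightarrow> coded_function B M \<theta> y = v y"
      if "open D" "v absolutely_integrable_on D" "\<forall>y\<in>D. v y \<in> M" "countable M" for v D
      using that by (intro key) auto
  qed
qed

text \<open>Replaces the uncountably many open neighbourhoods of the boundary by a sequence of
  collars, using that the frontier of a bounded set is compact.\<close>

lemma frontier_collar:
  fixes D :: "(real^'n) set"
  assumes D: "bounded D" and U: "open U" "frontier D \<subseteq> U"
  shows "\<exists>n. {y \<in> D. infdist y (frontier D) < rad n} \<subseteq> U"
proof (cases "frontier D = {}")
  case True
  then have "D = {} \<or> D = UNIV" by (simp add: frontier_eq_empty)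
  then have "D = {}" using D not_bounded_UNIV by blast
  then show ?thesis by simp
next
  case False
  obtain e where e: "0 < e" "{x. infdist x (frontier D) \<le> e} \<subseteq> U"
    using compact_in_open_separated[OF False compact_frontier_bounded[OF D] U] by blast
  from e(1) obtain n where n: "rad n < e" by (rule nat_approx_posE)
  have "{y \<in> D. infdist y (frontier D) < rad n} \<subseteq> {x. infdist x (frontier D) \<le> e}" using n by auto
  then show ?thesis using e(2) by blast
qed

text \<open>\<open>S\<close> consists of the codes that describe competitors up to null sets: finite
  variation, and the prescribed values on some collar. Both conditions are measurable, so the
  infimum over competitors becomes an infimum over a measurable set of codes.\<close>

lemma min_energy_measurable:
  fixes G :: "'w \<Rightarrow> ('n::finite, 'm::finite) tension"
  assumes P: "finite_measure P" "complete_measure P" and G: "random_surface_tension P c G"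
    and d: "2 \<le> CARD('n)" and D: "open D" "bounded D" and M: "finite M" "a \<in> M" "b \<in> M"
  shows "(\<lambda>\<omega>. min_energy M (G \<omega>) a b \<nu> D) \<in> borel_measurable P"
proof -
  let ?H = "hausdorff_measure (real CARD('n) - 1) :: (real^'n) measure"
  obtain B :: "nat \<Rightarrow> (real^'n) set" where B: "\<forall>i. open (B i)"
    and dense: "\<forall>v D. open D \<longrightarrow> v absolutely_integrable_on D \<longrightarrow> (\<forall>y\<in>D. v y \<in> M) \<longrightarrow> countable M \<longrightarrow>
      (\<exists>\<theta>. AE y in lborel. y \<in> D \<longrightarrow> coded_function B M \<theta> y = v y)"
    using coded_function_dense[of M] by (elim exE conjE) (rule that; assumption)
  let ?u = "coded_function B M"
  have ne: "M \<noteq> {}" using M by blast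
  interpret coded: random_partition baire ?u M
  proof
    show "(\<lambda>p. ?u (fst p) (snd p)) \<in> borel_measurable (baire \<Otimes>\<^sub>M borel)"
      using B by (intro coded_function_joint) auto
  qed (use coded_function_in[OF ne] M(1) in auto)
  define V where "V n = {y \<in> D. infdist y (frontier D) < rad n}" for n
  have Vopen: "open {y. infdist y (frontier D) < rad n}" for n
    by (intro open_Collect_less continuous_intros)
  have Vb: "V n \<in> sets borel" for n
    using open_Int[OF D(1) Vopen[of n]] by (auto simp: V_def Int_def)
  define S where "S = {\<theta>. total_variation (?u \<theta>) D < \<infinity> \<and> (\<exists>n. AE y in lborel. y \<in> V n \<longrightarrow> ?u \<theta> y = u_jump a b \<nu> y)}"
  have S: "S \<in> sets baire"
  proof -
    have "Measurable.pred baire (\<lambda>\<theta>. total_variation (?u \<theta>) D < \<infinity> \<and> (\<exists>n. AE y in lborel. y \<in> V n \<longrightarrow> ?u \<theta> y = u_jump a b \<nu> y))"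
      by (intro pred_intros_logic pred_intros_countable coded.total_variation_finite_measurable[OF D] coded.AE_eq_measurable u_jump_borel Vb)
    then show ?thesis by (simp add: S_def pred_def space_PiM)
  qed
  have sp: "\<theta> \<in> space baire" for \<theta> by (simp add: space_PiM)
  have cong: "(\<integral>\<^sup>+x\<in>D. jump_energy g v x \<partial>?H) = (\<integral>\<^sup>+x\<in>D. jump_energy g w x \<partial>?H)"
    if "AE y in lborel. y \<in> D \<longrightarrow> v y = w y" for g :: "('n, 'm) tension" and v w
    by (intro nn_integral_cong) (auto simp: indicator_def intro!: jump_energy_cong[OF _ D(1) _ that])
  have "min_energy M (G \<omega>) a b \<nu> D = (INF \<theta>\<in>S. \<integral>\<^sup>+x\<in>D. jump_energy (G \<omega>) (?u \<theta>) x \<partial>?H)" for \<omega>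
    unfolding min_energy_def
  proof (rule antisym; rule INF_mono)
    fix \<theta> assume \<theta>: "\<theta> \<in> S"
    then obtain n where n: "AE y in lborel. y \<in> V n \<longrightarrow> ?u \<theta> y = u_jump a b \<nu> y" unfolding S_def by blast
    \<comment> \<open>A code attains the boundary values only almost everywhere on the collar;
      overwriting them there makes the function admissible and leaves the energy unchanged.\<close>
    define w where "w y = (if y \<in> V n then u_jump a b \<nu> y else ?u \<theta> y)" for y
    have ae: "AE y in lborel. y \<in> D \<longrightarrow> w y = ?u \<theta> y" using n by (auto simp: w_def elim!: eventually_mono)
    note [measurable] = u_jump_borel coded.u_borel[OF sp] Vb
    have wm: "w \<in> borel_measurable borel" unfolding w_def[abs_def] by measurable
    have wM: "w y \<in> M" for y using coded_function_in[OF ne] M by (auto simp: w_def u_jump_def)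
    obtain K where "\<And>y. norm (w y) \<le> K" using finite_imp_bounded[OF M(1)] wM by (auto simp: bounded_iff)
    then have "w absolutely_integrable_on D" by (intro bounded_set_absolutely_integrable[OF wm D])
    moreover have "total_variation w D < \<infinity>" using total_variation_cong_AE[OF ae] \<theta> by (simp add: S_def)
    ultimately have BV: "w \<in> BV_M M D" using wM by (simp add: BV_M_def)
    have "frontier D \<subseteq> {y. infdist y (frontier D) < rad n}" by auto
    then have "w \<in> admissible M (u_jump a b \<nu>) D"
      using BV Vopen[of n] unfolding admissible_def by (auto simp: w_def V_def)
    moreover have "energy M (G \<omega>) w D \<le> (\<integral>\<^sup>+x\<in>D. jump_energy (G \<omega>) (?u \<theta>) x \<partial>?H)"
      unfolding energy_eq[OF BV] cong[OF ae] ..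
    ultimately show "\<exists>w\<in>admissible M (u_jump a b \<nu>) D. energy M (G \<omega>) w D \<le> (\<integral>\<^sup>+x\<in>D. jump_energy (G \<omega>) (?u \<theta>) x \<partial>?H)"
      by blast
  next
    fix v :: "real^'n \<Rightarrow> real^'m" assume v: "v \<in> admissible M (u_jump a b \<nu>) D"
    then have BV: "v \<in> BV_M M D" by (simp add: admissible_def)
    obtain U where U: "open U" "frontier D \<subseteq> U" "\<And>x. x \<in> U \<Longrightarrow> x \<in> D \<Longrightarrow> v x = u_jump a b \<nu> x"
      using v unfolding admissible_def by blast
    obtain n where n: "V n \<subseteq> U" using frontier_collar[OF D(2) U(1,2)] unfolding V_def by blast
    obtain \<theta> where ae: "AE y in lborel. y \<in> D \<longrightarrow> ?u \<theta> y = v y"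
      using dense[rule_format, OF D(1), of v] BV countable_finite[OF M(1)] unfolding BV_M_def by blast
    have "AE y in lborel. y \<in> V n \<longrightarrow> ?u \<theta> y = u_jump a b \<nu> y"
      using ae by eventually_elim (use n U(3) in \<open>auto simp: V_def\<close>)
    then have "\<theta> \<in> S" using total_variation_cong_AE[OF ae] BV by (auto simp: S_def BV_M_def)
    moreover have "(\<integral>\<^sup>+x\<in>D. jump_energy (G \<omega>) (?u \<theta>) x \<partial>?H) \<le> energy M (G \<omega>) v D"
      unfolding energy_eq[OF BV] cong[OF ae] ..
    ultimately show "\<exists>\<theta>\<in>S. (\<integral>\<^sup>+x\<in>D. jump_energy (G \<omega>) (?u \<theta>) x \<partial>?H) \<le> energy M (G \<omega>) v D" by blast
  qed
  then show ?thesis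
    using borel_measurable_INF_baire[OF P coded.energy_integral_measurable[OF G borel_open[OF D(1)] d] S] by simp
qed

section \<open>Assembly for the cell functional and choice of the constant\<close>

theorem theorem3p3:
  fixes P :: "'w measure"
    and G :: "'w \<Rightarrow> ('n::{finite,linorder}, 'm::finite) tension"
    and \<tau> :: "(real, 'n) vec \<Rightarrow> 'w \<Rightarrow> 'w"
    and M :: "((real, 'm) vec) set"
    and c :: real
    and \<pi> :: "real \<Rightarrow> real"
  assumes "CARD('n) \<ge> 2"
    and "finite M"
    and "prob_space P"
    and "complete_measure P"
    and "c \<ge> 1"
    and "random_surface_tension P c G"
    and "mp_group_action P \<tau>"
    and "stationary P \<tau> G"
    and "multiscale_FI P c G \<pi>"
  shows "\<exists>cd > 0. \<forall>p \<ge> 1. \<forall>a \<in> M. \<forall>b \<in> M. \<forall>\<nu> \<in> sphere (0::(real, 'n) vec) 1. \<forall>t l.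
     1 \<le> l \<and> l \<le> t \<longrightarrow>
       (\<integral>\<^sup>+ \<omega>. ennreal (\<bar>X_cell M t l a b \<nu> (G \<omega>) - (\<integral> \<omega>'. X_cell M t l a b \<nu> (G \<omega>') \<partial>P)\<bar> powr (2 * p)) \<partial>P)
         \<le> ennreal ((cd * p\<^sup>2) powr p * t powr (p * (1 - real CARD('n))) * l powr p)
           * (\<integral>\<^sup>+ s \<in> {0<..}. ennreal ((s + 1) powr (2 * p * (real CARD('n) - 1)) * \<pi> s) \<partial>lborel)
     \<and> variance_enn P (\<lambda>\<omega>. X_cell M t l a b \<nu> (G \<omega>))
         \<le> ennreal (cd * t powr (1 - real CARD('n)) * l)
           * (\<integral>\<^sup>+ s \<in> {0<..}. ennreal ((s + 1) powr (2 * (real CARD('n) - 1)) * \<pi> s) \<partial>lborel)"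
proof -
  define d where "d = real CARD('n)"
  have d2: "2 \<le> d" using assms(1) by (simp add: d_def)
  obtain C where C: "0 < C" and FI: "\<And>X :: ('n, 'm) tension \<Rightarrow> real. (\<lambda>\<omega>. X (G \<omega>)) \<in> borel_measurable P \<Longrightarrow>
        variance_enn P (\<lambda>\<omega>. X (G \<omega>)) \<le> ennreal C * outer_nn_integral P (\<lambda>\<omega>.
           outer_nn_integral lborel (\<lambda>s. indicator {0<..} s *
             outer_nn_integral lborel (\<lambda>x. (oscillation c X (G \<omega>) (ball x (s + 1)))\<^sup>2)
             * ennreal ((s + 1) powr (- real CARD('n)) * \<pi> s)))"
    and \<pi>: "set_borel_measurable lborel {0<..} \<pi>" "\<And>s. 0 < s \<Longrightarrow> 0 \<le> \<pi> s"
    using assms(9) unfolding multiscale_FI_def set_integrable_def set_borel_measurable_def by auto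
  have GA: "G \<omega> \<in> adm_class c" if "\<omega> \<in> space P" for \<omega>
    using assms(6) that by (simp add: random_surface_tension_def)
  have fP: "finite_measure P" using assms(3) by (simp add: prob_space_def)
  \<comment> \<open>The maximum with 1 makes the oscillation constant \<open>k\<close> strictly
    positive.\<close>
  define C1 where "C1 = max 1 (osc_const TYPE('n) c)"
  have C1: "1 \<le> C1" "osc_const TYPE('n) c \<le> C1" by (simp_all add: C1_def)
  define mc where "mc = moment_const C (enn2real (\<integral>\<^sup>+s\<in>{0<..}. ennreal (\<pi> s) \<partial>lborel))"
  \<comment> \<open>The variance bound carries \<open>C\<close> alone; with this comparison one
    constant \<open>cd\<close> serves both estimates.\<close>
  have mc: "C \<le> mc"
  proof -
    have "C * 1 \<le> max 1 C * max 1 m0" for m0 :: real using C by (intro mult_mono) auto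
    moreover have "max 1 C * max 1 m0 \<le> (384 * exp 2) * (max 1 C * max 1 m0)" for m0 :: real
    proof -
      have "1 \<le> exp (2::real)" by simp
      then have "1 \<le> 384 * exp (2::real)" by linarith
      then have "1 * (max 1 C * max 1 m0) \<le> 384 * exp 2 * (max 1 C * max 1 m0)" by (intro mult_right_mono) auto
      then show ?thesis by simp
    qed
    ultimately show ?thesis unfolding mc_def moment_const_def mult.assoc mult_1_right by (rule order_trans)
  qed
  \<comment> \<open>\<open>3 ^ CARD('n)\<close> is the volume factor of the enlarged cell,
    \<open>C1\<close> enters through the squared oscillation, and \<open>mc\<close> comes from the
    absorption of moments; none of them depends on \<open>p\<close>, \<open>a\<close>,
    \<open>b\<close>, \<open>\<nu>\<close>, \<open>t\<close> or \<open>l\<close>.\<close>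
  define cd where "cd = mc * (3 ^ CARD('n) * C1\<^sup>2)"
  have k0: "0 < 3 ^ CARD('n) * C1\<^sup>2" using C1 by simp
  have cd0: "0 < cd" unfolding cd_def by (rule mult_pos_pos[OF less_le_trans[OF C mc] k0])
  have main: "(\<integral>\<^sup>+ \<omega>. ennreal (\<bar>X_cell M t l a b \<nu> (G \<omega>) - (\<integral> \<omega>'. X_cell M t l a b \<nu> (G \<omega>') \<partial>P)\<bar> powr (2 * p)) \<partial>P)
         \<le> ennreal ((cd * p\<^sup>2) powr p * t powr (p * (1 - real CARD('n))) * l powr p)
           * (\<integral>\<^sup>+ s \<in> {0<..}. ennreal ((s + 1) powr (2 * p * (real CARD('n) - 1)) * \<pi> s) \<partial>lborel)" (is ?A)
    and var: "variance_enn P (\<lambda>\<omega>. X_cell M t l a b \<nu> (G \<omega>))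
         \<le> ennreal (cd * t powr (1 - real CARD('n)) * l)
           * (\<integral>\<^sup>+ s \<in> {0<..}. ennreal ((s + 1) powr (2 * (real CARD('n) - 1)) * \<pi> s) \<partial>lborel)" (is ?B)
    if p: "1 \<le> p" and ab: "a \<in> M" "b \<in> M" and \<nu>: "norm \<nu> = 1" and l: "1 \<le> l" "l \<le> t" for p a b \<nu> t l
  proof -
    let ?D = "rect \<nu> t l"
    have D: "open ?D" "bounded ?D" using open_rect[OF \<nu>] bounded_rect[OF \<nu> l(2)] by auto
    have c0: "0 \<le> c" using assms(5) by simp
    define V where "V = 3 ^ CARD('n) * t powr (d - 1) * l"
    define k where "k = t powr (1 - d) * C1"
    have t1: "1 \<le> t" using l by simp
    have V1: "1 \<le> V"
    proof -
      have "1 * 1 * 1 \<le> V" unfolding V_def using t1 l d2 by (intro mult_mono ge_one_powr_ge_zero one_le_power) auto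
      then show ?thesis by simp
    qed
    have k1: "0 < k" using t1 C1 by (simp add: k_def)
    \<comment> \<open>The scaling of the theorem: the volume contributes t^(d-1) l, and the squared
      oscillation t^(2(1-d)).\<close>
    have Vk: "V * k\<^sup>2 = 3 ^ CARD('n) * C1\<^sup>2 * (t powr (1 - d) * l)"
    proof -
      have cancel: "t powr (d - 1) * (t powr (1 - d))\<^sup>2 = t powr (1 - d)"
        using t1 by (simp add: power2_eq_square flip: powr_add)
      have "V * k\<^sup>2 = 3 ^ CARD('n) * C1\<^sup>2 * ((t powr (d - 1) * (t powr (1 - d))\<^sup>2) * l)"
        by (simp only: V_def k_def power_mult_distrib mult.assoc mult.commute mult.left_commute)
      then show ?thesis by (simp only: cancel)
    qed
    have "\<exists>N. \<forall>s>0. N s \<in> sets borel \<and> {x. ball x (s + 1) \<inter> ?D \<noteq> {}} \<subseteq> N s \<and> emeasure lborel (N s) \<le> ennreal (V * (s + 1) ^ CARD('n))"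
    proof (intro choice allI)
      show "\<exists>N. 0 < s \<longrightarrow> N \<in> sets borel \<and> {x. ball x (s + 1) \<inter> ?D \<noteq> {}} \<subseteq> N \<and> emeasure lborel N \<le> ennreal (V * (s + 1) ^ CARD('n))" for s
        using emeasure_enlarged_rect[OF \<nu> l, of "s + 1"] by (cases "0 < s") (auto simp: V_def d_def)
    qed
    then obtain N where N: "\<And>s. 0 < s \<Longrightarrow> N s \<in> sets borel" "\<And>s. 0 < s \<Longrightarrow> {x. ball x (s + 1) \<inter> ?D \<noteq> {}} \<subseteq> N s"
      "\<And>s. 0 < s \<Longrightarrow> emeasure lborel (N s) \<le> ennreal (V * (s + 1) ^ CARD('n))" by metis
    let ?X = "X_cell M t l a b \<nu> :: ('n, 'm) tension \<Rightarrow> real"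
    obtain B where B: "\<And>g. g \<in> adm_class c \<Longrightarrow> 0 \<le> ?X g \<and> ?X g \<le> B"
      using X_cell_bounded[OF c0 assms(2) ab \<nu> l(2)] by blast
    have B': "\<bar>?X g\<bar> \<le> B" if "g \<in> adm_class c" for g using B[OF that] by simp
    have Xm: "(\<lambda>\<omega>. ?X (G \<omega>)) \<in> borel_measurable P"
      using min_energy_measurable[OF fP assms(4,6,1) D assms(2) ab, of \<nu>] unfolding X_cell_eq by measurable
    have osc: "?X g' - ?X g \<le> (if x \<in> N s then k * (s + 1) powr (d - 1) else 0)"
      if "0 < s" "g \<in> adm_class c" "g' \<in> adm_class c"
        and eq: "\<And>y \<zeta> \<nu>. y \<notin> ball x (s + 1) \<Longrightarrow> norm \<nu> = 1 \<Longrightarrow> g' y \<zeta> \<nu> = g y \<zeta> \<nu>" for g g' s x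
    proof -
      have le: "?X g' \<le> ?X g + t powr (1 - d) * (if ball x (s + 1) \<inter> ?D = {} then 0 else osc_const TYPE('n) c * (s + 1) powr (d - 1))"
        unfolding d_def using that(1) by (intro X_cell_modify[OF that(2,3) c0 eq assms(2) ab \<nu> _ l(2)]) auto
      show ?thesis
      proof (cases "ball x (s + 1) \<inter> ?D = {}")
        case True
        then have "?X g' - ?X g \<le> 0" using le by simp
        also have "0 \<le> (if x \<in> N s then k * (s + 1) powr (d - 1) else 0)" using k1 by simp
        finally show ?thesis .
      next
        case False
        then have "x \<in> N s" using N(2)[OF that(1)] by blast
        have "t powr (1 - d) * (osc_const TYPE('n) c * (s + 1) powr (d - 1)) \<le> t powr (1 - d) * (C1 * (s + 1) powr (d - 1))"
          using C1 by (intro mult_left_mono mult_right_mono) auto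
        then show ?thesis using le False \<open>x \<in> N s\<close> by (simp add: k_def mult.assoc)
      qed
    qed
    have e0: "0 \<le> d - 1" using d2 by simp
    have mm1: "variance_enn P (\<lambda>\<omega>. ?X (G \<omega>)) \<le> ennreal (C * (3 ^ CARD('n) * C1\<^sup>2 * (t powr (1 - real CARD('n)) * l)))
        * (\<integral>\<^sup>+ s \<in> {0<..}. ennreal ((s + 1) powr (2 * (real CARD('n) - 1)) * \<pi> s) \<partial>lborel)"
      unfolding d_def[symmetric] Vk[symmetric]
      by (rule multiscale_moments(1)[where X = ?X and B = B and N = N and V = V and k = k and e = "d - 1", OF assms(3) C]) (fact FI Xm GA B' N(1) N(3) V1 k1 osc e0 \<pi>(1) \<pi>(2))+
    have mm2: "(\<integral>\<^sup>+ \<omega>. ennreal (\<bar>?X (G \<omega>) - (\<integral> \<omega>'. ?X (G \<omega>') \<partial>P)\<bar> powr (2 * p)) \<partial>P)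
        \<le> ennreal ((mc * p\<^sup>2 * (3 ^ CARD('n) * C1\<^sup>2 * (t powr (1 - real CARD('n)) * l))) powr p)
        * (\<integral>\<^sup>+ s \<in> {0<..}. ennreal ((s + 1) powr (2 * p * (real CARD('n) - 1)) * \<pi> s) \<partial>lborel)"
      unfolding mc_def d_def[symmetric] Vk[symmetric]
      by (rule multiscale_moments(2)[where X = ?X and B = B and N = N and V = V and k = k and e = "d - 1", OF assms(3) C]) (fact FI Xm GA B' N(1) N(3) V1 k1 osc e0 \<pi>(1) \<pi>(2) p)+
    have tl: "0 \<le> t powr (1 - real CARD('n)) * l" using l by simp
    show ?B
    proof (rule order_trans[OF mm1], intro mult_right_mono ennreal_leI)
      have "C * (3 ^ CARD('n) * C1\<^sup>2 * (t powr (1 - real CARD('n)) * l)) \<le> mc * (3 ^ CARD('n) * C1\<^sup>2 * (t powr (1 - real CARD('n)) * l))"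
        using k0 tl mc by (intro mult_right_mono) auto
      then show "C * (3 ^ CARD('n) * C1\<^sup>2 * (t powr (1 - real CARD('n)) * l)) \<le> cd * t powr (1 - real CARD('n)) * l"
        by (simp only: cd_def mult.assoc)
    qed simp
    have "(mc * p\<^sup>2 * (3 ^ CARD('n) * C1\<^sup>2 * (t powr (1 - real CARD('n)) * l))) powr p
        = ((cd * p\<^sup>2) * (t powr (1 - real CARD('n)) * l)) powr p"
      by (simp only: cd_def mult.assoc mult.commute mult.left_commute)
    also have "\<dots> = (cd * p\<^sup>2) powr p * t powr (p * (1 - real CARD('n))) * l powr p"
      using cd0 l by (simp add: powr_mult powr_powr mult.commute)
    finally show ?A using mm2 by simp
  qed
  show ?thesis using cd0 main var by (intro exI[of _ cd]) (auto simp del: mult_1)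
qed

end
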